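(* Let $(W,S)$ be a Coxeter system of type $A$ and let $(\mathscr{I},J)$ be a $W$-graph ideal (that is, $J\subseteq S$ and $\mathscr I\subseteq W$ is a $W$-graph ideal with respect to $J$). Then $\mathscr{I}w_J=\{xw_J\mid x\in\mathscr I\}$ is a union of Kazhdan–Lusztig left cells of $W$, where $w_J$ is the longest element of the standard parabolic subgroup $W_J$ generated by $J$.
   Context: Let $(W,S)$ be a Coxeter system with length function $l$ and Bruhat order $\leqslant$. The left weak order $\leqslant_{\mathsf L}$ on $W$ is defined by $y\leqslant_{\mathsf L}x$ iff $l(xy^{-1})=l(x)-l(y)$. An ideal of $(W,\leqslant_{\mathsf L})$ is a subset $\mathscr I$ such that $x\in\mathscr I$ and $y\leqslant_{\mathsf L}x$ imply $y\in\mathscr I$. For $J\subseteq S$, $W_J$ is the subgroup generated by $J$ and $D_J=\{w\in W\mid l(ws)>l(w)\text{ for all }s\in J\}$. Type $A$ means $W$ is (isomorphic to) a symmetric group $\mathrm{Sym}(n)$ with $S$ the simple transpositions $(i,i+1)$. Kazhdan–Lusztig left cells are the usual ones, i.e. the equivalence classes of the preorder on $W$ generated by: $x\leqslant y$ if the Kazhdan–Lusztig basis element $C_x$ occurs with nonzero coefficient in $T_sC_y$ for some $s\in S$. $W$-graph ideals (Howlett–Nguyen). Let $\mathcal A=\mathbb Z[q,q^{-1}]$, $\mathcal A^+=\mathbb Z[q]$, and let $\mathcal H$ be the Hecke algebra of $(W,S)$ over $\mathcal A$, generated by $T_s$ ($s\in S$) subject to the braid relations and $T_s^2=1+(q-q^{-1})T_s$.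 Let $a\mapsto\overline a$ be the ring involution of $\mathcal A$ with $\overline q=q^{-1}$, extended to the semilinear ring involution of $\mathcal H$ with $\overline{T_s}=T_s^{-1}$. Let $\mathscr I$ be a nonempty ideal of $(W,\leqslant_{\mathsf L})$ and $J\subseteq S$ with $\mathscr I\subseteq D_J$. For $w\in\mathscr I$ the set $S$ is the disjoint union of $\mathrm{SA}(w)=\{s\mid sw>w,\ sw\in\mathscr I\}$, $\mathrm{SD}(w)=\{s\mid sw<w\}$, $\mathrm{WD}_J(w)=\{s\mid sw\notin D_J\}$ and $\mathrm{WA}_J(w)=\{s\mid sw\in D_J\setminus\mathscr I\}$. Then $(\mathscr I,J)$ is a $W$-graph ideal (equivalently, $\mathscr I$ is a $W$-graph ideal with respect to $J$) if: (i) there is an $\mathcal H$-module $\mathscr S$ that is free over $\mathcal A$ with basis $(b_w\mid w\in\mathscr I)$ such that for all $s\in S$, $w\in\mathscr I$: $T_sb_w=b_{sw}$ if $s\in\mathrm{SA}(w)$; $T_sb_w=b_{sw}+(q-q^{-1})b_w$ if $s\in\mathrm{SD}(w)$; $T_sb_w=-q^{-1}b_w$ if $s\in\mathrm{WD}_J(w)$; $T_sb_w=qb_w-\sum_{y\in\mathscr I,\,y<sw}r^s_{y,w}b_y$ for some $r^s_{y,w}\in q\mathcal A^+$ if $s\in\mathrm{WA}_J(w)$; and (ii) $\mathscr S$ admits an $\mathcal A$-semilinear involution $\alpha\mapsto\overline\alpha$ with $\overline{b_1}=b_1$ and $\overline{h\alpha}=\overline h\,\overline\alpha$ for all $h\in\mathcal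 H$, $\alpha\in\mathscr S$. *)

theory Defs
  imports
    "HOL-Algebra.Sym_Groups"
    "HOL-Algebra.QuotRing"
    "HOL-Algebra.Multiplicative_Group"
    "HOL-Library.Poly_Mapping"
begin

section \<open>Lengths, orders and parabolic subgroups\<close>

text \<open>
  Throughout, \<open>G\<close> is the group \<open>W\<close> and \<open>S\<close> its set of simple reflections.
\<close>

definition gen_prod :: "('a, 'c) monoid_scheme \<Rightarrow> 'a list \<Rightarrow> 'a" where
  "gen_prod G ss = foldr (\<otimes>\<^bsub>G\<^esub>) ss \<one>\<^bsub>G\<^esub>"

definition cox_length :: "('a, 'c) monoid_scheme \<Rightarrow> 'a set \<Rightarrow> 'a \<Rightarrow> nat" where
  "cox_length G S w = (LEAST k. \<exists>ss. set ss \<subseteq> S \<and> length ss = k \<and> gen_prod G ss = w)"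

definition reduced_word :: "('a, 'c) monoid_scheme \<Rightarrow> 'a set \<Rightarrow> 'a \<Rightarrow> 'a list \<Rightarrow> bool" where
  "reduced_word G S w ss \<longleftrightarrow>
     set ss \<subseteq> S \<and> gen_prod G ss = w \<and> length ss = cox_length G S w"

definition type_A :: "('a, 'c) monoid_scheme \<Rightarrow> 'a set \<Rightarrow> bool" where
  "type_A G S \<longleftrightarrow> S \<subseteq> carrier G \<and>
     (\<exists>n. \<exists>\<phi>\<in>iso G (sym_group n). \<phi> ` S = {transpose i (Suc i) | i. 1 \<le> i \<and> i < n})"

definition reflections :: "('a, 'c) monoid_scheme \<Rightarrow> 'a set \<Rightarrow> 'a set" where
  "reflections G S = {w \<otimes>\<^bsub>G\<^esub> s \<otimes>\<^bsub>G\<^esub> inv\<^bsub>G\<^esub> w | w s. w \<in> carrier G \<and> s \<in> S}"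

definition bruhat_less :: "('a, 'c) monoid_scheme \<Rightarrow> 'a set \<Rightarrow> 'a \<Rightarrow> 'a \<Rightarrow> bool" where
  "bruhat_less G S x y \<longleftrightarrow>
     (x, y) \<in> {(u, u \<otimes>\<^bsub>G\<^esub> t) | u t. u \<in> carrier G \<and> t \<in> reflections G S \<and>
                 cox_length G S u < cox_length G S (u \<otimes>\<^bsub>G\<^esub> t)}\<^sup>+"

text \<open>
  The defining equation \<open>l(x y\<^sup>-\<^sup>1) = l(x) - l(y)\<close> is written additively, because
  subtraction on \<^typ>\<open>nat\<close> truncates.
\<close>

definition left_weak_le :: "('a, 'c) monoid_scheme \<Rightarrow> 'a set \<Rightarrow> 'a \<Rightarrow> 'a \<Rightarrow> bool" where
  "left_weak_le G S y x \<longleftrightarrow>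
     cox_length G S (x \<otimes>\<^bsub>G\<^esub> inv\<^bsub>G\<^esub> y) + cox_length G S y = cox_length G S x"

definition left_weak_ideal :: "('a, 'c) monoid_scheme \<Rightarrow> 'a set \<Rightarrow> 'a set \<Rightarrow> bool" where
  "left_weak_ideal G S I \<longleftrightarrow> I \<subseteq> carrier G \<and>
     (\<forall>x\<in>I. \<forall>y\<in>carrier G. left_weak_le G S y x \<longrightarrow> y \<in> I)"

definition D_set :: "('a, 'c) monoid_scheme \<Rightarrow> 'a set \<Rightarrow> 'a set \<Rightarrow> 'a set" where
  "D_set G S J =
     {w \<in> carrier G. \<forall>s\<in>J. cox_length G S (w \<otimes>\<^bsub>G\<^esub> s) > cox_length G S w}"

definition longest_elt :: "('a, 'c) monoid_scheme \<Rightarrow> 'a set \<Rightarrow> 'a set \<Rightarrow> 'a" where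
  "longest_elt G S J = (ARG_MAX (cox_length G S) w. w \<in> generate G J)"


section \<open>Laurent polynomials\<close>

text \<open>
  The ring of Laurent polynomials is the group ring of the additive group of integers;
  the key \<open>k\<close> of a finitely supported map \<open>int \<Rightarrow>\<^sub>0 int\<close> stands for \<open>q\<close> to the \<open>k\<close>, and
  the multiplication on \<open>\<Rightarrow>\<^sub>0\<close> is convolution.
\<close>

type_synonym laurent = "int \<Rightarrow>\<^sub>0 int"

definition qpow :: "int \<Rightarrow> laurent" where
  "qpow k = Poly_Mapping.single k 1"

definition laurent_bar :: "laurent \<Rightarrow> laurent" where
  "laurent_bar a = Poly_Mapping.map_key uminus a"

definition laurent_plus :: "laurent set" where
  "laurent_plus = {a. Poly_Mapping.keys a \<subseteq> {0..}}"

definition q_laurent_plus :: "laurent set" where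
  "q_laurent_plus = (\<lambda>a. qpow 1 * a) ` laurent_plus"


section \<open>The Hecke algebra\<close>

text \<open>
  Words in the generators form a monoid under concatenation, written additively so that
  \<open>'a gen_word \<Rightarrow>\<^sub>0 laurent\<close>, with its convolution product, is the free associative
  algebra on the letters.
\<close>

datatype 'a gen_word = Gen_Word (letters: "'a list")

instantiation gen_word :: (type) monoid_add
begin

definition zero_gen_word :: "'a gen_word" where
  "0 = Gen_Word []"

definition plus_gen_word :: "'a gen_word \<Rightarrow> 'a gen_word \<Rightarrow> 'a gen_word" where
  "u + v = Gen_Word (letters u @ letters v)"

instance
  by standard (simp_all add: zero_gen_word_def plus_gen_word_def)

end

type_synonym 'a free_alg = "'a gen_word \<Rightarrow>\<^sub>0 laurent"

definition free_algebra :: "'a set \<Rightarrow> 'a free_alg ring" where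
  "free_algebra S =
     \<lparr>carrier = {f. \<forall>u\<in>Poly_Mapping.keys f. set (letters u) \<subseteq> S},
      mult = (*), one = 1, zero = 0, add = (+)\<rparr>"

definition free_word :: "'a list \<Rightarrow> 'a free_alg" where
  "free_word ss = Poly_Mapping.single (Gen_Word ss) 1"

definition free_scalar :: "laurent \<Rightarrow> 'a free_alg" where
  "free_scalar a = Poly_Mapping.single 0 a"

text \<open>\<open>alternating m s t\<close> is the word \<open>s t s t \<dots>\<close> with \<open>m\<close> letters.\<close>

fun alternating :: "nat \<Rightarrow> 'a \<Rightarrow> 'a \<Rightarrow> 'a list" where
  "alternating 0 s t = []"
| "alternating (Suc m) s t = s # alternating m t s"

text \<open>
  \<^term>\<open>group.ord G x\<close> is \<open>0\<close> if \<open>x\<close> has infinite order; then the braid relator is \<open>0\<close>, that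
  is, no relation is imposed.
\<close>

definition hecke_relators :: "('a, 'c) monoid_scheme \<Rightarrow> 'a set \<Rightarrow> 'a free_alg set" where
  "hecke_relators G S =
     {free_word [s, s] - (1 + free_scalar (qpow 1 - qpow (-1)) * free_word [s]) | s. s \<in> S} \<union>
     {free_word (alternating (group.ord G (s \<otimes>\<^bsub>G\<^esub> t)) s t)
        - free_word (alternating (group.ord G (s \<otimes>\<^bsub>G\<^esub> t)) t s) | s t. s \<in> S \<and> t \<in> S \<and> s \<noteq> t}"

definition hecke_ideal :: "('a, 'c) monoid_scheme \<Rightarrow> 'a set \<Rightarrow> 'a free_alg set" where
  "hecke_ideal G S = genideal (free_algebra S) (hecke_relators G S)"

definition hecke_algebra :: "('a, 'c) monoid_scheme \<Rightarrow> 'a set \<Rightarrow> 'a free_alg set ring" where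
  "hecke_algebra G S = free_algebra S Quot hecke_ideal G S"

definition hecke_class :: "('a, 'c) monoid_scheme \<Rightarrow> 'a set \<Rightarrow> 'a free_alg \<Rightarrow> 'a free_alg set" where
  "hecke_class G S f = hecke_ideal G S +>\<^bsub>free_algebra S\<^esub> f"

definition hecke_scalar :: "('a, 'c) monoid_scheme \<Rightarrow> 'a set \<Rightarrow> laurent \<Rightarrow> 'a free_alg set" where
  "hecke_scalar G S a = hecke_class G S (free_scalar a)"

definition hecke_gen :: "('a, 'c) monoid_scheme \<Rightarrow> 'a set \<Rightarrow> 'a \<Rightarrow> 'a free_alg set" where
  "hecke_gen G S s = hecke_class G S (free_word [s])"

text \<open>\<open>T\<^sub>w\<close> does not depend on the reduced word chosen for \<open>w\<close> (Matsumoto).\<close>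

definition hecke_T :: "('a, 'c) monoid_scheme \<Rightarrow> 'a set \<Rightarrow> 'a \<Rightarrow> 'a free_alg set" where
  "hecke_T G S w = hecke_class G S (free_word (SOME ss. reduced_word G S w ss))"

text \<open>
  The restriction to \<^const>\<open>extensional\<close> functions only pins down the irrelevant values outside
  the carrier, making the bar involution unique as a HOL function.
\<close>

definition hecke_bar ::
    "('a, 'c) monoid_scheme \<Rightarrow> 'a set \<Rightarrow> 'a free_alg set \<Rightarrow> 'a free_alg set" where
  "hecke_bar G S = (THE \<beta>.
     \<beta> \<in> ring_hom (hecke_algebra G S) (hecke_algebra G S) \<and>
     \<beta> \<in> extensional (carrier (hecke_algebra G S)) \<and>
     (\<forall>h\<in>carrier (hecke_algebra G S). \<beta> (\<beta> h) = h) \<and>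
     (\<forall>a. \<beta> (hecke_scalar G S a) = hecke_scalar G S (laurent_bar a)) \<and>
     (\<forall>s\<in>S. \<beta> (hecke_gen G S s) = inv\<^bsub>hecke_algebra G S\<^esub> (hecke_gen G S s)))"


section \<open>Kazhdan--Lusztig left cells\<close>

text \<open>
  In the normalization \<open>T\<^sub>s\<^sup>2 = 1 + (q - q\<^sup>-\<^sup>1) T\<^sub>s\<close>, \<open>C\<^sub>w\<close> is the unique bar-invariant element
  of \<open>T\<^sub>w + \<Sum>\<^bsub>y < w\<^esub> q \<int>[q] T\<^sub>y\<close>; for instance \<open>C\<^sub>s = T\<^sub>s - q\<close>.
\<close>

definition KL_basis :: "('a, 'c) monoid_scheme \<Rightarrow> 'a set \<Rightarrow> 'a \<Rightarrow> 'a free_alg set" where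
  "KL_basis G S w = (THE c.
     c \<in> carrier (hecke_algebra G S) \<and> hecke_bar G S c = c \<and>
     (\<exists>p. (\<forall>y. bruhat_less G S y w \<longrightarrow> p y \<in> q_laurent_plus) \<and>
        c = hecke_T G S w \<oplus>\<^bsub>hecke_algebra G S\<^esub>
              (\<Oplus>\<^bsub>hecke_algebra G S\<^esub> y\<in>{y. bruhat_less G S y w}.
                 hecke_scalar G S (p y) \<otimes>\<^bsub>hecke_algebra G S\<^esub> hecke_T G S y)))"

text \<open>
  \<open>C\<^sub>x\<close> occurs with nonzero coefficient in the expansion of \<open>T\<^sub>s C\<^sub>y\<close> in the basis
  \<open>(C\<^sub>z)\<close>, for some \<open>s\<close>.
\<close>

definition KL_occurs :: "('a, 'c) monoid_scheme \<Rightarrow> 'a set \<Rightarrow> 'a \<Rightarrow> 'a \<Rightarrow> bool" where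
  "KL_occurs G S x y \<longleftrightarrow> (\<exists>s\<in>S. \<exists>a :: 'a \<Rightarrow>\<^sub>0 laurent.
     Poly_Mapping.keys a \<subseteq> carrier G \<and>
     hecke_gen G S s \<otimes>\<^bsub>hecke_algebra G S\<^esub> KL_basis G S y =
       (\<Oplus>\<^bsub>hecke_algebra G S\<^esub> z\<in>Poly_Mapping.keys a.
          hecke_scalar G S (Poly_Mapping.lookup a z) \<otimes>\<^bsub>hecke_algebra G S\<^esub> KL_basis G S z) \<and>
     Poly_Mapping.lookup a x \<noteq> 0)"

definition KL_left_preorder :: "('a, 'c) monoid_scheme \<Rightarrow> 'a set \<Rightarrow> ('a \<times> 'a) set" where
  "KL_left_preorder G S =
     {(x, y). x \<in> carrier G \<and> y \<in> carrier G \<and> KL_occurs G S x y}\<^sup>*"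

definition left_cells :: "('a, 'c) monoid_scheme \<Rightarrow> 'a set \<Rightarrow> 'a set set" where
  "left_cells G S =
     carrier G // {(x, y). (x, y) \<in> KL_left_preorder G S \<and> (y, x) \<in> KL_left_preorder G S}"


section \<open>W-graph ideals\<close>

definition SA :: "('a, 'c) monoid_scheme \<Rightarrow> 'a set \<Rightarrow> 'a set \<Rightarrow> 'a \<Rightarrow> 'a set" where
  "SA G S I w = {s \<in> S. bruhat_less G S w (s \<otimes>\<^bsub>G\<^esub> w) \<and> s \<otimes>\<^bsub>G\<^esub> w \<in> I}"

definition SD :: "('a, 'c) monoid_scheme \<Rightarrow> 'a set \<Rightarrow> 'a \<Rightarrow> 'a set" where
  "SD G S w = {s \<in> S. bruhat_less G S (s \<otimes>\<^bsub>G\<^esub> w) w}"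

definition WD :: "('a, 'c) monoid_scheme \<Rightarrow> 'a set \<Rightarrow> 'a set \<Rightarrow> 'a \<Rightarrow> 'a set" where
  "WD G S J w = {s \<in> S. s \<otimes>\<^bsub>G\<^esub> w \<notin> D_set G S J}"

definition WA :: "('a, 'c) monoid_scheme \<Rightarrow> 'a set \<Rightarrow> 'a set \<Rightarrow> 'a set \<Rightarrow> 'a \<Rightarrow> 'a set" where
  "WA G S I J w = {s \<in> S. s \<otimes>\<^bsub>G\<^esub> w \<in> D_set G S J - I}"

text \<open>
  The free module with basis \<open>(b\<^sub>w | w \<in> I)\<close>, modelled by the finitely supported functions
  on \<open>I\<close>. Every free module with a basis indexed by \<open>I\<close> is isomorphic to this one by an
  isomorphism matching the bases, so asking for a Hecke module structure on it loses no generality.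
\<close>

definition free_module :: "'a set \<Rightarrow> ('a \<Rightarrow>\<^sub>0 laurent) set" where
  "free_module I = {m. Poly_Mapping.keys m \<subseteq> I}"

definition bas :: "'a \<Rightarrow> 'a \<Rightarrow>\<^sub>0 laurent" where
  "bas w = Poly_Mapping.single w 1"

definition smul :: "laurent \<Rightarrow> ('a \<Rightarrow>\<^sub>0 laurent) \<Rightarrow> 'a \<Rightarrow>\<^sub>0 laurent" where
  "smul a m = Poly_Mapping.map (\<lambda>c. a * c) m"

text \<open>\<open>act\<close> makes the free module a left module over the Hecke algebra, extending its scalar
  multiplication.\<close>

definition hecke_module ::
    "('a, 'c) monoid_scheme \<Rightarrow> 'a set \<Rightarrow> 'a set \<Rightarrow>
      ('a free_alg set \<Rightarrow> ('a \<Rightarrow>\<^sub>0 laurent) \<Rightarrow> ('a \<Rightarrow>\<^sub>0 laurent)) \<Rightarrow> bool" where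
  "hecke_module G S I act \<longleftrightarrow>
     (\<forall>h\<in>carrier (hecke_algebra G S). \<forall>m\<in>free_module I. act h m \<in> free_module I) \<and>
     (\<forall>h\<in>carrier (hecke_algebra G S). \<forall>m\<in>free_module I. \<forall>m'\<in>free_module I.
        act h (m + m') = act h m + act h m') \<and>
     (\<forall>h\<in>carrier (hecke_algebra G S). \<forall>h'\<in>carrier (hecke_algebra G S). \<forall>m\<in>free_module I.
        act (h \<oplus>\<^bsub>hecke_algebra G S\<^esub> h') m = act h m + act h' m) \<and>
     (\<forall>h\<in>carrier (hecke_algebra G S). \<forall>h'\<in>carrier (hecke_algebra G S). \<forall>m\<in>free_module I.
        act (h \<otimes>\<^bsub>hecke_algebra G S\<^esub> h') m = act h (act h' m)) \<and>
     (\<forall>m\<in>free_module I. act \<one>\<^bsub>hecke_algebra G S\<^esub> m = m) \<and>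
     (\<forall>a. \<forall>m\<in>free_module I. act (hecke_scalar G S a) m = smul a m)"

definition w_graph_ideal ::
    "('a, 'c) monoid_scheme \<Rightarrow> 'a set \<Rightarrow> 'a set \<Rightarrow> 'a set \<Rightarrow> bool" where
  "w_graph_ideal G S I J \<longleftrightarrow>
     I \<noteq> {} \<and> left_weak_ideal G S I \<and> J \<subseteq> S \<and> I \<subseteq> D_set G S J \<and>
     (\<exists>act. hecke_module G S I act \<and>
        (\<forall>w\<in>I.
           (\<forall>s\<in>SA G S I w. act (hecke_gen G S s) (bas w) = bas (s \<otimes>\<^bsub>G\<^esub> w)) \<and>
           (\<forall>s\<in>SD G S w. act (hecke_gen G S s) (bas w) =
              bas (s \<otimes>\<^bsub>G\<^esub> w) + smul (qpow 1 - qpow (-1)) (bas w)) \<and>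
           (\<forall>s\<in>WD G S J w. act (hecke_gen G S s) (bas w) = smul (- qpow (-1)) (bas w)) \<and>
           (\<forall>s\<in>WA G S I J w. \<exists>r.
              (\<forall>y\<in>I. bruhat_less G S y (s \<otimes>\<^bsub>G\<^esub> w) \<longrightarrow> r y \<in> q_laurent_plus) \<and>
              act (hecke_gen G S s) (bas w) = smul (qpow 1) (bas w) -
                (\<Sum>y\<in>{y \<in> I. bruhat_less G S y (s \<otimes>\<^bsub>G\<^esub> w)}. smul (r y) (bas y)))) \<and>
        (\<exists>\<beta>. (\<forall>m\<in>free_module I. \<beta> m \<in> free_module I \<and> \<beta> (\<beta> m) = m) \<and>
           (\<forall>m\<in>free_module I. \<forall>m'\<in>free_module I. \<beta> (m + m') = \<beta> m + \<beta> m') \<and>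
           (\<forall>a. \<forall>m\<in>free_module I. \<beta> (smul a m) = smul (laurent_bar a) (\<beta> m)) \<and>
           \<beta> (bas \<one>\<^bsub>G\<^esub>) = bas \<one>\<^bsub>G\<^esub> \<and>
           (\<forall>h\<in>carrier (hecke_algebra G S). \<forall>m\<in>free_module I.
              \<beta> (act h m) = act (hecke_bar G S h) (\<beta> m))))"

end

theory Submission
  imports Defs
begin

text \<open>
  Multiplying by \<open>w\<^sub>J\<close> turns the descents and weak descents of \<open>x \<in> I\<close> into the left descents of \<open>x w\<^sub>J\<close>.
  The bar involution equips the module with a canonical basis whose matrices form a W-graph. Let \<open>s\<close> and
  \<open>t\<close> be adjacent and suppose that \<open>x \<in> I\<close> descends at \<open>t\<close> but not at \<open>s\<close>, and that a left star operation
  takes \<open>x w\<^sub>J\<close> to \<open>s x w\<^sub>J\<close>. If \<open>s x \<notin> I\<close>, the leading term expected in \<open>T\<^sub>s C\<^sub>x\<close> is missing and the braid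
  relation fails. So \<open>I w\<^sub>J\<close> is closed under left star operations.

  In type \<open>A\<close> this is enough, since any two elements of a left cell are connected by left star
  operations. Indeed, the Kazhdan--Lusztig left preorder is monotone in right descent sets and preserved by right
  star operations, so the elements of a left cell have the same generalized \<open>\<tau>\<close>-invariant. Left and right star
  operations commute, so two such permutations can be moved to column words of tableaux, on which
  the descents determine the shape. Column words of tableaux of the same shape have a common
  normal form under left star operations.
\<close>

section \<open>Permutations, Knuth relations and star operations\<close>

text \<open>Two modules occur: the one attached to \<open>(I, J)\<close> and the left regular
  module, in which the cells live. The locale \<open>bar_module\<close> axiomatizes both, the second
  being the case \<open>I = carrier G\<close>, \<open>J = {}\<close>, so one construction yields
  either canonical basis and the formula for \<open>T\<^sub>s\<close> on it. The Hecke algebra is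
  given by generators and relations, and its bar involution and Kazhdan--Lusztig basis by definite
  descriptions, so it has to be shown that the \<open>T\<^sub>w\<close> form a basis and that the
  described objects exist; the free algebra is made to act on a free module with basis W for this
  purpose. The obstacle in the module of \<open>(I, J)\<close> is that a weak descent
  \<open>s\<close> of \<open>w\<close> must act on \<open>C w\<close> by \<open>- q^-1\<close>,
  although \<open>C w\<close> is not obtained by applying \<open>T\<^sub>s\<close>;
  \<open>negative_C\<close> settles it. The combinatorics stays with permutations: words are pushed
  towards column words of tableaux by making early descents as heavy as possible, and a tableau word
  whose inverse is one too is forced to reverse consecutive blocks, hence is determined by its
  descents.\<close>

definition inversions :: "nat \<Rightarrow> (nat \<Rightarrow> nat) \<Rightarrow> (nat \<times> nat) set" where
  "inversions n z = {(a, b). 1 \<le> a \<and> a < b \<and> b \<le> n \<and> z b < z a}"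

lemma finite_inversions: "finite (inversions n z)"
  by (rule finite_subset[of _ "{1..n} \<times> {1..n}"]) (auto simp: inversions_def)

lemma card_inversions_adjacent:
  assumes z: "z permutes {1..n}" and a: "1 \<le> a" "Suc a \<le> n" and lt: "z a < z (Suc a)"
  shows "card (inversions n (z \<circ> transpose a (Suc a))) = Suc (card (inversions n z))"
proof -
  let ?t = "transpose a (Suc a)"
  let ?f = "map_prod ?t ?t"
  have inj: "inj_on ?f (inversions n z)"
    by (rule inj_onI) (auto dest!: inj_onD[OF inj_transpose])
  have "inversions n (z \<circ> ?t) = insert (a, Suc a) (?f ` inversions n z)"
  proof (rule subset_antisym; rule subsetI)
    fix pq assume pq: "pq \<in> inversions n (z \<circ> ?t)"
    obtain p q where [simp]: "pq = (p, q)" by force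
    show "pq \<in> insert (a, Suc a) (?f ` inversions n z)"
    proof (cases "(p, q) = (a, Suc a)")
      case False
      have "(?t p, ?t q) \<in> inversions n z"
        using pq False a lt by (auto simp: inversions_def transpose_def split: if_splits)
      moreover have "pq = ?f (?t p, ?t q)" by simp
      ultimately show ?thesis by blast
    qed auto
  next
    fix pq assume "pq \<in> insert (a, Suc a) (?f ` inversions n z)"
    thus "pq \<in> inversions n (z \<circ> ?t)"
      using a lt by (auto simp: inversions_def transpose_def split: if_splits)
  qed
  moreover have "(a, Suc a) \<notin> ?f ` inversions n z"
    using lt by (auto simp: inversions_def transpose_def split: if_splits)
  ultimately show ?thesis
    by (simp add: card_image[OF inj] finite_inversions)
qed

lemma card_inversions_transpose:
  assumes ab: "1 \<le> a" "a < b" "b \<le> n" and lt: "z a < z b"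
  shows "card (inversions n z) < card (inversions n (z \<circ> transpose a b))"
proof -
  let ?t = "transpose a b"
  \<comment> \<open>Moving both positions of a pair by \<open>?t\<close> would reverse the pairs
    with one end at \<open>a\<close> or \<open>b\<close> and the other strictly between. Those
    inversions survive unmoved, because \<open>z a < z b\<close>.\<close>
  define f where "f = (\<lambda>(p, q). if (p = a \<and> q < b) \<or> (a < p \<and> q = b) then (p, q) else (?t p, ?t q))"
  have inj: "inj_on f (inversions n z)"
    using ab lt by (auto simp: inj_on_def f_def inversions_def transpose_def split: if_splits)
  have sub: "f ` inversions n z \<subseteq> inversions n (z \<circ> ?t) - {(a, b)}"
    using ab lt by (auto simp: f_def inversions_def transpose_def split: if_splits)
  have mem: "(a, b) \<in> inversions n (z \<circ> ?t)"
    using ab lt by (auto simp: inversions_def)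
  have "card (inversions n z) = card (f ` inversions n z)" by (simp add: card_image[OF inj])
  also have "\<dots> \<le> card (inversions n (z \<circ> ?t) - {(a, b)})"
    by (rule card_mono[OF _ sub]) (simp add: finite_inversions)
  also have "\<dots> < card (inversions n (z \<circ> ?t))"
    using mem finite_inversions by (intro psubset_card_mono) auto
  finally show ?thesis .
qed

lemma inversions_inv_image:
  assumes z: "z permutes {1..n}" and ab: "(a, b) \<in> inversions n z"
  shows "(z b, z a) \<in> inversions n (inv' z)"
proof -
  have "z a \<in> {1..n}" "z b \<in> {1..n}"
    using ab permutes_in_image[OF z, of a] permutes_in_image[OF z, of b] by (auto simp: inversions_def)
  then show ?thesis
    using ab by (simp add: inversions_def permutes_inverses[OF z])
qed

lemma card_inversions_inv:
  assumes z: "z permutes {1..n}"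
  shows "card (inversions n (inv' z)) = card (inversions n z)"
proof -
  have le: "card (inversions n z) \<le> card (inversions n (inv' z))" if z: "z permutes {1..n}" for z
  proof (rule card_inj_on_le[where f = "\<lambda>(a, b). (z b, z a)"])
    show "inj_on (\<lambda>(a, b). (z b, z a)) (inversions n z)"
      using permutes_inj[OF z] by (auto simp: inj_on_def)
    show "(\<lambda>(a, b). (z b, z a)) ` inversions n z \<subseteq> inversions n (inv' z)"
      using inversions_inv_image[OF z] by auto
  qed (rule finite_inversions)
  from le[OF z] le[OF permutes_inv[OF z]] show ?thesis
    by (simp add: permutes_inv_inv[OF z])
qed

text \<open>Counting up from 1 gives \<open>i \<le> z i\<close>, counting down from \<open>n\<close>
  gives \<open>z i \<le> i\<close>.\<close>

lemma ascending_permutation_id: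
  assumes z: "z permutes {1..n}" and asc: "\<And>i. 1 \<le> i \<Longrightarrow> i < n \<Longrightarrow> z i < z (Suc i)"
  shows "z = id"
proof -
  have le: "i \<le> z i" if "1 \<le> i" "i \<le> n" for i
    using that
  proof (induction i rule: nat_induct_at_least)
    case base
    then show ?case using permutes_in_image[OF z, of 1] by auto
  next
    case (Suc i)
    then show ?case using asc[of i] by fastforce
  qed
  have ge: "z (n - k) \<le> n - k" if "k < n" for k
    using that
  proof (induction k)
    case 0
    then show ?case using permutes_in_image[OF z, of n] by auto
  next
    case (Suc k)
    then have "z (n - Suc k) < z (Suc (n - Suc k))" by (intro asc) auto
    with Suc show ?case by (simp add: Suc_diff_Suc)
  qed
  show ?thesis
  proof
    fix i show "z i = id i"
    proof (cases "i \<in> {1..n}")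
      case True
      with le[of i] ge[of "n - i"] show ?thesis by auto
    next
      case False
      with z show ?thesis by (simp add: permutes_not_in)
    qed
  qed
qed

section \<open>Knuth relations and column insertion\<close>

definition strictly_between :: "nat \<Rightarrow> nat \<Rightarrow> nat \<Rightarrow> bool" where
  "strictly_between b a c \<longleftrightarrow> a < b \<and> b < c \<or> c < b \<and> b < a"

text \<open>The elementary Knuth relations: two neighbours are swapped when the letter next to the
  pair, on one side or the other, lies between them in value. The relation is symmetric because
  \<open>strictly_between\<close> is symmetric in its last two arguments.\<close>

inductive knuth_step :: "nat list \<Rightarrow> nat list \<Rightarrow> bool" where
  swap_left: "strictly_between c a b \<Longrightarrow> knuth_step (p @ [a, b, c] @ q) (p @ [b, a, c] @ q)"
| swap_right: "strictly_between a b c \<Longrightarrow> knuth_step (p @ [a, b, c] @ q) (p @ [a, c, b] @ q)"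

abbreviation knuth :: "nat list \<Rightarrow> nat list \<Rightarrow> bool" where
  "knuth \<equiv> knuth_step\<^sup>*\<^sup>*"

lemma knuth_step_context: "knuth_step u v \<Longrightarrow> knuth_step (p @ u @ q) (p @ v @ q)"
proof (induction rule: knuth_step.induct)
  case (swap_left c a b p' q')
  from knuth_step.swap_left[OF this, of "p @ p'" "q' @ q"] show ?case by simp
next
  case (swap_right a b c p' q')
  from knuth_step.swap_right[OF this, of "p @ p'" "q' @ q"] show ?case by simp
qed

lemma knuth_context: "knuth u v \<Longrightarrow> knuth (p @ u @ q) (p @ v @ q)"
  by (induction rule: rtranclp_induct) (auto intro: rtranclp.rtrancl_into_rtrancl knuth_step_context)

lemma knuth_Cons: "knuth u v \<Longrightarrow> knuth (a # u) (a # v)"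
  using knuth_context[of u v "[a]" "[]"] by simp

abbreviation decreasing :: "nat list \<Rightarrow> bool" where
  "decreasing \<equiv> sorted_wrt (>)"

text \<open>Each letter \<open>y\<close> passed by \<open>u\<close> is smaller than the letter in
  front of \<open>u\<close>, which in turn is smaller than \<open>u\<close>. That letter is the
  witness of the swap, and \<open>y\<close> takes over its role for the next one.\<close>

lemma knuth_move_right:
  "decreasing (a # Y) \<Longrightarrow> a < u \<Longrightarrow> knuth (a # u # Y) (a # Y @ [u])"
proof (induction Y arbitrary: a)
  case (Cons y Y)
  have "knuth_step ([] @ [a, u, y] @ Y) ([] @ [a, y, u] @ Y)"
    using Cons.prems by (intro knuth_step.swap_right) (auto simp: strictly_between_def)
  moreover have "knuth (a # y # u # Y) (a # y # Y @ [u])"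
    using Cons.prems by (intro knuth_Cons Cons.IH) auto
  ultimately show ?case by (simp add: converse_rtranclp_into_rtranclp)
qed simp

text \<open>Here the witness is the letter \<open>e\<close> behind the pair:
  \<open>a < e < x\<close>, as the column decreases. The final \<open>u\<close> supplies the witness
  of the last swap.\<close>

lemma knuth_move_left:
  "decreasing (X @ [u]) \<Longrightarrow> \<forall>x\<in>set (X @ [u]). a < x \<Longrightarrow> knuth (a # X @ [u]) (X @ [a, u])"
proof (induction X)
  case (Cons x X)
  obtain e Z where e: "X @ [u] = e # Z" by (cases X) auto
  have "knuth_step ([] @ [a, x, e] @ Z) ([] @ [x, a, e] @ Z)"
    using Cons.prems e by (intro knuth_step.swap_left) (auto simp: strictly_between_def)
  then have "knuth_step (a # x # X @ [u]) (x # a # X @ [u])" using e by simp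
  moreover have "knuth (x # a # X @ [u]) (x # X @ [a, u])"
    using Cons.prems by (intro knuth_Cons Cons.IH) auto
  ultimately show ?case by (simp add: converse_rtranclp_into_rtranclp)
qed simp

text \<open>This is column bumping: \<open>u\<close> is the smallest letter of the column exceeding
  \<open>a\<close>; it is replaced by \<open>a\<close> and leaves the column on the right.\<close>

lemma knuth_column_insertion:
  assumes dec: "decreasing (X @ u # Y)" and a: "a < u" "\<forall>x\<in>set Y. x < a"
  shows "knuth (a # X @ u # Y) (X @ a # Y @ [u])"
proof -
  have "knuth (a # X @ [u]) (X @ [a, u])"
    using dec a by (intro knuth_move_left) (auto simp: sorted_wrt_append intro: less_trans)
  from knuth_context[OF this, of "[]" Y] have "knuth (a # X @ u # Y) (X @ a # u # Y)" by simp
  also have "knuth (a # u # Y) (a # Y @ [u])"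
    using dec a by (intro knuth_move_right) (auto simp: sorted_wrt_append)
  then have "knuth (X @ a # u # Y) (X @ a # Y @ [u])"
    using knuth_context[of "a # u # Y" "a # Y @ [u]" X "[]"] by simp
  finally show ?thesis .
qed

text \<open>Two adjacent columns of a tableau, read from bottom to top and aligned at their tops.\<close>

definition column_pair :: "nat list \<Rightarrow> nat list \<Rightarrow> bool" where
  "column_pair A C \<longleftrightarrow> (\<exists>A1 A2. A = A1 @ A2 \<and> list_all2 (<) A2 C)"

text \<open>
  Column insertion of \<open>A\<close>, from right to left, into the column \<open>C\<close>. In the resulting column
  \<open>U @ L\<close> the letters of \<open>U\<close> are those of \<open>C\<close> exceeding all letters inserted so far.
\<close>

lemma insert_column:
  assumes "decreasing A" "decreasing C" "distinct (A @ C)"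
  shows "\<exists>U V L D. C = U @ V \<and> knuth (A @ C) (U @ L @ D) \<and> decreasing (U @ L) \<and>
    set A \<subseteq> set L \<and> (\<forall>a. (\<forall>x\<in>set A. x < a) \<longrightarrow> (\<forall>x\<in>set L. x < a)) \<and> length A \<le> length L \<and>
    (length L > length A \<or> column_pair A V \<and> (U \<noteq> [] \<longrightarrow> length V = length A))"
  using assms
proof (induction A)
  case Nil
  then show ?case
    by (intro exI[of _ C] exI[of _ "[]"]) (auto simp: column_pair_def)
next
  case (Cons a A)
  then obtain U V L D where C: "C = U @ V" and kn: "knuth (A @ C) (U @ L @ D)"
    and dec: "decreasing (U @ L)" and sub: "set A \<subseteq> set L"
    and bd: "\<And>a. (\<forall>x\<in>set A. x < a) \<Longrightarrow> (\<forall>x\<in>set L. x < a)" and len: "length A \<le> length L"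
    and alt: "length L > length A \<or> column_pair A V \<and> (U \<noteq> [] \<longrightarrow> length V = length A)"
    by auto
  have La: "\<forall>x\<in>set L. x < a" using Cons.prems bd[of a] by auto
  \<comment> \<open>As \<open>U\<close> decreases, its letters above \<open>a\<close> form an
    initial segment; the last of them, if there is one, is the letter that \<open>a\<close>
    bumps.\<close>
  define U1 U2 where "U1 = takeWhile ((<) a) U" and "U2 = dropWhile ((<) a) U"
  have U: "U = U1 @ U2" by (simp add: U1_def U2_def)
  have U1: "\<forall>x\<in>set U1. a < x" using set_takeWhileD U1_def by fastforce
  have U2: "\<forall>x\<in>set U2. x < a"
  proof (cases U2)
    case (Cons e Z)
    then have "\<not> a < e" using hd_dropWhile[of "(<) a" U] U2_def by auto
    moreover have "e \<noteq> a" using Cons.prems U C Cons by auto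
    ultimately have "e < a" by simp
    moreover have "\<forall>x\<in>set Z. x < e" using dec U Cons by (simp add: sorted_wrt_append)
    ultimately show ?thesis using Cons by (metis less_trans set_ConsD)
  qed auto
  have kn': "knuth (a # A @ C) (a # U @ L @ D)" by (rule knuth_Cons[OF kn])
  show ?case
  proof (cases U1 rule: rev_cases)
    case Nil
    \<comment> \<open>Nothing is bumped, so the column grows by one letter. If it is still no longer
      than \<open>a # A\<close>, then \<open>U\<close> was already empty, and \<open>a\<close> joins
      the unmatched bottom part of the first column.\<close>
    have cp: "column_pair (a # A) C" if "\<not> length (U @ L) > length A"
    proof -
      from that len have "U = []" "\<not> length A < length L" by (cases U; simp)+
      with alt have "U = []" "column_pair A V" by auto
      then show ?thesis using C by (auto simp: column_pair_def) (metis append_Cons)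
    qed
    have bd': "x < b" if "\<forall>x\<in>set (a # A). x < b" "x \<in> set (a # U @ L)" for b x
    proof -
      have "x \<le> a" using that(2) U Nil U2 La by auto
      then show ?thesis using that(1) by auto
    qed
    show ?thesis
    proof (intro exI conjI)
      show "C = [] @ C" by simp
      show "knuth ((a # A) @ C) ([] @ (a # U @ L) @ D)" using kn' by simp
      show "decreasing ([] @ (a # U @ L))" using Nil dec U U2 La by auto
      show "set (a # A) \<subseteq> set (a # U @ L)" "length (a # A) \<le> length (a # U @ L)"
        using sub len by auto
      show "\<forall>b. (\<forall>x\<in>set (a # A). x < b) \<longrightarrow> (\<forall>x\<in>set (a # U @ L). x < b)" using bd' by blast
      show "length (a # A) < length (a # U @ L) \<or>
          column_pair (a # A) C \<and> ([] \<noteq> ([]::nat list) \<longrightarrow> length C = length (a # A))"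
        using cp by auto
    qed
  next
    case (snoc X u)
    have "decreasing (X @ u # U2 @ L)" using dec U snoc by simp
    then have "knuth (a # X @ u # U2 @ L) (X @ a # (U2 @ L) @ [u])"
      using U1 U2 La snoc by (intro knuth_column_insertion) auto
    from knuth_context[OF this, of "[]" D]
    have "knuth (a # U @ L @ D) (X @ (a # U2 @ L) @ u # D)" by (simp add: U snoc)
    with kn' have k: "knuth (a # A @ C) (X @ (a # U2 @ L) @ u # D)" by (rule rtranclp_trans)
    have d: "decreasing (X @ (a # U2 @ L))"
      using dec U snoc U1 U2 La by (auto simp: sorted_wrt_append)
    \<comment> \<open>If \<open>U2\<close> is nonempty or \<open>L\<close> was already too long, the
      new column is longer. Otherwise the bumped \<open>u > a\<close> becomes the partner of
      \<open>a\<close>, and the lengths of \<open>V\<close> and \<open>A\<close> agree because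
      \<open>U\<close> was nonempty.\<close>
    have cp: "column_pair (a # A) (u # U2 @ V) \<and> (X \<noteq> [] \<longrightarrow> length (u # U2 @ V) = length (a # A))"
      if "\<not> length (U2 @ L) > length A"
    proof -
      from that len have U2: "U2 = []" and "\<not> length A < length L" by (cases U2; simp)+
      with alt U snoc have p: "column_pair A V" "length V = length A" by auto
      from p obtain A1 A2 where "A = A1 @ A2" "list_all2 (<) A2 V" by (auto simp: column_pair_def)
      with p list_all2_lengthD[of "(<)" A2 V] have "list_all2 (<) A V" by simp
      then have "list_all2 (<) (a # A) (u # V)" using U1 snoc by auto
      then show ?thesis using U2 p by (auto simp: column_pair_def intro: exI[of _ "[]"])
    qed
    have bd': "x < b" if "\<forall>x\<in>set (a # A). x < b" "x \<in> set (a # U2 @ L)" for b x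
    proof -
      have "x \<le> a" using that(2) U2 La by auto
      then show ?thesis using that(1) by auto
    qed
    show ?thesis
    proof (intro exI conjI)
      show "C = X @ u # U2 @ V" using C U snoc by simp
      show "knuth ((a # A) @ C) (X @ (a # U2 @ L) @ u # D)" using k by simp
      show "decreasing (X @ (a # U2 @ L))" by (rule d)
      show "set (a # A) \<subseteq> set (a # U2 @ L)" "length (a # A) \<le> length (a # U2 @ L)"
        using sub len by auto
      show "\<forall>b. (\<forall>x\<in>set (a # A). x < b) \<longrightarrow> (\<forall>x\<in>set (a # U2 @ L). x < b)" using bd' by blast
      show "length (a # A) < length (a # U2 @ L) \<or> column_pair (a # A) (u # U2 @ V) \<and>
          (X \<noteq> [] \<longrightarrow> length (u # U2 @ V) = length (a # A))"
        using cp by auto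
    qed
  qed
qed

text \<open>A nonempty leftover \<open>U\<close> already makes \<open>U @ L\<close> longer than
  \<open>A\<close>, and \<open>U = []\<close> means \<open>V = C\<close>; so failure to be a column
  pair forces a longer column.\<close>

lemma knuth_lengthen_column:
  assumes "decreasing A" "decreasing C" "distinct (A @ C)" "\<not> column_pair A C"
  obtains A' D where "knuth (A @ C) (A' @ D)" "decreasing A'" "length A < length A'"
proof -
  from insert_column[OF assms(1-3)]
  obtain U V L D where *: "C = U @ V" "knuth (A @ C) (U @ L @ D)" "decreasing (U @ L)" "length A \<le> length L"
    "length L > length A \<or> column_pair A V \<and> (U \<noteq> [] \<longrightarrow> length V = length A)" by blast
  have "length A < length (U @ L)" using * assms(4) by (cases U) auto
  with * show ?thesis by (intro that[of "U @ L" D]) auto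
qed

section \<open>Right star operations as Knuth relations on one-line notation\<close>

definition descents :: "nat \<Rightarrow> (nat \<Rightarrow> nat) \<Rightarrow> nat set" where
  "descents n z = {j. 1 \<le> j \<and> j < n \<and> z (Suc j) < z j}"

text \<open>The right star operation for the transpositions at \<open>j\<close> and
  \<open>j + 1\<close>. It is defined exactly when one of these two positions is a descent and the
  other is not, and the two alternatives exclude each other.\<close>

definition star_step :: "nat \<Rightarrow> nat \<Rightarrow> (nat \<Rightarrow> nat) \<Rightarrow> (nat \<Rightarrow> nat) \<Rightarrow> bool" where
  "star_step n j z z' \<longleftrightarrow> 1 \<le> j \<and> j + 2 \<le> n \<and>
     (strictly_between (z (j + 2)) (z j) (z (j + 1)) \<and> z' = z \<circ> transpose j (j + 1) \<or>
      strictly_between (z j) (z (j + 1)) (z (j + 2)) \<and> z' = z \<circ> transpose (j + 1) (j + 2))"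

abbreviation some_star_step :: "nat \<Rightarrow> (nat \<Rightarrow> nat) \<Rightarrow> (nat \<Rightarrow> nat) \<Rightarrow> bool" where
  "some_star_step n z z' \<equiv> \<exists>j. star_step n j z z'"

definition word :: "nat \<Rightarrow> (nat \<Rightarrow> nat) \<Rightarrow> nat list" where
  "word n z = map z [1..<Suc n]"

lemma star_step_permutes: "star_step n j z z' \<Longrightarrow> z permutes {1..n} \<Longrightarrow> z' permutes {1..n}"
  by (auto simp: star_step_def intro!: permutes_compose permutes_swap_id)

lemma star_steps_permutes:
  "(some_star_step n)\<^sup>*\<^sup>* z z' \<Longrightarrow> z permutes {1..n} \<Longrightarrow> z' permutes {1..n}"
  by (induction rule: rtranclp_induct) (auto dest: star_step_permutes)

lemma length_word [simp]: "length (word n z) = n"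
  by (simp add: word_def)

lemma word_nth: "i < n \<Longrightarrow> word n z ! i = z (Suc i)"
  by (simp add: word_def del: upt_Suc)

text \<open>List indices start at 0 and positions at 1, so a relation behind the prefix
  \<open>p\<close> is the star operation at \<open>length p + 1\<close>.\<close>

lemma knuth_step_word:
  assumes "knuth_step (word n z) w"
  shows "\<exists>j z'. star_step n j z z' \<and> w = word n z'"
  using assms
proof (cases rule: knuth_step.cases)
  case (swap_left c a b p q)
  have n: "n = length p + 3 + length q" using arg_cong[OF swap_left(1), of length] by simp
  have "word n z ! length p = a" "word n z ! (length p + 1) = b" "word n z ! (length p + 2) = c"
    unfolding swap_left(1) by (auto simp: nth_append)
  then have z: "z (length p + 1) = a" "z (length p + 2) = b" "z (length p + 3) = c"
    using n by (auto simp: word_nth numeral_3_eq_3 numeral_2_eq_2)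
  let ?z = "z \<circ> transpose (length p + 1) (length p + 2)"
  have "w = word n ?z"
  proof (rule nth_equalityI)
    fix i assume "i < length w"
    then have i: "i < n" using swap_left n by simp
    have "word n ?z ! i = (if i = length p then b else if i = length p + 1 then a else word n z ! i)"
      using i z by (auto simp: word_nth transpose_def)
    moreover have "word n z ! i = (p @ [a, b, c] @ q) ! i" by (simp only: swap_left(1))
    ultimately show "w ! i = word n ?z ! i"
      unfolding swap_left(2) by (auto simp: nth_append nth_Cons numeral_2_eq_2 split: nat.splits)
  qed (use swap_left n in simp)
  moreover have "star_step n (length p + 1) z ?z"
    using swap_left(3) z n by (simp add: star_step_def numeral_3_eq_3)
  ultimately show ?thesis by blast
next
  case (swap_right a b c p q)
  have n: "n = length p + 3 + length q" using arg_cong[OF swap_right(1), of length] by simp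
  have "word n z ! length p = a" "word n z ! (length p + 1) = b" "word n z ! (length p + 2) = c"
    unfolding swap_right(1) by (auto simp: nth_append)
  then have z: "z (length p + 1) = a" "z (length p + 2) = b" "z (length p + 3) = c"
    using n by (auto simp: word_nth numeral_3_eq_3 numeral_2_eq_2)
  let ?z = "z \<circ> transpose (length p + 2) (length p + 3)"
  have "w = word n ?z"
  proof (rule nth_equalityI)
    fix i assume "i < length w"
    then have i: "i < n" using swap_right n by simp
    have "word n ?z ! i = (if i = length p + 1 then c else if i = length p + 2 then b else word n z ! i)"
      using i z by (auto simp: word_nth transpose_def numeral_3_eq_3)
    moreover have "word n z ! i = (p @ [a, b, c] @ q) ! i" by (simp only: swap_right(1))
    ultimately show "w ! i = word n ?z ! i"
      unfolding swap_right(2) by (auto simp: nth_append nth_Cons numeral_2_eq_2 split: nat.splits)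
  qed (use swap_right n in simp)
  moreover have "star_step n (length p + 1) z ?z"
    using swap_right(3) z n by (simp add: star_step_def numeral_3_eq_3 eval_nat_numeral)
  ultimately show ?thesis by blast
qed

lemma knuth_word:
  assumes "knuth (word n z) w"
  shows "\<exists>z'. (some_star_step n)\<^sup>*\<^sup>* z z' \<and> w = word n z'"
  using assms
proof (induction rule: rtranclp_induct)
  case (step v w)
  then obtain z' where z': "(some_star_step n)\<^sup>*\<^sup>* z z'" "v = word n z'" by blast
  with step(2) obtain j z'' where "star_step n j z' z''" "w = word n z''"
    using knuth_step_word by blast
  moreover from this z' have "(some_star_step n)\<^sup>*\<^sup>* z z''"
    by (blast intro: rtranclp.rtrancl_into_rtrancl)
  ultimately show ?case by blast
qed auto

section \<open>Column words of tableaux as permutations of maximal weight\<close>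

text \<open>A numerical form of the lexicographic order on descent sets in which the earliest
  difference decides: one descent outweighs all later ones together.\<close>

definition descent_weight :: "nat \<Rightarrow> (nat \<Rightarrow> nat) \<Rightarrow> nat" where
  "descent_weight n z = (\<Sum>j\<in>descents n z. 2 ^ (n - j))"

text \<open>The maximal decreasing runs are the columns from left to right, each read from bottom to
  top; \<open>i\<close> counts rows from the top, and the inequality compares horizontal neighbours.
  While \<open>a\<close> to \<open>b - 1\<close> is a full run, \<open>b\<close> to
  \<open>c - 1\<close> may be any initial part of the next one; stopping early only weakens the
  condition, since values fall along the run.\<close>

definition tableau :: "nat \<Rightarrow> (nat \<Rightarrow> nat) \<Rightarrow> bool" where
  "tableau n z \<longleftrightarrow> (\<forall>a b c. 1 \<le> a \<and> a < b \<and> b < c \<and> c \<le> Suc n \<and>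
     (\<forall>j. a \<le> j \<and> Suc j < b \<longrightarrow> z (Suc j) < z j) \<and> (\<forall>j. b \<le> j \<and> Suc j < c \<longrightarrow> z (Suc j) < z j) \<and>
     z (b - 1) < z b \<and> (a = 1 \<or> z (a - 1) < z a) \<longrightarrow>
     c - b \<le> b - a \<and> (\<forall>i < c - b. z (b - 1 - i) < z (c - 1 - i)))"

lemma finite_descents [simp]: "finite (descents n z)"
  by (rule finite_subset[of _ "{..n}"]) (auto simp: descents_def)

lemma sum_pow2_less: "(\<Sum>j\<in>{b..<n}. 2 ^ (n - j)) < (2::nat) ^ (n - b + 1)" if "b \<le> n"
  using that
proof (induction "n - b" arbitrary: b)
  case 0
  then show ?case by simp
next
  case (Suc k)
  then have "(\<Sum>j\<in>{Suc b..<n}. 2 ^ (n - j)) < (2::nat) ^ (n - Suc b + 1)" by (intro Suc.hyps) auto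
  moreover have "{b..<n} = insert b {Suc b..<n}" using Suc by auto
  moreover have "n - Suc b + 1 = n - b" using Suc by simp
  then have "(2::nat) ^ (n - Suc b + 1) = 2 ^ (n - b)" by (simp only:)
  ultimately show ?case by simp
qed

lemma descent_weight_less:
  assumes b: "b \<in> descents n z'" "b \<notin> descents n z"
    and sub: "\<And>j. j \<in> descents n z \<Longrightarrow> j < b \<Longrightarrow> j \<in> descents n z'"
  shows "descent_weight n z < descent_weight n z'"
proof -
  let ?f = "\<lambda>j. (2::nat) ^ (n - j)"
  let ?A = "{j \<in> descents n z. j < b}"
  have bn: "b < n" using b by (auto simp: descents_def)
  have "descent_weight n z \<le> sum ?f (?A \<union> {Suc b..<n})"
    unfolding descent_weight_def
  proof (rule sum_mono2)
    show "descents n z \<subseteq> ?A \<union> {Suc b..<n}"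
    proof
      fix j assume "j \<in> descents n z"
      moreover from this b have "j \<noteq> b" "j < n" by (auto simp: descents_def)
      ultimately show "j \<in> ?A \<union> {Suc b..<n}" by auto
    qed
  qed auto
  also have "\<dots> = sum ?f ?A + sum ?f {Suc b..<n}"
    by (rule sum.union_disjoint) auto
  also have "sum ?f {Suc b..<n} < 2 ^ (n - b)"
    using sum_pow2_less[of "Suc b" n] bn by (simp add: Suc_diff_Suc)
  then have "sum ?f ?A + sum ?f {Suc b..<n} < sum ?f (insert b ?A)" by (simp add: sum.insert)
  also have "\<dots> \<le> descent_weight n z'"
    unfolding descent_weight_def using b sub by (intro sum_mono2) auto
  finally show ?thesis .
qed

lemma decreasing_map:
  assumes "\<And>j. a \<le> j \<Longrightarrow> Suc j < b \<Longrightarrow> z (Suc j) < (z j :: nat)"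
  shows "decreasing (map z [a..<b])"
proof -
  have "z j < z i" if "a \<le> i" "i < j" "j < b" for i j
    using that(2,3)
  proof (induction j)
    case (Suc j)
    then show ?case using assms[of j] that(1) by (cases "i = j") (auto intro: less_trans)
  qed simp
  then show ?thesis by (auto simp: sorted_wrt_iff_nth_less)
qed

text \<open>If two neighbouring columns violate the condition, column insertion lengthens the left
  one without touching what precedes it. The ascent at \<open>b - 1\<close> becomes a descent, and
  the weight rises.\<close>

lemma max_weight_tableau:
  assumes z: "z permutes {1..n}"
    and max: "\<And>z'. (some_star_step n)\<^sup>*\<^sup>* z z' \<Longrightarrow> descent_weight n z' \<le> descent_weight n z"
  shows "tableau n z"
  unfolding tableau_def
proof (intro allI impI)
  fix a b c
  assume H: "1 \<le> a \<and> a < b \<and> b < c \<and> c \<le> Suc n \<and>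
     (\<forall>j. a \<le> j \<and> Suc j < b \<longrightarrow> z (Suc j) < z j) \<and> (\<forall>j. b \<le> j \<and> Suc j < c \<longrightarrow> z (Suc j) < z j) \<and>
     z (b - 1) < z b \<and> (a = 1 \<or> z (a - 1) < z a)"
  define A C P Q where "A = map z [a..<b]" and "C = map z [b..<c]"
    and "P = map z [1..<a]" and "Q = map z [c..<Suc n]"
  have split: "[i..<k] = [i..<j] @ [j..<k]" if "i \<le> j" "j \<le> k" for i j k :: nat
    using upt_add_eq_append[OF that(1), of "k - j"] that(2) by simp
  have "[1..<Suc n] = [1..<a] @ [a..<b] @ [b..<c] @ [c..<Suc n]"
    using H split[of 1 a "Suc n"] split[of a b "Suc n"] split[of b c "Suc n"] by simp
  then have word: "word n z = P @ (A @ C) @ Q"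
    by (simp add: word_def A_def C_def P_def Q_def del: upt_Suc)
  have dA: "decreasing A" and dC: "decreasing C"
    unfolding A_def C_def using H by (auto intro!: decreasing_map)
  have dist: "distinct (A @ C)"
    unfolding A_def C_def map_append[symmetric] distinct_map
    using inj_on_subset[OF permutes_inj[OF z] subset_UNIV] by simp
  have "column_pair A C"
  proof (rule ccontr)
    assume "\<not> column_pair A C"
    from knuth_lengthen_column[OF dA dC dist this] obtain A' D
      where kn: "knuth (A @ C) (A' @ D)" and A': "decreasing A'" "length A < length A'" by blast
    from knuth_context[OF kn, of P Q] word have "knuth (word n z) (P @ (A' @ D) @ Q)" by simp
    from knuth_word[OF this] obtain z' where z': "(some_star_step n)\<^sup>*\<^sup>* z z'"
      "word n z' = P @ A' @ D @ Q" by auto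
    have len: "length P = a - 1" "length A' > b - a" using A' by (auto simp: P_def A_def)
    have lenn: "length P + length A' \<le> n" using arg_cong[OF z'(2), of length] by simp
    have low: "z' j = z j" if "1 \<le> j" "j < a" for j
    proof -
      have "j - 1 < length P" using that len by linarith
      then have "word n z' ! (j - 1) = word n z ! (j - 1)" by (simp add: z'(2) word nth_append)
      moreover have "j - 1 < n" "Suc (j - 1) = j" using that H by linarith+
      ultimately show ?thesis using word_nth[of "j - 1" n z] word_nth[of "j - 1" n z'] by simp
    qed
    have dec: "z' (Suc j) < z' j" if "a \<le> j" "j \<le> b - 1" for j
    proof -
      have *: "\<not> j < length P" "j - length P = Suc (j - a)" "Suc (j - a) < length A'"
        "\<not> j - 1 < length P" "j - 1 - length P = j - a"
        using that H len by linarith+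
      then have "word n z' ! j < word n z' ! (j - 1)"
        using sorted_wrt_nth_less[OF A'(1), of "j - a" "Suc (j - a)"]
        by (simp add: z'(2) nth_append)
      moreover have "j - 1 < n" "Suc (j - 1) = j" "j < n" using that H lenn len by linarith+
      ultimately show ?thesis using word_nth[of "j - 1" n z'] word_nth[of j n z'] by simp
    qed
    have "descent_weight n z < descent_weight n z'"
    proof (rule descent_weight_less)
      show "b - 1 \<in> descents n z'" using H dec[of "b - 1"] len lenn by (auto simp: descents_def)
      show "b - 1 \<notin> descents n z" using H by (auto simp: descents_def)
      fix j assume j: "j \<in> descents n z" "j < b - 1"
      \<comment> \<open>Position \<open>a - 1\<close> was no descent before, so it imposes nothing;
        earlier positions are untouched, and those inside the longer column all descend.\<close>
      consider "Suc j < a" | "Suc j = a" | "a \<le> j" by linarith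
      then show "j \<in> descents n z'"
      proof cases
        case 1
        then show ?thesis using j low[of j] low[of "Suc j"] by (auto simp: descents_def)
      next
        case 2
        then show ?thesis using j H by (auto simp: descents_def)
      next
        case 3
        then show ?thesis using j dec[of j] by (auto simp: descents_def)
      qed
    qed
    with max[OF z'(1)] show False by simp
  qed
  then obtain A1 A2 where A: "A = A1 @ A2" and l2: "list_all2 (<) A2 C" by (auto simp: column_pair_def)
  have len: "length A2 = c - b" using list_all2_lengthD[OF l2] by (simp add: C_def)
  have lenA: "length A1 + length A2 = b - a" using arg_cong[OF A, of length] by (simp add: A_def)
  have "z (b - 1 - i) < z (c - 1 - i)" if i: "i < c - b" for i
  proof -
    let ?k = "c - b - 1 - i"
    have "A2 ! ?k < C ! ?k" using list_all2_nthD[OF l2, of ?k] i len by simp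
    moreover have "C ! ?k = z (c - 1 - i)" using i by (simp add: C_def algebra_simps)
    moreover have "A2 ! ?k = A ! (length A1 + ?k)" by (simp add: A)
    moreover have "A ! (length A1 + ?k) = z (b - 1 - i)"
    proof -
      have *: "length A1 + ?k = b - a - 1 - i" using lenA len i by linarith
      show ?thesis unfolding * using i len lenA H by (simp add: A_def)
    qed
    ultimately show ?thesis by simp
  qed
  moreover have "c - b \<le> b - a" using lenA len by simp
  ultimately show "c - b \<le> b - a \<and> (\<forall>i < c - b. z (b - 1 - i) < z (c - 1 - i))" by blast
qed

section \<open>Rows and columns recovered from descents\<close>

text \<open>The row of position \<open>p\<close>, counted from 0 at the top of its column: the
  number of letters that still follow in the run.\<close>

definition run_rank :: "nat \<Rightarrow> (nat \<Rightarrow> nat) \<Rightarrow> nat \<Rightarrow> nat" where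
  "run_rank n z p = (LEAST k. p + k \<notin> descents n z)"

lemma run_rank_end: "p + run_rank n z p \<notin> descents n z"
  unfolding run_rank_def by (rule LeastI[of _ n]) (auto simp: descents_def)

lemma run_rank_descent: "p \<le> j \<Longrightarrow> j < p + run_rank n z p \<Longrightarrow> j \<in> descents n z"
  using not_less_Least[of "j - p" "\<lambda>k. p + k \<notin> descents n z"] by (auto simp: run_rank_def)

lemma run_rank_eqI:
  assumes "\<And>j. p \<le> j \<Longrightarrow> j < p + k \<Longrightarrow> j \<in> descents n z" "p + k \<notin> descents n z"
  shows "run_rank n z p = k"
  unfolding run_rank_def
proof (rule Least_equality)
  fix y assume "p + y \<notin> descents n z"
  with assms(1)[of "p + y"] show "k \<le> y" by linarith
qed (rule assms(2))

lemma run_rank_le: "1 \<le> p \<Longrightarrow> p \<le> n \<Longrightarrow> p + run_rank n z p \<le> n"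
  using run_rank_descent[of p "p + run_rank n z p - 1" n z]
  by (cases "run_rank n z p") (auto simp: descents_def)

lemma run_rank_add:
  assumes "\<And>j. p \<le> j \<Longrightarrow> j < p' \<Longrightarrow> j \<in> descents n z" "p \<le> p'"
  shows "run_rank n z p = run_rank n z p' + (p' - p)"
proof (rule run_rank_eqI)
  fix j assume j: "p \<le> j" "j < p + (run_rank n z p' + (p' - p))"
  show "j \<in> descents n z"
  proof (cases "j < p'")
    case False
    with j assms(2) show ?thesis by (intro run_rank_descent[of p']) auto
  qed (use assms(1) j in auto)
next
  have "p + (run_rank n z p' + (p' - p)) = p' + run_rank n z p'" using assms(2) by simp
  then show "p + (run_rank n z p' + (p' - p)) \<notin> descents n z" using run_rank_end[of p' n z] by (simp only:) simp
qed

text \<open>Position 1 qualifies because 0 is never a descent.\<close>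

definition run_start :: "nat \<Rightarrow> (nat \<Rightarrow> nat) \<Rightarrow> nat \<Rightarrow> bool" where
  "run_start n z b \<longleftrightarrow> 1 \<le> b \<and> b - 1 \<notin> descents n z"

lemma obtain_run_start:
  assumes "1 \<le> p"
  obtains b where "run_start n z b" "b \<le> p" "\<And>j. b \<le> j \<Longrightarrow> j < p \<Longrightarrow> j \<in> descents n z"
proof -
  let ?P = "\<lambda>b. 1 \<le> b \<and> b \<le> p \<and> (\<forall>j. b \<le> j \<and> j < p \<longrightarrow> j \<in> descents n z)"
  define b where "b = (LEAST b. ?P b)"
  have P: "?P b" unfolding b_def by (rule LeastI[of ?P p]) (use assms in auto)
  have least: "b \<le> y" if "?P y" for y
    unfolding b_def using that by (rule Least_le[of ?P])
  have "b - 1 \<notin> descents n z"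
  proof
    assume d: "b - 1 \<in> descents n z"
    then have "1 \<le> b - 1" by (auto simp: descents_def)
    moreover have "j \<in> descents n z" if "b - 1 \<le> j" "j < p" for j
      using that P d by (cases "j = b - 1") auto
    ultimately have "?P (b - 1)" using P by auto
    then have "b \<le> b - 1" by (rule least)
    with P \<open>1 \<le> b - 1\<close> show False by linarith
  qed
  with P show ?thesis by (intro that[of b]) (auto simp: run_start_def)
qed

lemma same_run_rank_neq:
  assumes "run_start n z b" "b \<le> p" "p < p'" "\<And>j. b \<le> j \<Longrightarrow> j < p' \<Longrightarrow> j \<in> descents n z"
  shows "run_rank n z p' < run_rank n z p"
proof -
  have "run_rank n z p = run_rank n z p' + (p' - p)"
  proof (rule run_rank_add)
    fix j assume "p \<le> j" "j < p'"
    then show "j \<in> descents n z" using assms(2,4) by simp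
  qed (use assms(3) in simp)
  with assms(3) show ?thesis by simp
qed

text \<open>The position obtained is the left neighbour of \<open>p\<close> in its row. The run of
  \<open>p\<close> ends just before \<open>p + ?r + 1\<close>, and row \<open>?r\<close> of the
  tableau condition for this choice of \<open>c\<close> is the inequality wanted.\<close>

lemma tableau_previous_run:
  assumes t: "tableau n z" and z: "z permutes {1..n}" and p: "p \<le> n"
    and b: "run_start n z b" "1 < b" "b \<le> p" "\<And>j. b \<le> j \<Longrightarrow> j < p \<Longrightarrow> j \<in> descents n z"
  obtains a p' where "run_start n z a" "a \<le> p'" "p' < b" "z p' < z p"
    "run_rank n z p' = run_rank n z p" "\<And>j. a \<le> j \<Longrightarrow> j < b - 1 \<Longrightarrow> j \<in> descents n z"
proof -
  obtain a where a: "run_start n z a" "a \<le> b - 1" "\<And>j. a \<le> j \<Longrightarrow> j < b - 1 \<Longrightarrow> j \<in> descents n z"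
  proof -
    have "1 \<le> b - 1" using b(2) by simp
    then show ?thesis using that obtain_run_start[of "b - 1" n z] by blast
  qed
  let ?r = "run_rank n z p"
  have pr: "p + ?r \<le> n" using run_rank_le[of p n z] b p by (auto simp: run_start_def)
  have asc: "z i < z (Suc i)" if "i \<notin> descents n z" "1 \<le> i" "i < n" for i
  proof -
    have "z i \<noteq> z (Suc i)" using inj_eq[OF permutes_inj[OF z], of i "Suc i"] by simp
    with that show ?thesis by (simp add: descents_def)
  qed
  have *: "z (b - 1) < z b"
    using asc[of "b - 1"] b p by (auto simp: run_start_def)
  have **: "a = 1 \<or> z (a - 1) < z a"
    using asc[of "a - 1"] a b p by (cases "a = 1") (auto simp: run_start_def)
  have d1: "\<forall>j. a \<le> j \<and> Suc j < b \<longrightarrow> z (Suc j) < z j"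
    using a(3) by (auto simp: descents_def)
  have d2: "\<forall>j. b \<le> j \<and> Suc j < p + ?r + 1 \<longrightarrow> z (Suc j) < z j"
  proof (intro allI impI)
    fix j assume j: "b \<le> j \<and> Suc j < p + ?r + 1"
    have "j \<in> descents n z" using j b(4)[of j] run_rank_descent[of p j n z] by (cases "j < p") auto
    then show "z (Suc j) < z j" by (simp add: descents_def)
  qed
  have main: "p + ?r + 1 - b \<le> b - a \<and> (\<forall>i < p + ?r + 1 - b. z (b - 1 - i) < z (p + ?r + 1 - 1 - i))"
    using t[unfolded tableau_def, rule_format, of a b "p + ?r + 1"] a b d1 d2 * ** pr
    by (auto simp: run_start_def)
  let ?q = "b - 1 - ?r"
  have ri: "?r < p + ?r + 1 - b" using b by simp
  have "z ?q < z p" using main[THEN conjunct2, rule_format, OF ri] by simp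
  moreover have aq: "a \<le> ?q" using main[THEN conjunct1] ri a b by linarith
  moreover have "run_rank n z ?q = ?r"
  proof (rule run_rank_eqI)
    have "?q + ?r = b - 1" using main ri b by linarith
    then show "?q + ?r \<notin> descents n z" "\<And>j. ?q \<le> j \<Longrightarrow> j < ?q + ?r \<Longrightarrow> j \<in> descents n z"
      using b(1) a(3) aq by (auto simp: run_start_def)
  qed
  ultimately show ?thesis using a b by (intro that[of a ?q]) auto
qed

text \<open>Passing to the left neighbour of \<open>p'\<close> lowers the value and keeps the rank.
  Ranks within one column are distinct, so repeating this cannot jump over \<open>p\<close>.\<close>

lemma tableau_rows_increase:
  assumes t: "tableau n z" and z: "z permutes {1..n}"
  shows "1 \<le> p \<Longrightarrow> p < p' \<Longrightarrow> p' \<le> n \<Longrightarrow> run_rank n z p = run_rank n z p' \<Longrightarrow> z p < z p'"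
proof (induction p' rule: less_induct)
  case (less p')
  obtain b where b: "run_start n z b" "b \<le> p'" "\<And>j. b \<le> j \<Longrightarrow> j < p' \<Longrightarrow> j \<in> descents n z"
    using obtain_run_start[of p' n z] less.prems by auto
  have pb: "p < b"
    using same_run_rank_neq[OF b(1) _ less.prems(2) b(3)] less.prems by force
  then have "1 < b" using less.prems by simp
  obtain a q where a: "run_start n z a" "a \<le> q" "q < b" "z q < z p'"
    "run_rank n z q = run_rank n z p'" "\<And>j. a \<le> j \<Longrightarrow> j < b - 1 \<Longrightarrow> j \<in> descents n z"
    using tableau_previous_run[OF t z less.prems(3) b(1) \<open>1 < b\<close> b(2,3)] by blast
  consider "p = q" | "p < q" | "q < p" by linarith
  then show ?case
  proof cases
    case 1
    then show ?thesis using a by simp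
  next
    case 2
    then have "z p < z q" using less a b by (intro less.IH) auto
    then show ?thesis using a by simp
  next
    case 3
    then have "run_rank n z p < run_rank n z q"
      using a pb by (intro same_run_rank_neq[OF a(1)]) auto
    then show ?thesis using less a by simp
  qed
qed

text \<open>Column heights weakly decrease: moving to left neighbours keeps the rank and ends in the
  column of \<open>p\<close>, whose largest rank is at its start.\<close>

lemma tableau_run_rank_le:
  assumes t: "tableau n z" and z: "z permutes {1..n}" and p: "run_start n z p"
  shows "p \<le> p' \<Longrightarrow> p' \<le> n \<Longrightarrow> run_rank n z p' \<le> run_rank n z p"
proof (induction p' rule: less_induct)
  case (less p')
  have p1: "1 \<le> p" using p by (simp add: run_start_def)
  obtain b where b: "run_start n z b" "b \<le> p'" "\<And>j. b \<le> j \<Longrightarrow> j < p' \<Longrightarrow> j \<in> descents n z"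
    using obtain_run_start[of p' n z] less.prems p1 by auto
  have "\<not> b < p"
  proof
    assume "b < p"
    then have "b \<le> p - 1" "p - 1 < p'" using less.prems by linarith+
    then show False using b(3) p by (simp add: run_start_def)
  qed
  show ?case
  proof (cases "b = p")
    case True
    then show ?thesis using run_rank_add[of p p' n z] b less.prems by auto
  next
    case False
    with \<open>\<not> b < p\<close> p1 have "p < b" "1 < b" by auto
    obtain a q where a: "run_start n z a" "a \<le> q" "q < b" "z q < z p'"
      "run_rank n z q = run_rank n z p'" "\<And>j. a \<le> j \<Longrightarrow> j < b - 1 \<Longrightarrow> j \<in> descents n z"
      using tableau_previous_run[OF t z less.prems(2) b(1) \<open>1 < b\<close> b(2,3)] by blast
    have "\<not> a < p"
    proof
      assume "a < p"
      then have "a \<le> p - 1" "p - 1 < b - 1" using \<open>p < b\<close> p1 by linarith+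
      then show False using a(6) p by (simp add: run_start_def)
    qed
    then have "run_rank n z q \<le> run_rank n z p" using a b less.prems by (intro less.IH) auto
    then show ?thesis using a by simp
  qed
qed

section \<open>Tableau words whose inverse is a tableau word\<close>

lemma run_decreasing: "i \<le> j \<Longrightarrow> j \<le> run_rank n z p \<Longrightarrow> z (p + j) + (j - i) \<le> z (p + i)"
proof (induction j rule: nat_induct_at_least)
  case (Suc j)
  have "p + j \<in> descents n z" using Suc by (intro run_rank_descent[of p]) auto
  then have "z (Suc (p + j)) < z (p + j)" by (simp add: descents_def)
  with Suc show ?case by simp
qed simp

text \<open>The values from \<open>Suc K\<close> to \<open>Suc K + m\<close> stand at positions
  moving to the left, since the inverse descends there, whereas along a row values increase to the
  right. Hence they lie in distinct rows, and the column starting at \<open>Suc K\<close> meets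
  every row that is left.\<close>

lemma inverse_run_rank_le:
  assumes z: "z permutes {1..n}" and t: "tableau n z"
    and K: "K < n" and stable: "\<forall>i. K < i \<longrightarrow> i \<le> n \<longrightarrow> K < inv' z i"
    and start: "run_start n z (Suc K)"
  defines "m \<equiv> run_rank n (inv' z) (Suc K)" and "p \<equiv> \<lambda>i. inv' z (Suc K + i)"
  shows "m \<le> run_rank n z (Suc K)" "\<And>i. i \<le> m \<Longrightarrow> K < p i \<and> p i \<le> n"
    "inj_on (\<lambda>i. run_rank n z (p i)) {..m}"
proof -
  have zp: "z (p i) = Suc K + i" for i by (simp add: p_def permutes_inverses[OF z])
  have mn: "Suc K + m \<le> n" unfolding m_def using K by (intro run_rank_le) auto
  show range: "K < p i \<and> p i \<le> n" if "i \<le> m" for i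
    using that stable[rule_format, of "Suc K + i"] mn permutes_in_image[OF permutes_inv[OF z], of "Suc K + i"]
    by (auto simp: p_def)
  have neq: "run_rank n z (p i) \<noteq> run_rank n z (p j)" if "i < j" "j \<le> m" for i j
  proof
    assume eq: "run_rank n z (p i) = run_rank n z (p j)"
    have "p j < p i" using run_decreasing[of i j n "inv' z" "Suc K"] that by (simp add: p_def m_def)
    then have "z (p j) < z (p i)"
      using eq range[of i] range[of j] that by (intro tableau_rows_increase[OF t z]) auto
    with that show False by (simp add: zp)
  qed
  then show inj: "inj_on (\<lambda>i. run_rank n z (p i)) {..m}"
    by (intro inj_onI) (metis atMost_iff linorder_neqE_nat)
  have "(\<lambda>i. run_rank n z (p i)) ` {..m} \<subseteq> {..run_rank n z (Suc K)}"
    using range by (auto intro!: tableau_run_rank_le[OF t z start] simp: Suc_le_eq)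
  then have "card {..m} \<le> card {..run_rank n z (Suc K)}"
    using inj by (intro card_inj_on_le) auto
  then show "m \<le> run_rank n z (Suc K)" by simp
qed

text \<open>The row bound for \<open>z\<close> and for its inverse gives both first columns the same
  height. The value \<open>Suc K + i\<close> cannot have rank above \<open>i\<close>, as the letters
  behind it in its run are smaller and still exceed \<open>K\<close>; since the ranks are distinct,
  each must be exactly \<open>i\<close>.\<close>

lemma tableau_first_block:
  assumes z: "z permutes {1..n}" and t: "tableau n z" "tableau n (inv' z)"
    and K: "K < n" and stable: "\<forall>i. K < i \<longrightarrow> i \<le> n \<longrightarrow> K < z i"
      "\<forall>i. K < i \<longrightarrow> i \<le> n \<longrightarrow> K < inv' z i"
    and start: "run_start n z (Suc K)" "run_start n (inv' z) (Suc K)"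
  defines "k \<equiv> run_rank n z (Suc K)"
  shows "run_rank n (inv' z) (Suc K) = k" "\<And>i. i \<le> k \<Longrightarrow> z (Suc K + i) = Suc K + (k - i)"
proof -
  let ?p = "\<lambda>i. inv' z (Suc K + i)"
  note z' = permutes_inv[OF z]
  note ii = permutes_inv_inv[OF z]
  note A = inverse_run_rank_le[OF z t(1) K stable(2) start(1)]
  note B = inverse_run_rank_le[OF z' t(2) K, unfolded ii, OF stable(1) start(2)]
  show eq: "run_rank n (inv' z) (Suc K) = k" using A(1) B(1) by (simp add: k_def)
  note range = A(2)[unfolded eq] and inj = A(3)[unfolded eq]
  have zp: "z (?p i) = Suc K + i" for i by (simp add: permutes_inverses[OF z])
  have le: "run_rank n z (?p i) \<le> i" if "i \<le> k" for i
  proof -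
    let ?r = "run_rank n z (?p i)"
    have "?p i + ?r \<le> n" using range[OF that] by (intro run_rank_le) auto
    then have "K < z (?p i + ?r)" using range[OF that] by (intro stable(1)[rule_format]) auto
    with run_decreasing[of 0 ?r n z "?p i"] zp[of i] show ?thesis by simp
  qed
  have rank: "run_rank n z (?p i) = i" if "i \<le> k" for i
    using that
  proof (induction i rule: less_induct)
    case (less i)
    have "\<not> run_rank n z (?p i) < i"
    proof
      assume a: "run_rank n z (?p i) < i"
      with less have "run_rank n z (?p (run_rank n z (?p i))) = run_rank n z (?p i)" by auto
      from inj_onD[OF inj this] a less.prems show False by auto
    qed
    with le[OF less.prems] show ?case by simp
  qed
  have pk: "?p k + k \<le> n" using run_rank_le[of "?p k" n z] range[of k] rank[of k] by simp
  \<comment> \<open>The run from \<open>?p k\<close> has \<open>k + 1\<close> letters, starts with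
    the value \<open>Suc K + k\<close> and stays above \<open>K\<close>, so it takes every value in
    between.\<close>
  have val: "z (?p k + i) = Suc K + (k - i)" if "i \<le> k" for i
  proof -
    have "K < z (?p k + k)" using range[of k] pk by (intro stable(1)[rule_format]) auto
    moreover have "z (?p k + k) + (k - i) \<le> z (?p k + i)"
      using run_decreasing[of i k n z "?p k"] that rank[of k] by simp
    moreover have "z (?p k + i) + i \<le> z (?p k)"
      using run_decreasing[of 0 i n z "?p k"] that rank[of k] by simp
    ultimately show ?thesis using zp[of k] that by linarith
  qed
  \<comment> \<open>Were this run not the first column, its top letter would stand in row 0 to the
    right of the top of the first column and exceed it, although it is \<open>Suc K\<close>, the
    least value left.\<close>
  have "\<not> Suc K + k < ?p k + k"
  proof
    assume lt: "Suc K + k < ?p k + k"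
    have "run_rank n z (Suc K + k) = 0"
      using run_rank_end[of "Suc K" n z] by (intro run_rank_eqI) (auto simp: k_def)
    moreover have "run_rank n z (?p k + k) = 0"
      using run_rank_end[of "?p k" n z] rank[of k] by (intro run_rank_eqI) auto
    ultimately have "z (Suc K + k) < z (?p k + k)"
      using lt pk by (intro tableau_rows_increase[OF t(1) z]) auto
    moreover have "K < z (Suc K + k)" using lt pk by (intro stable(1)[rule_format]) auto
    ultimately show False using val[of k] by simp
  qed
  then have "?p k = Suc K" using range[of k] by simp
  with val show "z (Suc K + i) = Suc K + (k - i)" if "i \<le> k" for i using that by simp
qed

lemma run_rank_cong: "descents n z = descents n z' \<Longrightarrow> run_rank n z p = run_rank n z' p"
  by (simp add: run_rank_def)

text \<open>Such a permutation reverses the successive blocks cut out by its descents, so it can be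
  recovered block by block. In \<open>good z K\<close> the first \<open>K\<close> positions are
  finished, for the permutation and its inverse alike.\<close>

lemma tableau_unique:
  assumes z: "z permutes {1..n}" "tableau n z" "tableau n (inv' z)"
    and z': "z' permutes {1..n}" "tableau n z'" "tableau n (inv' z')"
    and desc: "descents n z = descents n z'"
  shows "z = z'"
proof -
  define good where "good z K \<longleftrightarrow> (\<forall>i. K < i \<longrightarrow> i \<le> n \<longrightarrow> K < z i) \<and>
    (\<forall>i. K < i \<longrightarrow> i \<le> n \<longrightarrow> K < inv' z i) \<and> run_start n z (Suc K) \<and> run_start n (inv' z) (Suc K)"
    for z K
  have good_step: "good z (Suc K + run_rank n z (Suc K))"
    if good: "good z K" and K: "K < n" and z: "z permutes {1..n}" "tableau n z" "tableau n (inv' z)" for z K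
  proof -
    let ?k = "run_rank n z (Suc K)"
    note block = tableau_first_block[OF z K] 
    have eq: "run_rank n (inv' z) (Suc K) = ?k"
      and val: "\<And>i. i \<le> ?k \<Longrightarrow> z (Suc K + i) = Suc K + (?k - i)"
      using block good by (auto simp: good_def)
    have inv_val: "inv' z (Suc K + i) = Suc K + (?k - i)" if "i \<le> ?k" for i
      using val[of "?k - i"] that permutes_inverses(2)[OF z(1), of "Suc K + (?k - i)"] by simp
    have 1: "Suc K + ?k < z i" if "Suc K + ?k < i" "i \<le> n" for i
    proof (rule ccontr)
      assume a: "\<not> Suc K + ?k < z i"
      have "K < z i" using good that by (auto simp: good_def)
      with a have "inv' z (Suc K + (z i - Suc K)) = Suc K + (?k - (z i - Suc K))"
        by (intro inv_val) auto
      with \<open>K < z i\<close> that show False by (simp add: permutes_inverses[OF z(1)])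
    qed
    have 2: "Suc K + ?k < inv' z i" if "Suc K + ?k < i" "i \<le> n" for i
    proof (rule ccontr)
      assume a: "\<not> Suc K + ?k < inv' z i"
      have "K < inv' z i" using good that by (auto simp: good_def)
      with a have "z (Suc K + (inv' z i - Suc K)) = Suc K + (?k - (inv' z i - Suc K))"
        by (intro val) auto
      with \<open>K < inv' z i\<close> that show False by (simp add: permutes_inverses[OF z(1)])
    qed
    show ?thesis
      using 1 2 run_rank_end[of "Suc K" n z] run_rank_end[of "Suc K" n "inv' z"]
      by (auto simp: good_def run_start_def eq)
  qed
  have main: "\<forall>i. K < i \<longrightarrow> z i = z' i" if "good z K" "good z' K" for K
    using that
  proof (induction "n - K" arbitrary: K rule: less_induct)
    case less
    show ?case
    proof (cases "K < n")
      case False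
      then show ?thesis using z(1) z'(1) by (auto simp: permutes_def)
    next
      case True
      let ?k = "run_rank n z (Suc K)"
      have k: "run_rank n z' (Suc K) = ?k" using run_rank_cong[OF desc] by simp
      have IH: "\<forall>i. Suc K + ?k < i \<longrightarrow> z i = z' i"
        using good_step[OF less.prems(1) True z] good_step[OF less.prems(2) True z'] True
        by (intro less.hyps) (auto simp: k)
      have "z (Suc K + i) = z' (Suc K + i)" if "i \<le> ?k" for i
        using tableau_first_block(2)[OF z True, of i] tableau_first_block(2)[OF z' True, of i] less.prems that
        by (auto simp: good_def k)
      then have "z i = z' i" if "K < i" "i \<le> Suc K + ?k" for i
        using that by (metis Suc_leI add_le_cancel_left le_Suc_ex)
      with IH show ?thesis by (metis linorder_not_less)
    qed
  qed
  have good0: "good w 0" if "w permutes {1..n}" for w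
    using permutes_in_image[OF that] permutes_in_image[OF permutes_inv[OF that]]
    by (auto simp: good_def run_start_def descents_def Suc_le_eq)
  have "z i = z' i" for i
    using main[OF good0[OF z(1)] good0[OF z'(1)]] z(1) z'(1) by (cases "i = 0") (auto simp: permutes_def)
  then show ?thesis by blast
qed

section \<open>Left star operations\<close>

text \<open>No number lies between \<open>v\<close> and \<open>Suc v\<close>, so only the comparison
  of these two is reversed.\<close>

lemma transpose_adjacent_less_iff:
  assumes "a \<noteq> b" "{a, b} \<noteq> {v, Suc v}"
  shows "transpose v (Suc v) a < transpose v (Suc v) b \<longleftrightarrow> a < (b::nat)"
  using assms by (auto simp: transpose_def doubleton_eq_iff)

text \<open>A uniform form of both alternatives: the swap takes place at \<open>i\<close>, and
  \<open>k\<close> is the third position, whose value is the witness.\<close>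

lemma star_step_iff:
  "star_step n j z z' \<longleftrightarrow> 1 \<le> j \<and> j + 2 \<le> n \<and> (\<exists>i k. (i = j \<and> k = j + 2 \<or> i = j + 1 \<and> k = j) \<and>
     strictly_between (z k) (z i) (z (Suc i)) \<and> z' = z \<circ> transpose i (Suc i))"
  unfolding star_step_def by auto

lemma inv_comp_transpose:
  assumes "z permutes A" shows "inv' (z \<circ> transpose a b) = transpose a b \<circ> inv' z"
  using assms by (simp add: o_inv_distrib permutes_bij)

lemma inv_eq_comp_transpose:
  assumes "z permutes A" "z' permutes A" "inv' z' = inv' z \<circ> transpose a b"
  shows "z' = transpose a b \<circ> z"
  using inv_comp_transpose[OF permutes_inv[OF assms(1)], of a b] permutes_inv_inv[OF assms(1)]
    permutes_inv_inv[OF assms(2)] assms(3) by simp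

text \<open>The dual Knuth relation: the values \<open>v\<close> and \<open>Suc v\<close> are
  exchanged when the next larger or next smaller value stands between them in position; see
  \<open>left_stepE\<close>.\<close>

definition left_step :: "nat \<Rightarrow> (nat \<Rightarrow> nat) \<Rightarrow> (nat \<Rightarrow> nat) \<Rightarrow> bool" where
  "left_step n z z' \<longleftrightarrow> z permutes {1..n} \<and> z' permutes {1..n} \<and> (\<exists>j. star_step n j (inv' z) (inv' z'))"

lemma left_stepE:
  assumes "left_step n z z'"
  obtains v w where "z permutes {1..n}" "z' = transpose v (Suc v) \<circ> z" "1 \<le> v" "Suc v \<le> n" "1 \<le> w" "w \<le> n"
    "w = Suc (Suc v) \<or> Suc w = v" "strictly_between (inv' z w) (inv' z v) (inv' z (Suc v))"
proof -
  from assms obtain j where zz: "z permutes {1..n}" "z' permutes {1..n}"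
    and "star_step n j (inv' z) (inv' z')" by (auto simp: left_step_def)
  then obtain i k where *: "1 \<le> j" "j + 2 \<le> n" "i = j \<and> k = j + 2 \<or> i = j + 1 \<and> k = j"
     "strictly_between (inv' z k) (inv' z i) (inv' z (Suc i))" "inv' z' = inv' z \<circ> transpose i (Suc i)"
    by (auto simp: star_step_iff)
  from inv_eq_comp_transpose[OF zz *(5)] have "z' = transpose i (Suc i) \<circ> z" .
  with * zz show ?thesis by (intro that[of i k]) auto
qed

lemma left_stepI:
  assumes z: "z permutes {1..n}" and "1 \<le> v" "Suc v \<le> n" "1 \<le> w" "w \<le> n"
    "w = Suc (Suc v) \<or> Suc w = v" "strictly_between (inv' z w) (inv' z v) (inv' z (Suc v))"
  shows "left_step n z (transpose v (Suc v) \<circ> z)"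
proof -
  have t: "transpose v (Suc v) permutes {1..n}" using assms by (intro permutes_swap_id) auto
  have "inv' (transpose v (Suc v) \<circ> z) = inv' z \<circ> transpose v (Suc v)"
    using permutes_bij[OF z] by (simp add: o_inv_distrib)
  moreover have "star_step n (min v w) (inv' z) (inv' z \<circ> transpose v (Suc v))"
    unfolding star_step_iff using assms
    by (intro conjI exI[of _ v] exI[of _ w]) auto
  ultimately show ?thesis
    unfolding left_step_def using z permutes_compose[OF z t] by auto
qed

lemma star_step_sym: "star_step n j z z' \<Longrightarrow> star_step n j z' z"
proof -
  have fl: "(z \<circ> transpose a b) \<circ> transpose a b = z" for a b :: nat
    by (simp add: fun_eq_iff)
  assume "star_step n j z z'"
  then show ?thesis
    unfolding star_step_def using fl by (auto simp: strictly_between_def)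
qed

lemma left_step_sym: "left_step n z z' \<Longrightarrow> left_step n z' z"
  unfolding left_step_def using star_step_sym by blast

text \<open>The witness stands strictly between the exchanged values, so these are never at adjacent
  positions and no comparison of neighbours changes.\<close>

lemma left_step_descents:
  assumes "left_step n z z'" shows "descents n z' = descents n z"
proof -
  from assms obtain v w where z: "z permutes {1..n}" and z': "z' = transpose v (Suc v) \<circ> z"
    and b: "strictly_between (inv' z w) (inv' z v) (inv' z (Suc v))" by (elim left_stepE) 
  have "z' (Suc i) < z' i \<longleftrightarrow> z (Suc i) < z i" for i
    unfolding z' o_def
  proof (rule transpose_adjacent_less_iff)
    show "z (Suc i) \<noteq> z i" using inj_eq[OF permutes_inj[OF z]] by simp
    show "{z (Suc i), z i} \<noteq> {v, Suc v}"
    proof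
      assume "{z (Suc i), z i} = {v, Suc v}"
      then have "inv' z v = Suc i \<and> inv' z (Suc v) = i \<or> inv' z v = i \<and> inv' z (Suc v) = Suc i"
        by (auto simp: doubleton_eq_iff permutes_inv_eq[OF z])
      with b show False by (auto simp: strictly_between_def)
    qed
  qed
  then show ?thesis by (simp add: descents_def)
qed

text \<open>The only comparison at risk is that of horizontal neighbours holding \<open>v\<close> on
  the left and \<open>Suc v\<close> on the right. The witness \<open>w\<close> then lies between
  them in reading order, and its own horizontal neighbour would need a value that is already
  taken.\<close>

lemma left_step_tableau:
  assumes ls: "left_step n z z'" and t: "tableau n z"
  shows "tableau n z'"
  unfolding tableau_def
proof (intro allI impI)
  from ls obtain v w where z: "z permutes {1..n}" and z': "z' = transpose v (Suc v) \<circ> z"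
    and vw: "1 \<le> v" "Suc v \<le> n" "1 \<le> w" "w \<le> n" "w = Suc (Suc v) \<or> Suc w = v"
    and btw: "strictly_between (inv' z w) (inv' z v) (inv' z (Suc v))" by (elim left_stepE) 
  have desc: "z' (Suc i) < z' i \<longleftrightarrow> z (Suc i) < z i" if "1 \<le> i" "i < n" for i
    using left_step_descents[OF ls] that by (auto simp: descents_def set_eq_iff)
  have neq: "z i \<noteq> z j" "z' i \<noteq> z' j" if "i \<noteq> j" for i j
    using that by (simp_all add: z' inj_eq[OF permutes_inj[OF z]] inj_eq[OF inj_transpose])
  fix a b c
  assume H: "1 \<le> a \<and> a < b \<and> b < c \<and> c \<le> Suc n \<and>
     (\<forall>j. a \<le> j \<and> Suc j < b \<longrightarrow> z' (Suc j) < z' j) \<and> (\<forall>j. b \<le> j \<and> Suc j < c \<longrightarrow> z' (Suc j) < z' j) \<and>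
     z' (b - 1) < z' b \<and> (a = 1 \<or> z' (a - 1) < z' a)"
  have asc: "z' (i - 1) < z' i \<longleftrightarrow> z (i - 1) < z i" if "1 < i" "i \<le> n" for i
  proof -
    obtain i' where i: "i = Suc i'" "1 \<le> i'" "i' < n" using \<open>1 < i\<close> \<open>i \<le> n\<close> by (cases i) auto
    show ?thesis using desc[OF i(2,3)] neq[of i' "Suc i'"] unfolding i(1) by (simp; linarith)
  qed
  have d1: "\<forall>j. a \<le> j \<and> Suc j < b \<longrightarrow> z (Suc j) < z j"
    and d2: "\<forall>j. b \<le> j \<and> Suc j < c \<longrightarrow> z (Suc j) < z j"
    using H desc by auto
  have "z (b - 1) < z b" "a = 1 \<or> z (a - 1) < z a" using H asc[of b] asc[of a] by (simp, cases "a = 1") auto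
  with d1 d2 H t[unfolded tableau_def, rule_format, of a b c]
  have len: "c - b \<le> b - a" and col: "\<And>i. i < c - b \<Longrightarrow> z (b - 1 - i) < z (c - 1 - i)" by auto
  have dec1: "z j < z i" if "a \<le> i" "i < j" "j < b" for i j
    using that(2,3)
  proof (induction j)
    case (Suc j)
    then show ?case using d1[rule_format, of j] that(1) by (cases "i = j") (auto intro: less_trans)
  qed simp
  have dec2: "z j < z i" if "b \<le> i" "i < j" "j < c" for i j
    using that(2,3)
  proof (induction j)
    case (Suc j)
    then show ?case using d2[rule_format, of j] that(1) by (cases "i = j") (auto intro: less_trans)
  qed simp
  have "z' (b - 1 - i) < z' (c - 1 - i)" if i: "i < c - b" for i
  proof -
    define p p' where "p = b - 1 - i" and "p' = c - 1 - i"
    have p: "a \<le> p" "p < b" "b \<le> p'" "p' < c" using i len H by (auto simp: p_def p'_def)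
    have lt: "z p < z p'" using col[OF i] by (simp add: p_def p'_def)
    have "{z p, z p'} \<noteq> {v, Suc v}"
    proof
      assume "{z p, z p'} = {v, Suc v}"
      with lt have v: "z p = v" "z p' = Suc v" by (auto simp: doubleton_eq_iff)
      then have vi: "inv' z v = p" "inv' z (Suc v) = p'" by (auto simp: permutes_inv_eq[OF z])
      define q where "q = inv' z w"
      have zq: "z q = w" by (simp add: q_def permutes_inverses[OF z])
      have q: "p < q" "q < p'" using btw vi p by (auto simp: strictly_between_def q_def)
      \<comment> \<open>In the left column \<open>w = v - 1\<close>, and its right neighbour must
        lie strictly between \<open>v - 1\<close> and \<open>v + 1\<close>. In the right column
        \<open>w = v + 2\<close>, and its left neighbour must lie strictly between \<open>v\<close>
        and \<open>v + 2\<close>.\<close>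
      show False
      proof (cases "q < b")
        case True
        then have "w < v" using dec1[of p q] p q v zq by simp
        then have w: "Suc w = v" using vw by auto
        define i' where "i' = b - 1 - q"
        have i': "i' < i" "q = b - 1 - i'" using q True p by (auto simp: i'_def p_def)
        have "w < z (c - 1 - i')" using col[of i'] i' i zq by simp
        moreover have "z (c - 1 - i') < Suc v"
          using dec2[of p' "c - 1 - i'"] p i' i H v by (simp add: p'_def)
        ultimately have "z (c - 1 - i') = z p" using w v by simp
        moreover have "c - 1 - i' \<noteq> p" using i' i p by linarith
        ultimately show False using neq(1) by blast
      next
        case False
        then have "Suc v < w" using dec2[of q p'] p q v zq by simp
        then have w: "w = Suc (Suc v)" using vw by auto
        define i' where "i' = c - 1 - q"
        have i': "i < i'" "i' < c - b" "q = c - 1 - i'" using q False p H by (auto simp: i'_def p'_def)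
        have "z (b - 1 - i') < w" using col[of i'] i' zq by simp
        moreover have "v < z (b - 1 - i')"
          using dec1[of "b - 1 - i'" p] p i' i H v len by (simp add: p_def)
        ultimately have "z (b - 1 - i') = z p'" using w v by simp
        moreover have "b - 1 - i' \<noteq> p'" using i' p by linarith
        ultimately show False using neq(1) by blast
      qed
    qed
    then have "z' p < z' p'"
      unfolding z' o_def using transpose_adjacent_less_iff[of "z p" "z p'" v] lt by auto
    then show ?thesis by (simp add: p_def p'_def)
  qed
  with len show "c - b \<le> b - a \<and> (\<forall>i < c - b. z' (b - 1 - i) < z' (c - 1 - i))" by blast
qed

text \<open>
  The two stars commute with the same pair of transpositions unless the three positions carry exactly
  the three values; then the square is one of the four below, and the transpositions change.
\<close>

lemma star_square_block:
  assumes z: "z permutes {1..n}" and j: "1 \<le> j" "j + 2 \<le> n" and u: "1 \<le> u" "u + 2 \<le> n"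
    and pat: "z j = u \<and> z (j + 1) = u + 2 \<and> z (j + 2) = u + 1 \<and> i = j \<and> v = u \<and> i' = j + 1 \<and> v' = u + 1 \<or>
      z j = u + 2 \<and> z (j + 1) = u \<and> z (j + 2) = u + 1 \<and> i = j \<and> v = u + 1 \<and> i' = j + 1 \<and> v' = u \<or>
      z j = u + 1 \<and> z (j + 1) = u \<and> z (j + 2) = u + 2 \<and> i = j + 1 \<and> v = u + 1 \<and> i' = j \<and> v' = u \<or>
      z j = u + 1 \<and> z (j + 1) = u + 2 \<and> z (j + 2) = u \<and> i = j + 1 \<and> v = u \<and> i' = j \<and> v' = u + 1"
  defines "zl \<equiv> transpose v (Suc v) \<circ> z" and "z' \<equiv> z \<circ> transpose i (Suc i)"
  shows "star_step n j zl (zl \<circ> transpose i' (Suc i'))" "left_step n z' (zl \<circ> transpose i' (Suc i'))"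
proof -
  have inj: "z a = z b \<longleftrightarrow> a = b" for a b using inj_eq[OF permutes_inj[OF z]] .
  have iz: "inv' z (z a) = a" for a by (simp add: permutes_inverses[OF z])
  have other: "z x \<noteq> u \<and> z x \<noteq> u + 1 \<and> z x \<noteq> u + 2" if "x \<noteq> j" "x \<noteq> j + 1" "x \<noteq> j + 2" for x
    using pat that inj[of x j] inj[of x "j + 1"] inj[of x "j + 2"] by metis
  have eq: "zl \<circ> transpose i' (Suc i') = transpose v' (Suc v') \<circ> z'"
  proof
    fix x
    consider "x = j" | "x = j + 1" | "x = j + 2" | "x \<noteq> j" "x \<noteq> j + 1" "x \<noteq> j + 2" by blast
    then show "(zl \<circ> transpose i' (Suc i')) x = (transpose v' (Suc v') \<circ> z') x"
    proof cases
      case 4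
      have "i = j \<or> i = j + 1" "i' = j \<or> i' = j + 1" "v = u \<or> v = u + 1" "v' = u \<or> v' = u + 1"
        using pat by blast+
      then have "transpose i (Suc i) x = x" "transpose i' (Suc i') x = x"
        "transpose v (Suc v) (z x) = z x" "transpose v' (Suc v') (z x) = z x"
        using other[OF 4] 4 by (auto intro!: transpose_apply_other)
      then show ?thesis by (simp add: zl_def z'_def)
    qed (use pat in \<open>elim disjE conjE; simp add: zl_def z'_def transpose_def\<close>)+
  qed
  have p: "z' permutes {1..n}" 
    unfolding z'_def using pat j by (intro permutes_compose permutes_swap_id z) auto
  show "star_step n j zl (zl \<circ> transpose i' (Suc i'))"
    using pat j unfolding star_step_def zl_def
    by (elim disjE conjE; simp add: strictly_between_def transpose_def)
  have inv: "inv' z' = transpose i (Suc i) \<circ> inv' z"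
    unfolding z'_def by (rule inv_comp_transpose[OF z])
  \<comment> \<open>The one of the three values that exchanging \<open>v'\<close> and
    \<open>Suc v'\<close> leaves alone.\<close>
  define w where "w = (if v' = u then u + 2 else u)"
  have pos: "inv' z (z j) = j" "inv' z (z (j + 1)) = j + 1" "inv' z (z (j + 2)) = j + 2" by (rule iz)+
  have "left_step n z' (transpose v' (Suc v') \<circ> z')"
  proof (rule left_stepI[OF p, of _ w])
    show "strictly_between (inv' z' w) (inv' z' v') (inv' z' (Suc v'))"
      unfolding inv w_def using pat pos
      by (elim disjE conjE; simp add: strictly_between_def transpose_def)
  qed (use pat u in \<open>elim disjE conjE; simp add: w_def\<close>)+
  then show "left_step n z' (zl \<circ> transpose i' (Suc i'))" by (simp only: eq)
qed

lemma strictly_between_transpose: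
  assumes "strictly_between c a b" "{c, a} \<noteq> {v, Suc v}" "{c, b} \<noteq> {v, Suc v}"
  shows "strictly_between (transpose v (Suc v) c) (transpose v (Suc v) a) (transpose v (Suc v) b)"
proof -
  have "c \<noteq> a" "c \<noteq> b" using assms(1) by (auto simp: strictly_between_def)
  with assms transpose_adjacent_less_iff[of a c v] transpose_adjacent_less_iff[of c a v]
    transpose_adjacent_less_iff[of b c v] transpose_adjacent_less_iff[of c b v]
  show ?thesis by (auto simp: strictly_between_def insert_commute)
qed

text \<open>One star operation can disturb the other only by reversing a comparison that the other
  uses, that is, if a pair used by one is the pair swapped by the other. Otherwise the same two
  transpositions apply in either order.\<close>

lemma star_step_left_step_square:
  assumes r: "star_step n j z z'" and l: "left_step n z zl"
  obtains y where "star_step n j zl y" "left_step n z' y"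
proof -
  from l obtain v w where z: "z permutes {1..n}" and zl: "zl = transpose v (Suc v) \<circ> z"
    and vw: "1 \<le> v" "Suc v \<le> n" "1 \<le> w" "w \<le> n" "w = Suc (Suc v) \<or> Suc w = v"
    and lb: "strictly_between (inv' z w) (inv' z v) (inv' z (Suc v))" by (elim left_stepE) 
  from r obtain i k where j: "1 \<le> j" "j + 2 \<le> n" and ik: "i = j \<and> k = j + 2 \<or> i = j + 1 \<and> k = j"
    and rb: "strictly_between (z k) (z i) (z (Suc i))" and z': "z' = z \<circ> transpose i (Suc i)"
    by (auto simp: star_step_iff)
  have inv: "inv' z a = b \<longleftrightarrow> z b = a" for a b using permutes_inv_eq[OF z] .
  have zi: "z (inv' z a) = a" for a by (simp add: permutes_inverses[OF z])
  have p: "z' permutes {1..n}" using star_step_permutes[OF r z] .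
  show ?thesis
  proof (cases "{z k, z i} = {v, Suc v} \<or> {z k, z (Suc i)} = {v, Suc v} \<or>
      {inv' z w, inv' z v} = {i, Suc i} \<or> {inv' z w, inv' z (Suc v)} = {i, Suc i}")
    case False
    have "strictly_between (zl k) (zl i) (zl (Suc i))"
      unfolding zl o_def using False by (intro strictly_between_transpose[OF rb]) simp_all
    then have "star_step n j zl (zl \<circ> transpose i (Suc i))"
      unfolding star_step_iff using j ik by blast
    moreover have "left_step n z' (transpose v (Suc v) \<circ> z')"
    proof (rule left_stepI[OF p vw])
      show "strictly_between (inv' z' w) (inv' z' v) (inv' z' (Suc v))"
        unfolding z' inv_comp_transpose[OF z] o_apply
        using False by (intro strictly_between_transpose[OF lb]) simp_all
    qed
    moreover have "transpose v (Suc v) \<circ> z' = zl \<circ> transpose i (Suc i)"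
      by (simp add: zl z' comp_assoc)
    ultimately show ?thesis by (intro that) simp_all
  next
    case True
    \<comment> \<open>A single coincidence forces all of them: the three positions carry exactly
      \<open>u\<close>, \<open>u + 1\<close> and \<open>u + 2\<close>, with the witness value
      \<open>w\<close> in the middle position.\<close>
    define u where "u = min v w"
    have u: "1 \<le> u" "u + 2 \<le> n" using vw by (auto simp: u_def)
    have "z j = u \<and> z (j + 1) = u + 2 \<and> z (j + 2) = u + 1 \<and> i = j \<and> v = u \<or>
      z j = u + 2 \<and> z (j + 1) = u \<and> z (j + 2) = u + 1 \<and> i = j \<and> v = u + 1 \<or>
      z j = u + 1 \<and> z (j + 1) = u \<and> z (j + 2) = u + 2 \<and> i = j + 1 \<and> v = u + 1 \<or>
      z j = u + 1 \<and> z (j + 1) = u + 2 \<and> z (j + 2) = u \<and> i = j + 1 \<and> v = u"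
    proof -
      define a b c where "a = inv' z v" and "b = inv' z (Suc v)" and "c = inv' z w"
      have zabc: "z a = v" "z b = Suc v" "z c = w" by (simp_all add: a_def b_def c_def zi)
      have x: "z x = v \<longleftrightarrow> x = a" "z x = Suc v \<longleftrightarrow> x = b" for x
        using inv[of v x] inv[of "Suc v" x] by (auto simp: a_def b_def)
      have sb: "strictly_between c a b" using lb by (simp add: a_def b_def c_def)
      have "k = a \<and> i = b \<or> k = b \<and> i = a \<or> k = a \<and> Suc i = b \<or> k = b \<and> Suc i = a \<or>
        c = i \<and> a = Suc i \<or> c = Suc i \<and> a = i \<or> c = i \<and> b = Suc i \<or> c = Suc i \<and> b = i"
        using True by (auto simp: doubleton_eq_iff x a_def b_def c_def)
      moreover have "k = b" if "c = i \<and> a = Suc i \<or> c = Suc i \<and> a = i"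
      proof -
        have "z k = Suc v" using that rb zabc vw by (auto simp: strictly_between_def)
        then show ?thesis by (simp add: x)
      qed
      moreover have "k = a" if "c = i \<and> b = Suc i \<or> c = Suc i \<and> b = i"
      proof -
        have "z k = v" using that rb zabc vw by (auto simp: strictly_between_def)
        then show ?thesis by (simp add: x)
      qed
      ultimately have abc: "a = j \<and> c = j + 1 \<and> b = j + 2 \<or> a = j + 2 \<and> c = j + 1 \<and> b = j"
        using sb ik by (auto simp: strictly_between_def)
      have "z (j + 1) = w" "z j = v \<and> z (j + 2) = Suc v \<or> z j = Suc v \<and> z (j + 2) = v"
        using abc zabc by (elim disjE conjE; simp)+
      moreover have "w = Suc (Suc v) \<and> u = v \<or> w = u \<and> v = Suc u"
        using vw(5) by (auto simp: u_def)
      ultimately show ?thesis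
        using rb ik by (elim disjE conjE; simp add: strictly_between_def)
    qed
    then obtain i' v' where "z j = u \<and> z (j + 1) = u + 2 \<and> z (j + 2) = u + 1 \<and> i = j \<and> v = u \<and> i' = j + 1 \<and> v' = u + 1 \<or>
      z j = u + 2 \<and> z (j + 1) = u \<and> z (j + 2) = u + 1 \<and> i = j \<and> v = u + 1 \<and> i' = j + 1 \<and> v' = u \<or>
      z j = u + 1 \<and> z (j + 1) = u \<and> z (j + 2) = u + 2 \<and> i = j + 1 \<and> v = u + 1 \<and> i' = j \<and> v' = u \<or>
      z j = u + 1 \<and> z (j + 1) = u + 2 \<and> z (j + 2) = u \<and> i = j + 1 \<and> v = u \<and> i' = j \<and> v' = u + 1"
      by blast
    from star_square_block[OF z j u this] show ?thesis
      unfolding z'[symmetric] zl[symmetric] by (rule that)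
  qed
qed

lemma star_step_unique: "star_step n j z y \<Longrightarrow> star_step n j z y' \<Longrightarrow> y = y'"
  unfolding star_step_def strictly_between_def by auto

lemma left_steps_star_step:
  assumes "(left_step n)\<^sup>*\<^sup>* z y" "star_step n j z z'"
  obtains y' where "star_step n j y y'" "(left_step n)\<^sup>*\<^sup>* z' y'"
proof -
  have "\<exists>y'. star_step n j y y' \<and> (left_step n)\<^sup>*\<^sup>* z' y'"
    using assms
  proof (induction rule: rtranclp_induct)
    case (step y x)
    then obtain y' where y': "star_step n j y y'" "(left_step n)\<^sup>*\<^sup>* z' y'" by blast
    obtain x' where "star_step n j x x'" "left_step n y' x'"
      using star_step_left_step_square[OF y'(1) step(2)] by blast
    with y' show ?case by (blast intro: rtranclp.rtrancl_into_rtrancl)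
  qed auto
  then show ?thesis using that by blast
qed

lemma left_steps_sym: "(left_step n)\<^sup>*\<^sup>* z y \<Longrightarrow> (left_step n)\<^sup>*\<^sup>* y z"
  using left_step_sym by (metis sympI symp_rtranclp sympD)

lemma left_steps_invariant:
  assumes "(left_step n)\<^sup>*\<^sup>* z y"
  shows "descents n y = descents n z" "tableau n z \<Longrightarrow> tableau n y" "z permutes {1..n} \<Longrightarrow> y permutes {1..n}"
  using assms
proof (induction rule: rtranclp_induct)
  case (step x y)
  { case 1 show ?case using step left_step_descents by metis }
  { case 2 then show ?case using step left_step_tableau by metis }
  { case 3 then show ?case using step by (simp add: left_step_def) }
qed auto

section \<open>Normal forms and connectedness\<close>

lemma descent_weight_bound: "descent_weight n z < 2 ^ (n + 1)"
proof -
  have "descent_weight n z \<le> (\<Sum>j\<in>{0..<n}. 2 ^ (n - j))"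
    unfolding descent_weight_def by (intro sum_mono2) (auto simp: descents_def)
  also have "\<dots> < 2 ^ (n + 1)" using sum_pow2_less[of 0 n] by simp
  finally show ?thesis .
qed

lemma obtain_max_descent_weight:
  assumes "P x"
  obtains y where "P y" "\<And>w. P w \<Longrightarrow> descent_weight n (f w) \<le> descent_weight n (f y)"
  using ex_has_greatest_nat[of P x "\<lambda>w. descent_weight n (f w)" "2 ^ (n + 1)"] assms
    descent_weight_bound less_imp_le by metis

lemma left_steps_inv:
  assumes "(some_star_step n)\<^sup>*\<^sup>* (inv' c) w" "c permutes {1..n}"
  shows "(left_step n)\<^sup>*\<^sup>* c (inv' w)"
  using assms(1)
proof (induction rule: rtranclp_induct)
  case base
  show ?case by (simp add: permutes_inv_inv[OF assms(2)])
next
  case (step w w')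
  have w: "w permutes {1..n}"
    by (rule star_steps_permutes[OF step(1) permutes_inv[OF assms(2)]])
  with step(2) have w': "w' permutes {1..n}" using star_step_permutes by blast
  have "left_step n (inv' w) (inv' w')"
    using step(2) permutes_inv[OF w] permutes_inv[OF w']
    by (simp add: left_step_def permutes_inv_inv[OF w] permutes_inv_inv[OF w'])
  with step.IH rtranclp.rtrancl_into_rtrancl[of "left_step n" c "inv' w" "inv' w'"] show ?case by simp
qed

text \<open>Left star operations are star operations on the inverse, so maximizing the weight of the
  inverse makes it a tableau word, while the descents and the tableau property of the permutation
  itself are kept.\<close>

lemma tableau_left_normal_form:
  assumes "z permutes {1..n}" "tableau n z"
  obtains c where "(left_step n)\<^sup>*\<^sup>* z c" "c permutes {1..n}" "tableau n c" "tableau n (inv' c)"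
    "descents n c = descents n z"
proof -
  obtain c where c: "(left_step n)\<^sup>*\<^sup>* z c"
    and max: "\<And>w. (left_step n)\<^sup>*\<^sup>* z w \<Longrightarrow> descent_weight n (inv' w) \<le> descent_weight n (inv' c)"
    using obtain_max_descent_weight[of "(left_step n)\<^sup>*\<^sup>* z" z n inv'] by blast
  note inv = left_steps_invariant[OF c]
  have cp: "c permutes {1..n}" using inv assms by simp
  have "tableau n (inv' c)"
  proof (rule max_weight_tableau[OF permutes_inv[OF cp]])
    fix w assume w: "(some_star_step n)\<^sup>*\<^sup>* (inv' c) w"
    have "inv' (inv' w) = w"
      by (rule permutes_inv_inv[OF star_steps_permutes[OF w permutes_inv[OF cp]]])
    with max[OF rtranclp_trans[OF c left_steps_inv[OF w cp]]]
    show "descent_weight n w \<le> descent_weight n (inv' c)" by simp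
  qed
  with c cp inv assms show ?thesis using that[of c] by blast
qed

text \<open>
  Moving both permutations in parallel to maximal descent weight makes them column words of tableaux of the same
  shape, and these have the same left normal form.
\<close>

lemma generalized_tau_invariant_connected:
  assumes sym: "\<And>z y. E z y \<Longrightarrow> E y z"
    and perm: "\<And>z y. E z y \<Longrightarrow> z permutes {1..n}"
    and desc: "\<And>z y. E z y \<Longrightarrow> descents n z = descents n y"
    and star: "\<And>j z y z'. E z y \<Longrightarrow> star_step n j z z' \<Longrightarrow> \<exists>y'. star_step n j y y' \<and> E z' y'"
    and E: "E z y"
  shows "(left_step n)\<^sup>*\<^sup>* z y"
proof -
  let ?L = "(left_step n)\<^sup>*\<^sup>*"
  \<comment> \<open>The implication remembers that connectedness of the current pair carries back to
    \<open>z\<close> and \<open>y\<close>. It survives a step because left operations commute with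
    star operations and a star operation is undone at the same \<open>j\<close>.\<close>
  define good where "good p \<longleftrightarrow> E (fst p) (snd p) \<and> (?L (fst p) (snd p) \<longrightarrow> ?L z y)" for p
  have good_step: "\<exists>y''. good (z'', y'') \<and> star_step n j y' y''"
    if g: "good (z', y')" and s: "star_step n j z' z''" for j z' y' z''
  proof -
    from g s obtain y'' where y'': "star_step n j y' y''" "E z'' y''"
      using star by (fastforce simp: good_def)
    have "?L z' y'" if L: "?L z'' y''"
    proof -
      obtain b where b: "star_step n j y'' b" "?L z' b"
        using left_steps_star_step[OF L star_step_sym[OF s]] by blast
      then have "b = y'" using star_step_unique star_step_sym[OF y''(1)] by blast
      with b show ?thesis by simp
    qed
    with y'' g show ?thesis by (auto simp: good_def)
  qed
  have good_steps: "\<exists>y''. good (z'', y'')"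
    if "(some_star_step n)\<^sup>*\<^sup>* z' z''" "good (z', y')" for z' y' z''
    using that
  proof (induction rule: rtranclp_induct)
    case (step u v)
    then show ?case using good_step by meson
  qed auto
  have swap: "good (z', y') \<longleftrightarrow> good (y', z')" for z' y'
    using sym left_steps_sym by (auto simp: good_def)
  have "good (z, y)" using E by (simp add: good_def)
  then obtain p where p: "good p"
    and max: "\<And>q. good q \<Longrightarrow> descent_weight n (fst q) \<le> descent_weight n (fst p)"
    using obtain_max_descent_weight[of good "(z, y)" n fst] by blast
  obtain z' y' where [simp]: "p = (z', y')" by force
  have g: "good (z', y')" using p by simp
  then have Ezy: "E z' y'" by (simp add: good_def)
  have zp: "z' permutes {1..n}" and yp: "y' permutes {1..n}" using perm Ezy sym by blast+
  have d: "descents n z' = descents n y'" using desc Ezy by blast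
  have tz: "tableau n z'"
    using good_steps[OF _ g] max by (intro max_weight_tableau[OF zp]) fastforce
  \<comment> \<open>The weight depends on descents only, and \<open>good\<close> is symmetric, so
    the maximum attained at \<open>z'\<close> also bounds every weight reached from
    \<open>y'\<close>.\<close>
  have ty: "tableau n y'"
  proof (rule max_weight_tableau[OF yp])
    fix w assume "(some_star_step n)\<^sup>*\<^sup>* y' w"
    then obtain x where x: "good (w, x)" using good_steps g swap by blast
    then have "descent_weight n w \<le> descent_weight n z'" using max[of "(w, x)"] by simp
    then show "descent_weight n w \<le> descent_weight n y'" by (simp add: descent_weight_def d)
  qed
  obtain c where c: "?L z' c" "c permutes {1..n}" "tableau n c" "tableau n (inv' c)"
    "descents n c = descents n z'" using tableau_left_normal_form[OF zp tz] .
  obtain c' where c': "?L y' c'" "c' permutes {1..n}" "tableau n c'" "tableau n (inv' c')"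
    "descents n c' = descents n y'" using tableau_left_normal_form[OF yp ty] .
  have "c = c'" using c c' d by (intro tableau_unique[of c n c']) auto
  with c c' have "?L z' y'" using left_steps_sym rtranclp_trans by metis
  with g show ?thesis by (simp add: good_def)
qed

section \<open>Coxeter systems of type A\<close>

locale type_A_system = group G for G (structure) +
  fixes S :: "'a set" and n :: nat and \<phi> :: "'a \<Rightarrow> nat \<Rightarrow> nat"
  assumes S_carrier: "S \<subseteq> carrier G"
    and phi_iso: "\<phi> \<in> iso G (sym_group n)"
    and phi_S: "\<phi> ` S = {transpose i (Suc i) | i. 1 \<le> i \<and> i < n}"
begin

section \<open>Length, descents and the exchange property\<close>

abbreviation len :: "'a \<Rightarrow> nat" where
  "len \<equiv> cox_length G S"

abbreviation ldesc :: "'a \<Rightarrow> 'a \<Rightarrow> bool" where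
  "ldesc s w \<equiv> len (s \<otimes> w) < len w"

abbreviation rdesc :: "'a \<Rightarrow> 'a \<Rightarrow> bool" where
  "rdesc s w \<equiv> len (w \<otimes> s) < len w"

lemma S_closed [simp]: "s \<in> S \<Longrightarrow> s \<in> carrier G"
  using S_carrier by blast

text \<open>With this convention right multiplication by a generator permutes positions and left
  multiplication permutes values.\<close>

lemma phi_mult: "x \<in> carrier G \<Longrightarrow> y \<in> carrier G \<Longrightarrow> \<phi> (x \<otimes> y) = \<phi> x \<circ> \<phi> y"
  using phi_iso by (simp add: iso_def hom_def sym_group_mult)

lemma phi_permutes: "x \<in> carrier G \<Longrightarrow> \<phi> x permutes {1..n}"
  using phi_iso by (auto simp: iso_def hom_def sym_group_carrier)

lemma phi_eq_iff: "x \<in> carrier G \<Longrightarrow> y \<in> carrier G \<Longrightarrow> \<phi> x = \<phi> y \<longleftrightarrow> x = y"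
  using phi_iso by (auto simp: iso_def bij_betw_def dest: inj_onD)

lemma phi_one: "\<phi> \<one> = id"
proof -
  have "\<phi> \<one> \<circ> \<phi> \<one> = \<phi> \<one>" using phi_mult[of \<one> \<one>] by simp
  then have "\<phi> \<one> (\<phi> \<one> x) = \<phi> \<one> x" for x by (metis comp_apply)
  then show ?thesis using inj_eq[OF permutes_inj[OF phi_permutes[OF one_closed]]] by (auto simp: fun_eq_iff)
qed

lemma phi_inv: "x \<in> carrier G \<Longrightarrow> \<phi> (inv x) = inv' (\<phi> x)"
  using phi_mult[of "inv x" x] phi_mult[of x "inv x"]
  by (intro inv_unique_comp[symmetric]) (simp_all add: phi_one)

lemma gen_index:
  assumes "s \<in> S" obtains i where "1 \<le> i" "i < n" "\<phi> s = transpose i (Suc i)"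
  using assms phi_S by blast

lemma index_gen:
  assumes "1 \<le> i" "i < n" obtains s where "s \<in> S" "\<phi> s = transpose i (Suc i)"
proof -
  have "transpose i (Suc i) \<in> \<phi> ` S" using assms phi_S by blast
  then show ?thesis using that by auto
qed

lemma finite_carrier: "finite (carrier G)"
proof (rule inj_on_finite[of \<phi> _ "{p. p permutes {1..n}}"])
  show "inj_on \<phi> (carrier G)" using phi_eq_iff by (auto simp: inj_on_def)
qed (use phi_permutes in \<open>auto simp: finite_permutations\<close>)

lemma gen_square: "s \<in> S \<Longrightarrow> s \<otimes> s = \<one>"
proof -
  assume s: "s \<in> S"
  then obtain i where "\<phi> s = transpose i (Suc i)" by (elim gen_index)
  then have "\<phi> (s \<otimes> s) = \<phi> \<one>" using s by (simp add: phi_mult phi_one)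
  then show ?thesis using phi_eq_iff s by simp
qed

lemma gen_cancel: "s \<in> S \<Longrightarrow> w \<in> carrier G \<Longrightarrow> s \<otimes> (s \<otimes> w) = w"
  by (simp add: gen_square m_assoc[symmetric])

lemma gen_cancel_right: "s \<in> S \<Longrightarrow> w \<in> carrier G \<Longrightarrow> w \<otimes> s \<otimes> s = w"
  by (simp add: gen_square m_assoc)

lemma gen_inv: "s \<in> S \<Longrightarrow> inv s = s"
  by (simp add: gen_square inv_equality)

lemma card_inversions_mult_gen:
  assumes "w \<in> carrier G" "s \<in> S" "\<phi> s = transpose i (Suc i)" "1 \<le> i" "i < n"
  shows "card (inversions n (\<phi> (w \<otimes> s))) = (if \<phi> w i < \<phi> w (Suc i)
    then Suc (card (inversions n (\<phi> w))) else card (inversions n (\<phi> w)) - 1)"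
    and "\<not> \<phi> w i < \<phi> w (Suc i) \<Longrightarrow> 0 < card (inversions n (\<phi> w))"
proof -
  have e: "\<phi> (w \<otimes> s) = \<phi> w \<circ> transpose i (Suc i)" using assms by (simp add: phi_mult)
  have w: "\<phi> w = \<phi> (w \<otimes> s) \<circ> transpose i (Suc i)" unfolding e by (simp add: fun_eq_iff)
  have "\<phi> w i \<noteq> \<phi> w (Suc i)" using inj_eq[OF permutes_inj[OF phi_permutes]] assms by simp
  then have "\<not> \<phi> w i < \<phi> w (Suc i) \<Longrightarrow> card (inversions n (\<phi> w)) = Suc (card (inversions n (\<phi> (w \<otimes> s))))"
    using card_inversions_adjacent[OF phi_permutes, of "w \<otimes> s" i, folded w] assms
    by (simp add: e)
  then show "card (inversions n (\<phi> (w \<otimes> s))) = (if \<phi> w i < \<phi> w (Suc i)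
    then Suc (card (inversions n (\<phi> w))) else card (inversions n (\<phi> w)) - 1)"
    "\<not> \<phi> w i < \<phi> w (Suc i) \<Longrightarrow> 0 < card (inversions n (\<phi> w))"
    using card_inversions_adjacent[OF phi_permutes, of w i] assms by (auto simp: e)
qed

lemma gen_prod_simps [simp]: "gen_prod G [] = \<one>" "gen_prod G (s # ss) = s \<otimes> gen_prod G ss"
  by (simp_all add: gen_prod_def)

lemma gen_prod_closed: "set ss \<subseteq> carrier G \<Longrightarrow> gen_prod G ss \<in> carrier G"
  by (induction ss) auto

lemma gen_prod_append:
  "set ss \<subseteq> carrier G \<Longrightarrow> set ts \<subseteq> carrier G \<Longrightarrow> gen_prod G (ss @ ts) = gen_prod G ss \<otimes> gen_prod G ts"
  by (induction ss) (auto simp: gen_prod_closed m_assoc)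

text \<open>Sorting: right multiplication at a descent removes one inversion, and a permutation
  without descents is the identity.\<close>

lemma word_of_inversions:
  "w \<in> carrier G \<Longrightarrow> \<exists>ss. set ss \<subseteq> S \<and> length ss = card (inversions n (\<phi> w)) \<and> gen_prod G ss = w"
proof (induction "card (inversions n (\<phi> w))" arbitrary: w rule: less_induct)
  case less
  show ?case
  proof (cases "\<exists>i. 1 \<le> i \<and> i < n \<and> \<not> \<phi> w i < \<phi> w (Suc i)")
    case False
    then have "\<phi> w = id" using ascending_permutation_id[OF phi_permutes] less.prems by blast
    then have "w = \<one>" using phi_eq_iff[of w \<one>] phi_one less.prems by simp
    moreover have "inversions n (\<phi> w) = {}" using \<open>\<phi> w = id\<close> by (auto simp: inversions_def)
    ultimately show ?thesis by (intro exI[of _ "[]"]) simp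
  next
    case True
    then obtain i where i: "1 \<le> i" "i < n" "\<not> \<phi> w i < \<phi> w (Suc i)" by blast
    obtain s where s: "s \<in> S" "\<phi> s = transpose i (Suc i)" using index_gen[OF i(1,2)] .
    note * = card_inversions_mult_gen[OF less.prems s i(1,2)]
    then obtain ss where ss: "set ss \<subseteq> S" "length ss = card (inversions n (\<phi> (w \<otimes> s)))"
      "gen_prod G ss = w \<otimes> s" using less.hyps[of "w \<otimes> s"] i less.prems s by auto
    have "gen_prod G (ss @ [s]) = w"
      using ss s S_carrier less.prems by (subst gen_prod_append) (auto simp: gen_cancel_right)
    moreover have "length (ss @ [s]) = card (inversions n (\<phi> w))" using * i ss by simp
    ultimately show ?thesis using ss s by (intro exI[of _ "ss @ [s]"]) auto
  qed
qed

lemma inversions_word_le: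
  "set ss \<subseteq> S \<Longrightarrow> card (inversions n (\<phi> (gen_prod G ss))) \<le> length ss"
proof (induction ss rule: rev_induct)
  case Nil
  have "inversions n (\<phi> (gen_prod G [])) = {}" by (auto simp: inversions_def phi_one)
  then show ?case by (simp only: card.empty)
next
  case (snoc s ss)
  then obtain i where i: "1 \<le> i" "i < n" "\<phi> s = transpose i (Suc i)" by (auto elim: gen_index)
  have c: "gen_prod G ss \<in> carrier G" using snoc S_carrier by (intro gen_prod_closed) auto
  have "gen_prod G (ss @ [s]) = gen_prod G ss \<otimes> s"
    using snoc S_carrier by (subst gen_prod_append) auto
  then show ?case using card_inversions_mult_gen(1)[OF c _ i(3,1,2)] snoc by auto
qed

lemma len_inversions: "w \<in> carrier G \<Longrightarrow> len w = card (inversions n (\<phi> w))"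
  unfolding cox_length_def using word_of_inversions inversions_word_le
  by (intro Least_equality) auto

lemma reduced_word_ex: "w \<in> carrier G \<Longrightarrow> \<exists>ss. reduced_word G S w ss"
  using word_of_inversions[of w] by (auto simp: reduced_word_def len_inversions)

lemma len_word_le: "set ss \<subseteq> S \<Longrightarrow> len (gen_prod G ss) \<le> length ss"
  using inversions_word_le[of ss] S_carrier len_inversions[OF gen_prod_closed, of ss] by auto

lemma len_inv: "w \<in> carrier G \<Longrightarrow> len (inv w) = len w"
  by (simp add: len_inversions phi_inv card_inversions_inv[OF phi_permutes])

lemma rdesc_iff:
  assumes "w \<in> carrier G" "s \<in> S" "\<phi> s = transpose i (Suc i)" "1 \<le> i" "i < n"
  shows "rdesc s w \<longleftrightarrow> \<phi> w (Suc i) < \<phi> w i"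
proof -
  have "\<phi> w i \<noteq> \<phi> w (Suc i)" using inj_eq[OF permutes_inj[OF phi_permutes]] assms by simp
  then show ?thesis using card_inversions_mult_gen[OF assms] assms by (auto simp: len_inversions)
qed

lemma len_gen_right: "w \<in> carrier G \<Longrightarrow> s \<in> S \<Longrightarrow> len (w \<otimes> s) = Suc (len w) \<or> len w = Suc (len (w \<otimes> s))"
proof -
  assume a: "w \<in> carrier G" "s \<in> S"
  then obtain i where i: "1 \<le> i" "i < n" "\<phi> s = transpose i (Suc i)" by (elim gen_index)
  show ?thesis
    using card_inversions_mult_gen[OF a i(3,1,2)] a by (auto simp: len_inversions)
qed

lemma inv_mult_gen: "w \<in> carrier G \<Longrightarrow> s \<in> S \<Longrightarrow> inv (s \<otimes> w) = inv w \<otimes> s"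
  by (simp add: inv_mult_group gen_inv)

lemma len_gen_left_inv: "w \<in> carrier G \<Longrightarrow> s \<in> S \<Longrightarrow> len (s \<otimes> w) = len (inv w \<otimes> s)"
  using len_inv[of "s \<otimes> w"] by (simp add: inv_mult_gen)

lemma ldesc_rdesc_inv: "w \<in> carrier G \<Longrightarrow> s \<in> S \<Longrightarrow> ldesc s w \<longleftrightarrow> rdesc s (inv w)"
  by (simp add: len_gen_left_inv len_inv)

lemma rdesc_ldesc_inv: "w \<in> carrier G \<Longrightarrow> s \<in> S \<Longrightarrow> rdesc s w \<longleftrightarrow> ldesc s (inv w)"
  by (simp add: ldesc_rdesc_inv)

lemma len_gen_left: "w \<in> carrier G \<Longrightarrow> s \<in> S \<Longrightarrow> len (s \<otimes> w) = Suc (len w) \<or> len w = Suc (len (s \<otimes> w))"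
  using len_gen_right[of "inv w" s] by (simp add: len_gen_left_inv len_inv)

lemma ldesc_iff:
  assumes "w \<in> carrier G" "s \<in> S" "\<phi> s = transpose i (Suc i)" "1 \<le> i" "i < n"
  shows "ldesc s w \<longleftrightarrow> \<phi> (inv w) (Suc i) < \<phi> (inv w) i"
  using assms by (simp add: ldesc_rdesc_inv rdesc_iff)

lemma ldesc_flip: "w \<in> carrier G \<Longrightarrow> s \<in> S \<Longrightarrow> ldesc s (s \<otimes> w) \<longleftrightarrow> \<not> ldesc s w"
  using len_gen_left[of w s] by (auto simp: gen_cancel)

lemma rdesc_flip: "w \<in> carrier G \<Longrightarrow> s \<in> S \<Longrightarrow> rdesc s (w \<otimes> s) \<longleftrightarrow> \<not> rdesc s w"
  using len_gen_right[of w s] by (auto simp: gen_cancel_right)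

lemma len_one: "len \<one> = 0"
  using len_word_le[of "[]"] by simp

lemma len_gen: "s \<in> S \<Longrightarrow> len s = 1"
  using len_gen_left[of \<one> s] by (simp add: len_one)

lemma gen_mult_neq: "s \<in> S \<Longrightarrow> w \<in> carrier G \<Longrightarrow> s \<otimes> w \<noteq> w"
  using len_gen_left[of w s] by auto

lemma ldesc_ex:
  assumes w: "w \<in> carrier G" "w \<noteq> \<one>" shows "\<exists>s\<in>S. ldesc s w"
proof -
  obtain ss where ss: "set ss \<subseteq> S" "gen_prod G ss = w" "length ss = len w"
    using reduced_word_ex[OF w(1)] by (auto simp: reduced_word_def)
  with w obtain s ts where [simp]: "ss = s # ts" by (cases ss) auto
  have "gen_prod G ts \<in> carrier G" using ss S_carrier by (intro gen_prod_closed) auto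
  then have "s \<otimes> w = gen_prod G ts" using ss by (auto simp: gen_cancel)
  then have "ldesc s w" using len_word_le[of ts] ss by auto
  then show ?thesis using ss by auto
qed

text \<open>Left multiplication by \<open>s\<close> can turn the ascent of \<open>\<phi> w\<close>
  at \<open>j\<close> into a descent only if the two values there are \<open>i\<close> and
  \<open>Suc i\<close>; in that case both products exchange the same two entries.\<close>

lemma exchange:
  assumes w: "w \<in> carrier G" and s: "s \<in> S" and t: "t \<in> S"
    and "\<not> ldesc s w" "\<not> rdesc t w" "len (s \<otimes> w \<otimes> t) < len (s \<otimes> w)"
  shows "s \<otimes> w = w \<otimes> t"
proof -
  obtain i j where i: "1 \<le> i" "i < n" "\<phi> s = transpose i (Suc i)"
    and j: "1 \<le> j" "j < n" "\<phi> t = transpose j (Suc j)" using gen_index s t by metis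
  have neq: "\<phi> w j \<noteq> \<phi> w (Suc j)" using inj_eq[OF permutes_inj[OF phi_permutes]] w by simp
  have "\<not> \<phi> w (Suc j) < \<phi> w j" using assms rdesc_iff[OF w t j(3,1,2)] by simp
  moreover have "transpose i (Suc i) (\<phi> w (Suc j)) < transpose i (Suc i) (\<phi> w j)"
    using assms(6) rdesc_iff[OF _ t j(3,1,2), of "s \<otimes> w"] w s by (simp add: phi_mult i)
  ultimately have "{\<phi> w (Suc j), \<phi> w j} = {i, Suc i}"
    using transpose_adjacent_less_iff neq by metis
  then have e: "\<phi> w j = i \<and> \<phi> w (Suc j) = Suc i \<or> \<phi> w (Suc j) = i \<and> \<phi> w j = Suc i"
    by (auto simp: doubleton_eq_iff)
  have "transpose i (Suc i) (\<phi> w x) = \<phi> w (transpose j (Suc j) x)" for x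
  proof (cases "x = j \<or> x = Suc j")
    case False
    then have "\<phi> w x \<noteq> \<phi> w j" "\<phi> w x \<noteq> \<phi> w (Suc j)"
      using inj_eq[OF permutes_inj[OF phi_permutes[OF w]]] by auto
    with e False have "\<phi> w x \<noteq> i" "\<phi> w x \<noteq> Suc i" by auto
    with False show ?thesis by (simp add: transpose_def)
  qed (use e in auto)
  then have "\<phi> (s \<otimes> w) = \<phi> (w \<otimes> t)" using w s t by (simp add: phi_mult i j fun_eq_iff)
  then show ?thesis using phi_eq_iff w s t by simp
qed

section \<open>Pairs of generators and star operations on group elements\<close>

lemma gen_commute_or_braid:
  assumes s: "s \<in> S" and t: "t \<in> S" and st: "s \<noteq> t"
  obtains "s \<otimes> t = t \<otimes> s" | "s \<otimes> t \<noteq> t \<otimes> s" "s \<otimes> t \<otimes> s = t \<otimes> s \<otimes> t"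
proof (cases "s \<otimes> t = t \<otimes> s")
  case False
  obtain i j where i: "1 \<le> i" "i < n" "\<phi> s = transpose i (Suc i)"
    and j: "1 \<le> j" "j < n" "\<phi> t = transpose j (Suc j)" using gen_index s t by metis
  have "\<not> (i + 1 < j \<or> j + 1 < i)"
  proof
    assume "i + 1 < j \<or> j + 1 < i"
    then have "\<phi> (s \<otimes> t) = \<phi> (t \<otimes> s)"
      using s t by (auto simp: phi_mult i j fun_eq_iff transpose_def)
    then show False using False phi_eq_iff s t by simp
  qed
  moreover have "i \<noteq> j" using st phi_eq_iff[of s t] s t i j by auto
  ultimately have "j = Suc i \<or> i = Suc j" by linarith
  then have "\<phi> (s \<otimes> t \<otimes> s) = \<phi> (t \<otimes> s \<otimes> t)"
    using s t by (elim disjE) (auto simp: phi_mult i j fun_eq_iff transpose_def)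
  then have "s \<otimes> t \<otimes> s = t \<otimes> s \<otimes> t" using phi_eq_iff s t by simp
  with False show ?thesis by (rule that(2))
qed (rule that(1))

lemma noncommuting_index:
  assumes s: "s \<in> S" and t: "t \<in> S" and st: "s \<otimes> t \<noteq> t \<otimes> s"
  obtains i j where "1 \<le> i" "i < n" "\<phi> s = transpose i (Suc i)" "1 \<le> j" "j < n"
    "\<phi> t = transpose j (Suc j)" "j = Suc i \<or> i = Suc j"
proof -
  obtain i j where i: "1 \<le> i" "i < n" "\<phi> s = transpose i (Suc i)"
    and j: "1 \<le> j" "j < n" "\<phi> t = transpose j (Suc j)" using gen_index s t by metis
  have "\<not> (i + 1 < j \<or> j + 1 < i)"
  proof
    assume "i + 1 < j \<or> j + 1 < i"
    then have "\<phi> (s \<otimes> t) = \<phi> (t \<otimes> s)"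
      using s t by (auto simp: phi_mult i j fun_eq_iff transpose_def)
    then show False using st phi_eq_iff s t by simp
  qed
  moreover have "i \<noteq> j" using st phi_eq_iff[of s t] s t i j by auto
  ultimately have "j = Suc i \<or> i = Suc j" by linarith
  with i j show ?thesis by (rule that)
qed

lemma index_noncommuting:
  assumes s: "s \<in> S" and t: "t \<in> S" and i: "\<phi> s = transpose i (Suc i)" "\<phi> t = transpose j (Suc j)"
    and ij: "j = Suc i \<or> i = Suc j"
  shows "s \<otimes> t \<noteq> t \<otimes> s"
proof
  assume "s \<otimes> t = t \<otimes> s"
  then have "\<phi> s \<circ> \<phi> t = \<phi> t \<circ> \<phi> s" using phi_mult s t by (metis S_closed)
  then have "(\<phi> s \<circ> \<phi> t) (max i j) = (\<phi> t \<circ> \<phi> s) (max i j)" by simp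
  with ij show False by (auto simp: i transpose_def)
qed

lemma ldesc_commute:
  assumes w: "w \<in> carrier G" and s: "s \<in> S" and t: "t \<in> S" and st: "s \<noteq> t" "s \<otimes> t = t \<otimes> s"
  shows "ldesc s (t \<otimes> w) \<longleftrightarrow> ldesc s w"
proof -
  obtain i j where i: "1 \<le> i" "i < n" "\<phi> s = transpose i (Suc i)"
    and j: "1 \<le> j" "j < n" "\<phi> t = transpose j (Suc j)" using gen_index s t by metis
  have "i \<noteq> j" using st phi_eq_iff[of s t] s t i j by auto
  moreover have "\<not> (j = Suc i \<or> i = Suc j)" using index_noncommuting[OF s t i(3) j(3)] st by blast
  ultimately show ?thesis
    using w s t by (simp add: ldesc_iff[OF _ s i(3,1,2)] inv_mult_gen phi_mult j transpose_def)
qed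

text \<open>
  Lengths along a coset of a dihedral subgroup of order 6 are read off from the relative order of the
  three values of the inverse permutation that the coset permutes.
\<close>

lemma ldesc_braid:
  assumes w: "w \<in> carrier G" and s: "s \<in> S" and t: "t \<in> S" and st: "s \<otimes> t \<noteq> t \<otimes> s"
  shows "\<not> ldesc s w \<Longrightarrow> \<not> ldesc t w \<Longrightarrow> \<not> ldesc t (s \<otimes> w) \<and> \<not> ldesc s (t \<otimes> (s \<otimes> w))"
    and "ldesc s w \<Longrightarrow> ldesc t w \<Longrightarrow> ldesc t (s \<otimes> w) \<and> ldesc s (t \<otimes> (s \<otimes> w))"
    and "ldesc t w \<Longrightarrow> \<not> ldesc s w \<Longrightarrow> ldesc t (s \<otimes> w) \<longleftrightarrow> ldesc s (t \<otimes> w)"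
proof -
  obtain i j where i: "1 \<le> i" "i < n" "\<phi> s = transpose i (Suc i)"
    and j: "1 \<le> j" "j < n" "\<phi> t = transpose j (Suc j)" and ij: "j = Suc i \<or> i = Suc j"
    using noncommuting_index[OF s t st] .
  have ls: "ldesc s x \<longleftrightarrow> \<phi> (inv x) (Suc i) < \<phi> (inv x) i" if "x \<in> carrier G" for x
    using ldesc_iff[OF that s i(3,1,2)] .
  have lt: "ldesc t x \<longleftrightarrow> \<phi> (inv x) (Suc j) < \<phi> (inv x) j" if "x \<in> carrier G" for x
    using ldesc_iff[OF that t j(3,1,2)] .
  have p: "\<phi> (inv (s \<otimes> x)) = \<phi> (inv x) \<circ> transpose i (Suc i)"
    "\<phi> (inv (t \<otimes> x)) = \<phi> (inv x) \<circ> transpose j (Suc j)" if "x \<in> carrier G" for x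
    using that s t by (simp_all add: inv_mult_gen phi_mult i j)
  have neq: "\<phi> (inv w) a \<noteq> \<phi> (inv w) b" if "a \<noteq> b" for a b
    using inj_eq[OF permutes_inj[OF phi_permutes]] w that by simp
  show "\<not> ldesc s w \<Longrightarrow> \<not> ldesc t w \<Longrightarrow> \<not> ldesc t (s \<otimes> w) \<and> \<not> ldesc s (t \<otimes> (s \<otimes> w))"
    "ldesc s w \<Longrightarrow> ldesc t w \<Longrightarrow> ldesc t (s \<otimes> w) \<and> ldesc s (t \<otimes> (s \<otimes> w))"
    "ldesc t w \<Longrightarrow> \<not> ldesc s w \<Longrightarrow> ldesc t (s \<otimes> w) \<longleftrightarrow> ldesc s (t \<otimes> w)"
    using ij w s t neq[of "i" "Suc i"] neq[of j "Suc j"] neq[of i "Suc (Suc i)"] neq[of j "Suc (Suc j)"]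
    by (auto simp: ls lt p transpose_def)
qed

text \<open>Meant for \<open>y\<close> with \<open>r\<close> but not \<open>u\<close> as a right
  descent and \<open>r\<close>, \<open>u\<close> not commuting: of \<open>y \<otimes> r\<close> and
  \<open>y \<otimes> u\<close> it picks the one with \<open>u\<close> but not
  \<open>r\<close>.\<close>

definition star :: "'a \<Rightarrow> 'a \<Rightarrow> 'a \<Rightarrow> 'a" where
  "star r u y = (if rdesc r (y \<otimes> u) then y \<otimes> r else y \<otimes> u)"

lemma star_type:
  assumes y: "y \<in> carrier G" and r: "r \<in> S" and u: "u \<in> S" and ru: "r \<otimes> u \<noteq> u \<otimes> r"
    and d: "rdesc r y" "\<not> rdesc u y"
  shows "rdesc u (star r u y)" "\<not> rdesc r (star r u y)" "star r u y \<in> carrier G"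
    "rdesc r (y \<otimes> u) \<longleftrightarrow> rdesc u (y \<otimes> r)"
proof -
  have iv: "inv (y \<otimes> r) = r \<otimes> inv y" "inv (y \<otimes> u) = u \<otimes> inv y"
    using y r u by (simp_all add: inv_mult_group gen_inv)
  show e: "rdesc r (y \<otimes> u) \<longleftrightarrow> rdesc u (y \<otimes> r)"
    using ldesc_braid(3)[of "inv y" u r] y r u ru d by (simp add: rdesc_ldesc_inv iv)
  show "rdesc u (star r u y)" "\<not> rdesc r (star r u y)" "star r u y \<in> carrier G"
    using e rdesc_flip[OF y r] rdesc_flip[OF y u] d y r u by (auto simp: star_def)
qed

lemma star_star_step:
  assumes y: "y \<in> carrier G" and r: "r \<in> S" and u: "u \<in> S"
    and i: "\<phi> r = transpose i (Suc i)" "\<phi> u = transpose j (Suc j)" "j = Suc i \<or> i = Suc j"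
      "1 \<le> i" "i < n" "1 \<le> j" "j < n"
    and d: "rdesc r y" "\<not> rdesc u y"
  shows "star_step n (min i j) (\<phi> y) (\<phi> (star r u y))"
proof -
  have rr: "rdesc r x \<longleftrightarrow> \<phi> x (Suc i) < \<phi> x i" if "x \<in> carrier G" for x
    using rdesc_iff[OF that r i(1,4,5)] .
  have uu: "rdesc u x \<longleftrightarrow> \<phi> x (Suc j) < \<phi> x j" if "x \<in> carrier G" for x
    using rdesc_iff[OF that u i(2,6,7)] .
  have p: "\<phi> (y \<otimes> r) = \<phi> y \<circ> transpose i (Suc i)" "\<phi> (y \<otimes> u) = \<phi> y \<circ> transpose j (Suc j)"
    using y r u by (simp_all add: phi_mult i)
  have neq: "\<phi> y a \<noteq> \<phi> y b" if "a \<noteq> b" for a b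
    using inj_eq[OF permutes_inj[OF phi_permutes]] y that by simp
  show ?thesis
    using i d y r u neq[of j "Suc j"] neq[of i "Suc (Suc i)"] neq[of j "Suc (Suc j)"]
    unfolding star_step_def star_def
    by (auto simp: rr uu p strictly_between_def transpose_def)
qed

text \<open>The generators depend only on \<open>k\<close> and on which of the two positions is a
  descent, so one pair \<open>r\<close>, \<open>u\<close> serves all elements with the same descent
  pattern. This lets a star operation be applied to two elements of a cell at once.\<close>

lemma star_step_star:
  assumes y: "y \<in> carrier G" and st: "star_step n k (\<phi> y) z"
  obtains r u where "r \<in> S" "u \<in> S" "r \<otimes> u \<noteq> u \<otimes> r" "rdesc r y" "\<not> rdesc u y" "z = \<phi> (star r u y)"
    "\<And>x. x \<in> carrier G \<Longrightarrow> rdesc r x \<Longrightarrow> \<not> rdesc u x \<Longrightarrow> star_step n k (\<phi> x) (\<phi> (star r u x))"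
proof -
  have k: "1 \<le> k" "k + 2 \<le> n" using st by (auto simp: star_step_def)
  obtain a where a: "a \<in> S" "\<phi> a = transpose k (Suc k)" using index_gen[of k] k by auto
  obtain b where b: "b \<in> S" "\<phi> b = transpose (Suc k) (Suc (Suc k))" using index_gen[of "Suc k"] k by auto
  have ra: "rdesc a y \<longleftrightarrow> \<phi> y (Suc k) < \<phi> y k" using k by (intro rdesc_iff[OF y a]) auto
  have rb: "rdesc b y \<longleftrightarrow> \<phi> y (Suc (Suc k)) < \<phi> y (Suc k)" using k by (intro rdesc_iff[OF y b]) auto
  have nc: "a \<otimes> b \<noteq> b \<otimes> a" using index_noncommuting[OF a(1) b(1) a(2) b(2)] by simp
  have A: "star_step n k (\<phi> x) (\<phi> (star a b x))" if "x \<in> carrier G" "rdesc a x" "\<not> rdesc b x" for x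
    using star_star_step[OF that(1) a(1) b(1) a(2) b(2) _ _ _ _ _ that(2,3)] k by simp
  have B: "star_step n k (\<phi> x) (\<phi> (star b a x))" if "x \<in> carrier G" "rdesc b x" "\<not> rdesc a x" for x
    using star_star_step[OF that(1) b(1) a(1) b(2) a(2) _ _ _ _ _ that(2,3)] k by simp
  have "rdesc a y \<noteq> rdesc b y"
    using st unfolding star_step_def ra rb by (auto simp: strictly_between_def)
  then consider "rdesc a y" "\<not> rdesc b y" | "rdesc b y" "\<not> rdesc a y" by blast
  then show ?thesis
  proof cases
    case 1
    show ?thesis using that[OF a(1) b(1) nc 1 star_step_unique[OF st A[OF y 1]] A] .
  next
    case 2
    show ?thesis using that[OF b(1) a(1) nc[symmetric] 2 star_step_unique[OF st B[OF y 2]] B] .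
  qed
qed

text \<open>The generator \<open>t\<close> exchanges the witness value \<open>w\<close> with
  whichever of \<open>v\<close>, \<open>Suc v\<close> is next to it. Betweenness in position says
  that exactly one of \<open>s\<close> and \<open>t\<close> is a left descent, before and after the
  step.\<close>

lemma left_step_gen:
  assumes x: "x \<in> carrier G" and st: "left_step n (\<phi> x) z"
  obtains s t where "s \<in> S" "t \<in> S" "s \<otimes> t \<noteq> t \<otimes> s" "z = \<phi> (s \<otimes> x)"
    "ldesc t x \<longleftrightarrow> \<not> ldesc s x" "ldesc t (s \<otimes> x) \<longleftrightarrow> \<not> ldesc s (s \<otimes> x)"
proof -
  obtain v w where *: "z = transpose v (Suc v) \<circ> \<phi> x" "1 \<le> v" "Suc v \<le> n" "1 \<le> w" "w \<le> n"
    "w = Suc (Suc v) \<or> Suc w = v" "strictly_between (inv' (\<phi> x) w) (inv' (\<phi> x) v) (inv' (\<phi> x) (Suc v))"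
    using left_stepE[OF st] by metis
  define j where "j = (if w = Suc (Suc v) then Suc v else w)"
  have j: "1 \<le> j" "j < n" "j = Suc v \<or> v = Suc j" using * by (auto simp: j_def)
  obtain s where s: "s \<in> S" "\<phi> s = transpose v (Suc v)" using index_gen[of v] * by auto
  obtain t where t: "t \<in> S" "\<phi> t = transpose j (Suc j)" using index_gen[of j] j by auto
  have v: "v < n" using * by simp
  have ls: "ldesc s y \<longleftrightarrow> \<phi> (inv y) (Suc v) < \<phi> (inv y) v" if "y \<in> carrier G" for y
    using ldesc_iff[OF that s *(2) v] .
  have lt: "ldesc t y \<longleftrightarrow> \<phi> (inv y) (Suc j) < \<phi> (inv y) j" if "y \<in> carrier G" for y
    using ldesc_iff[OF that t j(1,2)] .
  have p: "\<phi> (inv (s \<otimes> x)) = \<phi> (inv x) \<circ> transpose v (Suc v)"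
    using x s by (simp add: inv_mult_gen phi_mult)
  have b: "strictly_between (\<phi> (inv x) w) (\<phi> (inv x) v) (\<phi> (inv x) (Suc v))"
    using * x by (simp add: phi_inv)
  show ?thesis
  proof (rule that[OF s(1) t(1)])
    show "s \<otimes> t \<noteq> t \<otimes> s" using index_noncommuting[OF s(1) t(1) s(2) t(2) j(3)] .
    show "z = \<phi> (s \<otimes> x)" using * x s by (simp add: phi_mult)
    show "ldesc t x \<longleftrightarrow> \<not> ldesc s x" "ldesc t (s \<otimes> x) \<longleftrightarrow> \<not> ldesc s (s \<otimes> x)"
      using *(6) b x s t by (auto simp: ls lt p j_def strictly_between_def transpose_def)
  qed
qed

section \<open>Bruhat order\<close>

abbreviation bruhat :: "'a \<Rightarrow> 'a \<Rightarrow> bool" where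
  "bruhat \<equiv> bruhat_less G S"

definition bruhat_edges :: "('a \<times> 'a) set" where
  "bruhat_edges = {(u, u \<otimes> t) | u t. u \<in> carrier G \<and> t \<in> reflections G S \<and> len u < len (u \<otimes> t)}"

lemma bruhat_trancl: "bruhat x y \<longleftrightarrow> (x, y) \<in> bruhat_edges\<^sup>+"
  by (simp add: bruhat_less_def bruhat_edges_def)

lemma reflections_closed: "t \<in> reflections G S \<Longrightarrow> t \<in> carrier G"
  by (auto simp: reflections_def)

lemma bruhat_edge_len: "(x, y) \<in> bruhat_edges \<Longrightarrow> len x < len y \<and> x \<in> carrier G \<and> y \<in> carrier G"
  by (auto simp: bruhat_edges_def reflections_closed)

lemma bruhat_len: "bruhat x y \<Longrightarrow> len x < len y \<and> x \<in> carrier G \<and> y \<in> carrier G"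
  unfolding bruhat_trancl by (induction rule: trancl_induct) (auto dest: bruhat_edge_len)

lemma bruhat_trans: "bruhat x y \<Longrightarrow> bruhat y z \<Longrightarrow> bruhat x z"
  unfolding bruhat_trancl by (rule trancl_trans)

lemma gen_edge: "w \<in> carrier G \<Longrightarrow> s \<in> S \<Longrightarrow> len w < len (s \<otimes> w) \<Longrightarrow> (w, s \<otimes> w) \<in> bruhat_edges"
proof -
  assume w: "w \<in> carrier G" and s: "s \<in> S" and l: "len w < len (s \<otimes> w)"
  have "inv w \<otimes> s \<otimes> w \<in> reflections G S"
    unfolding reflections_def using w s
    by (intro CollectI exI[of _ "inv w"] exI[of _ s]) simp
  moreover have "w \<otimes> (inv w \<otimes> s \<otimes> w) = s \<otimes> w" using w s by (simp add: m_assoc[symmetric])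
  ultimately show ?thesis unfolding bruhat_edges_def using w l by force
qed

lemma bruhat_gen_iff: "w \<in> carrier G \<Longrightarrow> s \<in> S \<Longrightarrow> bruhat w (s \<otimes> w) \<longleftrightarrow> \<not> ldesc s w"
  using gen_edge[of w s] bruhat_len[of w "s \<otimes> w"] len_gen_left[of w s] by (auto simp: bruhat_trancl)

lemma bruhat_gen_iff': "w \<in> carrier G \<Longrightarrow> s \<in> S \<Longrightarrow> bruhat (s \<otimes> w) w \<longleftrightarrow> ldesc s w"
  using bruhat_gen_iff[of "s \<otimes> w" s] ldesc_flip[of w s] by (simp add: gen_cancel)

lemma reflection_transpose:
  assumes "t \<in> reflections G S"
  obtains a b where "1 \<le> a" "a < b" "b \<le> n" "\<phi> t = transpose a b"
proof -
  from assms obtain w s where w: "w \<in> carrier G" and s: "s \<in> S" and t: "t = w \<otimes> s \<otimes> inv w"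
    by (auto simp: reflections_def)
  obtain i where i: "1 \<le> i" "i < n" "\<phi> s = transpose i (Suc i)" using gen_index s .
  have "\<phi> t = \<phi> w \<circ> transpose i (Suc i) \<circ> inv' (\<phi> w)"
    using w s by (simp add: t phi_mult phi_inv i)
  also have "\<dots> = transpose (\<phi> w i) (\<phi> w (Suc i))"
    using permutes_inv_eq[OF phi_permutes[OF w]] permutes_inverses(1)[OF phi_permutes[OF w]]
    by (auto simp: fun_eq_iff transpose_def)
  finally have t: "\<phi> t = transpose (\<phi> w i) (\<phi> w (Suc i))" .
  have "\<phi> w i \<noteq> \<phi> w (Suc i)" using inj_eq[OF permutes_inj[OF phi_permutes[OF w]]] by simp
  moreover have "\<phi> w i \<in> {1..n}" "\<phi> w (Suc i) \<in> {1..n}"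
    using permutes_in_image[OF phi_permutes[OF w]] i by auto
  ultimately consider "\<phi> w i < \<phi> w (Suc i)" | "\<phi> w (Suc i) < \<phi> w i" by linarith
  then show ?thesis
  proof cases
    case 1
    with t \<open>\<phi> w i \<in> {1..n}\<close> \<open>\<phi> w (Suc i) \<in> {1..n}\<close> show ?thesis by (intro that) auto
  next
    case 2
    with t \<open>\<phi> w i \<in> {1..n}\<close> \<open>\<phi> w (Suc i) \<in> {1..n}\<close> show ?thesis
      by (intro that[of "\<phi> w (Suc i)" "\<phi> w i"]) (auto simp: transpose_commute)
  qed
qed

lemma len_mult_reflection:
  assumes u: "u \<in> carrier G" and t: "t \<in> carrier G" and ab: "1 \<le> a" "a < b" "b \<le> n" "\<phi> t = transpose a b"
  shows "len u < len (u \<otimes> t) \<longleftrightarrow> \<phi> u a < \<phi> u b"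
proof -
  have e: "\<phi> (u \<otimes> t) = \<phi> u \<circ> transpose a b" using u t ab by (simp add: phi_mult)
  have u': "\<phi> u = \<phi> (u \<otimes> t) \<circ> transpose a b" unfolding e by (simp add: fun_eq_iff)
  have "\<phi> u a \<noteq> \<phi> u b" using inj_eq[OF permutes_inj[OF phi_permutes[OF u]]] ab by simp
  moreover have "len u < len (u \<otimes> t)" if "\<phi> u a < \<phi> u b"
    using card_inversions_transpose[OF ab(1-3) that] u t by (simp add: len_inversions e)
  moreover have "len (u \<otimes> t) < len u" if "\<phi> u b < \<phi> u a"
  proof -
    have "card (inversions n (\<phi> (u \<otimes> t))) < card (inversions n (\<phi> (u \<otimes> t) \<circ> transpose a b))"
      by (rule card_inversions_transpose[OF ab(1-3)]) (use that ab in \<open>simp add: e\<close>)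
    then show ?thesis by (simp only: u'[symmetric] len_inversions[OF u] len_inversions[OF m_closed[OF u t]])
  qed
  ultimately show ?thesis by (meson linorder_neqE_nat order_less_asym)
qed

text \<open>The values at \<open>a\<close> and \<open>b\<close> stay in order when \<open>i\<close>
  and \<open>Suc i\<close> are exchanged, unless they are this very pair; then the edge itself is
  left multiplication by \<open>s\<close>.\<close>

lemma bruhat_edge_gen:
  assumes xy: "(x, y) \<in> bruhat_edges" and s: "s \<in> S"
  shows "s \<otimes> x = y \<or> (s \<otimes> x, s \<otimes> y) \<in> bruhat_edges"
proof -
  obtain t where x: "x \<in> carrier G" and t: "t \<in> reflections G S" and y: "y = x \<otimes> t"
    and l: "len x < len (x \<otimes> t)" using xy by (auto simp: bruhat_edges_def)
  obtain a b where ab: "1 \<le> a" "a < b" "b \<le> n" "\<phi> t = transpose a b" using reflection_transpose[OF t] .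
  obtain i where i: "1 \<le> i" "i < n" "\<phi> s = transpose i (Suc i)" using gen_index s .
  note tc = reflections_closed[OF t]
  have lt: "\<phi> x a < \<phi> x b" using l len_mult_reflection[OF x tc ab] by simp
  have inj: "\<phi> x p = \<phi> x q \<longleftrightarrow> p = q" for p q using inj_eq[OF permutes_inj[OF phi_permutes[OF x]]] .
  show ?thesis
  proof (cases "{\<phi> x a, \<phi> x b} = {i, Suc i}")
    case True
    with lt have e: "\<phi> x a = i" "\<phi> x b = Suc i" by (auto simp: doubleton_eq_iff)
    have "transpose i (Suc i) (\<phi> x p) = \<phi> x (transpose a b p)" for p
      using e inj[of p a] inj[of p b] by (cases "p = a \<or> p = b") (auto simp: transpose_def)
    then have "\<phi> (s \<otimes> x) = \<phi> y" using x s tc by (simp add: y phi_mult i ab fun_eq_iff)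
    then show ?thesis using phi_eq_iff x s tc y by simp
  next
    case False
    then have "\<phi> (s \<otimes> x) a < \<phi> (s \<otimes> x) b"
      using transpose_adjacent_less_iff[of "\<phi> x a" "\<phi> x b" i] lt x s by (simp add: phi_mult i)
    then have "len (s \<otimes> x) < len (s \<otimes> x \<otimes> t)" using len_mult_reflection[OF _ tc ab, of "s \<otimes> x"] x s by simp
    then have "(s \<otimes> x, s \<otimes> x \<otimes> t) \<in> bruhat_edges" using x s t by (auto simp: bruhat_edges_def)
    then show ?thesis using x s tc y by (simp add: m_assoc)
  qed
qed

lemma bruhat_lifting_weak:
  assumes s: "s \<in> S" shows "(x, w) \<in> bruhat_edges\<^sup>* \<Longrightarrow> (s \<otimes> x, w) \<in> bruhat_edges\<^sup>* \<or> (s \<otimes> x, s \<otimes> w) \<in> bruhat_edges\<^sup>*"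
proof (induction rule: rtrancl_induct)
  case (step w w')
  from bruhat_edge_gen[OF step(2) s] step show ?case
    by (auto intro: rtrancl_into_rtrancl)
qed auto

text \<open>By the weak form \<open>s \<otimes> y\<close> is below \<open>w\<close> or below
  \<open>s \<otimes> w\<close>, and here \<open>w\<close> lies below \<open>s \<otimes> w\<close>;
  cancellation makes the relation strict.\<close>

lemma bruhat_lifting:
  assumes s: "s \<in> S" and b: "bruhat y w" and d: "\<not> ldesc s w"
  shows "bruhat (s \<otimes> y) (s \<otimes> w)"
proof -
  have c: "y \<in> carrier G" "w \<in> carrier G" and neq: "y \<noteq> w" using bruhat_len[OF b] by auto
  have e: "(w, s \<otimes> w) \<in> bruhat_edges" using d len_gen_left[OF c(2) s] by (intro gen_edge c s) auto
  have "s \<otimes> y \<noteq> s \<otimes> w" using neq c s gen_cancel by metis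
  moreover have "(s \<otimes> y, s \<otimes> w) \<in> bruhat_edges\<^sup>*"
    using bruhat_lifting_weak[OF s trancl_into_rtrancl] b e
    unfolding bruhat_trancl by (meson rtrancl_into_rtrancl)
  ultimately show ?thesis unfolding bruhat_trancl by (simp add: rtrancl_eq_or_trancl)
qed

section \<open>Weak order ideals, minimal coset representatives, longest elements\<close>

lemma left_ideal_gen_closed:
  assumes I: "left_weak_ideal G S I" and w: "w \<in> I" and s: "s \<in> S" "ldesc s w"
  shows "s \<otimes> w \<in> I"
proof -
  have c: "w \<in> carrier G" using I w by (auto simp: left_weak_ideal_def)
  have "w \<otimes> inv (s \<otimes> w) = s" using c s by (simp add: inv_mult_gen m_assoc[symmetric])
  then have "left_weak_le G S (s \<otimes> w) w"
    using len_gen_left[OF c s(1)] s len_gen by (auto simp: left_weak_le_def)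
  then show ?thesis using I w c s by (auto simp: left_weak_ideal_def)
qed

lemma left_ideal_one:
  assumes I: "left_weak_ideal G S I" "I \<noteq> {}" shows "\<one> \<in> I"
proof -
  obtain w where w: "w \<in> I" "\<And>y. y \<in> I \<Longrightarrow> len w \<le> len y"
    using I(2) ex_has_least_nat[of "\<lambda>w. w \<in> I" _ len] by blast
  have c: "w \<in> carrier G" using I w by (auto simp: left_weak_ideal_def)
  have "w = \<one>"
  proof (rule ccontr)
    assume "w \<noteq> \<one>"
    then obtain s where "s \<in> S" "ldesc s w" using ldesc_ex c by blast
    with w(2)[OF left_ideal_gen_closed[OF I(1) w(1)]] show False by force
  qed
  with w show ?thesis by simp
qed

lemma D_set_ldesc:
  assumes d: "d \<in> D_set G S J" and s: "s \<in> S" "ldesc s d" and J: "J \<subseteq> S"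
  shows "s \<otimes> d \<in> D_set G S J"
proof -
  have c: "d \<in> carrier G" using d by (simp add: D_set_def)
  have "len (s \<otimes> d) < len (s \<otimes> d \<otimes> t)" if "t \<in> J" for t
  proof -
    have t: "t \<in> S" using that J by blast
    have "len d < len (d \<otimes> t)" using d that by (simp add: D_set_def)
    moreover have "len (s \<otimes> (d \<otimes> t)) = Suc (len (d \<otimes> t)) \<or> len (d \<otimes> t) = Suc (len (s \<otimes> (d \<otimes> t)))"
      using c t s by (intro len_gen_left) auto
    ultimately show ?thesis using c s t by (auto simp: m_assoc)
  qed
  then show ?thesis using c s by (simp add: D_set_def)
qed

text \<open>Deodhar's lemma: \<open>s \<otimes> d\<close> has acquired a right descent
  \<open>t\<close> in \<open>J\<close> that \<open>d\<close> lacks, and the exchange property gives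
  the equation.\<close>

lemma D_set_exchange:
  assumes d: "d \<in> D_set G S J" and s: "s \<in> S" and nd: "s \<otimes> d \<notin> D_set G S J" and J: "J \<subseteq> S"
  obtains t where "t \<in> J" "s \<otimes> d = d \<otimes> t" "\<not> ldesc s d"
proof -
  have c: "d \<in> carrier G" using d by (simp add: D_set_def)
  have nl: "\<not> ldesc s d" using D_set_ldesc[OF d s _ J] nd by blast
  obtain t where t: "t \<in> J" "\<not> len (s \<otimes> d) < len (s \<otimes> d \<otimes> t)" using nd c s by (auto simp: D_set_def)
  then have tS: "t \<in> S" using J by blast
  have "len d < len (d \<otimes> t)" using d t by (simp add: D_set_def)
  moreover have "len (s \<otimes> d \<otimes> t) < len (s \<otimes> d)" using t len_gen_right[of "s \<otimes> d" t] c s tS by auto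
  ultimately have "s \<otimes> d = d \<otimes> t" using nl by (intro exchange c s tS) auto
  with t nl show ?thesis by (intro that)
qed

lemma D_set_exchange_conv:
  assumes d: "d \<in> D_set G S J" and t: "t \<in> J" and e: "s \<otimes> d = d \<otimes> t" and J: "J \<subseteq> S"
  shows "s \<otimes> d \<notin> D_set G S J"
proof
  have c: "d \<in> carrier G" using d by (simp add: D_set_def)
  assume "s \<otimes> d \<in> D_set G S J"
  then have "len (s \<otimes> d) < len (s \<otimes> d \<otimes> t)" using t by (simp add: D_set_def)
  moreover have "s \<otimes> d \<otimes> t = d" using e c t J by (simp add: gen_cancel_right subsetD)
  moreover have "len d < len (d \<otimes> t)" using d t by (simp add: D_set_def)
  ultimately show False using e by simp
qed

text \<open>Split off the last letter \<open>r\<close>: either \<open>t\<close> is already a descent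
  of the product of the other letters, or exchange shows that \<open>r\<close> is the letter to
  delete. Using only letters of \<open>ts\<close> is what confines reduced words to \<open>J\<close>
  later.\<close>

lemma exchange_reduced_word:
  "set ts \<subseteq> S \<Longrightarrow> len (gen_prod G ts) = length ts \<Longrightarrow> t \<in> S \<Longrightarrow> ldesc t (gen_prod G ts) \<Longrightarrow>
    \<exists>us. set us \<subseteq> set ts \<and> Suc (length us) = length ts \<and> gen_prod G us = t \<otimes> gen_prod G ts"
proof (induction ts rule: rev_induct)
  case Nil
  then show ?case by (simp add: len_one)
next
  case (snoc r ts)
  define y where "y = gen_prod G ts"
  have r: "r \<in> S" and t: "t \<in> S" using snoc by auto
  have y: "y \<in> carrier G" unfolding y_def using snoc S_carrier by (intro gen_prod_closed) auto
  have e: "gen_prod G (ts @ [r]) = y \<otimes> r"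
    using snoc S_carrier by (subst gen_prod_append) (auto simp: y_def)
  have "len y \<le> length ts" unfolding y_def using snoc by (intro len_word_le) auto
  then have ly: "len y = length ts" "\<not> rdesc r y" using len_gen_right[OF y r] snoc.prems(2) e by auto
  show ?case
  proof (cases "ldesc t y")
    case True
    then obtain us where us: "set us \<subseteq> set ts" "Suc (length us) = length ts" "gen_prod G us = t \<otimes> y"
      using snoc.IH snoc.prems ly y_def by auto
    have "set us \<subseteq> carrier G" using us(1) snoc.prems(1) S_carrier by auto
    then have "gen_prod G (us @ [r]) = gen_prod G us \<otimes> r"
      using r by (subst gen_prod_append) auto
    then have "gen_prod G (us @ [r]) = t \<otimes> gen_prod G (ts @ [r])" using us y r t by (simp add: e m_assoc)
    then show ?thesis using us by (intro exI[of _ "us @ [r]"]) auto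
  next
    case False
    have "len (t \<otimes> y \<otimes> r) < len (t \<otimes> y)"
      using snoc.prems(4) False ly len_gen_left[OF y t] len_gen_right[OF y r] y r t
        len_gen_left[of "y \<otimes> r" t]
      by (auto simp: e m_assoc)
    then have "t \<otimes> y = y \<otimes> r" using exchange[OF y t r False ly(2)] by simp
    then have "t \<otimes> (y \<otimes> r) = y" using y r t by (simp add: m_assoc[symmetric] gen_cancel_right)
    then show ?thesis unfolding e by (intro exI[of _ ts]) (auto simp: y_def)
  qed
qed

lemma parabolic_word:
  assumes J: "J \<subseteq> S" and w: "w \<in> generate G J"
  shows "\<exists>ts. set ts \<subseteq> J \<and> gen_prod G ts = w \<and> length ts = len w"
proof -
  have red: "\<exists>us. set us \<subseteq> J \<and> gen_prod G us = gen_prod G ts \<and> length us = len (gen_prod G ts)"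
    if "set ts \<subseteq> J" for ts
    using that
  proof (induction ts)
    case Nil
    then show ?case by (simp add: len_one)
  next
    case (Cons t ts)
    then obtain us where us: "set us \<subseteq> J" "gen_prod G us = gen_prod G ts" "length us = len (gen_prod G ts)"
      by auto
    have t: "t \<in> S" and c: "gen_prod G ts \<in> carrier G"
      using Cons J S_carrier by (auto intro!: gen_prod_closed)
    show ?case
    proof (cases "ldesc t (gen_prod G ts)")
      case True
      then obtain vs where "set vs \<subseteq> set us" "Suc (length vs) = length us" "gen_prod G vs = t \<otimes> gen_prod G us"
        using exchange_reduced_word[of us t] us J t by auto
      then show ?thesis using us len_gen_left[OF c t] True by (intro exI[of _ vs]) auto
    next
      case False
      then show ?thesis using us Cons len_gen_left[OF c t] by (intro exI[of _ "t # us"]) auto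
    qed
  qed
  have JC: "J \<subseteq> carrier G" using J S_carrier by blast
  have "\<exists>ts. set ts \<subseteq> J \<and> gen_prod G ts = w"
    using w
  proof (induction rule: generate.induct)
    case one
    then show ?case by (intro exI[of _ "[]"]) simp
  next
    case (incl h)
    then show ?case using JC by (intro exI[of _ "[h]"]) auto
  next
    case (inv h)
    then show ?case using JC J by (intro exI[of _ "[h]"]) (auto simp: gen_inv)
  next
    case (eng h1 h2)
    then obtain us vs where "set us \<subseteq> J" "gen_prod G us = h1" "set vs \<subseteq> J" "gen_prod G vs = h2" by blast
    then show ?case using JC by (intro exI[of _ "us @ vs"]) (subst gen_prod_append, auto)
  qed
  with red show ?thesis by blast
qed

lemma parabolic_rdesc:
  assumes J: "J \<subseteq> S" and w: "w \<in> generate G J" "w \<noteq> \<one>"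
  shows "\<exists>t\<in>J. rdesc t w"
proof -
  obtain ts where ts: "set ts \<subseteq> J" "gen_prod G ts = w" "length ts = len w" using parabolic_word[OF J w(1)] by blast
  with w obtain us t where [simp]: "ts = us @ [t]" by (cases ts rule: rev_cases) auto
  have t: "t \<in> J" "t \<in> S" and us: "set us \<subseteq> S" using ts J by auto
  have c: "gen_prod G us \<in> carrier G" using us S_carrier by (intro gen_prod_closed) auto
  have "w = gen_prod G us \<otimes> t"
    using ts(2) us t S_carrier by (subst (asm) \<open>ts = us @ [t]\<close>, subst (asm) gen_prod_append) auto
  then have "w \<otimes> t = gen_prod G us" using c t by (simp add: gen_cancel_right)
  then have "rdesc t w" using len_word_le[OF us] ts by simp
  with t show ?thesis by blast
qed

text \<open>Write \<open>d = s d'\<close>, \<open>w = w' t\<close> and \<open>y = d' w'\<close>. The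
  lengths of \<open>y\<close>, \<open>y t\<close> and \<open>s y\<close> are known inductively, so
  by exchange additivity can fail only if \<open>s y = y t\<close>.\<close>

lemma len_coset:
  assumes J: "J \<subseteq> S"
  shows "d \<in> D_set G S J \<Longrightarrow> w \<in> generate G J \<Longrightarrow> len (d \<otimes> w) = len d + len w"
proof (induction "len d" arbitrary: d w rule: less_induct)
  case outer: less
  note dJ = outer.prems(1)
  from outer.prems(2) show ?case
  proof (induction "len w" arbitrary: w rule: less_induct)
  case less
  have JC: "J \<subseteq> carrier G" using J S_carrier by blast
  have gc: "x \<in> carrier G" if "x \<in> generate G J" for x using generate_in_carrier[OF JC that] .
  have d: "d \<in> carrier G" and w: "w \<in> carrier G" using dJ less.prems gc by (auto simp: D_set_def)
  show ?case
  proof (cases "d = \<one> \<or> w = \<one>")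
    case True
    then show ?thesis using d w by (auto simp: len_one)
  next
    case False
    obtain s where s: "s \<in> S" "ldesc s d" using ldesc_ex[OF d] False by blast
    define d' where "d' = s \<otimes> d"
    have d': "d' \<in> D_set G S J" unfolding d'_def by (rule D_set_ldesc[OF dJ s J])
    have dc: "d' \<in> carrier G" using d' by (simp add: D_set_def)
    have ds: "d = s \<otimes> d'" unfolding d'_def using d s by (simp add: gen_cancel)
    have ld: "len d = Suc (len d')" using len_gen_left[OF d s(1)] s(2) d'_def by auto
    obtain t where t: "t \<in> J" "rdesc t w" using parabolic_rdesc[OF J less.prems] False by blast
    have tS: "t \<in> S" using t J by blast
    define w' where "w' = w \<otimes> t"
    have w': "w' \<in> generate G J" unfolding w'_def using less.prems t by (blast intro: generate.eng generate.incl)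
    have wc: "w' \<in> carrier G" using gc[OF w'] .
    have wt: "w = w' \<otimes> t" unfolding w'_def using w tS by (simp add: gen_cancel_right)
    have lw: "len w = Suc (len w')" using len_gen_right[OF w tS] t(2) w'_def by auto
    define y where "y = d' \<otimes> w'"
    have y: "y \<in> carrier G" using y_def dc wc by simp
    have ly: "len y = len d' + len w'" unfolding y_def using ld by (intro outer.hyps d' w') auto
    have lyt: "len (y \<otimes> t) = len d' + len w"
    proof -
      have "y \<otimes> t = d' \<otimes> w" unfolding y_def using wt dc wc tS by (simp add: m_assoc)
      then show ?thesis using outer.hyps[OF _ d' less.prems] ld by simp
    qed
    have lsy: "len (s \<otimes> y) = len d + len w'"
    proof -
      have "s \<otimes> y = d \<otimes> w'" unfolding y_def using ds dc wc s by (simp add: m_assoc)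
      then show ?thesis using less.hyps[OF _ w'] lw by simp
    qed
    have dw: "d \<otimes> w = s \<otimes> y \<otimes> t" using ds wt dc wc s tS by (simp add: y_def m_assoc)
    show ?thesis
    proof (rule ccontr)
      assume neq: "len (d \<otimes> w) \<noteq> len d + len w"
      then have "len (s \<otimes> y \<otimes> t) < len (s \<otimes> y)"
        using len_gen_right[of "s \<otimes> y" t] lsy lw dw y s tS by auto
      then have e: "s \<otimes> y = y \<otimes> t" using ly lyt lsy ld lw by (intro exchange y s(1) tS) auto
      \<comment> \<open>Now \<open>d = d' g\<close>, and by induction \<open>g\<close> has length 1.
        Some \<open>r\<close> in \<open>J\<close> shortens \<open>g\<close>, so \<open>r\<close>
        does not lengthen \<open>d\<close>, contrary to \<open>d\<close> being a minimal coset
        representative.\<close>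
      define g where "g = w \<otimes> inv w'"
      have g: "g \<in> generate G J" unfolding g_def
        using generate_m_inv_closed[OF JC w'] less.prems by (intro generate.eng)
      have gC: "g \<in> carrier G" using gc[OF g] .
      have "d \<otimes> w' = d' \<otimes> w" using e ds wt dc wc s tS by (simp add: y_def m_assoc)
      then have "d \<otimes> w' \<otimes> inv w' = d' \<otimes> w \<otimes> inv w'" by simp
      then have dg: "d = d' \<otimes> g" using d dc w wc by (simp add: g_def m_assoc)
      have "len d = len d' + len g" using dg outer.hyps[OF _ d' g] ld by simp
      then have lg: "len g = 1" using ld by simp
      then have "g \<noteq> \<one>" using len_one by auto
      then obtain r where r: "r \<in> J" "rdesc r g" using parabolic_rdesc[OF J g] by blast
      have rS: "r \<in> S" using r J by blast
      have "len (d \<otimes> r) \<le> len d"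
      proof -
        have gr: "g \<otimes> r \<in> generate G J" using g r by (blast intro: generate.eng generate.incl)
        have "d \<otimes> r = d' \<otimes> (g \<otimes> r)" using dg dc gC rS by (simp add: m_assoc)
        moreover have "len (g \<otimes> r) = 0" using r lg by simp
        ultimately show ?thesis using outer.hyps[OF _ d' gr] ld by simp
      qed
      then show False using dJ r by (auto simp: D_set_def)
    qed
  qed
  qed
qed

lemma longest_elt_props:
  assumes J: "J \<subseteq> S"
  shows "longest_elt G S J \<in> generate G J"
    "w \<in> generate G J \<Longrightarrow> len w \<le> len (longest_elt G S J)"
proof -
  have fin: "finite (generate G J)"
    using finite_carrier generate_in_carrier J S_carrier by (meson finite_subset subset_iff subset_trans)
  have one: "\<one> \<in> generate G J" by (rule generate.one)
  have "\<forall>y. y \<in> generate G J \<longrightarrow> len y < Suc (Max (len ` generate G J))"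
    using fin by (auto simp: less_Suc_eq_le)
  from arg_max_nat_lemma[of "\<lambda>w. w \<in> generate G J", OF one this]
  show "longest_elt G S J \<in> generate G J"
    "w \<in> generate G J \<Longrightarrow> len w \<le> len (longest_elt G S J)"
    unfolding longest_elt_def by auto
qed

lemma longest_elt_closed: "J \<subseteq> S \<Longrightarrow> longest_elt G S J \<in> carrier G"
  using generate_in_carrier[OF _ longest_elt_props(1)] S_carrier by blast

text \<open>If \<open>s \<otimes> d = d \<otimes> t\<close> with \<open>t\<close> in
  \<open>J\<close>, then \<open>t\<close> passes to the longest element and shortens it. Otherwise
  \<open>s \<otimes> d\<close> is again a minimal representative, and lengths add for both
  products.\<close>

lemma ldesc_longest_coset:
  assumes J: "J \<subseteq> S" and d: "d \<in> D_set G S J" and s: "s \<in> S"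
  shows "ldesc s (d \<otimes> longest_elt G S J) \<longleftrightarrow> ldesc s d \<or> s \<otimes> d \<notin> D_set G S J"
proof -
  let ?w = "longest_elt G S J"
  note w = longest_elt_props[OF J]
  have dc: "d \<in> carrier G" using d by (simp add: D_set_def)
  have wc: "?w \<in> carrier G" by (rule longest_elt_closed[OF J])
  have ldw: "len (d \<otimes> ?w) = len d + len ?w" by (rule len_coset[OF J d w(1)])
  show ?thesis
  proof (cases "s \<otimes> d \<in> D_set G S J")
    case True
    have "len (s \<otimes> (d \<otimes> ?w)) = len (s \<otimes> d) + len ?w"
      using len_coset[OF J True w(1)] dc wc s by (simp add: m_assoc)
    with True ldw show ?thesis by simp
  next
    case False
    then obtain t where t: "t \<in> J" "s \<otimes> d = d \<otimes> t" using D_set_exchange[OF d s _ J] by blast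
    have tS: "t \<in> S" using t J by blast
    have tw: "t \<otimes> ?w \<in> generate G J" using t w(1) by (blast intro: generate.eng generate.incl)
    have "s \<otimes> (d \<otimes> ?w) = d \<otimes> (t \<otimes> ?w)" using t dc wc s tS by (simp add: m_assoc[symmetric])
    then have "len (s \<otimes> (d \<otimes> ?w)) = len d + len (t \<otimes> ?w)" using len_coset[OF J d tw] by simp
    moreover have "len (t \<otimes> ?w) < len ?w"
      using w(2)[OF tw] len_gen_left[OF wc tS] by auto
    ultimately show ?thesis using False ldw by simp
  qed
qed

end

section \<open>Laurent polynomials\<close>

lemma poly_mapping_expand: "a = (\<Sum>i\<in>Poly_Mapping.keys a. Poly_Mapping.single i (Poly_Mapping.lookup a i))"
proof (rule poly_mapping_eqI)
  fix k
  have "(\<Sum>i\<in>Poly_Mapping.keys a. Poly_Mapping.lookup a i when i = k) = Poly_Mapping.lookup a k"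
    by (simp add: when_def sum.delta not_in_keys_iff_lookup_eq_zero)
  then show "Poly_Mapping.lookup a k =
      Poly_Mapping.lookup (\<Sum>i\<in>Poly_Mapping.keys a. Poly_Mapping.single i (Poly_Mapping.lookup a i)) k"
    by (simp add: lookup_sum lookup_single)
qed

lemma lookup_qpow_mult: "Poly_Mapping.lookup (qpow k * a) j = Poly_Mapping.lookup a (j - k)"
proof -
  have "qpow k * a = (\<Sum>i\<in>Poly_Mapping.keys a. Poly_Mapping.single (k + i) (Poly_Mapping.lookup a i))"
    by (subst (1) poly_mapping_expand[of a]) (simp add: qpow_def sum_distrib_left mult_single)
  also have "Poly_Mapping.lookup \<dots> j = (\<Sum>i\<in>Poly_Mapping.keys a. if i = j - k then Poly_Mapping.lookup a i else 0)"
    unfolding lookup_sum lookup_single by (rule sum.cong) (auto simp: when_def)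
  also have "\<dots> = Poly_Mapping.lookup a (j - k)"
    by (simp add: sum.delta not_in_keys_iff_lookup_eq_zero)
  finally show ?thesis .
qed

lemma qpow_cancel: "qpow 1 * qpow (-1) = 1" "qpow (-1) * qpow 1 = 1"
  by (simp_all add: qpow_def mult_single)

lemma lookup_qpow: "Poly_Mapping.lookup (qpow k) j = (if j = k then 1 else 0)"
  by (simp add: qpow_def lookup_single when_def)

text \<open>The subring of polynomials in \<open>q\<close>; \<open>vanishing\<close> is its ideal of
  multiples of \<open>q\<close>. The congruences used to construct canonical bases are modulo this
  ideal.\<close>

definition regular :: "laurent \<Rightarrow> bool" where
  "regular a \<longleftrightarrow> (\<forall>k<0. Poly_Mapping.lookup a k = 0)"

definition vanishing :: "laurent \<Rightarrow> bool" where
  "vanishing a \<longleftrightarrow> (\<forall>k\<le>0. Poly_Mapping.lookup a k = 0)"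

lemma q_laurent_plus_vanishing: "q_laurent_plus = {a. vanishing a}"
proof (rule subset_antisym; rule subsetI)
  fix a assume "a \<in> q_laurent_plus"
  then obtain b where b: "Poly_Mapping.keys b \<subseteq> {0..}" "a = qpow 1 * b"
    by (auto simp: q_laurent_plus_def laurent_plus_def)
  have "Poly_Mapping.lookup b k = 0" if "k < 0" for k
    using b(1) that by (force simp: in_keys_iff)
  then show "a \<in> {a. vanishing a}" by (simp add: b(2) vanishing_def lookup_qpow_mult)
next
  fix a assume a: "a \<in> {a. vanishing a}"
  have "qpow (-1) * a \<in> laurent_plus"
    unfolding laurent_plus_def
  proof (intro CollectI subsetI)
    fix k assume "k \<in> Poly_Mapping.keys (qpow (-1) * a)"
    then have "\<not> k + 1 \<le> 0" using a by (auto simp: vanishing_def in_keys_iff lookup_qpow_mult)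
    then show "k \<in> {0..}" by simp
  qed
  moreover have "a = qpow 1 * (qpow (-1) * a)" by (simp add: qpow_cancel mult.assoc[symmetric])
  ultimately show "a \<in> q_laurent_plus" unfolding q_laurent_plus_def by blast
qed

lemma vanishing_regular: "vanishing a \<Longrightarrow> regular a"
  by (simp add: vanishing_def regular_def)

lemma regular_closed:
  "regular 0" "regular 1" "regular (of_int k)" "regular (qpow 1)"
  "regular a \<Longrightarrow> regular b \<Longrightarrow> regular (a + b)" "regular a \<Longrightarrow> regular b \<Longrightarrow> regular (a - b)"
  "regular a \<Longrightarrow> regular (- a)" "regular a \<Longrightarrow> regular b \<Longrightarrow> regular (a * b)"
proof -
  assume ab: "regular a" "regular b"
  have k: "0 \<le> k" if "k \<in> Poly_Mapping.keys a \<or> k \<in> Poly_Mapping.keys b" for k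
    using ab that by (auto simp: regular_def in_keys_iff not_less[symmetric])
  show "regular (a * b)" unfolding regular_def
  proof (intro allI impI)
    fix k :: int assume "k < 0"
    have "k \<notin> Poly_Mapping.keys (a * b)"
    proof
      assume "k \<in> Poly_Mapping.keys (a * b)"
      then obtain i j where "k = i + j" "i \<in> Poly_Mapping.keys a" "j \<in> Poly_Mapping.keys b"
        using keys_mult[of a b] by blast
      with k[of i] k[of j] \<open>k < 0\<close> show False by simp
    qed
    then show "Poly_Mapping.lookup (a * b) k = 0" by (simp add: in_keys_iff)
  qed
qed (auto simp: regular_def lookup_add lookup_minus lookup_one lookup_of_int lookup_qpow when_def)

lemma regular_sum: "(\<And>x. x \<in> A \<Longrightarrow> regular (f x)) \<Longrightarrow> regular (sum f A)"
  by (simp add: regular_def lookup_sum)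

lemma vanishing_mult:
  assumes ab: "regular a" "vanishing b" shows "vanishing (a * b)" "vanishing (b * a)"
proof -
  have k: "0 \<le> k" if "k \<in> Poly_Mapping.keys a" for k
    using ab that by (auto simp: regular_def in_keys_iff not_less[symmetric])
  have k': "0 < k" if "k \<in> Poly_Mapping.keys b" for k
    using ab that by (auto simp: vanishing_def in_keys_iff not_le[symmetric])
  show "vanishing (a * b)" unfolding vanishing_def
  proof (intro allI impI)
    fix l :: int assume "l \<le> 0"
    have "l \<notin> Poly_Mapping.keys (a * b)"
    proof
      assume "l \<in> Poly_Mapping.keys (a * b)"
      then obtain i j where "l = i + j" "i \<in> Poly_Mapping.keys a" "j \<in> Poly_Mapping.keys b"
        using keys_mult[of a b] by blast
      with k[of i] k'[of j] \<open>l \<le> 0\<close> show False by simp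
    qed
    then show "Poly_Mapping.lookup (a * b) l = 0" by (simp add: in_keys_iff)
  qed
  then show "vanishing (b * a)" by (simp add: mult.commute)
qed

lemma vanishing_closed:
  "vanishing 0" "vanishing (qpow 1)"
  "vanishing a \<Longrightarrow> vanishing b \<Longrightarrow> vanishing (a + b)" "vanishing a \<Longrightarrow> vanishing b \<Longrightarrow> vanishing (a - b)"
  "vanishing a \<Longrightarrow> vanishing (- a)"
  by (auto simp: vanishing_def lookup_add lookup_minus lookup_qpow)

lemma vanishing_sum: "(\<And>x. x \<in> A \<Longrightarrow> vanishing (f x)) \<Longrightarrow> vanishing (sum f A)"
  by (simp add: vanishing_def lookup_sum)

lemma vanishing_minus_const: "regular a \<Longrightarrow> vanishing (a - of_int (Poly_Mapping.lookup a 0))"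
  by (auto simp: vanishing_def regular_def lookup_minus lookup_of_int when_def)

lemma lookup_laurent_bar: "Poly_Mapping.lookup (laurent_bar a) k = Poly_Mapping.lookup a (- k)"
  by (simp add: laurent_bar_def map_key.rep_eq inj_def)

lemma laurent_bar_add: "laurent_bar (a + b) = laurent_bar a + laurent_bar b"
  by (rule poly_mapping_eqI) (simp add: lookup_laurent_bar lookup_add)

lemma laurent_bar_uminus: "laurent_bar (- a) = - laurent_bar a"
  by (rule poly_mapping_eqI) (simp add: lookup_laurent_bar)

lemma laurent_bar_diff: "laurent_bar (a - b) = laurent_bar a - laurent_bar b"
  by (rule poly_mapping_eqI) (simp add: lookup_laurent_bar lookup_minus)

lemma laurent_bar_0: "laurent_bar 0 = 0"
  by (rule poly_mapping_eqI) (simp add: lookup_laurent_bar)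

lemma laurent_bar_bar: "laurent_bar (laurent_bar a) = a"
  by (rule poly_mapping_eqI) (simp add: lookup_laurent_bar)

lemma laurent_bar_single: "laurent_bar (Poly_Mapping.single k c) = Poly_Mapping.single (- k) c"
  by (rule poly_mapping_eqI) (auto simp: lookup_laurent_bar lookup_single when_def)

lemma laurent_bar_of_int: "laurent_bar (of_int k) = of_int k"
  by (rule poly_mapping_eqI) (auto simp: lookup_laurent_bar lookup_of_int when_def)

lemma laurent_bar_1: "laurent_bar 1 = 1"
  using laurent_bar_of_int[of 1] by simp

lemma laurent_bar_qpow: "laurent_bar (qpow k) = qpow (- k)"
  by (simp add: qpow_def laurent_bar_single)

lemma laurent_bar_sum: "laurent_bar (sum f A) = (\<Sum>x\<in>A. laurent_bar (f x))"
  by (rule poly_mapping_eqI) (simp add: lookup_laurent_bar lookup_sum)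

lemma laurent_bar_mult: "laurent_bar (a * b) = laurent_bar a * laurent_bar b"
proof -
  have "a * b = (\<Sum>i\<in>Poly_Mapping.keys a. \<Sum>j\<in>Poly_Mapping.keys b.
      Poly_Mapping.single (i + j) (Poly_Mapping.lookup a i * Poly_Mapping.lookup b j))"
    by (subst (1) poly_mapping_expand[of a], subst (1) poly_mapping_expand[of b])
      (simp add: sum_product mult_single)
  then have "laurent_bar (a * b) = (\<Sum>i\<in>Poly_Mapping.keys a. \<Sum>j\<in>Poly_Mapping.keys b.
      Poly_Mapping.single (- i) (Poly_Mapping.lookup a i) * Poly_Mapping.single (- j) (Poly_Mapping.lookup b j))"
    by (simp add: laurent_bar_sum laurent_bar_single mult_single)
  also have "\<dots> = laurent_bar a * laurent_bar b"
    by (subst (3) poly_mapping_expand[of a], subst (3) poly_mapping_expand[of b])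
      (simp add: laurent_bar_sum laurent_bar_single sum_product)
  finally show ?thesis .
qed

lemma bar_invariant_vanishing: "vanishing a \<Longrightarrow> laurent_bar a = a \<Longrightarrow> a = 0"
proof (rule poly_mapping_eqI)
  fix k assume a: "vanishing a" "laurent_bar a = a"
  show "Poly_Mapping.lookup a k = Poly_Mapping.lookup 0 k"
    using a lookup_laurent_bar[of a k] by (cases "k \<le> 0") (auto simp: vanishing_def)
qed

text \<open>The factor is the difference of the eigenvalues \<open>q\<close> and
  \<open>- q^-1\<close> of \<open>T\<^sub>s\<close>; it is nonzero, and Laurent polynomials form a
  domain.\<close>

lemma q_plus_inverse_cancel:
  assumes "(qpow 1 + qpow (-1)) * a = 0" shows "a = (0 :: laurent)"
proof -
  have "Poly_Mapping.lookup (qpow 1 + qpow (-1)) 1 = 1" by (simp add: lookup_add lookup_qpow)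
  then have "qpow 1 + qpow (-1) \<noteq> 0" by (metis lookup_zero zero_neq_one)
  with assms show ?thesis by simp
qed

section \<open>The free module\<close>

lemma lookup_smul: "Poly_Mapping.lookup (smul a m) w = a * Poly_Mapping.lookup m w"
  by (simp add: smul_def map.rep_eq when_def)

lemma lookup_bas: "Poly_Mapping.lookup (bas w) z = (if z = w then 1 else 0)"
  by (simp add: bas_def lookup_single when_def)

lemma smul_laws:
  "smul a (m + m') = smul a m + smul a m'" "smul a (m - m') = smul a m - smul a m'"
  "smul a (- m) = - smul a m" "smul a 0 = 0" "smul 0 m = 0" "smul 1 m = m"
  "smul (a + b) m = smul a m + smul b m" "smul (a - b) m = smul a m - smul b m"
  "smul (- a) m = - smul a m" "smul a (smul b m) = smul (a * b) m"
  by (auto intro!: poly_mapping_eqI simp: lookup_smul lookup_add lookup_minus algebra_simps)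

lemma smul_sum: "smul a (sum f A) = (\<Sum>x\<in>A. smul a (f x))"
  by (rule poly_mapping_eqI) (simp add: lookup_smul lookup_sum sum_distrib_left)

lemma smul_sum_left: "smul (sum f A) m = (\<Sum>x\<in>A. smul (f x) m)"
  by (rule poly_mapping_eqI) (simp add: lookup_smul lookup_sum sum_distrib_right)

lemma free_module_iff: "m \<in> free_module I \<longleftrightarrow> (\<forall>w. w \<notin> I \<longrightarrow> Poly_Mapping.lookup m w = 0)"
  by (auto simp: free_module_def in_keys_iff)

lemma free_module_closed:
  "0 \<in> free_module I" "w \<in> I \<Longrightarrow> bas w \<in> free_module I"
  "m \<in> free_module I \<Longrightarrow> m' \<in> free_module I \<Longrightarrow> m + m' \<in> free_module I"
  "m \<in> free_module I \<Longrightarrow> m' \<in> free_module I \<Longrightarrow> m - m' \<in> free_module I"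
  "m \<in> free_module I \<Longrightarrow> - m \<in> free_module I"
  "m \<in> free_module I \<Longrightarrow> smul a m \<in> free_module I"
  by (auto simp: free_module_iff lookup_add lookup_minus lookup_smul lookup_bas)

lemma free_module_sum: "(\<And>x. x \<in> A \<Longrightarrow> f x \<in> free_module I) \<Longrightarrow> sum f A \<in> free_module I"
  by (simp add: free_module_iff lookup_sum)

lemma free_module_expand:
  assumes "finite I" "m \<in> free_module I"
  shows "m = (\<Sum>w\<in>I. smul (Poly_Mapping.lookup m w) (bas w))"
  using assms by (intro poly_mapping_eqI)
    (simp add: lookup_sum lookup_smul lookup_bas if_distrib[of "(*) _"] sum.delta' free_module_iff cong: if_cong)

abbreviation lk :: "('a \<Rightarrow>\<^sub>0 'b::zero) \<Rightarrow> 'a \<Rightarrow> 'b" where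
  "lk \<equiv> Poly_Mapping.lookup"

section \<open>Modules with a bar involution and their canonical bases\<close>

text \<open>Operators \<open>T s\<close> satisfying the Hecke relations stand for the action of the
  algebra, so that the regular module fits as well. In \<open>bar_T\<close> the inverse of
  \<open>T\<^sub>s\<close> is written as \<open>T\<^sub>s - (q - q^-1)\<close>.\<close>

locale bar_module = type_A_system +
  fixes I J :: "'a set" and T :: "'a \<Rightarrow> ('a \<Rightarrow>\<^sub>0 laurent) \<Rightarrow> ('a \<Rightarrow>\<^sub>0 laurent)"
    and \<beta> :: "('a \<Rightarrow>\<^sub>0 laurent) \<Rightarrow> ('a \<Rightarrow>\<^sub>0 laurent)"
  assumes J_S: "J \<subseteq> S" and I_ideal: "left_weak_ideal G S I" and I_ne: "I \<noteq> {}" and I_D: "I \<subseteq> D_set G S J"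
    and T_closed: "s \<in> S \<Longrightarrow> m \<in> free_module I \<Longrightarrow> T s m \<in> free_module I"
    and T_add: "s \<in> S \<Longrightarrow> m \<in> free_module I \<Longrightarrow> m' \<in> free_module I \<Longrightarrow> T s (m + m') = T s m + T s m'"
    and T_smul: "s \<in> S \<Longrightarrow> m \<in> free_module I \<Longrightarrow> T s (smul a m) = smul a (T s m)"
    and T_quadratic: "s \<in> S \<Longrightarrow> m \<in> free_module I \<Longrightarrow> T s (T s m) = m + smul (qpow 1 - qpow (-1)) (T s m)"
    and T_commute: "s \<in> S \<Longrightarrow> t \<in> S \<Longrightarrow> s \<otimes> t = t \<otimes> s \<Longrightarrow> m \<in> free_module I \<Longrightarrow> T s (T t m) = T t (T s m)"
    and T_braid: "s \<in> S \<Longrightarrow> t \<in> S \<Longrightarrow> s \<otimes> t \<noteq> t \<otimes> s \<Longrightarrow> m \<in> free_module I \<Longrightarrow>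
      T s (T t (T s m)) = T t (T s (T t m))"
    and T_ascent: "s \<in> S \<Longrightarrow> w \<in> I \<Longrightarrow> s \<otimes> w \<in> I \<Longrightarrow> \<not> ldesc s w \<Longrightarrow> T s (bas w) = bas (s \<otimes> w)"
    and T_descent: "s \<in> S \<Longrightarrow> w \<in> I \<Longrightarrow> ldesc s w \<Longrightarrow>
      T s (bas w) = bas (s \<otimes> w) + smul (qpow 1 - qpow (-1)) (bas w)"
    and T_weak_descent: "s \<in> S \<Longrightarrow> w \<in> I \<Longrightarrow> s \<otimes> w \<notin> D_set G S J \<Longrightarrow> T s (bas w) = smul (- qpow (-1)) (bas w)"
    and T_weak_ascent: "s \<in> S \<Longrightarrow> w \<in> I \<Longrightarrow> s \<otimes> w \<in> D_set G S J \<Longrightarrow> s \<otimes> w \<notin> I \<Longrightarrow>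
      \<exists>r. (\<forall>y\<in>I. bruhat y (s \<otimes> w) \<longrightarrow> vanishing (r y)) \<and>
        T s (bas w) = smul (qpow 1) (bas w) - (\<Sum>y\<in>{y \<in> I. bruhat y (s \<otimes> w)}. smul (r y) (bas y))"
    and bar_closed: "m \<in> free_module I \<Longrightarrow> \<beta> m \<in> free_module I"
    and bar_add: "m \<in> free_module I \<Longrightarrow> m' \<in> free_module I \<Longrightarrow> \<beta> (m + m') = \<beta> m + \<beta> m'"
    and bar_smul: "m \<in> free_module I \<Longrightarrow> \<beta> (smul a m) = smul (laurent_bar a) (\<beta> m)"
    and bar_one: "\<beta> (bas \<one>) = bas \<one>"
    and bar_T: "s \<in> S \<Longrightarrow> m \<in> free_module I \<Longrightarrow> \<beta> (T s m) = T s (\<beta> m) - smul (qpow 1 - qpow (-1)) (\<beta> m)"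
begin

abbreviation FM where "FM \<equiv> free_module I"

lemma I_carrier: "I \<subseteq> carrier G"
  using I_ideal by (simp add: left_weak_ideal_def)

lemma I_closed: "w \<in> I \<Longrightarrow> w \<in> carrier G"
  using I_carrier by blast

lemma finite_I: "finite I"
  using finite_subset[OF I_carrier finite_carrier] .

lemmas I_descent = left_ideal_gen_closed[OF I_ideal]
lemmas I_one = left_ideal_one[OF I_ideal I_ne]

lemma T_0: "s \<in> S \<Longrightarrow> T s 0 = 0"
  using T_smul[of s 0 0] by (simp add: free_module_closed smul_laws)

lemma T_diff: "s \<in> S \<Longrightarrow> m \<in> FM \<Longrightarrow> m' \<in> FM \<Longrightarrow> T s (m - m') = T s m - T s m'"
  using T_add[of s m "smul (- 1) m'"] T_smul[of s m' "- 1"] by (simp add: free_module_closed smul_laws)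

lemma T_sum: "s \<in> S \<Longrightarrow> (\<And>x. x \<in> A \<Longrightarrow> f x \<in> FM) \<Longrightarrow> T s (sum f A) = (\<Sum>x\<in>A. T s (f x))"
  by (induction A rule: infinite_finite_induct) (auto simp: T_0 T_add free_module_sum)

lemma bar_0: "\<beta> 0 = 0"
  using bar_smul[of 0 0] by (simp add: free_module_closed smul_laws laurent_bar_0)

lemma bar_diff: "m \<in> FM \<Longrightarrow> m' \<in> FM \<Longrightarrow> \<beta> (m - m') = \<beta> m - \<beta> m'"
  using bar_add[of m "smul (- 1) m'"] bar_smul[of m' "- 1"]
  by (simp add: free_module_closed smul_laws laurent_bar_uminus laurent_bar_1)

lemma bar_sum: "(\<And>x. x \<in> A \<Longrightarrow> f x \<in> FM) \<Longrightarrow> \<beta> (sum f A) = (\<Sum>x\<in>A. \<beta> (f x))"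
  by (induction A rule: infinite_finite_induct) (auto simp: bar_0 bar_add free_module_sum)

lemma T_expand: "s \<in> S \<Longrightarrow> m \<in> FM \<Longrightarrow> lk (T s m) z = (\<Sum>y\<in>I. lk m y * lk (T s (bas y)) z)"
proof -
  assume s: "s \<in> S" and m: "m \<in> FM"
  have "T s m = T s (\<Sum>y\<in>I. smul (lk m y) (bas y))"
    using free_module_expand[OF finite_I m] by simp
  also have "\<dots> = (\<Sum>y\<in>I. smul (lk m y) (T s (bas y)))"
    using s by (subst T_sum) (auto simp: free_module_closed T_smul)
  finally show ?thesis by (simp add: lookup_sum lookup_smul)
qed

text \<open>By \<open>ldesc_longest_coset\<close> these are the left descents of
  \<open>w \<otimes> longest_elt G S J\<close>; by \<open>negative_C\<close> they all act on
  \<open>C w\<close> by \<open>- q^-1\<close>.\<close>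

definition tau :: "'a \<Rightarrow> 'a \<Rightarrow> bool" where
  "tau s w \<longleftrightarrow> ldesc s w \<or> s \<otimes> w \<notin> D_set G S J"

lemma generator_cases:
  assumes s: "s \<in> S" and w: "w \<in> I"
  obtains (ascent) "\<not> tau s w" "\<not> ldesc s w" "s \<otimes> w \<in> I"
    | (descent) "tau s w" "ldesc s w" "s \<otimes> w \<in> I"
    | (weak_descent) "tau s w" "\<not> ldesc s w" "s \<otimes> w \<notin> D_set G S J" "s \<otimes> w \<notin> I"
    | (weak_ascent) "\<not> tau s w" "\<not> ldesc s w" "s \<otimes> w \<in> D_set G S J" "s \<otimes> w \<notin> I"
  using I_descent[OF w s] I_D D_set_ldesc[OF _ s _ J_S, of w] w unfolding tau_def by blast

lemma T_bas_support:
  assumes s: "s \<in> S" and w: "w \<in> I" and z: "lk (T s (bas w)) z \<noteq> 0"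
  shows "z = w \<or> z = s \<otimes> w \<or> bruhat z (s \<otimes> w)"
proof (cases rule: generator_cases[OF s w, case_names ascent descent weak_descent weak_ascent])
  case weak_ascent
  then obtain r where "T s (bas w) = smul (qpow 1) (bas w) - (\<Sum>y\<in>{y \<in> I. bruhat y (s \<otimes> w)}. smul (r y) (bas y))"
    using T_weak_ascent[OF s w] by blast
  moreover have "(\<Sum>y\<in>{y \<in> I. bruhat y (s \<otimes> w)}. r y * lk (bas y) z) = 0" if "\<not> bruhat z (s \<otimes> w)"
    using that by (intro sum.neutral) (auto simp: lookup_bas)
  ultimately show ?thesis
    using z by (auto simp: lookup_minus lookup_smul lookup_bas lookup_sum split: if_splits)
qed (use z s w in \<open>auto simp: T_ascent T_descent T_weak_descent lookup_add lookup_smul lookup_bas split: if_splits\<close>)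

text \<open>The only negative power of \<open>q\<close> in the matrix of \<open>T\<^sub>s\<close> is
  the diagonal term \<open>- q^-1\<close> at descents and weak descents.\<close>

lemma T_bas_regular:
  assumes s: "s \<in> S" and w: "w \<in> I"
  shows "regular (lk (T s (bas w)) z + (if z = w \<and> tau s w then qpow (-1) else 0))"
proof (cases rule: generator_cases[OF s w, case_names ascent descent weak_descent weak_ascent])
  case weak_ascent
  then obtain r where r: "\<forall>y\<in>I. bruhat y (s \<otimes> w) \<longrightarrow> vanishing (r y)" "T s (bas w) = smul (qpow 1) (bas w) - (\<Sum>y\<in>{y \<in> I. bruhat y (s \<otimes> w)}. smul (r y) (bas y))"
    using T_weak_ascent[OF s w] by blast
  have "regular (\<Sum>y\<in>{y \<in> I. bruhat y (s \<otimes> w)}. r y * lk (bas y) z)"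
    using r(1) by (intro regular_sum regular_closed) (auto simp: vanishing_regular lookup_bas regular_closed)
  then show ?thesis using weak_ascent(1)
    by (auto simp: r(2) lookup_minus lookup_smul lookup_bas lookup_sum regular_closed)
qed (use s w in \<open>auto simp: T_ascent T_descent T_weak_descent lookup_add lookup_smul lookup_bas
  algebra_simps regular_closed\<close>)

text \<open>At a weak ascent this is where the requirement enters that the coefficients
  \<open>r\<close> be polynomial multiples of \<open>q\<close>.\<close>

lemma T_ascent_leading:
  assumes s: "s \<in> S" and w: "w \<in> I" and d: "\<not> tau s w"
  shows "vanishing (lk (T s (bas w) - smul (qpow 1) (bas w)) z - (if s \<otimes> w \<in> I \<and> z = s \<otimes> w then 1 else 0))"
proof (cases rule: generator_cases[OF s w, case_names ascent descent weak_descent weak_ascent])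
  case weak_ascent
  then obtain r where r: "\<forall>y\<in>I. bruhat y (s \<otimes> w) \<longrightarrow> vanishing (r y)" "T s (bas w) = smul (qpow 1) (bas w) - (\<Sum>y\<in>{y \<in> I. bruhat y (s \<otimes> w)}. smul (r y) (bas y))"
    using T_weak_ascent[OF s w] by blast
  have "vanishing (\<Sum>y\<in>{y \<in> I. bruhat y (s \<otimes> w)}. r y * lk (bas y) z)"
    using r(1) by (intro vanishing_sum) (auto simp: lookup_bas vanishing_closed)
  then show ?thesis using weak_ascent by (simp add: r(2) lookup_minus lookup_smul lookup_sum vanishing_closed)
qed (use d s w in \<open>auto simp: T_ascent lookup_minus lookup_smul lookup_bas vanishing_closed\<close>)

lemma T_descent_leading:
  assumes s: "s \<in> S" and w: "w \<in> I" and d: "tau s w"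
  shows "vanishing (lk (T s (bas w) + smul (qpow (-1)) (bas w)) z - (if ldesc s w \<and> z = s \<otimes> w then 1 else 0))"
  using d s w
  by (cases rule: generator_cases[OF s w]) (auto simp: T_descent T_weak_descent lookup_add lookup_smul lookup_bas vanishing_closed algebra_simps)

text \<open>Coefficients in the ideal times polynomial matrix entries stay in the ideal, so only the
  diagonal term \<open>- q^-1\<close> has to be compensated.\<close>

lemma T_vanishing:
  assumes s: "s \<in> S" and m: "m \<in> FM" and v: "\<And>y. vanishing (lk m y)"
  shows "vanishing (lk (T s m) z + (if tau s z then qpow (-1) * lk m z else 0))"
proof -
  have mz: "lk m z = 0" if "z \<notin> I" using m that by (simp add: free_module_iff)
  have "lk (T s m) z + (if tau s z then qpow (-1) * lk m z else 0) =
      (\<Sum>y\<in>I. lk m y * (lk (T s (bas y)) z + (if z = y \<and> tau s y then qpow (-1) else 0)))"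
  proof -
    have "(\<Sum>y\<in>I. lk m y * (if z = y \<and> tau s y then qpow (-1) else 0)) =
        (\<Sum>y\<in>I. if y = z then (if tau s z then qpow (-1) * lk m z else 0) else 0)"
      by (intro sum.cong) auto
    also have "\<dots> = (if tau s z then qpow (-1) * lk m z else 0)"
      using mz finite_I by (simp add: sum.delta)
    finally show ?thesis by (simp add: T_expand[OF s m] distrib_left sum.distrib)
  qed
  also have "vanishing \<dots>"
    using v T_bas_regular[OF s] by (intro vanishing_sum vanishing_mult)
  finally show ?thesis .
qed

lemma T_strictly_below:
  assumes s: "s \<in> S" and v: "v \<in> carrier G" "\<not> ldesc s v" and m: "m \<in> FM"
    and b: "\<And>y. lk m y \<noteq> 0 \<Longrightarrow> bruhat y v" and z: "lk (T s m) z \<noteq> 0"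
  shows "bruhat z (s \<otimes> v)"
proof -
  obtain y where y: "y \<in> I" "lk m y \<noteq> 0" "lk (T s (bas y)) z \<noteq> 0"
    using z unfolding T_expand[OF s m] by (metis (no_types, lifting) mult_eq_0_iff sum.neutral)
  have yv: "bruhat y v" using b y by blast
  have "bruhat v (s \<otimes> v)" using v s by (simp add: bruhat_gen_iff)
  then show ?thesis
    using T_bas_support[OF s y(1,3)] yv bruhat_lifting[OF s yv v(2)] bruhat_trans by blast
qed

text \<open>Split off the leading term: the rest of \<open>m\<close> is strictly below
  \<open>v\<close>, and by the lifting property its image is strictly below
  \<open>s \<otimes> v\<close>.\<close>

lemma T_top:
  assumes s: "s \<in> S" and v: "v \<in> I" "s \<otimes> v \<in> I" "\<not> ldesc s v" and m: "m \<in> FM"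
    and b: "\<And>y. lk m y \<noteq> 0 \<Longrightarrow> y = v \<or> bruhat y v"
  shows "lk (T s m) (s \<otimes> v) = lk m v" "lk (T s m) z \<noteq> 0 \<Longrightarrow> z = s \<otimes> v \<or> bruhat z (s \<otimes> v)"
proof -
  define m' where "m' = m - smul (lk m v) (bas v)"
  have m': "m' \<in> FM" using m v by (simp add: m'_def free_module_closed)
  have vc: "v \<in> carrier G" using I_closed v by blast
  have b': "bruhat y v" if "lk m' y \<noteq> 0" for y
    using that b[of y] by (auto simp: m'_def lookup_minus lookup_smul lookup_bas split: if_splits)
  have "m = smul (lk m v) (bas v) + m'" by (simp add: m'_def)
  then have "T s m = smul (lk m v) (bas (s \<otimes> v)) + T s m'"
    using T_add[OF s _ m', of "smul (lk m v) (bas v)"] s v by (simp add: free_module_closed T_smul T_ascent)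
  moreover have "bruhat z (s \<otimes> v)" if "lk (T s m') z \<noteq> 0" for z
    using T_strictly_below[OF s vc v(3) m' b' that] .
  ultimately show "lk (T s m) (s \<otimes> v) = lk m v" "lk (T s m) z \<noteq> 0 \<Longrightarrow> z = s \<otimes> v \<or> bruhat z (s \<otimes> v)"
    using bruhat_len[of "s \<otimes> v" "s \<otimes> v"] by (auto simp: lookup_add lookup_smul lookup_bas split: if_splits)
qed

lemma descent_factor:
  assumes w: "w \<in> I" "w \<noteq> \<one>"
  obtains s v where "s \<in> S" "v \<in> I" "w = s \<otimes> v" "\<not> ldesc s v" "len v < len w" "bruhat v w" "\<not> tau s v" "v = s \<otimes> w"
    "ldesc s w"
proof -
  obtain s where s: "s \<in> S" "ldesc s w" using ldesc_ex[OF I_closed[OF w(1)] w(2)] by blast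
  note wc = I_closed[OF w(1)]
  have e: "w = s \<otimes> (s \<otimes> w)" using gen_cancel[OF s(1) wc] by simp
  have nd: "\<not> ldesc s (s \<otimes> w)" using ldesc_flip[OF wc s(1)] s by simp
  moreover have "\<not> tau s (s \<otimes> w)" using nd e w I_D by (auto simp: tau_def)
  ultimately show ?thesis
    using s e I_descent[OF w(1) s] bruhat_gen_iff'[OF wc s(1)] by (intro that[of s "s \<otimes> w"]) auto
qed

text \<open>Unitriangularity of the bar involution, by induction from
  \<open>bas w = T s (bas v)\<close> and the leading term of \<open>T s\<close>.\<close>

lemma bar_bas:
  "w \<in> I \<Longrightarrow> lk (\<beta> (bas w)) w = 1 \<and> (\<forall>z. lk (\<beta> (bas w)) z \<noteq> 0 \<longrightarrow> z = w \<or> bruhat z w)"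
proof (induction "len w" arbitrary: w rule: less_induct)
  case less
  show ?case
  proof (cases "w = \<one>")
    case True
    then show ?thesis by (simp add: bar_one lookup_bas)
  next
    case False
    then obtain s v where s: "s \<in> S" and v: "v \<in> I" and wv: "w = s \<otimes> v" and d: "\<not> ldesc s v"
      and l: "len v < len w" and b: "bruhat v w" using descent_factor less.prems by metis
    have IH: "lk (\<beta> (bas v)) v = 1" "\<And>z. lk (\<beta> (bas v)) z \<noteq> 0 \<Longrightarrow> z = v \<or> bruhat z v"
      using less.hyps[OF l v] by auto
    have fm: "\<beta> (bas v) \<in> FM" using v by (simp add: bar_closed free_module_closed)
    have "bas w = T s (bas v)" using T_ascent[OF s v] d less.prems wv by simp
    then have e: "\<beta> (bas w) = T s (\<beta> (bas v)) - smul (qpow 1 - qpow (-1)) (\<beta> (bas v))"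
      using bar_T[OF s, of "bas v"] v by (simp add: free_module_closed)
    have nw: "lk (\<beta> (bas v)) w = 0" using IH(2)[of w] l bruhat_len[of w v] by auto
    note top = T_top[OF s v less.prems[unfolded wv] d fm IH(2), folded wv]
    show ?thesis
    proof (intro conjI allI impI)
      show "lk (\<beta> (bas w)) w = 1" using top(1) IH(1) nw by (simp add: e lookup_minus lookup_smul)
      fix z assume "lk (\<beta> (bas w)) z \<noteq> 0"
      then have "lk (T s (\<beta> (bas v))) z \<noteq> 0 \<or> lk (\<beta> (bas v)) z \<noteq> 0"
        by (auto simp: e lookup_minus lookup_smul)
      then show "z = w \<or> bruhat z w" using top(2) IH(2) b bruhat_trans by blast
    qed
  qed
qed

text \<open>At an element of maximal length in the support, unitriangularity makes the coefficient
  itself bar invariant, and a bar invariant polynomial multiple of \<open>q\<close> is zero.\<close>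

lemma bar_invariant_vanishing_0:
  assumes m: "m \<in> FM" and inv: "\<beta> m = m" and v: "\<And>y. vanishing (lk m y)"
  shows "m = 0"
proof (rule ccontr)
  assume "m \<noteq> 0"
  then obtain w0 where "lk m w0 \<noteq> 0" by (metis lookup_zero poly_mapping_eqI)
  moreover have "\<forall>y. lk m y \<noteq> 0 \<longrightarrow> len y < Suc (Max (len ` I))"
    using m finite_I by (auto simp: free_module_iff less_Suc_eq_le intro!: Max_ge)
  ultimately obtain w where w: "lk m w \<noteq> 0" "\<And>y. lk m y \<noteq> 0 \<Longrightarrow> len y \<le> len w"
    using ex_has_greatest_nat[of "\<lambda>y. lk m y \<noteq> 0" w0 len "Suc (Max (len ` I))"] less_imp_le_nat by metis
  have wI: "w \<in> I" using m w by (auto simp: free_module_iff)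
  have "lk m w = lk (\<beta> (\<Sum>y\<in>I. smul (lk m y) (bas y))) w"
    using inv free_module_expand[OF finite_I m] by simp
  also have "\<dots> = (\<Sum>y\<in>I. laurent_bar (lk m y) * lk (\<beta> (bas y)) w)"
    by (subst bar_sum) (auto simp: free_module_closed bar_smul lookup_sum lookup_smul)
  also have "\<dots> = (\<Sum>y\<in>I. if y = w then laurent_bar (lk m w) else 0)"
  proof (rule sum.cong)
    fix y assume y: "y \<in> I"
    have "lk (\<beta> (bas y)) w = 0" if "lk m y \<noteq> 0" "y \<noteq> w"
      using bar_bas[OF y] bruhat_len[of w y] w(2)[OF that(1)] that by fastforce
    then show "laurent_bar (lk m y) * lk (\<beta> (bas y)) w = (if y = w then laurent_bar (lk m w) else 0)"
      using bar_bas[OF y] by (cases "lk m y = 0") (auto simp: laurent_bar_0)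
  qed simp
  also have "\<dots> = laurent_bar (lk m w)" using wI finite_I by (simp add: sum.delta)
  finally show False using bar_invariant_vanishing[OF v[of w]] w(1) by simp
qed

section \<open>The canonical basis and the action of generators on it\<close>

definition canonical :: "'a \<Rightarrow> ('a \<Rightarrow>\<^sub>0 laurent) \<Rightarrow> bool" where
  "canonical w c \<longleftrightarrow> c \<in> FM \<and> \<beta> c = c \<and> lk c w = 1 \<and>
     (\<forall>y. y \<noteq> w \<longrightarrow> vanishing (lk c y) \<and> (lk c y \<noteq> 0 \<longrightarrow> bruhat y w))"

lemma bar_T_minus_q:
  assumes "s \<in> S" "m \<in> FM" "\<beta> m = m"
  shows "\<beta> (T s m - smul (qpow 1) m) = T s m - smul (qpow 1) m"
  using assms by (simp add: bar_diff bar_T bar_smul T_closed free_module_closed laurent_bar_qpow smul_laws)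

text \<open>Write \<open>c = bas w + p\<close>, where all coefficients of \<open>p\<close> are
  multiples of \<open>q\<close>. Modulo such multiples \<open>T s p\<close> contributes only
  \<open>- q^-1\<close> times the coefficient at \<open>z\<close>, and the constant term of this is
  minus the coefficient of \<open>q^1\<close> in \<open>lk c z\<close>.\<close>

lemma T_minus_q_canonical:
  assumes s: "s \<in> S" and w: "w \<in> I" and c: "canonical w c" and d: "\<not> tau s w"
  shows "vanishing (lk (T s c - smul (qpow 1) c) z - (if s \<otimes> w \<in> I \<and> z = s \<otimes> w then 1 else 0)
    + (if tau s z then of_int (lk (lk c z) 1) else 0))"
proof -
  define \<delta> :: laurent where "\<delta> = (if s \<otimes> w \<in> I \<and> z = s \<otimes> w then 1 else 0)"
  define p where "p = c - bas w"
  have p: "p \<in> FM" "\<And>y. vanishing (lk p y)"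
    using c w by (auto simp: p_def canonical_def free_module_closed lookup_minus lookup_bas vanishing_closed)
  have cp: "c = bas w + p" by (simp add: p_def)
  have 1: "vanishing (lk (T s p) z + (if tau s z then qpow (-1) * lk p z else 0))"
    by (rule T_vanishing[OF s p])
  have 2: "vanishing (lk (T s (bas w) - smul (qpow 1) (bas w)) z - \<delta>)"
    unfolding \<delta>_def by (rule T_ascent_leading[OF s w d])
  have 3: "vanishing (qpow 1 * lk p z)"
    using p by (intro vanishing_mult) (auto simp: regular_closed)
  have 4: "vanishing (if tau s z then of_int (lk (lk c z) 1) - qpow (-1) * lk p z else 0)"
  proof (cases "tau s z")
    case True
    with d have "z \<noteq> w" by auto
    then have e: "lk p z = lk c z" by (simp add: p_def lookup_minus lookup_bas)
    have "regular (qpow (-1) * lk p z)" using p(2)[of z] by (simp add: regular_def vanishing_def lookup_qpow_mult)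
    from vanishing_closed(5)[OF vanishing_minus_const[OF this]] show ?thesis
      using True by (simp add: lookup_qpow_mult e)
  qed (simp add: vanishing_closed)
  have v: "vanishing ((lk (T s p) z + (if tau s z then qpow (-1) * lk p z else 0)) +
      (lk (T s (bas w) - smul (qpow 1) (bas w)) z - \<delta>) -
      qpow 1 * lk p z + (if tau s z then of_int (lk (lk c z) 1) - qpow (-1) * lk p z else 0))"
    by (rule vanishing_closed(3)[OF vanishing_closed(4)[OF vanishing_closed(3)[OF 1 2] 3] 4])
  have "T s c = T s (bas w) + T s p" "lk c z = lk (bas w) z + lk p z"
    unfolding cp using s w p by (auto intro!: T_add simp: free_module_closed lookup_add)
  then have eq: "lk (T s c - smul (qpow 1) c) z =
      lk (T s p) z + lk (T s (bas w) - smul (qpow 1) (bas w)) z - qpow 1 * lk p z"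
    by (simp add: lookup_add lookup_minus lookup_smul algebra_simps)
  show ?thesis
    unfolding \<delta>_def[symmetric] eq using v by (cases "tau s z") (simp_all add: algebra_simps)
qed

text \<open>The companion for descents: adding \<open>q^-1\<close> cancels the negative powers at
  \<open>z\<close> with \<open>tau s z\<close> and leaves the coefficient of \<open>q^1\<close> at
  all other \<open>z\<close>.\<close>

lemma T_plus_canonical:
  assumes s: "s \<in> S" and w: "w \<in> I" and c: "canonical w c" and d: "tau s w"
  shows "vanishing (lk (T s c + smul (qpow (-1)) c) z - (if ldesc s w \<and> z = s \<otimes> w then 1 else 0)
    - (if tau s z then 0 else of_int (lk (lk c z) 1)))"
proof -
  define \<delta> :: laurent where "\<delta> = (if ldesc s w \<and> z = s \<otimes> w then 1 else 0)"
  define p where "p = c - bas w"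
  have p: "p \<in> FM" "\<And>y. vanishing (lk p y)"
    using c w by (auto simp: p_def canonical_def free_module_closed lookup_minus lookup_bas vanishing_closed)
  have cp: "c = bas w + p" by (simp add: p_def)
  have 1: "vanishing (lk (T s p) z + (if tau s z then qpow (-1) * lk p z else 0))"
    by (rule T_vanishing[OF s p])
  have 2: "vanishing (lk (T s (bas w) + smul (qpow (-1)) (bas w)) z - \<delta>)"
    unfolding \<delta>_def by (rule T_descent_leading[OF s w d])
  have 3: "vanishing (if tau s z then 0 else qpow (-1) * lk p z - of_int (lk (lk c z) 1))"
  proof (cases "tau s z")
    case False
    with d have "z \<noteq> w" by auto
    then have e: "lk p z = lk c z" by (simp add: p_def lookup_minus lookup_bas)
    have "regular (qpow (-1) * lk p z)" using p(2)[of z] by (simp add: regular_def vanishing_def lookup_qpow_mult)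
    from vanishing_minus_const[OF this] show ?thesis
      using False by (simp add: lookup_qpow_mult e)
  qed (simp add: vanishing_closed)
  have v: "vanishing ((lk (T s p) z + (if tau s z then qpow (-1) * lk p z else 0)) +
      (lk (T s (bas w) + smul (qpow (-1)) (bas w)) z - \<delta>) +
      (if tau s z then 0 else qpow (-1) * lk p z - of_int (lk (lk c z) 1)))"
    by (rule vanishing_closed(3)[OF vanishing_closed(3)[OF 1 2] 3])
  have "T s c = T s (bas w) + T s p" "lk c z = lk (bas w) z + lk p z"
    unfolding cp using s w p by (auto intro!: T_add simp: free_module_closed lookup_add)
  then have eq: "lk (T s c + smul (qpow (-1)) c) z =
      lk (T s p) z + lk (T s (bas w) + smul (qpow (-1)) (bas w)) z + qpow (-1) * lk p z"
    by (simp add: lookup_add lookup_smul algebra_simps)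
  show ?thesis
    unfolding \<delta>_def[symmetric] eq using v by (cases "tau s z") (simp_all add: algebra_simps)
qed

lemma T_uminus: "s \<in> S \<Longrightarrow> m \<in> FM \<Longrightarrow> T s (- m) = - T s m"
  using T_diff[of s 0 m] by (simp add: free_module_closed T_0)

text \<open>The usual recursion: for \<open>w = s v\<close>, applying \<open>T\<^sub>s - q\<close>
  to the element for \<open>v\<close> gives a bar invariant vector, and the integer constant terms
  it has below \<open>w\<close> are removed by adding canonical elements of smaller length.\<close>

lemma canonical_exists: "w \<in> I \<Longrightarrow> \<exists>c. canonical w c"
proof (induction "len w" arbitrary: w rule: less_induct)
  case less
  show ?case
  proof (cases "w = \<one>")
    case True
    then have "canonical w (bas w)"
      using I_one by (auto simp: canonical_def bar_one lookup_bas vanishing_closed free_module_closed)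
    then show ?thesis by blast
  next
    case False
    then obtain s v where s: "s \<in> S" and v: "v \<in> I" and wv: "w = s \<otimes> v" and d: "\<not> ldesc s v"
      and l: "len v < len w" and b: "bruhat v w" and nt: "\<not> tau s v" using descent_factor less.prems by metis
    obtain c where c: "canonical v c" using less.hyps[OF l v] by blast
    \<comment> \<open>By \<open>T_minus_q_canonical\<close> a constant term below \<open>w\<close>
      occurs only at \<open>y\<close> with \<open>tau s y\<close>, where it is \<open>- k y\<close>;
      hence \<open>Z\<close> is added.\<close>
    define Y where "Y = {y \<in> I. bruhat y v \<and> tau s y}"
    have "\<exists>f. \<forall>y\<in>Y. canonical y (f y)"
      using less.hyps l bruhat_len by (intro bchoice) (auto simp: Y_def, meson order.strict_trans)
    then obtain f where f: "\<And>y. y \<in> Y \<Longrightarrow> canonical y (f y)" by blast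
    have finY: "finite Y" using finite_I by (simp add: Y_def)
    define k where "k y = (of_int (lk (lk c y) 1) :: laurent)" for y
    define X where "X = T s c - smul (qpow 1) c"
    define Z where "Z = (\<Sum>y\<in>Y. smul (k y) (f y))"
    have cF: "c \<in> FM" "\<beta> c = c" using c by (auto simp: canonical_def)
    have fF: "f y \<in> FM" "\<beta> (f y) = f y" "lk (f y) y = 1" if "y \<in> Y" for y
      using f[OF that] by (auto simp: canonical_def)
    have fv: "vanishing (lk (f y) z)" "lk (f y) z \<noteq> 0 \<Longrightarrow> bruhat z y" if "y \<in> Y" "z \<noteq> y" for y z
      using f[OF that(1)] that(2) by (auto simp: canonical_def)
    have XF: "X \<in> FM" "\<beta> X = X"
      using bar_T_minus_q[OF s cF] s cF by (auto simp: X_def free_module_closed T_closed)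
    have ZF: "Z \<in> FM" unfolding Z_def using fF by (intro free_module_sum free_module_closed)
    have Zb: "\<beta> Z = Z" unfolding Z_def
      using fF by (subst bar_sum) (auto simp: free_module_closed bar_smul k_def laurent_bar_of_int)
    have cb: "y = v \<or> bruhat y v" if "lk c y \<noteq> 0" for y using c that by (auto simp: canonical_def)
    note top = T_top[OF s v less.prems[unfolded wv] d cF(1) cb, folded wv]
    have cw: "lk c w = 0" using cb[of w] l bruhat_len[of w v] by auto
    have Zsupp: "bruhat z w" if nz: "lk Z z \<noteq> 0" for z
    proof -
      obtain y where "y \<in> Y" "lk (f y) z \<noteq> 0"
        using nz unfolding Z_def lookup_sum lookup_smul by (metis (no_types, lifting) mult_zero_right sum.neutral)
      then have "bruhat y v" "z = y \<or> bruhat z y" using fv[of y z] by (auto simp: Y_def)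
      then show ?thesis using b bruhat_trans by blast
    qed
    have Xsupp: "z = w \<or> bruhat z w" if "lk X z \<noteq> 0" for z
    proof -
      have "lk (T s c) z \<noteq> 0 \<or> lk c z \<noteq> 0" using that by (auto simp: X_def lookup_minus lookup_smul)
      then show ?thesis using top(2)[of z] cb[of z] b bruhat_trans by blast
    qed
    have "canonical w (X + Z)"
      unfolding canonical_def
    proof (intro conjI allI impI)
      show "X + Z \<in> FM" "\<beta> (X + Z) = X + Z" using XF ZF Zb by (simp_all add: free_module_closed bar_add)
      have "\<not> bruhat w w" using bruhat_len[of w w] by auto
      then have "lk Z w = 0" using Zsupp by blast
      moreover have "lk X w = 1" using top(1) cw c by (simp add: X_def lookup_minus lookup_smul canonical_def)
      ultimately show "lk (X + Z) w = 1" by (simp add: lookup_add)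
      fix z assume zw: "z \<noteq> w"
      show "bruhat z w" if "lk (X + Z) z \<noteq> 0" using that Xsupp[of z] Zsupp[of z] zw
        by (cases "lk X z = 0") (auto simp: lookup_add)
      have x: "vanishing (lk X z + (if tau s z then k z else 0))"
        using T_minus_q_canonical[OF s v c nt, of z] zw wv
        by (cases "tau s z") (simp_all add: X_def k_def)
      have kz: "k z = 0" if "z \<notin> Y" "tau s z"
      proof -
        have "lk c z = 0" if "z \<in> I"
          using cb[of z] that \<open>z \<notin> Y\<close> \<open>tau s z\<close> nt by (auto simp: Y_def)
        moreover have "lk c z = 0" if "z \<notin> I" using cF that by (simp add: free_module_iff)
        ultimately show ?thesis by (cases "z \<in> I") (simp_all add: k_def)
      qed
      have "vanishing (lk Z z - (if tau s z then k z else 0))"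
      proof -
        have "lk Z z - (if tau s z then k z else 0) = (\<Sum>y\<in>Y. k y * lk (f y) z - (if y = z then k z else 0))"
          using finY kz by (auto simp: Z_def lookup_sum lookup_smul sum_subtractf sum.delta' Y_def)
        also have "vanishing \<dots>"
        proof (rule vanishing_sum)
          fix y assume y: "y \<in> Y"
          show "vanishing (k y * lk (f y) z - (if y = z then k z else 0))"
            using fF(3)[OF y] fv(1)[OF y, of z]
            by (cases "y = z") (auto simp: vanishing_closed k_def intro!: vanishing_mult(1) regular_closed)
        qed
        finally show ?thesis .
      qed
      from vanishing_closed(3)[OF x this] show "vanishing (lk (X + Z) z)" by (simp add: lookup_add algebra_simps)
    qed
    then show ?thesis by blast
  qed
qed

definition C :: "'a \<Rightarrow> ('a \<Rightarrow>\<^sub>0 laurent)" where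
  "C w = (SOME c. canonical w c)"

lemma canonical_C: "w \<in> I \<Longrightarrow> canonical w (C w)"
  unfolding C_def using canonical_exists by (rule someI_ex)

lemma canonical_unique: "canonical w c \<Longrightarrow> canonical w c' \<Longrightarrow> c = c'"
proof -
  assume c: "canonical w c" and c': "canonical w c'"
  have "vanishing (lk (c - c') y)" for y
    using c c' by (cases "y = w") (auto simp: canonical_def lookup_minus vanishing_closed)
  then have "c - c' = 0"
    using c c' by (intro bar_invariant_vanishing_0) (auto simp: canonical_def free_module_closed bar_diff)
  then show ?thesis by simp
qed

lemma C_props:
  assumes "w \<in> I"
  shows "C w \<in> FM" "\<beta> (C w) = C w" "lk (C w) w = 1" "y \<noteq> w \<Longrightarrow> vanishing (lk (C w) y)"
    "lk (C w) y \<noteq> 0 \<Longrightarrow> y = w \<or> bruhat y w"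
  using canonical_C[OF assms] by (auto simp: canonical_def)

text \<open>The difference of the two sides is bar invariant with all coefficients in the ideal,
  hence zero. This turns congruences for coefficients into exact formulas in the canonical
  basis.\<close>

lemma bar_invariant_expand:
  assumes m: "m \<in> FM" "\<beta> m = m" and r: "\<And>y. vanishing (lk m y - of_int (k y))"
  shows "m = (\<Sum>y\<in>I. smul (of_int (k y)) (C y))"
proof -
  let ?Z = "\<Sum>y\<in>I. smul (of_int (k y)) (C y)"
  have ZF: "?Z \<in> FM" by (intro free_module_sum free_module_closed C_props)
  have Zb: "\<beta> ?Z = ?Z"
    by (subst bar_sum) (auto simp: free_module_closed bar_smul C_props laurent_bar_of_int)
  have "vanishing (lk (m - ?Z) z)" for z
  proof -
    have kz: "of_int (k z) = (0 :: laurent)" if "z \<notin> I"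
    proof -
      have "vanishing (- of_int (k z))" using r[of z] m that by (simp add: free_module_iff)
      then show ?thesis using laurent_bar_of_int[of "- k z"] by (intro bar_invariant_vanishing[of "of_int (k z)"])
        (auto simp: laurent_bar_of_int dest: vanishing_closed(5))
    qed
    have "(\<Sum>y\<in>I. if y = z then of_int (k z) else 0) = (of_int (k z) :: laurent)"
      using kz finite_I by (auto simp: sum.delta')
    then have "lk (m - ?Z) z = (lk m z - of_int (k z)) -
        (\<Sum>y\<in>I. of_int (k y) * lk (C y) z - (if y = z then of_int (k z) else 0))"
      by (simp add: lookup_minus lookup_sum lookup_smul sum_subtractf)
    moreover have "vanishing (\<Sum>y\<in>I. of_int (k y) * lk (C y) z - (if y = z then of_int (k z) else 0))"
    proof (rule vanishing_sum)
      fix y assume y: "y \<in> I"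
      show "vanishing (of_int (k y) * lk (C y) z - (if y = z then of_int (k z) else 0))"
        using C_props(3)[OF y] C_props(4)[OF y, of z]
        by (cases "y = z") (auto simp: vanishing_closed intro!: vanishing_mult(1) regular_closed)
    qed
    ultimately show ?thesis using r vanishing_closed(4) by simp
  qed
  then have "m - ?Z = 0"
    using ZF Zb m by (intro bar_invariant_vanishing_0) (auto simp: free_module_closed bar_diff)
  then show ?thesis by simp
qed

lemma C_independent:
  assumes e: "(\<Sum>y\<in>I. smul (a y) (C y)) = (\<Sum>y\<in>I. smul (b y) (C y))" and w: "w \<in> I"
  shows "a w = b w"
proof (rule ccontr)
  assume neq: "a w \<noteq> b w"
  define P where "P y \<longleftrightarrow> y \<in> I \<and> a y \<noteq> b y" for y
  have "\<forall>y. P y \<longrightarrow> len y < Suc (Max (len ` I))"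
    using finite_I by (auto simp: P_def less_Suc_eq_le)
  then obtain z where z: "P z" "\<And>y. P y \<Longrightarrow> len y \<le> len z"
    using ex_has_greatest_nat[of P w len "Suc (Max (len ` I))"] neq w less_imp_le_nat P_def by metis
  have "0 = lk (\<Sum>y\<in>I. smul (a y - b y) (C y)) z"
    using e by (simp add: smul_laws sum_subtractf)
  also have "\<dots> = (\<Sum>y\<in>I. if y = z then a z - b z else 0)"
    unfolding lookup_sum lookup_smul
  proof (rule sum.cong)
    fix y assume y: "y \<in> I"
    have "lk (C y) z = 0" if "a y \<noteq> b y" "y \<noteq> z"
      using C_props(5)[OF y, of z] bruhat_len[of z y] z(2)[of y] that y by (fastforce simp: P_def)
    then show "(a y - b y) * lk (C y) z = (if y = z then a z - b z else 0)"
      using C_props(3)[OF y] by (cases "a y = b y") auto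
  qed simp
  also have "\<dots> = a z - b z" using z finite_I by (simp add: P_def sum.delta')
  finally show False using z by (simp add: P_def)
qed

text \<open>The edge weights of the W-graph in this normalization, where signs are reversed:
  \<open>C\<^sub>s = T\<^sub>s - q\<close> in the Hecke algebra gives weight -1 between the identity
  and \<open>s\<close>.\<close>

definition \<mu> :: "'a \<Rightarrow> 'a \<Rightarrow> int" where
  "\<mu> y w = lk (lk (C w) y) 1"

lemma \<mu>_bruhat: "w \<in> I \<Longrightarrow> y \<noteq> w \<Longrightarrow> \<mu> y w \<noteq> 0 \<Longrightarrow> bruhat y w"
  using C_props(5)[of w y] by (cases "lk (C w) y = 0") (auto simp: \<mu>_def)

lemma T_C_ascent:
  assumes s: "s \<in> S" and w: "w \<in> I" and d: "\<not> tau s w"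
  shows "T s (C w) = smul (qpow 1) (C w) + (if s \<otimes> w \<in> I then C (s \<otimes> w) else 0) -
    (\<Sum>y\<in>I. smul (of_int (if tau s y then \<mu> y w else 0)) (C y))"
proof -
  let ?k = "\<lambda>y. (if s \<otimes> w \<in> I \<and> y = s \<otimes> w then 1 else 0) - (if tau s y then \<mu> y w else 0)"
  have "T s (C w) - smul (qpow 1) (C w) = (\<Sum>y\<in>I. smul (of_int (?k y)) (C y))"
  proof (rule bar_invariant_expand)
    show "T s (C w) - smul (qpow 1) (C w) \<in> FM"
      using s w by (simp add: free_module_closed T_closed C_props)
    show "\<beta> (T s (C w) - smul (qpow 1) (C w)) = T s (C w) - smul (qpow 1) (C w)"
      by (rule bar_T_minus_q[OF s C_props(1,2)[OF w]])
    fix y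
    show "vanishing (lk (T s (C w) - smul (qpow 1) (C w)) y - of_int (?k y))"
      using T_minus_q_canonical[OF s w canonical_C[OF w] d, of y]
      by (auto simp: \<mu>_def algebra_simps split: if_splits)
  qed
  also have "\<dots> = (\<Sum>y\<in>I. smul (if s \<otimes> w \<in> I \<and> y = s \<otimes> w then 1 else 0) (C y)) -
      (\<Sum>y\<in>I. smul (of_int (if tau s y then \<mu> y w else 0)) (C y))"
    unfolding sum_subtractf[symmetric] by (rule sum.cong) (auto simp: smul_laws)
  also have "(\<Sum>y\<in>I. smul (if s \<otimes> w \<in> I \<and> y = s \<otimes> w then 1 else 0) (C y)) =
      (\<Sum>y\<in>I. if y = s \<otimes> w then C (s \<otimes> w) else 0)"
    by (rule sum.cong) (auto simp: smul_laws)
  also have "\<dots> = (if s \<otimes> w \<in> I then C (s \<otimes> w) else 0)" using finite_I by (simp add: sum.delta)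
  finally show ?thesis by (simp add: algebra_simps)
qed

section \<open>Descents and weak descents act by a scalar\<close>

definition negative :: "'a \<Rightarrow> ('a \<Rightarrow>\<^sub>0 laurent) \<Rightarrow> bool" where
  "negative s m \<longleftrightarrow> m \<in> FM \<and> T s m = smul (- qpow (-1)) m"

lemma negative_closed:
  "s \<in> S \<Longrightarrow> negative s 0" "s \<in> S \<Longrightarrow> negative s m \<Longrightarrow> negative s (smul a m)"
  "s \<in> S \<Longrightarrow> negative s m \<Longrightarrow> negative s m' \<Longrightarrow> negative s (m + m')"
  "s \<in> S \<Longrightarrow> negative s m \<Longrightarrow> negative s m' \<Longrightarrow> negative s (m - m')"
  by (auto simp: negative_def free_module_closed T_0 T_smul T_add T_diff smul_laws mult.commute)

lemma negative_sum: "s \<in> S \<Longrightarrow> (\<And>x. x \<in> A \<Longrightarrow> negative s (f x)) \<Longrightarrow> negative s (sum f A)"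
  by (induction A rule: infinite_finite_induct) (auto simp: negative_closed)

text \<open>The quadratic relation reads
  \<open>(T\<^sub>s + q^-1) (T\<^sub>s - q) = 0\<close>.\<close>

lemma negative_T_minus_q:
  assumes "s \<in> S" "m \<in> FM" shows "negative s (T s m - smul (qpow 1) m)"
proof -
  have "T s (T s m - smul (qpow 1) m) = m + smul (qpow 1 - qpow (-1)) (T s m) - smul (qpow 1) (T s m)"
    using assms by (simp add: T_diff T_closed free_module_closed T_smul T_quadratic)
  also have "\<dots> = smul (- qpow (-1)) (T s m - smul (qpow 1) m)"
    by (simp add: smul_laws qpow_cancel algebra_simps)
  finally show ?thesis using assms by (simp add: negative_def free_module_closed T_closed)
qed

text \<open>For a negative \<open>C w\<close> the vector in \<open>T_plus_canonical\<close> is zero,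
  so the constant terms listed there must cancel.\<close>

lemma negative_mu:
  assumes s: "s \<in> S" and w: "w \<in> I" and neg: "negative s (C w)" and d: "tau s w"
    and y: "y \<in> I" "\<not> tau s y"
  shows "\<mu> y w = (if ldesc s w \<and> y = s \<otimes> w then -1 else 0)"
proof -
  have "T s (C w) + smul (qpow (-1)) (C w) = 0" using neg by (simp add: negative_def smul_laws)
  then have "vanishing (- (if ldesc s w \<and> y = s \<otimes> w then 1 else 0) - of_int (\<mu> y w))"
    using T_plus_canonical[OF s w canonical_C[OF w] d, of y] y by (simp add: \<mu>_def)
  then have "lk (- (if ldesc s w \<and> y = s \<otimes> w then 1 else 0) - of_int (\<mu> y w) :: laurent) 0 = 0"
    by (simp add: vanishing_def)
  then show ?thesis
    by (auto simp: lookup_minus lookup_of_int lookup_one split: if_splits)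
qed

text \<open>In the formula for \<open>T t (C v)\<close> each remaining \<open>C y\<close> has
  \<open>tau t y\<close> and is negative for \<open>t\<close>. It is negative for \<open>s\<close>
  as well unless \<open>\<not> tau s y\<close>, and then \<open>negative_mu\<close> leaves only
  \<open>y = s \<otimes> v\<close>, with coefficient -1. So \<open>N\<close> collects what is
  negative for both.\<close>

lemma T_C_descent_aux:
  assumes s: "s \<in> S" and t: "t \<in> S" and v: "v \<in> I" and w: "w = t \<otimes> v" "w \<in> I" "\<not> ldesc t v" "\<not> tau t v"
    and neg: "negative s (C v)" "tau s v" "s \<otimes> v \<noteq> v"
    and IH: "\<And>y. y \<in> I \<Longrightarrow> bruhat y v \<Longrightarrow> tau s y \<Longrightarrow> negative s (C y)"
    and IH': "\<And>y. y \<in> I \<Longrightarrow> bruhat y v \<Longrightarrow> tau t y \<Longrightarrow> negative t (C y)"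
  shows "\<exists>N. negative s N \<and> negative t N \<and>
    C w = T t (C v) - smul (qpow 1) (C v) + N - (if ldesc s v \<and> \<not> tau s (s \<otimes> v) \<and> tau t (s \<otimes> v) then C (s \<otimes> v) else 0)"
proof -
  define P where "P y \<longleftrightarrow> ldesc s v \<and> \<not> tau s y \<and> y = s \<otimes> v" for y
  let ?N = "\<Sum>y\<in>I. if tau t y \<and> tau s y then smul (of_int (\<mu> y v)) (C y) else 0"
  have mu0: "smul (of_int (\<mu> y v)) (C y) = 0" if "y \<in> I" "\<not> bruhat y v" "y \<noteq> v" for y
  proof -
    have "\<mu> y v = 0" using \<mu>_bruhat[OF v that(3)] that by blast
    then show ?thesis by (simp add: smul_laws)
  qed
  have N: "negative r ?N" if r: "r = s \<or> r = t" for r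
  proof (rule negative_sum)
    show "r \<in> S" using r s t by auto
    fix y assume y: "y \<in> I"
    show "negative r (if tau t y \<and> tau s y then smul (of_int (\<mu> y v)) (C y) else 0)"
    proof (cases "tau t y \<and> tau s y")
      case True
      then have "y \<noteq> v" using w(4) by metis
      then show ?thesis
        using True r IH[OF y] IH'[OF y] mu0[OF y] negative_closed(1,2)[OF \<open>r \<in> S\<close>]
        by (cases "bruhat y v") auto
    qed (simp only: if_False negative_closed(1)[OF \<open>r \<in> S\<close>])
  qed
  have "(\<Sum>y\<in>I. smul (of_int (if tau t y then \<mu> y v else 0)) (C y)) =
      (\<Sum>y\<in>I. (if tau t y \<and> tau s y then smul (of_int (\<mu> y v)) (C y) else 0) -
        (if y = s \<otimes> v then (if ldesc s v \<and> \<not> tau s (s \<otimes> v) \<and> tau t (s \<otimes> v) then C (s \<otimes> v) else 0) else 0))"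
  proof (rule sum.cong)
    fix y assume y: "y \<in> I"
    show "smul (of_int (if tau t y then \<mu> y v else 0)) (C y) = (if tau t y \<and> tau s y then smul (of_int (\<mu> y v)) (C y) else 0) -
        (if y = s \<otimes> v then (if ldesc s v \<and> \<not> tau s (s \<otimes> v) \<and> tau t (s \<otimes> v) then C (s \<otimes> v) else 0) else 0)"
      using negative_mu[OF s v neg(1,2) y] by (cases "tau s y") (auto simp: smul_laws)
  qed simp
  also have "\<dots> = ?N - (if ldesc s v \<and> \<not> tau s (s \<otimes> v) \<and> tau t (s \<otimes> v) then C (s \<otimes> v) else 0)"
  proof -
    have "s \<otimes> v \<in> I" if "ldesc s v" using I_descent[OF v s that] .
    then show ?thesis using finite_I by (auto simp: sum_subtractf sum.delta)
  qed
  finally have "T t (C v) = smul (qpow 1) (C v) + C w -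
      (?N - (if ldesc s v \<and> \<not> tau s (s \<otimes> v) \<and> tau t (s \<otimes> v) then C (s \<otimes> v) else 0))"
    using T_C_ascent[OF t v w(4)] w by simp
  then have "C w = T t (C v) - smul (qpow 1) (C v) + ?N -
      (if ldesc s v \<and> \<not> tau s (s \<otimes> v) \<and> tau t (s \<otimes> v) then C (s \<otimes> v) else 0)"
    by (simp add: algebra_simps)
  with N show ?thesis by blast
qed

lemma C_one: "C \<one> = bas \<one>"
proof (rule canonical_unique[OF canonical_C[OF I_one]])
  show "canonical \<one> (bas \<one>)"
    using I_one by (auto simp: canonical_def bar_one lookup_bas vanishing_closed free_module_closed)
qed

text \<open>With \<open>C\<^sub>s = T\<^sub>s - q\<close> the vector is
  \<open>(C\<^sub>t C\<^sub>s - 1) e\<close>. Since \<open>C\<^sub>t e = - (q + q^-1) e\<close>, its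
  multiple by \<open>- (q + q^-1)\<close> is
  \<open>(C\<^sub>t C\<^sub>s C\<^sub>t - C\<^sub>t) e\<close>, and the operator here is the
  Kazhdan--Lusztig element of the longest element of the subgroup generated by \<open>s\<close> and
  \<open>t\<close>.\<close>

lemma braid_combination_negative:
  assumes s: "s \<in> S" and t: "t \<in> S" and st: "s \<otimes> t \<noteq> t \<otimes> s" and e: "negative t e"
  shows "negative s (T t (T s e - smul (qpow 1) e) - smul (qpow 1) (T s e - smul (qpow 1) e) - e)"
proof -
  have F: "e \<in> FM" and Te: "T t e = smul (- qpow (-1)) e" using e by (auto simp: negative_def)
  let ?M = "T t (T s e) - smul (qpow 1) (T s e) + smul (qpow 1 * qpow 1) e"
  have M: "T t (T s e - smul (qpow 1) e) - smul (qpow 1) (T s e - smul (qpow 1) e) - e = ?M"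
    using s t F by (simp add: T_diff T_closed free_module_closed T_smul Te smul_laws qpow_cancel)
  have "T s ?M = T s (T t (T s e)) - smul (qpow 1) (T s (T s e)) + smul (qpow 1 * qpow 1) (T s e)"
    using s t F by (simp add: T_diff T_add T_closed free_module_closed T_smul)
  also have "T s (T t (T s e)) = smul (- qpow (-1)) (T t (T s e))"
    using s t F by (simp add: T_braid[OF s t st F] Te T_smul T_closed)
  also have "T s (T s e) = e + smul (qpow 1 - qpow (-1)) (T s e)" using s F by (rule T_quadratic)
  finally have "T s ?M = smul (- qpow (-1)) ?M"
    by (simp add: smul_laws qpow_cancel algebra_simps mult.assoc[symmetric])
  then show ?thesis unfolding M negative_def using s t F by (simp add: T_closed free_module_closed)
qed

text \<open>
  If \<open>s w = w r\<close> with \<open>r \<in> J\<close>, the recursion \<open>w = t v\<close> need not preserve negativity; when \<open>s\<close> and \<open>t\<close> do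
  not commute one has to descend two steps, to \<open>u = s t w\<close>.
\<close>

lemma negative_C: "w \<in> I \<Longrightarrow> s \<in> S \<Longrightarrow> tau s w \<Longrightarrow> negative s (C w)"
proof (induction "len w" arbitrary: w s rule: less_induct)
  case less
  note s = less.prems(2)
  note wc = I_closed[OF less.prems(1)]
  show ?case
  proof (cases "ldesc s w")
    case True
    define v where "v = s \<otimes> w"
    have v: "v \<in> I" and wv: "w = s \<otimes> v"
      using I_descent[OF less.prems(1) s True] gen_cancel[OF s wc] by (simp_all add: v_def)
    have "\<not> ldesc s v" using ldesc_flip[OF wc s] True by (simp add: v_def)
    moreover have "s \<otimes> v \<in> D_set G S J" using less.prems(1) I_D unfolding wv[symmetric] by blast
    ultimately have nt: "\<not> tau s v" by (simp add: tau_def)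
    have "negative s (\<Sum>y\<in>I. smul (of_int (if tau s y then \<mu> y v else 0)) (C y))"
    proof (rule negative_sum[OF s])
      fix y assume y: "y \<in> I"
      show "negative s (smul (of_int (if tau s y then \<mu> y v else 0)) (C y))"
      proof (cases "tau s y \<and> \<mu> y v \<noteq> 0")
        case t: True
        then have "y \<noteq> v" using nt by metis
        then have "bruhat y v" using \<mu>_bruhat[OF v] t by blast
        then have "len y < len w" using bruhat_len[of y v] True unfolding v_def by linarith
        then show ?thesis using less.hyps y s t negative_closed(2)[OF s] by simp
      qed (use negative_closed(1)[OF s] in \<open>auto simp: smul_laws\<close>)
    qed
    moreover have "C w = T s (C v) - smul (qpow 1) (C v) +
        (\<Sum>y\<in>I. smul (of_int (if tau s y then \<mu> y v else 0)) (C y))"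
      using T_C_ascent[OF s v nt] less.prems(1) wv by (simp add: algebra_simps)
    ultimately show ?thesis
      using negative_closed(3)[OF s negative_T_minus_q[OF s C_props(1)[OF v]]] by simp
  next
    case False
    then have nD: "s \<otimes> w \<notin> D_set G S J" using less.prems(3) by (simp add: tau_def)
    show ?thesis
    proof (cases "w = \<one>")
      case True
      then show ?thesis
        using T_weak_descent[OF s I_one] nD I_one by (simp add: negative_def C_one free_module_closed)
    next
      case w1: False
      obtain t v where t: "t \<in> S" and v: "v \<in> I" and wv: "w = t \<otimes> v" and dv: "\<not> ldesc t v"
        and l: "len v < len w" and b: "bruhat v w" and nt: "\<not> tau t v" and vw: "v = t \<otimes> w" and dw: "ldesc t w"
        using descent_factor[OF less.prems(1) w1] by metis
      have st: "s \<noteq> t" using dw False by auto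
      have wD: "w \<in> D_set G S J" and vD: "v \<in> D_set G S J" using less.prems(1) v I_D by auto
      obtain r where r: "r \<in> J" "s \<otimes> w = w \<otimes> r" using D_set_exchange[OF wD s nD J_S] by metis
      have rS: "r \<in> S" using r J_S by blast
      note vc = I_closed[OF v]
      have IH: "negative x (C y)" if "y \<in> I" "bruhat y v" "tau x y" "x \<in> S" for x y
        using less.hyps[OF _ that(1,4,3)] bruhat_len[OF that(2)] l by simp
      have wtv: "t \<otimes> v \<in> I" using less.prems(1) wv by simp
      show ?thesis
      proof (cases rule: gen_commute_or_braid[OF s t st, case_names commute braid])
        case commute
        \<comment> \<open>Cancelling \<open>t\<close> from \<open>s w = w r\<close> makes
          \<open>s\<close> a weak descent of \<open>v\<close> too, and \<open>T\<^sub>t\<close>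
          preserves negativity for \<open>s\<close> because the two operators commute.\<close>
        have "s \<otimes> v = v \<otimes> r"
        proof -
          have "s \<otimes> v = t \<otimes> (s \<otimes> w)" unfolding vw using commute wc s t by (simp add: m_assoc[symmetric])
          then show ?thesis using r(2) wc t rS by (simp add: vw m_assoc)
        qed
        then have tv: "tau s v" using D_set_exchange_conv[OF vD r(1) _ J_S] by (simp add: tau_def)
        have neg: "negative s (C v)" using less.hyps[OF l v s tv] .
        have "\<not> ldesc s v" using ldesc_commute[OF wc s t st commute] False vw by simp
        then obtain N where N: "negative s N" "C w = T t (C v) - smul (qpow 1) (C v) + N"
          using T_C_descent_aux[OF s t v wv less.prems(1) dv nt neg tv gen_mult_neq[OF s vc]] IH s t by auto
        have "T s (T t (C v)) = smul (- qpow (-1)) (T t (C v))"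
          using neg T_commute[OF s t commute] t by (simp add: negative_def T_smul)
        then have "negative s (T t (C v))" using neg t by (simp add: negative_def T_closed)
        then show ?thesis unfolding N(2) using N(1) neg s by (intro negative_closed)
      next
        case braid
        \<comment> \<open>Otherwise \<open>s\<close> and \<open>t\<close> are both ascents of
          \<open>v\<close> and \<open>t s w\<close> is two longer than \<open>w\<close>; but it
          equals \<open>v r\<close>, which is no longer than \<open>w\<close>.\<close>
        have sv: "ldesc s v"
        proof (rule ccontr)
          assume a: "\<not> ldesc s v"
          from ldesc_braid(1)[OF vc t s _ dv a] braid have "\<not> ldesc s w" "\<not> ldesc t (s \<otimes> w)"
            by (auto simp: wv)
          then have "len (t \<otimes> (s \<otimes> w)) = Suc (Suc (len w))"
            using len_gen_left[OF wc s] len_gen_left[of "s \<otimes> w" t] wc s t by auto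
          moreover have "t \<otimes> (s \<otimes> w) = v \<otimes> r" using r wc t rS by (simp add: vw m_assoc)
          ultimately show False using len_gen_right[OF vc rS] l by auto
        qed
        define u where "u = s \<otimes> v"
        have u: "u \<in> I" and vu: "v = s \<otimes> u"
          using I_descent[OF v s sv] gen_cancel[OF s vc] by (simp_all add: u_def)
        have uc: "u \<in> carrier G" using I_closed[OF u] .
        have uD: "u \<in> D_set G S J" using u I_D by auto
        have dsu: "\<not> ldesc s u" using ldesc_flip[OF vc s] sv by (simp add: u_def)
        have nsu: "\<not> tau s u" using dsu vu vD by (simp add: tau_def)
        \<comment> \<open>The weak descent moves to \<open>t\<close>:
          \<open>t u = t s t w = s t s w = s t w r = u r\<close>.\<close>
        have "t \<otimes> u = u \<otimes> r"
        proof -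
          have "t \<otimes> u = (t \<otimes> s \<otimes> t) \<otimes> w" using wc s t by (simp add: u_def vw m_assoc)
          also have "\<dots> = s \<otimes> t \<otimes> (s \<otimes> w)" using wc s t by (simp add: braid(2)[symmetric] m_assoc)
          also have "\<dots> = u \<otimes> r" using wc s t rS r(2) by (simp add: u_def vw m_assoc)
          finally show ?thesis .
        qed
        then have tuD: "t \<otimes> u \<notin> D_set G S J" using D_set_exchange_conv[OF uD r(1) _ J_S] by simp
        then have tu: "tau t u" and dtu: "\<not> ldesc t u"
          using D_set_ldesc[OF uD t _ J_S] by (auto simp: tau_def)
        have lu: "len u < len v" using sv by (simp add: u_def)
        have IHu: "negative x (C y)" if "y \<in> I" "bruhat y u" "tau x y" "x \<in> S" for x y
          using less.hyps[OF _ that(1,4,3)] bruhat_len[OF that(2)] l lu by simp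
        have e: "negative t (C u)" using less.hyps[OF _ u t tu] l lu by simp
        obtain N1 where N1: "negative s N1" "negative t N1" "C v = T s (C u) - smul (qpow 1) (C u) + N1"
          using T_C_descent_aux[OF t s u vu v dsu nsu e tu gen_mult_neq[OF t uc]] IHu s t dtu by auto
        have tv: "tau s v" using sv by (simp add: tau_def)
        have negv: "negative s (C v)" using less.hyps[OF l v s tv] .
        obtain N2 where N2: "negative s N2" "C w = T t (C v) - smul (qpow 1) (C v) + N2 - C u"
          using T_C_descent_aux[OF s t v wv less.prems(1) dv nt negv tv gen_mult_neq[OF s vc]] IH s t sv nsu tu
          by (auto simp: u_def)
        let ?e = "T s (C u) - smul (qpow 1) (C u)"
        have F: "?e \<in> FM" "N1 \<in> FM" using N1 s u by (auto simp: negative_def free_module_closed T_closed C_props)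
        have "T t (C v) = T t ?e + smul (- qpow (-1)) N1"
          unfolding N1(3) using T_add[OF t F] N1(2) by (simp add: negative_def)
        \<comment> \<open>The term \<open>- C u\<close>, produced because \<open>s\<close> and
          \<open>t\<close> have opposite status at \<open>u\<close>, is exactly what completes the
          braid combination.\<close>
        then have "C w = (T t ?e - smul (qpow 1) ?e - C u) + smul (- qpow (-1)) N1 - smul (qpow 1) N1 + N2"
          unfolding N2(2) N1(3) by (simp add: smul_laws algebra_simps)
        then show ?thesis
          using braid_combination_negative[OF s t braid(1) e] N1(1) N2(1) negative_closed[OF s] by simp
      qed
    qed
  qed
qed

text \<open>
  Otherwise \<open>T\<^sub>s C\<^sub>x \<equiv> q C\<^sub>x\<close> and \<open>T\<^sub>t C\<^sub>x = - q\<^sup>-\<^sup>1 C\<^sub>x\<close> modulo vectors negative for both \<open>s\<close> and \<open>t\<close>, against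
  the braid relation.
\<close>

lemma star_ascent_in_I:
  assumes s: "s \<in> S" and t: "t \<in> S" and st: "s \<otimes> t \<noteq> t \<otimes> s" and x: "x \<in> I"
    and d: "tau t x" "\<not> tau s x" "\<not> (ldesc t x \<and> tau s (t \<otimes> x))"
  shows "s \<otimes> x \<in> I"
proof (rule ccontr)
  assume nI: "s \<otimes> x \<notin> I"
  define k where "k y = (of_int (if tau s y then \<mu> y x else 0) :: laurent)" for y
  define N where "N = (\<Sum>y\<in>I. smul (k y) (C y))"
  note nt = negative_C[OF x t d(1)]
  \<comment> \<open>A contributing \<open>y\<close> with \<open>\<not> tau t y\<close> could by
    \<open>negative_mu\<close> only be \<open>t \<otimes> x\<close>, which the last part of
    \<open>d\<close> excludes.\<close>
  have k: "tau s y \<and> tau t y \<and> bruhat y x" if "y \<in> I" "k y \<noteq> 0" for y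
  proof -
    have y: "tau s y" "\<mu> y x \<noteq> 0" using that(2) by (auto simp: k_def split: if_splits)
    moreover have "tau t y"
    proof (rule ccontr)
      assume "\<not> tau t y"
      from negative_mu[OF t x nt d(1) that(1) this] y(2) have "ldesc t x" "y = t \<otimes> x"
        by (auto split: if_splits)
      with d(3) y(1) show False by simp
    qed
    moreover have "y \<noteq> x" using y(1) d(2) by metis
    ultimately show ?thesis using \<mu>_bruhat[OF x] by blast
  qed
  have N: "negative r N" if "r = s \<or> r = t" for r
    unfolding N_def
  proof (rule negative_sum)
    show r: "r \<in> S" using that s t by auto
    fix y assume y: "y \<in> I"
    show "negative r (smul (k y) (C y))"
      using k[OF y] negative_C[OF y r] that negative_closed(1,2)[OF r] by (cases "k y = 0") (auto simp: smul_laws)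
  qed
  let ?e = "C x"
  have F: "?e \<in> FM" "N \<in> FM" using x N by (auto simp: C_props negative_def)
  have Ts: "T s ?e = smul (qpow 1) ?e - N" using T_C_ascent[OF s x d(2)] nI by (simp add: N_def k_def)
  have Tt: "T t ?e = smul (- qpow (-1)) ?e" and TN: "T s N = smul (- qpow (-1)) N" "T t N = smul (- qpow (-1)) N"
    using nt N by (auto simp: negative_def)
  have "T s (T t (T s ?e)) = smul (- qpow 1) ?e + N - smul (qpow (-1) * qpow (-1)) N"
    using s t F by (simp add: Ts Tt TN T_diff T_smul T_uminus free_module_closed smul_laws qpow_cancel algebra_simps)
  moreover have "T t (T s (T t ?e)) = smul (qpow (-1)) ?e - smul (qpow (-1) * qpow (-1)) N"
    using s t F by (simp add: Ts Tt TN T_diff T_smul T_uminus free_module_closed smul_laws qpow_cancel algebra_simps)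
  \<comment> \<open>The terms in \<open>N\<close> with \<open>q^-2\<close> agree on both sides of
    the braid relation. Since \<open>N\<close> involves only \<open>C y\<close> with
    \<open>y\<close> strictly below \<open>x\<close>, it has coefficient 0 at \<open>x\<close>,
    while the right-hand side has \<open>q + q^-1\<close> there.\<close>
  ultimately have "N = smul (qpow 1 + qpow (-1)) ?e"
    using T_braid[OF s t st F(1)] by (simp add: smul_laws algebra_simps)
  then have "lk N x = qpow 1 + qpow (-1)" using x by (simp add: lookup_smul C_props)
  moreover have "lk N x = 0" unfolding N_def lookup_sum lookup_smul
  proof (rule sum.neutral, rule ballI)
    fix y assume y: "y \<in> I"
    show "k y * lk (C y) x = 0"
    proof (cases "k y = 0")
      case False
      then have "len y < len x" using k[OF y] bruhat_len by blast
      then have "lk (C y) x = 0" using C_props(5)[OF y, of x] bruhat_len[of x y] by force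
      then show ?thesis by simp
    qed simp
  qed
  ultimately show False using q_plus_inverse_cancel[of 1] by simp
qed

end

section \<open>The Hecke algebra\<close>

lemma free_algebra_simps [simp]:
  "mult (free_algebra S) = (*)" "one (free_algebra S) = 1" "zero (free_algebra S) = 0" "add (free_algebra S) = (+)"
  by (simp_all add: free_algebra_def)

lemma free_carrier_iff: "f \<in> carrier (free_algebra S) \<longleftrightarrow> (\<forall>u\<in>Poly_Mapping.keys f. set (letters u) \<subseteq> S)"
  by (simp add: free_algebra_def)

lemma letters_simps [simp]: "letters 0 = []" "letters (u + v) = letters u @ letters v"
  by (simp_all add: zero_gen_word_def plus_gen_word_def)

lemma free_carrier_closed:
  "0 \<in> carrier (free_algebra S)" "1 \<in> carrier (free_algebra S)"
  "f \<in> carrier (free_algebra S) \<Longrightarrow> g \<in> carrier (free_algebra S) \<Longrightarrow> f + g \<in> carrier (free_algebra S)"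
  "f \<in> carrier (free_algebra S) \<Longrightarrow> - f \<in> carrier (free_algebra S)"
  "f \<in> carrier (free_algebra S) \<Longrightarrow> g \<in> carrier (free_algebra S) \<Longrightarrow> f - g \<in> carrier (free_algebra S)"
  "f \<in> carrier (free_algebra S) \<Longrightarrow> g \<in> carrier (free_algebra S) \<Longrightarrow> f * g \<in> carrier (free_algebra S)"
  "set ss \<subseteq> S \<Longrightarrow> free_word ss \<in> carrier (free_algebra S)"
  "free_scalar a \<in> carrier (free_algebra S)"
proof -
  assume f: "f \<in> carrier (free_algebra S)" and g: "g \<in> carrier (free_algebra S)"
  show "f + g \<in> carrier (free_algebra S)" using f g keys_add[of f g] unfolding free_carrier_iff by blast
  show "f - g \<in> carrier (free_algebra S)" using f g keys_diff[of f g] unfolding free_carrier_iff by blast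
  show "f * g \<in> carrier (free_algebra S)" unfolding free_carrier_iff
  proof
    fix u assume "u \<in> Poly_Mapping.keys (f * g)"
    then obtain v w where "u = v + w" "v \<in> Poly_Mapping.keys f" "w \<in> Poly_Mapping.keys g"
      using keys_mult[of f g] by blast
    with f g show "set (letters u) \<subseteq> S" unfolding free_carrier_iff by simp
  qed
qed (auto simp: free_carrier_iff free_word_def free_scalar_def)

lemma free_algebra_ring: "ring (free_algebra S)"
proof (rule ringI)
  show "abelian_group (free_algebra S)"
  proof (rule abelian_groupI)
    fix f assume "f \<in> carrier (free_algebra S)"
    then show "\<exists>g\<in>carrier (free_algebra S). g \<oplus>\<^bsub>free_algebra S\<^esub> f = \<zero>\<^bsub>free_algebra S\<^esub>"
      by (intro bexI[of _ "- f"]) (simp_all add: free_carrier_closed)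
  qed (simp_all add: free_carrier_closed add_ac)
  show "monoid (free_algebra S)"
    by (rule monoidI) (simp_all add: free_carrier_closed mult.assoc)
qed (simp_all add: algebra_simps)

lemma free_algebra_a_minus:
  assumes "f \<in> carrier (free_algebra S)" "g \<in> carrier (free_algebra S)"
  shows "f \<ominus>\<^bsub>free_algebra S\<^esub> g = f - g"
proof -
  interpret ring "free_algebra S" by (rule free_algebra_ring)
  have "\<ominus>\<^bsub>free_algebra S\<^esub> g = - g"
    using assms by (intro minus_equality) (simp_all add: free_carrier_closed)
  then show ?thesis by (simp add: a_minus_def)
qed

lemma free_word_append: "free_word (xs @ ys) = free_word xs * free_word ys"
  by (simp add: free_word_def mult_single plus_gen_word_def)

lemma free_word_Cons: "free_word (x # xs) = free_word [x] * free_word xs"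
  using free_word_append[of "[x]" xs] by simp

lemma free_word_Nil: "free_word [] = 1"
  by (simp add: free_word_def zero_gen_word_def[symmetric])

lemma free_scalar_laws:
  "free_scalar (a + b) = free_scalar a + free_scalar b" "free_scalar (a - b) = free_scalar a - free_scalar b"
  "free_scalar (- a) = - free_scalar a" "free_scalar (a * b) = free_scalar a * free_scalar b"
  "free_scalar 0 = 0" "free_scalar 1 = 1"
  by (simp_all add: free_scalar_def single_add single_diff single_uminus mult_single)

lemma single_word: "Poly_Mapping.single u a = free_scalar a * free_word (letters u)"
  by (cases u) (simp add: free_scalar_def free_word_def mult_single)

lemma free_induct [consumes 1, case_names single add]:
  assumes f: "f \<in> carrier (free_algebra S)"
    and single: "\<And>u a. set (letters u) \<subseteq> S \<Longrightarrow> P (Poly_Mapping.single u a)"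
    and add: "\<And>f g. f \<in> carrier (free_algebra S) \<Longrightarrow> g \<in> carrier (free_algebra S) \<Longrightarrow> P f \<Longrightarrow> P g \<Longrightarrow> P (f + g)"
  shows "P f"
proof -
  have zero: "P 0" using single[of 0 0] by simp
  have "P (\<Sum>u\<in>A. Poly_Mapping.single u (lk f u)) \<and>
      (\<Sum>u\<in>A. Poly_Mapping.single u (lk f u)) \<in> carrier (free_algebra S)"
    if "finite A" "A \<subseteq> Poly_Mapping.keys f" for A
    using that
  proof (induction A)
    case (insert u A)
    have u: "set (letters u) \<subseteq> S" using insert f by (auto simp: free_carrier_iff)
    then have "Poly_Mapping.single u (lk f u) \<in> carrier (free_algebra S)"
      unfolding single_word by (simp add: free_carrier_closed)
    with insert single[OF u] show ?case by (auto intro: add free_carrier_closed)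
  qed (simp add: zero free_carrier_closed)
  from this[of "Poly_Mapping.keys f"] show ?thesis using poly_mapping_expand[of f] by simp
qed

lemma free_scalar_central: "free_scalar a * f = f * free_scalar a"
proof -
  have "f \<in> carrier (free_algebra UNIV)" by (simp add: free_carrier_iff)
  then show ?thesis
    by (induction rule: free_induct) (simp_all add: free_scalar_def mult_single mult.commute algebra_simps)
qed

text \<open>In the Hecke algebra \<open>T\<^sub>s\<^sup>-\<^sup>1 = T\<^sub>s - (q - q\<^sup>-\<^sup>1)\<close>.\<close>

definition bar_letter :: "'a \<Rightarrow> 'a free_alg" where
  "bar_letter s = free_word [s] - free_scalar (qpow 1 - qpow (-1))"

text \<open>A semilinear ring endomorphism of the free algebra, fixed by sending each generator to
  the expression for its inverse. It descends to the quotient because it maps relators into the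
  ideal.\<close>

definition free_bar :: "'a free_alg \<Rightarrow> 'a free_alg" where
  "free_bar f = (\<Sum>u\<in>Poly_Mapping.keys f. free_scalar (laurent_bar (lk f u)) * prod_list (map bar_letter (letters u)))"

lemma free_bar_add: "free_bar (f + g) = free_bar f + free_bar g"
  unfolding free_bar_def
  by (rule setsum_keys_plus_distrib) (simp_all add: laurent_bar_0 laurent_bar_add free_scalar_laws distrib_right)

lemma free_bar_single: "free_bar (Poly_Mapping.single u a) = free_scalar (laurent_bar a) * prod_list (map bar_letter (letters u))"
  by (simp add: free_bar_def laurent_bar_0 free_scalar_laws)

lemma free_bar_mult: "free_bar (f * g) = free_bar f * free_bar g"
proof -
  have "f \<in> carrier (free_algebra UNIV)" by (simp add: free_carrier_iff)
  then show ?thesis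
  proof (induction rule: free_induct)
    case (single u a)
    have "g \<in> carrier (free_algebra UNIV)" by (simp add: free_carrier_iff)
    then show ?case
    proof (induction rule: free_induct)
      case (single v b)
      let ?p = "prod_list (map bar_letter (letters u))" and ?r = "prod_list (map bar_letter (letters v))"
      have "free_scalar (laurent_bar a) * ?p * (free_scalar (laurent_bar b) * ?r) =
          free_scalar (laurent_bar a) * (?p * free_scalar (laurent_bar b)) * ?r"
        by (simp add: mult.assoc)
      also have "?p * free_scalar (laurent_bar b) = free_scalar (laurent_bar b) * ?p"
        by (rule free_scalar_central[symmetric])
      finally show ?case
        by (simp add: mult_single free_bar_single laurent_bar_mult free_scalar_laws(4) mult.assoc)
    qed (simp add: distrib_left free_bar_add)
  qed (simp add: distrib_right free_bar_add)
qed

lemma free_bar_uminus: "free_bar (- f) = - free_bar f"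
  using free_bar_add[of f "- f"] by (simp add: free_bar_def eq_neg_iff_add_eq_0 add.commute)

lemma free_bar_diff: "free_bar (f - g) = free_bar f - free_bar g"
  using free_bar_add[of f "- g"] by (simp add: free_bar_uminus)

lemma free_bar_scalar: "free_bar (free_scalar a) = free_scalar (laurent_bar a)"
  using free_bar_single[of 0 a] by (simp add: free_scalar_def)

lemma free_bar_word: "free_bar (free_word ss) = prod_list (map bar_letter ss)"
  by (simp add: free_word_def free_bar_single laurent_bar_1 free_scalar_laws)

lemma free_bar_one: "free_bar 1 = 1"
  using free_bar_word[of "[]"] by (simp add: free_word_Nil)

lemma bar_letter_closed: "s \<in> S \<Longrightarrow> bar_letter s \<in> carrier (free_algebra S)"
  by (simp add: bar_letter_def free_carrier_closed)

lemma free_bar_closed: "f \<in> carrier (free_algebra S) \<Longrightarrow> free_bar f \<in> carrier (free_algebra S)"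
proof (induction rule: free_induct)
  case (single u a)
  have "set ss \<subseteq> S \<Longrightarrow> prod_list (map bar_letter ss) \<in> carrier (free_algebra S)" for ss
    by (induction ss) (auto simp: free_carrier_closed bar_letter_closed)
  with single show ?case by (simp add: free_bar_single free_carrier_closed)
qed (simp add: free_bar_add free_carrier_closed)

context type_A_system
begin

section \<open>The quotient by the Hecke relations and its bar involution\<close>

abbreviation FA where "FA \<equiv> free_algebra S"
abbreviation HA where "HA \<equiv> hecke_algebra G S"
abbreviation cl where "cl \<equiv> hecke_class G S"
abbreviation gen where "gen \<equiv> hecke_gen G S"
abbreviation scalar where "scalar \<equiv> hecke_scalar G S"
abbreviation \<xi> :: laurent where "\<xi> \<equiv> qpow 1 - qpow (-1)"

lemma alternating_set: "set (alternating m s t) \<subseteq> {s, t}"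
  by (induction m s t rule: alternating.induct) auto

lemma relators_closed: "hecke_relators G S \<subseteq> carrier FA"
proof
  fix f assume "f \<in> hecke_relators G S"
  then consider s where "s \<in> S" "f = free_word [s, s] - (1 + free_scalar \<xi> * free_word [s])"
    | s t where "s \<in> S" "t \<in> S" "f = free_word (alternating (group.ord G (s \<otimes> t)) s t) - free_word (alternating (group.ord G (s \<otimes> t)) t s)"
    unfolding hecke_relators_def by blast
  then show "f \<in> carrier FA"
  proof cases
    case 1
    then show ?thesis by (simp add: free_carrier_closed)
  next
    case (2 s t)
    then have "set (alternating m s t) \<subseteq> S" "set (alternating m t s) \<subseteq> S" for m
      using alternating_set[of m s t] alternating_set[of m t s] by auto
    with 2 show ?thesis by (simp add: free_carrier_closed)
  qed
qed

lemma hecke_ideal_ideal: "ideal (hecke_ideal G S) FA"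
  unfolding hecke_ideal_def by (rule ring.genideal_ideal[OF free_algebra_ring relators_closed])

lemma relators_ideal: "f \<in> hecke_relators G S \<Longrightarrow> f \<in> hecke_ideal G S"
  unfolding hecke_ideal_def using ring.genideal_self[OF free_algebra_ring relators_closed] by blast

lemma hecke_ideal_least:
  assumes "ideal K FA" "hecke_relators G S \<subseteq> K" shows "hecke_ideal G S \<subseteq> K"
  unfolding hecke_ideal_def by (rule ring.genideal_minimal[OF free_algebra_ring assms])

lemma hecke_ring: "ring HA"
  unfolding hecke_algebra_def by (rule ideal.quotient_is_ring[OF hecke_ideal_ideal])

lemma cl_hom: "cl \<in> ring_hom FA HA"
  unfolding hecke_algebra_def hecke_class_def[abs_def] using ideal.rcos_ring_hom[OF hecke_ideal_ideal] by simp

lemma hecke_carrier: "carrier HA = cl ` carrier FA"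
  unfolding hecke_algebra_def FactRing_def hecke_class_def A_RCOSETS_def' by auto

lemma cl_closed: "f \<in> carrier FA \<Longrightarrow> cl f \<in> carrier HA"
  using hecke_carrier by blast

lemma cl_add: "f \<in> carrier FA \<Longrightarrow> g \<in> carrier FA \<Longrightarrow> cl (f + g) = cl f \<oplus>\<^bsub>HA\<^esub> cl g"
  using ring_hom_add[OF cl_hom] by simp

lemma cl_mult: "f \<in> carrier FA \<Longrightarrow> g \<in> carrier FA \<Longrightarrow> cl (f * g) = cl f \<otimes>\<^bsub>HA\<^esub> cl g"
  using ring_hom_mult[OF cl_hom] by simp

lemma cl_one: "cl 1 = \<one>\<^bsub>HA\<^esub>"
  using ring_hom_one[OF cl_hom] by simp

lemma cl_eq_iff: "f \<in> carrier FA \<Longrightarrow> g \<in> carrier FA \<Longrightarrow> cl f = cl g \<longleftrightarrow> f - g \<in> hecke_ideal G S"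
  using ring.quotient_eq_iff_same_a_r_cos[OF free_algebra_ring hecke_ideal_ideal, of f g]
  by (simp add: hecke_class_def free_algebra_a_minus)

lemma ord_commuting:
  assumes "s \<in> S" "t \<in> S" "s \<noteq> t" "s \<otimes> t = t \<otimes> s" shows "group.ord G (s \<otimes> t) = 2"
proof -
  have st: "s \<otimes> t \<in> carrier G" using assms by simp
  have "(s \<otimes> t) [^] (2::nat) = s \<otimes> (t \<otimes> s) \<otimes> t" using assms(1,2) by (simp add: numeral_2_eq_2 m_assoc)
  also have "\<dots> = \<one>" using assms by (simp add: assms(4)[symmetric] m_assoc gen_cancel gen_square)
  finally have "group.ord G (s \<otimes> t) dvd 2" using pow_eq_id[OF st] by blast
  moreover have "s \<otimes> t \<noteq> \<one>"
  proof
    assume "s \<otimes> t = \<one>"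
    then have "s = t" using gen_cancel_right[of t s] assms(1,2) by simp
    then show False using assms by simp
  qed
  then have "group.ord G (s \<otimes> t) \<noteq> 1" using ord_eq_1[OF st] by blast
  moreover have "d = 1 \<or> d = 2" if "d dvd 2" for d :: nat
  proof -
    have "d \<in> {0, 1, 2}" using dvd_imp_le[OF that] by auto
    then show ?thesis using that by auto
  qed
  ultimately show ?thesis by blast
qed

lemma ord_braid:
  assumes s: "s \<in> S" and t: "t \<in> S" and st: "s \<otimes> t \<noteq> t \<otimes> s" and br: "s \<otimes> t \<otimes> s = t \<otimes> s \<otimes> t"
  shows "group.ord G (s \<otimes> t) = 3"
proof -
  have c: "s \<otimes> t \<in> carrier G" using s t by simp
  have "(s \<otimes> t) [^] (3::nat) = (s \<otimes> t \<otimes> s) \<otimes> (t \<otimes> s \<otimes> t)" using s t by (simp add: numeral_3_eq_3 m_assoc)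
  also have "\<dots> = (t \<otimes> s \<otimes> t) \<otimes> (t \<otimes> s \<otimes> t)" by (simp only: br)
  also have "\<dots> = \<one>" using s t by (simp add: m_assoc gen_cancel gen_square)
  finally have "group.ord G (s \<otimes> t) dvd 3" using pow_eq_id[OF c] by blast
  moreover have "s \<otimes> t \<noteq> \<one>"
  proof
    assume "s \<otimes> t = \<one>"
    then have "s = t" using gen_cancel_right[of t s] s t by simp
    then show False using st by simp
  qed
  then have "group.ord G (s \<otimes> t) \<noteq> 1" using ord_eq_1[OF c] by blast
  moreover have "d = 1 \<or> d = 3" if "d dvd 3" for d :: nat
  proof -
    have "d \<in> {0, 1, 2, 3}" using dvd_imp_le[OF that] by auto
    then show ?thesis using that by auto
  qed
  ultimately show ?thesis by blast
qed

lemma noncommuting_braid: "s \<in> S \<Longrightarrow> t \<in> S \<Longrightarrow> s \<otimes> t \<noteq> t \<otimes> s \<Longrightarrow> s \<otimes> t \<otimes> s = t \<otimes> s \<otimes> t"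
  using gen_commute_or_braid[of s t] by metis

text \<open>For distinct generators in type A the product has order 2 or 3, so
  \<open>alternating\<close> produces words of one of these lengths.\<close>

lemma relator_cases:
  assumes "f \<in> hecke_relators G S"
  obtains (quadratic) s where "s \<in> S" "f = free_word [s, s] - (1 + free_scalar \<xi> * free_word [s])"
    | (commute) s t where "s \<in> S" "t \<in> S" "s \<otimes> t = t \<otimes> s" "f = free_word [s, t] - free_word [t, s]"
    | (braid) s t where "s \<in> S" "t \<in> S" "s \<otimes> t \<noteq> t \<otimes> s" "f = free_word [s, t, s] - free_word [t, s, t]"
proof -
  from assms consider s where "s \<in> S" "f = free_word [s, s] - (1 + free_scalar \<xi> * free_word [s])"
    | s t where "s \<in> S" "t \<in> S" "s \<noteq> t"
      "f = free_word (alternating (group.ord G (s \<otimes> t)) s t) - free_word (alternating (group.ord G (s \<otimes> t)) t s)"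
    unfolding hecke_relators_def by blast
  then show ?thesis
  proof cases
    case 1
    then show ?thesis by (rule quadratic)
  next
    case (2 s t)
    show ?thesis
    proof (cases "s \<otimes> t = t \<otimes> s")
      case True
      with 2 show ?thesis using ord_commuting[of s t] by (intro commute[of s t]) (auto simp: numeral_2_eq_2)
    next
      case False
      with 2 show ?thesis using ord_braid[OF 2(1,2) False] noncommuting_braid[of s t]
        by (intro braid[of s t]) (auto simp: numeral_3_eq_3)
    qed
  qed
qed

lemma quadratic_relator: "s \<in> S \<Longrightarrow> free_word [s, s] - (1 + free_scalar \<xi> * free_word [s]) \<in> hecke_relators G S"
  unfolding hecke_relators_def by blast

lemma commute_relator:
  assumes "s \<in> S" "t \<in> S" "s \<noteq> t" "s \<otimes> t = t \<otimes> s" shows "free_word [s, t] - free_word [t, s] \<in> hecke_relators G S"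
proof -
  have "free_word (alternating (group.ord G (s \<otimes> t)) s t) - free_word (alternating (group.ord G (s \<otimes> t)) t s) \<in> hecke_relators G S"
    using assms unfolding hecke_relators_def by blast
  then show ?thesis using ord_commuting[OF assms] by (simp add: numeral_2_eq_2)
qed

lemma braid_relator:
  assumes "s \<in> S" "t \<in> S" "s \<otimes> t \<noteq> t \<otimes> s" shows "free_word [s, t, s] - free_word [t, s, t] \<in> hecke_relators G S"
proof -
  have "free_word (alternating (group.ord G (s \<otimes> t)) s t) - free_word (alternating (group.ord G (s \<otimes> t)) t s) \<in> hecke_relators G S"
    using assms unfolding hecke_relators_def by blast
  then show ?thesis using ord_braid[OF assms noncommuting_braid[OF assms]] by (simp add: numeral_3_eq_3)
qed

lemma idealI_FA:
  assumes sub: "K \<subseteq> carrier FA" and zero: "0 \<in> K"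
    and add: "\<And>f g. f \<in> K \<Longrightarrow> g \<in> K \<Longrightarrow> f + g \<in> K" and neg: "\<And>f. f \<in> K \<Longrightarrow> - f \<in> K"
    and mult: "\<And>f g. f \<in> K \<Longrightarrow> g \<in> carrier FA \<Longrightarrow> g * f \<in> K \<and> f * g \<in> K"
  shows "ideal K FA"
proof (rule idealI[OF free_algebra_ring])
  interpret ring FA by (rule free_algebra_ring)
  have minus: "\<ominus>\<^bsub>FA\<^esub> f = - f" if "f \<in> carrier FA" for f
    using that by (intro minus_equality) (simp_all add: free_carrier_closed)
  show "subgroup K (add_monoid FA)"
  proof (rule group.subgroupI[OF a_group])
    show "inv\<^bsub>add_monoid FA\<^esub> f \<in> K" if "f \<in> K" for f
      using minus[of f] neg[OF that] that sub by (auto simp: a_inv_def)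
  qed (use sub zero add in auto)
qed (use mult in auto)

lemma hecke_ideal_closed:
  "0 \<in> hecke_ideal G S" "f \<in> hecke_ideal G S \<Longrightarrow> f \<in> carrier FA"
  "f \<in> hecke_ideal G S \<Longrightarrow> g \<in> hecke_ideal G S \<Longrightarrow> f + g \<in> hecke_ideal G S"
  "f \<in> hecke_ideal G S \<Longrightarrow> - f \<in> hecke_ideal G S"
  "f \<in> hecke_ideal G S \<Longrightarrow> g \<in> hecke_ideal G S \<Longrightarrow> f - g \<in> hecke_ideal G S"
  "f \<in> hecke_ideal G S \<Longrightarrow> g \<in> carrier FA \<Longrightarrow> g * f \<in> hecke_ideal G S"
  "f \<in> hecke_ideal G S \<Longrightarrow> g \<in> carrier FA \<Longrightarrow> f * g \<in> hecke_ideal G S"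
proof -
  interpret ideal "hecke_ideal G S" FA by (rule hecke_ideal_ideal)
  show 0: "0 \<in> hecke_ideal G S"
    using additive_subgroup.zero_closed[OF ideal.axioms(1)[OF hecke_ideal_ideal]] by simp
  show c: "f \<in> hecke_ideal G S \<Longrightarrow> f \<in> carrier FA" for f by (rule a_Hcarr)
  show add: "f \<in> hecke_ideal G S \<Longrightarrow> g \<in> hecke_ideal G S \<Longrightarrow> f + g \<in> hecke_ideal G S" for f g
    using additive_subgroup.a_closed[OF ideal.axioms(1)[OF hecke_ideal_ideal]] by simp
  show l: "f \<in> hecke_ideal G S \<Longrightarrow> g \<in> carrier FA \<Longrightarrow> g * f \<in> hecke_ideal G S" for f g
    using I_l_closed by simp
  show "f \<in> hecke_ideal G S \<Longrightarrow> g \<in> carrier FA \<Longrightarrow> f * g \<in> hecke_ideal G S" using I_r_closed by simp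
  have m: "f \<in> hecke_ideal G S \<Longrightarrow> - f \<in> hecke_ideal G S" for f
    using l[of f "- 1"] by (simp add: free_carrier_closed)
  then show "f \<in> hecke_ideal G S \<Longrightarrow> - f \<in> hecke_ideal G S" .
  show "f \<in> hecke_ideal G S \<Longrightarrow> g \<in> hecke_ideal G S \<Longrightarrow> f - g \<in> hecke_ideal G S"
    using add[of f "- g"] m by simp
qed

text \<open>Quadratic and commutation relators are fixed. A braid relator changes by a central
  multiple of the difference of the quadratic relators of \<open>s\<close> and
  \<open>t\<close>.\<close>

lemma free_bar_relator: "f \<in> hecke_relators G S \<Longrightarrow> free_bar f \<in> hecke_ideal G S"
proof (erule relator_cases)
  fix s assume s: "s \<in> S" "f = free_word [s, s] - (1 + free_scalar \<xi> * free_word [s])"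
  define c x :: "'a free_alg" where "c = free_scalar \<xi>" and "x = free_word [s]"
  have xx: "free_word [s, s] = x * x" using free_word_Cons[of s "[s]"] by (simp add: x_def)
  have "laurent_bar \<xi> = - \<xi>" by (simp add: laurent_bar_diff laurent_bar_qpow)
  then have c: "free_bar c = - c" by (simp only: c_def free_bar_scalar free_scalar_laws(3))
  have x: "free_bar x = x - c" by (simp add: x_def c_def free_bar_word bar_letter_def)
  have f: "f = x * x - (1 + c * x)" by (simp add: s xx c_def x_def)
  have "x * c = c * x" unfolding c_def by (rule free_scalar_central[symmetric])
  then have "free_bar f = f"
    unfolding f free_bar_diff free_bar_add free_bar_mult free_bar_one c x by (simp add: algebra_simps)
  then show ?thesis using relators_ideal[OF quadratic_relator[OF s(1)]] s by simp
next
  fix s t assume s: "s \<in> S" "t \<in> S" "s \<otimes> t = t \<otimes> s" "f = free_word [s, t] - free_word [t, s]"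
  define c :: "'a free_alg" where "c = free_scalar \<xi>"
  define x y where "x = free_word [s]" and "y = free_word [t]"
  have cc: "x * c = c * x" "y * c = c * y" unfolding c_def by (rule free_scalar_central[symmetric])+
  have w: "f = x * y - y * x"
    using free_word_append[of "[s]" "[t]"] free_word_append[of "[t]" "[s]"] by (simp add: s(4) x_def y_def)
  have "free_bar f = (x - c) * (y - c) - (y - c) * (x - c)"
    by (simp add: s(4) free_bar_diff free_bar_word bar_letter_def c_def x_def y_def)
  then have "free_bar f = f" unfolding w by (simp add: algebra_simps cc)
  then show ?thesis
    using relators_ideal[OF commute_relator[OF s(1,2) _ s(3)]] s hecke_ideal_closed(1) by (cases "s = t") auto
next
  fix s t assume s: "s \<in> S" "t \<in> S" "s \<otimes> t \<noteq> t \<otimes> s" "f = free_word [s, t, s] - free_word [t, s, t]"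
  define c :: "'a free_alg" where "c = free_scalar \<xi>"
  define x y where "x = free_word [s]" and "y = free_word [t]"
  have cc: "x * c = c * x" "y * c = c * y" unfolding c_def by (rule free_scalar_central[symmetric])+
  have cc': "x * (c * h) = c * (x * h)" "y * (c * h) = c * (y * h)" for h by (simp_all add: mult.assoc[symmetric] cc)
  have w: "free_word [s, t, s] = x * y * x" "free_word [t, s, t] = y * x * y"
      "free_word [s, s] = x * x" "free_word [t, t] = y * y"
    using free_word_append[of "[s]" "[t, s]"] free_word_append[of "[t]" "[s]"] free_word_append[of "[t]" "[s, t]"]
      free_word_append[of "[s]" "[t]"] free_word_append[of "[s]" "[s]"] free_word_append[of "[t]" "[t]"]
    by (simp_all add: x_def y_def mult.assoc)
  have "free_bar f = (x - c) * ((y - c) * (x - c)) - (y - c) * ((x - c) * (y - c))"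
    by (simp add: s(4) free_bar_diff free_bar_word bar_letter_def c_def x_def y_def)
  also have "(x - c) * ((y - c) * (x - c)) = x * y * x - c * (x * y + x * x + y * x) + c * (c * (x + x + y)) - c * (c * c)"
    by (simp add: left_diff_distrib right_diff_distrib distrib_left distrib_right mult.assoc cc cc')
  also have "(y - c) * ((x - c) * (y - c)) = y * x * y - c * (y * x + y * y + x * y) + c * (c * (y + y + x)) - c * (c * c)"
    by (simp add: left_diff_distrib right_diff_distrib distrib_left distrib_right mult.assoc cc cc')
  also have "(x * y * x - c * (x * y + x * x + y * x) + c * (c * (x + x + y)) - c * (c * c)) -
      (y * x * y - c * (y * x + y * y + x * y) + c * (c * (y + y + x)) - c * (c * c)) =
      (x * y * x - y * x * y) - c * ((x * x - (1 + c * x)) - (y * y - (1 + c * y)))"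
    by (simp add: right_diff_distrib distrib_left mult.assoc)
  also have "\<dots> \<in> hecke_ideal G S"
  proof -
    have "c \<in> carrier FA" by (simp add: c_def free_carrier_closed)
    moreover note relators_ideal[OF braid_relator[OF s(1-3)], unfolded w]
      relators_ideal[OF quadratic_relator[OF s(1)], unfolded w c_def[symmetric] x_def[symmetric]]
      relators_ideal[OF quadratic_relator[OF s(2)], unfolded w c_def[symmetric] y_def[symmetric]]
    ultimately show ?thesis
      by (metis hecke_ideal_closed(5) hecke_ideal_closed(6))
  qed
  finally show ?thesis .
qed

lemma free_bar_ideal: "f \<in> hecke_ideal G S \<Longrightarrow> free_bar f \<in> hecke_ideal G S"
proof -
  have "ideal {f \<in> carrier FA. free_bar f \<in> hecke_ideal G S} FA"
    by (rule idealI_FA) (auto simp: free_carrier_closed free_bar_add free_bar_uminus free_bar_mult free_bar_closed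
      hecke_ideal_closed free_bar_def[of 0])
  then have "hecke_ideal G S \<subseteq> {f \<in> carrier FA. free_bar f \<in> hecke_ideal G S}"
    using free_bar_relator relators_closed by (intro hecke_ideal_least) auto
  then show "f \<in> hecke_ideal G S \<Longrightarrow> free_bar f \<in> hecke_ideal G S" by blast
qed

lemma free_bar_cong: "f \<in> carrier FA \<Longrightarrow> g \<in> carrier FA \<Longrightarrow> cl f = cl g \<Longrightarrow> cl (free_bar f) = cl (free_bar g)"
  using free_bar_ideal[of "f - g"] by (simp add: cl_eq_iff free_bar_closed free_bar_diff)

lemma hecke_induct [consumes 1, case_names scalar gen add mult]:
  assumes h: "h \<in> carrier HA"
    and "\<And>a. P (scalar a)" "\<And>s. s \<in> S \<Longrightarrow> P (gen s)"
    and "\<And>x y. x \<in> carrier HA \<Longrightarrow> y \<in> carrier HA \<Longrightarrow> P x \<Longrightarrow> P y \<Longrightarrow> P (x \<oplus>\<^bsub>HA\<^esub> y)"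
    and "\<And>x y. x \<in> carrier HA \<Longrightarrow> y \<in> carrier HA \<Longrightarrow> P x \<Longrightarrow> P y \<Longrightarrow> P (x \<otimes>\<^bsub>HA\<^esub> y)"
  shows "P h"
proof -
  obtain f where f: "f \<in> carrier FA" "h = cl f" using h hecke_carrier by blast
  have word: "set ss \<subseteq> S \<Longrightarrow> P (cl (free_word ss))" for ss
  proof (induction ss)
    case Nil
    then show ?case using assms(2)[of 1] by (simp add: free_word_Nil hecke_scalar_def free_scalar_laws)
  next
    case (Cons s ss)
    then have "P (cl (free_word [s]) \<otimes>\<^bsub>HA\<^esub> cl (free_word ss))"
      using assms(3)[of s] by (intro assms(5)) (auto simp: hecke_gen_def cl_closed free_carrier_closed)
    then show ?case using Cons by (subst free_word_Cons) (simp add: cl_mult free_carrier_closed)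
  qed
  from f(1) have "P (cl f)"
  proof (induction rule: free_induct)
    case (single u a)
    then have "P (scalar a \<otimes>\<^bsub>HA\<^esub> cl (free_word (letters u)))"
      using word assms(2)[of a] by (intro assms(5)) (auto simp: hecke_scalar_def cl_closed free_carrier_closed)
    then show ?case using single by (simp add: single_word hecke_scalar_def cl_mult free_carrier_closed)
  next
    case (add f g)
    then show ?case using assms(4) by (simp add: cl_add cl_closed)
  qed
  with f show ?thesis by simp
qed

lemma gen_closed: "s \<in> S \<Longrightarrow> gen s \<in> carrier HA"
  by (simp add: hecke_gen_def cl_closed free_carrier_closed)

lemma scalar_closed: "scalar a \<in> carrier HA"
  by (simp add: hecke_scalar_def cl_closed free_carrier_closed)

lemma cl_bar_letter_inverse:
  assumes s: "s \<in> S"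
  shows "cl (bar_letter s) = inv\<^bsub>HA\<^esub> (gen s)" "gen s \<otimes>\<^bsub>HA\<^esub> cl (bar_letter s) = \<one>\<^bsub>HA\<^esub>"
    "cl (bar_letter s) \<otimes>\<^bsub>HA\<^esub> gen s = \<one>\<^bsub>HA\<^esub>"
proof -
  interpret HA: ring HA by (rule hecke_ring)
  let ?x = "free_word [s]" and ?c = "free_scalar \<xi> :: 'a free_alg"
  have xx: "free_word [s, s] = ?x * ?x" using free_word_Cons[of s "[s]"] by simp
  have i: "?x * ?x - (1 + ?c * ?x) \<in> hecke_ideal G S"
    using relators_ideal[OF quadratic_relator[OF s]] by (simp add: xx)
  have "cl (?x * bar_letter s) = cl 1" "cl (bar_letter s * ?x) = cl 1"
    using i s by (auto simp: cl_eq_iff free_carrier_closed bar_letter_closed bar_letter_def algebra_simps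
        free_scalar_central[of \<xi> ?x])
  then show 1: "gen s \<otimes>\<^bsub>HA\<^esub> cl (bar_letter s) = \<one>\<^bsub>HA\<^esub>" "cl (bar_letter s) \<otimes>\<^bsub>HA\<^esub> gen s = \<one>\<^bsub>HA\<^esub>"
    using s by (simp_all add: hecke_gen_def cl_mult cl_one free_carrier_closed bar_letter_closed)
  then show "cl (bar_letter s) = inv\<^bsub>HA\<^esub> (gen s)"
    using HA.inv_char[OF gen_closed[OF s] cl_closed[OF bar_letter_closed[OF s]]] by simp
qed

definition bar_spec :: "('a free_alg set \<Rightarrow> 'a free_alg set) \<Rightarrow> bool" where
  "bar_spec b \<longleftrightarrow> b \<in> ring_hom HA HA \<and> b \<in> extensional (carrier HA) \<and> (\<forall>h\<in>carrier HA. b (b h) = h) \<and>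
     (\<forall>a. b (scalar a) = scalar (laurent_bar a)) \<and> (\<forall>s\<in>S. b (gen s) = inv\<^bsub>HA\<^esub> (gen s))"

lemma bar_specD:
  assumes "bar_spec b"
  shows "b \<in> ring_hom HA HA" "b \<in> extensional (carrier HA)" "h \<in> carrier HA \<Longrightarrow> b (b h) = h"
    "b (scalar a) = scalar (laurent_bar a)" "s \<in> S \<Longrightarrow> b (gen s) = inv\<^bsub>HA\<^esub> (gen s)"
  using assms unfolding bar_spec_def by blast+

text \<open>Scalars and generators determine a ring homomorphism. Together with
  \<open>bar_fun_spec\<close> this gives the definite description in \<open>hecke_bar\<close> its
  value.\<close>

lemma bar_spec_unique:
  assumes b: "bar_spec b" and b': "bar_spec b'" shows "b = b'"
proof (rule extensionalityI[OF bar_specD(2)[OF b] bar_specD(2)[OF b']])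
  fix h assume "h \<in> carrier HA"
  then show "b h = b' h"
  proof (induction rule: hecke_induct)
    case (scalar a)
    show ?case by (simp only: bar_specD(4)[OF b] bar_specD(4)[OF b'])
  next
    case (gen s)
    then show ?case by (simp only: bar_specD(5)[OF b] bar_specD(5)[OF b'])
  next
    case (add x y)
    then show ?case by (simp only: ring_hom_add[OF bar_specD(1)[OF b]] ring_hom_add[OF bar_specD(1)[OF b']])
  next
    case (mult x y)
    then show ?case by (simp only: ring_hom_mult[OF bar_specD(1)[OF b]] ring_hom_mult[OF bar_specD(1)[OF b']])
  qed
qed

definition bar_fun :: "'a free_alg set \<Rightarrow> 'a free_alg set" where
  "bar_fun = restrict (\<lambda>h. cl (free_bar (SOME f. f \<in> carrier FA \<and> cl f = h))) (carrier HA)"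

lemma bar_fun_cl: "f \<in> carrier FA \<Longrightarrow> bar_fun (cl f) = cl (free_bar f)"
proof -
  assume f: "f \<in> carrier FA"
  define g where "g = (SOME g. g \<in> carrier FA \<and> cl g = cl f)"
  have "g \<in> carrier FA \<and> cl g = cl f" unfolding g_def by (rule someI[of _ f]) (simp add: f)
  then have "cl (free_bar g) = cl (free_bar f)" using f free_bar_cong by blast
  then show ?thesis by (simp add: bar_fun_def cl_closed f g_def)
qed

lemma bar_fun_spec: "bar_spec bar_fun"
proof -
  interpret HA: ring HA by (rule hecke_ring)
  have hom: "bar_fun \<in> ring_hom HA HA"
  proof (rule ring_hom_memI)
    fix x assume "x \<in> carrier HA"
    then obtain f where f: "f \<in> carrier FA" "x = cl f" using hecke_carrier by blast
    then show "bar_fun x \<in> carrier HA" by (simp add: bar_fun_cl cl_closed free_bar_closed)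
    fix y assume "y \<in> carrier HA"
    then obtain g where g: "g \<in> carrier FA" "y = cl g" using hecke_carrier by blast
    show "bar_fun (x \<otimes>\<^bsub>HA\<^esub> y) = bar_fun x \<otimes>\<^bsub>HA\<^esub> bar_fun y"
      using f g by (simp add: cl_mult[symmetric] bar_fun_cl free_carrier_closed free_bar_mult free_bar_closed)
    show "bar_fun (x \<oplus>\<^bsub>HA\<^esub> y) = bar_fun x \<oplus>\<^bsub>HA\<^esub> bar_fun y"
      using f g by (simp add: cl_add[symmetric] bar_fun_cl free_carrier_closed free_bar_add free_bar_closed)
  next
    show "bar_fun \<one>\<^bsub>HA\<^esub> = \<one>\<^bsub>HA\<^esub>" by (simp add: cl_one[symmetric] bar_fun_cl free_carrier_closed free_bar_one)
  qed
  have sc: "bar_fun (scalar a) = scalar (laurent_bar a)" for a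
    by (simp add: hecke_scalar_def bar_fun_cl free_carrier_closed free_bar_scalar)
  have gn: "bar_fun (gen s) = inv\<^bsub>HA\<^esub> (gen s)" if "s \<in> S" for s
    using that by (simp add: hecke_gen_def bar_fun_cl free_carrier_closed free_bar_word
        cl_bar_letter_inverse(1)[OF that, unfolded hecke_gen_def, symmetric])
  have inv: "bar_fun (bar_fun h) = h" if "h \<in> carrier HA" for h
    using that
  proof (induction rule: hecke_induct)
    \<comment> \<open>Applying the homomorphism to the product of \<open>cl (bar_letter s)\<close>
      and \<open>gen s\<close> shows that the image of the former is inverse to
      \<open>cl (bar_letter s)\<close>, hence equal to \<open>gen s\<close>.\<close>
    case (gen s)
    have c: "cl (bar_letter s) \<in> carrier HA" "bar_fun (cl (bar_letter s)) \<in> carrier HA"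
      using gen ring_hom_closed[OF hom] by (auto simp: cl_closed bar_letter_closed)
    have "bar_fun (gen s) = cl (bar_letter s)" using gn[OF gen] cl_bar_letter_inverse[OF gen] by simp
    moreover have "bar_fun (cl (bar_letter s)) \<otimes>\<^bsub>HA\<^esub> cl (bar_letter s) = \<one>\<^bsub>HA\<^esub>"
      using ring_hom_mult[OF hom c(1) gen_closed[OF gen]] cl_bar_letter_inverse(3)[OF gen]
        ring_hom_one[OF hom] calculation by simp
    ultimately show ?case
      using HA.inv_unique[OF _ cl_bar_letter_inverse(3)[OF gen]] cl_bar_letter_inverse[OF gen] c gen_closed[OF gen]
      by (metis HA.inv_unique)
  next
    case (add x y)
    then show ?case using ring_hom_add[OF hom] ring_hom_closed[OF hom] by simp
  next
    case (mult x y)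
    then show ?case using ring_hom_mult[OF hom] ring_hom_closed[OF hom] by simp
  qed (simp add: sc laurent_bar_bar)
  have "bar_fun \<in> extensional (carrier HA)" by (simp add: bar_fun_def)
  with hom sc gn inv show ?thesis unfolding bar_spec_def by blast
qed

lemma hecke_bar_spec: "bar_spec (hecke_bar G S)"
proof -
  have "hecke_bar G S = (THE b. bar_spec b)" unfolding hecke_bar_def bar_spec_def by simp
  then show ?thesis using bar_fun_spec bar_spec_unique by (metis theI)
qed

lemma hecke_bar_props:
  "h \<in> carrier HA \<Longrightarrow> hecke_bar G S h \<in> carrier HA"
  "h \<in> carrier HA \<Longrightarrow> h' \<in> carrier HA \<Longrightarrow> hecke_bar G S (h \<otimes>\<^bsub>HA\<^esub> h') = hecke_bar G S h \<otimes>\<^bsub>HA\<^esub> hecke_bar G S h'"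
  "h \<in> carrier HA \<Longrightarrow> h' \<in> carrier HA \<Longrightarrow> hecke_bar G S (h \<oplus>\<^bsub>HA\<^esub> h') = hecke_bar G S h \<oplus>\<^bsub>HA\<^esub> hecke_bar G S h'"
  "hecke_bar G S \<one>\<^bsub>HA\<^esub> = \<one>\<^bsub>HA\<^esub>"
  "hecke_bar G S (scalar a) = scalar (laurent_bar a)"
  "s \<in> S \<Longrightarrow> hecke_bar G S (gen s) = cl (bar_letter s)"
  using ring_hom_closed[OF bar_specD(1)[OF hecke_bar_spec]] ring_hom_mult[OF bar_specD(1)[OF hecke_bar_spec]]
    ring_hom_add[OF bar_specD(1)[OF hecke_bar_spec]] ring_hom_one[OF bar_specD(1)[OF hecke_bar_spec]]
    bar_specD(4,5)[OF hecke_bar_spec] cl_bar_letter_inverse(1)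
  by simp_all

end

section \<open>Left and right regular action on a free module\<close>

definition laurent_linear :: "(('a \<Rightarrow>\<^sub>0 laurent) \<Rightarrow> ('a \<Rightarrow>\<^sub>0 laurent)) \<Rightarrow> bool" where
  "laurent_linear A \<longleftrightarrow> (\<forall>m m'. A (m + m') = A m + A m') \<and> (\<forall>a m. A (smul a m) = smul a (A m))"

lemma laurent_linear_comp: "laurent_linear A \<Longrightarrow> laurent_linear B \<Longrightarrow> laurent_linear (\<lambda>m. A (B m))"
  by (simp add: laurent_linear_def)

lemma laurent_linear_0: "laurent_linear A \<Longrightarrow> A 0 = 0"
  unfolding laurent_linear_def by (metis smul_laws(4,5))

lemma laurent_linear_sum: "laurent_linear A \<Longrightarrow> A (sum f X) = (\<Sum>x\<in>X. A (f x))"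
  by (induction X rule: infinite_finite_induct) (auto simp: laurent_linear_0, auto simp: laurent_linear_def)

lemma laurent_linear_smul: "laurent_linear A \<Longrightarrow> A (smul a m) = smul a (A m)"
  by (simp add: laurent_linear_def)

lemma laurent_linear_add: "laurent_linear A \<Longrightarrow> A (m + m') = A m + A m'"
  by (simp add: laurent_linear_def)

lemma foldr_linear: "(\<And>s. s \<in> set ss \<Longrightarrow> laurent_linear (f s)) \<Longrightarrow> laurent_linear (foldr f ss)"
  by (induction ss) (auto simp: laurent_linear_def)

context type_A_system
begin

abbreviation "FG \<equiv> free_module (carrier G)"

lemma linear_ext:
  assumes "laurent_linear A" "laurent_linear B" "\<And>w. w \<in> carrier G \<Longrightarrow> A (bas w) = B (bas w)" "m \<in> FG"
  shows "A m = B m"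
proof -
  have m: "m = (\<Sum>w\<in>carrier G. smul (lk m w) (bas w))" by (rule free_module_expand[OF finite_carrier assms(4)])
  have "A m = (\<Sum>w\<in>carrier G. smul (lk m w) (A (bas w)))"
    by (subst m) (simp add: laurent_linear_sum[OF assms(1)] laurent_linear_smul[OF assms(1)])
  also have "\<dots> = (\<Sum>w\<in>carrier G. smul (lk m w) (B (bas w)))" using assms(3) by simp
  also have "\<dots> = B m"
    by (subst (2) m) (simp add: laurent_linear_sum[OF assms(2)] laurent_linear_smul[OF assms(2)])
  finally show ?thesis .
qed

definition extend :: "('a \<Rightarrow> ('a \<Rightarrow>\<^sub>0 laurent)) \<Rightarrow> ('a \<Rightarrow>\<^sub>0 laurent) \<Rightarrow> ('a \<Rightarrow>\<^sub>0 laurent)" where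
  "extend f m = (\<Sum>w\<in>carrier G. smul (lk m w) (f w))"

lemma extend_linear: "laurent_linear (extend f)"
  by (auto simp: laurent_linear_def extend_def lookup_add lookup_smul smul_laws sum.distrib smul_sum)

lemma extend_bas: "w \<in> carrier G \<Longrightarrow> extend f (bas w) = f w"
proof -
  assume w: "w \<in> carrier G"
  have "extend f (bas w) = (\<Sum>v\<in>carrier G. if v = w then f w else 0)"
    unfolding extend_def by (rule sum.cong) (auto simp: lookup_bas smul_laws)
  then show ?thesis using w finite_carrier by (simp add: sum.delta)
qed

lemma extend_closed: "(\<And>w. w \<in> carrier G \<Longrightarrow> f w \<in> FG) \<Longrightarrow> extend f m \<in> FG"
  unfolding extend_def by (intro free_module_sum free_module_closed)

text \<open>Left multiplication by \<open>T\<^sub>s\<close> in terms of the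
  \<open>T\<^sub>w\<close>, and \<open>rho\<close> likewise on the right, written down before the
  \<open>T\<^sub>w\<close> are known to be independent.\<close>

definition lam :: "'a \<Rightarrow> ('a \<Rightarrow>\<^sub>0 laurent) \<Rightarrow> ('a \<Rightarrow>\<^sub>0 laurent)" where
  "lam s = extend (\<lambda>w. bas (s \<otimes> w) + (if ldesc s w then smul \<xi> (bas w) else 0))"

definition rho :: "'a \<Rightarrow> ('a \<Rightarrow>\<^sub>0 laurent) \<Rightarrow> ('a \<Rightarrow>\<^sub>0 laurent)" where
  "rho s = extend (\<lambda>w. bas (w \<otimes> s) + (if rdesc s w then smul \<xi> (bas w) else 0))"

lemma lam_linear: "laurent_linear (lam s)" and rho_linear: "laurent_linear (rho s)"
  unfolding lam_def rho_def by (rule extend_linear)+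

lemma lam_bas: "w \<in> carrier G \<Longrightarrow> lam s (bas w) = bas (s \<otimes> w) + (if ldesc s w then smul \<xi> (bas w) else 0)"
  and rho_bas: "w \<in> carrier G \<Longrightarrow> rho s (bas w) = bas (w \<otimes> s) + (if rdesc s w then smul \<xi> (bas w) else 0)"
  unfolding lam_def rho_def by (simp_all add: extend_bas)

lemma lam_closed: "s \<in> S \<Longrightarrow> lam s m \<in> FG" and rho_closed: "s \<in> S \<Longrightarrow> rho s m \<in> FG"
  unfolding lam_def rho_def by (intro extend_closed; auto intro!: free_module_closed)+

lemma exchange_square_aux:
  assumes w: "w \<in> carrier G" and s: "s \<in> S" and t: "t \<in> S" and neq: "s \<otimes> w \<noteq> w \<otimes> t" and d: "\<not> ldesc s w"
  shows "\<not> ldesc s (w \<otimes> t)"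
proof
  assume a: "ldesc s (w \<otimes> t)"
  have "len (s \<otimes> w \<otimes> t) < len (w \<otimes> t)" using a w s t by (simp add: m_assoc)
  then show False
    using exchange[OF w s t d] neq len_gen_right[OF w t] len_gen_left[OF w s] d
      len_gen_right[of "s \<otimes> w" t] w s t by auto
qed

lemma exchange_square_left:
  assumes w: "w \<in> carrier G" and s: "s \<in> S" and t: "t \<in> S" and neq: "s \<otimes> w \<noteq> w \<otimes> t"
  shows "ldesc s (w \<otimes> t) \<longleftrightarrow> ldesc s w"
proof (cases "ldesc s w")
  case True
  have "s \<otimes> (s \<otimes> w) \<noteq> s \<otimes> w \<otimes> t"
  proof
    assume e: "s \<otimes> (s \<otimes> w) = s \<otimes> w \<otimes> t"
    then have "s \<otimes> (s \<otimes> (s \<otimes> w)) = s \<otimes> (s \<otimes> (w \<otimes> t))" using w s t by (simp add: m_assoc)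
    then show False using neq w s t by (simp add: gen_cancel)
  qed
  moreover have "\<not> ldesc s (s \<otimes> w)" using True ldesc_flip[OF w s] by simp
  ultimately have "\<not> ldesc s (s \<otimes> w \<otimes> t)"
    using exchange_square_aux[of "s \<otimes> w" s t] w s t by simp
  then have "ldesc s (w \<otimes> t)" using ldesc_flip[of "w \<otimes> t" s] w s t by (simp add: m_assoc)
  with True show ?thesis by simp
qed (use exchange_square_aux[OF w s t neq] in simp)

lemma exchange_square_right:
  assumes w: "w \<in> carrier G" and s: "s \<in> S" and t: "t \<in> S" and neq: "s \<otimes> w \<noteq> w \<otimes> t"
  shows "rdesc t (s \<otimes> w) \<longleftrightarrow> rdesc t w"
proof -
  have "t \<otimes> inv w \<noteq> inv w \<otimes> s"
  proof
    assume "t \<otimes> inv w = inv w \<otimes> s"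
    then have "inv (t \<otimes> inv w) = inv (inv w \<otimes> s)" by simp
    then show False using neq w s t by (simp add: inv_mult_group gen_inv)
  qed
  then have "ldesc t (inv w \<otimes> s) \<longleftrightarrow> ldesc t (inv w)" using w s t by (intro exchange_square_left) auto
  then show ?thesis using w s t by (simp add: rdesc_ldesc_inv inv_mult_gen)
qed

text \<open>Unless \<open>s w = w t\<close>, multiplication on one side does not affect the descents
  on the other. In the exceptional case the left descent \<open>s\<close> and the right descent
  \<open>t\<close> occur together.\<close>

lemma lam_rho_commute:
  assumes s: "s \<in> S" and t: "t \<in> S" and m: "m \<in> FG"
  shows "lam s (rho t m) = rho t (lam s m)"
proof (rule linear_ext[OF laurent_linear_comp[OF lam_linear rho_linear] laurent_linear_comp[OF rho_linear lam_linear] _ m])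
  fix w assume w: "w \<in> carrier G"
  note L = laurent_linear_add[OF lam_linear] laurent_linear_smul[OF lam_linear] laurent_linear_0[OF lam_linear]
    laurent_linear_add[OF rho_linear] laurent_linear_smul[OF rho_linear] laurent_linear_0[OF rho_linear]
  show "lam s (rho t (bas w)) = rho t (lam s (bas w))"
  proof (cases "s \<otimes> w = w \<otimes> t")
    case False
    then show ?thesis
      using w s t exchange_square_left[OF w s t False] exchange_square_right[OF w s t False]
      by (simp add: rho_bas lam_bas L smul_laws(1,4,10) m_assoc add_ac)
  next
    case True
    then have "ldesc s w \<longleftrightarrow> rdesc t w" by simp
    moreover have "ldesc s (w \<otimes> t) \<longleftrightarrow> \<not> ldesc s w" using ldesc_flip[OF w s] True by simp
    moreover have "rdesc t (s \<otimes> w) \<longleftrightarrow> \<not> rdesc t w" using rdesc_flip[OF w t] True by simp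
    moreover have "s \<otimes> (w \<otimes> t) = s \<otimes> w \<otimes> t" using w s t by (simp add: m_assoc)
    ultimately show ?thesis
      using w s t True by (simp add: rho_bas lam_bas L smul_laws(1,4,10) add_ac)
  qed
qed

lemma rdesc_factor:
  assumes w: "w \<in> carrier G" "w \<noteq> \<one>"
  obtains t v where "t \<in> S" "v \<in> carrier G" "w = v \<otimes> t" "\<not> rdesc t v" "len v < len w"
proof -
  have "inv w \<noteq> \<one>" using w by (metis inv_inv inv_one)
  then obtain t where t: "t \<in> S" "ldesc t (inv w)" using ldesc_ex[of "inv w"] w by auto
  then have "rdesc t w" using w by (simp add: rdesc_ldesc_inv)
  then show ?thesis using w t rdesc_flip[OF w(1) t(1)] gen_cancel_right[OF t(1) w(1)]
    by (intro that[of t "w \<otimes> t"]) auto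
qed

text \<open>Every basis vector arises from \<open>bas \<one>\<close> by right multiplications, so an
  operator commuting with all of them is determined by its value there. The commutation and braid
  relations for \<open>lam\<close> thus reduce to a check at the identity.\<close>

lemma commuting_operators_ext:
  assumes A: "laurent_linear A" and B: "laurent_linear B"
    and cA: "\<And>t m. t \<in> S \<Longrightarrow> m \<in> FG \<Longrightarrow> A (rho t m) = rho t (A m)"
    and cB: "\<And>t m. t \<in> S \<Longrightarrow> m \<in> FG \<Longrightarrow> B (rho t m) = rho t (B m)"
    and one: "A (bas \<one>) = B (bas \<one>)" and m: "m \<in> FG"
  shows "A m = B m"
proof (rule linear_ext[OF A B _ m])
  fix w assume "w \<in> carrier G"
  then show "A (bas w) = B (bas w)"
  proof (induction "len w" arbitrary: w rule: less_induct)
    case less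
    show ?case
    proof (cases "w = \<one>")
      case False
      then obtain t v where v: "t \<in> S" "v \<in> carrier G" "w = v \<otimes> t" "\<not> rdesc t v" "len v < len w"
        using rdesc_factor less.prems by metis
      then have "bas w = rho t (bas v)" by (simp add: rho_bas)
      moreover have "bas v \<in> FG" using v by (simp add: free_module_closed)
      ultimately show ?thesis using cA cB less.hyps[OF v(5,2)] v(1) by simp
    qed (use one in simp)
  qed
qed

lemma lam_quadratic: "s \<in> S \<Longrightarrow> m \<in> FG \<Longrightarrow> lam s (lam s m) = m + smul \<xi> (lam s m)"
proof -
  assume s: "s \<in> S" and m: "m \<in> FG"
  note L = laurent_linear_add[OF lam_linear] laurent_linear_smul[OF lam_linear] laurent_linear_0[OF lam_linear]
  have B: "laurent_linear (\<lambda>m. m + smul \<xi> (lam s m))"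
    by (simp add: laurent_linear_def L smul_laws algebra_simps)
  show ?thesis
  proof (rule linear_ext[OF laurent_linear_comp[OF lam_linear lam_linear] B _ m])
    fix w assume w: "w \<in> carrier G"
    show "lam s (lam s (bas w)) = bas w + smul \<xi> (lam s (bas w))"
      using w s ldesc_flip[OF w s]
      by (cases "ldesc s w") (simp_all add: lam_bas L gen_cancel smul_laws(1,4,10))
  qed
qed

lemma lam_commute:
  assumes s: "s \<in> S" and t: "t \<in> S" and st: "s \<otimes> t = t \<otimes> s" and m: "m \<in> FG"
  shows "lam s (lam t m) = lam t (lam s m)"
proof (cases "s = t")
  case False
  have one: "\<one> \<in> carrier G" by simp
  have n1: "\<not> len x < len \<one>" for x by (simp add: len_one)
  have n2: "\<not> ldesc s t" "\<not> ldesc t s"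
    using ldesc_commute[OF one s t False st] ldesc_commute[OF one t s _ st[symmetric]] False n1 s t by auto
  show ?thesis
    by (rule commuting_operators_ext[OF laurent_linear_comp[OF lam_linear lam_linear]
          laurent_linear_comp[OF lam_linear lam_linear] _ _ _ m])
      (use s t st n1 n2 in \<open>auto simp: lam_rho_commute lam_closed lam_bas\<close>)
qed simp

lemma lam_braid:
  assumes s: "s \<in> S" and t: "t \<in> S" and st: "s \<otimes> t \<noteq> t \<otimes> s" and m: "m \<in> FG"
  shows "lam s (lam t (lam s m)) = lam t (lam s (lam t m))"
proof -
  have one: "\<one> \<in> carrier G" by simp
  have n1: "\<not> len x < len \<one>" for x by (simp add: len_one)
  have n2: "\<not> ldesc t s" "\<not> ldesc s (t \<otimes> s)" "\<not> ldesc s t" "\<not> ldesc t (s \<otimes> t)"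
    using ldesc_braid(1)[OF one s t st] ldesc_braid(1)[OF one t s st[symmetric]] n1 s t by auto
  have br: "s \<otimes> (t \<otimes> s) = t \<otimes> (s \<otimes> t)" using noncommuting_braid[OF s t st] s t by (simp add: m_assoc)
  show ?thesis
    by (rule commuting_operators_ext[OF
          laurent_linear_comp[OF lam_linear laurent_linear_comp[OF lam_linear lam_linear]]
          laurent_linear_comp[OF lam_linear laurent_linear_comp[OF lam_linear lam_linear]] _ _ _ m])
      (use s t n1 n2 br in \<open>auto simp: lam_rho_commute lam_closed lam_bas\<close>)
qed

definition act :: "'a free_alg \<Rightarrow> ('a \<Rightarrow>\<^sub>0 laurent) \<Rightarrow> ('a \<Rightarrow>\<^sub>0 laurent)" where
  "act f m = (\<Sum>u\<in>Poly_Mapping.keys f. smul (lk f u) (foldr lam (letters u) m))"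

lemma act_add: "act (f + g) m = act f m + act g m"
  unfolding act_def by (rule setsum_keys_plus_distrib) (simp_all add: smul_laws)

lemma act_single: "act (Poly_Mapping.single u a) m = smul a (foldr lam (letters u) m)"
  by (simp add: act_def smul_laws)

lemma foldr_lam_linear: "laurent_linear (foldr lam ss)"
  by (rule foldr_linear[OF lam_linear])

lemma act_linear: "laurent_linear (act f)"
  unfolding laurent_linear_def act_def
  by (auto simp: laurent_linear_add[OF foldr_lam_linear] laurent_linear_smul[OF foldr_lam_linear]
      smul_laws smul_sum sum.distrib mult.commute)

lemma act_mult: "act (f * g) m = act f (act g m)"
proof -
  have "f \<in> carrier (free_algebra UNIV)" by (simp add: free_carrier_iff)
  then show ?thesis
  proof (induction rule: free_induct)
    case (single u a)
    have "g \<in> carrier (free_algebra UNIV)" by (simp add: free_carrier_iff)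
    then show ?case
    proof (induction rule: free_induct)
      case (single v b)
      show ?case
        by (simp add: mult_single act_single laurent_linear_smul[OF foldr_lam_linear] smul_laws)
    qed (simp add: distrib_left act_add laurent_linear_add[OF act_linear])
  qed (simp add: distrib_right act_add)
qed

lemma act_uminus: "act (- f) m = - act f m"
  using act_add[of f "- f" m] by (simp add: act_def eq_neg_iff_add_eq_0 add.commute)

lemma act_diff: "act (f - g) m = act f m - act g m"
  using act_add[of f "- g" m] by (simp add: act_uminus)

lemma act_word: "act (free_word ss) m = foldr lam ss m"
  by (simp add: free_word_def act_single smul_laws)

lemma act_scalar: "act (free_scalar a) m = smul a m"
  by (simp add: free_scalar_def act_single)

lemma act_one: "act 1 m = m"
  using act_word[of "[]" m] by (simp add: free_word_Nil)

lemma act_closed: "f \<in> carrier FA \<Longrightarrow> m \<in> FG \<Longrightarrow> act f m \<in> FG"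
proof (induction rule: free_induct)
  case (single u a)
  have "set ss \<subseteq> S \<Longrightarrow> foldr lam ss m \<in> FG" for ss using single(2) by (induction ss) (auto simp: lam_closed)
  with single show ?case by (simp add: act_single free_module_closed)
qed (simp add: act_add free_module_closed)

lemma act_ideal: "f \<in> hecke_ideal G S \<Longrightarrow> m \<in> FG \<Longrightarrow> act f m = 0"
proof -
  let ?K = "{f \<in> carrier FA. \<forall>m\<in>FG. act f m = 0}"
  have "ideal ?K FA"
    by (rule idealI_FA)
      (auto simp: free_carrier_closed act_add act_uminus act_mult act_closed laurent_linear_0[OF act_linear] act_def[of 0])
  moreover have "hecke_relators G S \<subseteq> ?K"
  proof
    fix f assume f: "f \<in> hecke_relators G S"
    then have "act f m = 0" if "m \<in> FG" for m
      using that
      by (elim relator_cases)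
        (auto simp: act_diff act_add act_mult act_word act_scalar act_one lam_quadratic lam_commute lam_braid)
    then show "f \<in> ?K" using f relators_closed by auto
  qed
  ultimately have "hecke_ideal G S \<subseteq> ?K" by (rule hecke_ideal_least)
  then show "f \<in> hecke_ideal G S \<Longrightarrow> m \<in> FG \<Longrightarrow> act f m = 0" by blast
qed

text \<open>The coordinates of \<open>h\<close> with respect to the \<open>T\<^sub>w\<close>,
  obtained by acting on \<open>bas \<one>\<close>. By \<open>act_ideal\<close> the choice of
  representative does not matter.\<close>

definition ev :: "'a free_alg set \<Rightarrow> ('a \<Rightarrow>\<^sub>0 laurent)" where
  "ev h = act (SOME f. f \<in> carrier FA \<and> cl f = h) (bas \<one>)"

lemma act_cong: "f \<in> carrier FA \<Longrightarrow> g \<in> carrier FA \<Longrightarrow> cl f = cl g \<Longrightarrow> m \<in> FG \<Longrightarrow> act f m = act g m"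
  using act_ideal[of "f - g" m] by (simp add: cl_eq_iff act_diff)

lemma bas_one_FG: "bas \<one> \<in> FG"
  by (simp add: free_module_closed)

lemma ev_cl: "f \<in> carrier FA \<Longrightarrow> ev (cl f) = act f (bas \<one>)"
proof -
  assume f: "f \<in> carrier FA"
  define g where "g = (SOME g. g \<in> carrier FA \<and> cl g = cl f)"
  have g: "g \<in> carrier FA \<and> cl g = cl f" unfolding g_def by (rule someI[of _ f]) (simp add: f)
  have "act g (bas \<one>) = act f (bas \<one>)" using f g bas_one_FG by (intro act_cong) auto
  then show ?thesis by (simp add: ev_def g_def)
qed

lemma ev_closed: "h \<in> carrier HA \<Longrightarrow> ev h \<in> FG"
  using hecke_carrier by (auto simp: ev_cl act_closed bas_one_FG)

lemma ev_add: "h \<in> carrier HA \<Longrightarrow> h' \<in> carrier HA \<Longrightarrow> ev (h \<oplus>\<^bsub>HA\<^esub> h') = ev h + ev h'"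
  using hecke_carrier by (auto simp: cl_add[symmetric] ev_cl free_carrier_closed act_add)

lemma ev_scalar_mult: "h \<in> carrier HA \<Longrightarrow> ev (scalar a \<otimes>\<^bsub>HA\<^esub> h) = smul a (ev h)"
  using hecke_carrier
  by (auto simp: hecke_scalar_def cl_mult[symmetric] ev_cl free_carrier_closed act_mult act_scalar)

lemma ev_gen_mult: "s \<in> S \<Longrightarrow> h \<in> carrier HA \<Longrightarrow> ev (gen s \<otimes>\<^bsub>HA\<^esub> h) = lam s (ev h)"
  using hecke_carrier
  by (auto simp: hecke_gen_def cl_mult[symmetric] ev_cl free_carrier_closed act_mult act_word)

section \<open>The standard basis of the Hecke algebra\<close>

lemma cl_word_Cons:
  "s \<in> S \<Longrightarrow> set ss \<subseteq> S \<Longrightarrow> cl (free_word (s # ss)) = gen s \<otimes>\<^bsub>HA\<^esub> cl (free_word ss)"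
  by (subst free_word_Cons) (simp add: hecke_gen_def cl_mult free_carrier_closed)

lemma cl_gen_commute:
  assumes "s \<in> S" "t \<in> S" "s \<otimes> t = t \<otimes> s" "set ss \<subseteq> S"
  shows "cl (free_word (s # t # ss)) = cl (free_word (t # s # ss))"
proof (cases "s = t")
  case False
  have "free_word (s # t # ss) - free_word (t # s # ss) = (free_word [s, t] - free_word [t, s]) * free_word ss"
    using free_word_append[of "[s, t]" ss] free_word_append[of "[t, s]" ss] by (simp add: left_diff_distrib)
  also have "\<dots> \<in> hecke_ideal G S"
    using relators_ideal[OF commute_relator[OF assms(1,2) False assms(3)]] assms(4)
    by (simp add: hecke_ideal_closed(7) free_carrier_closed)
  finally show ?thesis using assms by (simp add: cl_eq_iff free_carrier_closed)
qed simp

lemma cl_gen_braid: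
  assumes "s \<in> S" "t \<in> S" "s \<otimes> t \<noteq> t \<otimes> s" "set ss \<subseteq> S"
  shows "cl (free_word (s # t # s # ss)) = cl (free_word (t # s # t # ss))"
proof -
  have "free_word (s # t # s # ss) - free_word (t # s # t # ss) = (free_word [s, t, s] - free_word [t, s, t]) * free_word ss"
    using free_word_append[of "[s, t, s]" ss] free_word_append[of "[t, s, t]" ss] by (simp add: left_diff_distrib)
  also have "\<dots> \<in> hecke_ideal G S"
    using relators_ideal[OF braid_relator[OF assms(1-3)]] assms(4)
    by (simp add: hecke_ideal_closed(7) free_carrier_closed)
  finally show ?thesis using assms by (simp add: cl_eq_iff free_carrier_closed)
qed

lemma reduced_word_Cons:
  assumes w: "w \<in> carrier G" and s: "s \<in> S"
  shows "reduced_word G S w (s # ss) \<longleftrightarrow> ldesc s w \<and> reduced_word G S (s \<otimes> w) ss"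
proof
  assume r: "reduced_word G S w (s # ss)"
  then have c: "gen_prod G ss \<in> carrier G" using S_carrier by (intro gen_prod_closed) (auto simp: reduced_word_def)
  have sw: "s \<otimes> w = gen_prod G ss" using r s c by (auto simp: reduced_word_def gen_cancel)
  have "len (gen_prod G ss) \<le> length ss" using r by (intro len_word_le) (auto simp: reduced_word_def)
  then show "ldesc s w \<and> reduced_word G S (s \<otimes> w) ss"
    using r sw len_gen_left[OF w s] by (auto simp: reduced_word_def)
next
  assume "ldesc s w \<and> reduced_word G S (s \<otimes> w) ss"
  then show "reduced_word G S w (s # ss)"
    using len_gen_left[OF w s] w s by (auto simp: reduced_word_def gen_cancel)
qed

text \<open>If two reduced words begin with different letters \<open>s\<close> and \<open>t\<close>,
  both letters are left descents, so \<open>w\<close> also has reduced words beginning with either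
  side of the relation between \<open>s\<close> and \<open>t\<close> and continuing alike. Induction
  compares each given word with one of these.\<close>

lemma matsumoto:
  "w \<in> carrier G \<Longrightarrow> reduced_word G S w ss \<Longrightarrow> reduced_word G S w ts \<Longrightarrow> cl (free_word ss) = cl (free_word ts)"
proof (induction "len w" arbitrary: w ss ts rule: less_induct)
  case less
  note w = less.prems(1)
  show ?case
  proof (cases ss)
    case Nil
    then have "ts = []" using less.prems by (simp add: reduced_word_def)
    with Nil show ?thesis by simp
  next
    case (Cons s ss')
    then obtain t ts' where ts: "ts = t # ts'" using less.prems by (cases ts) (auto simp: reduced_word_def)
    have S: "s \<in> S" "t \<in> S" "set ss' \<subseteq> S" "set ts' \<subseteq> S"
      using less.prems Cons ts by (auto simp: reduced_word_def)
    have rs: "ldesc s w" "reduced_word G S (s \<otimes> w) ss'" and rt: "ldesc t w" "reduced_word G S (t \<otimes> w) ts'"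
      using less.prems Cons ts reduced_word_Cons[OF w S(1)] reduced_word_Cons[OF w S(2)] by auto
    have IH: "cl (free_word us) = cl (free_word vs)"
      if "x \<in> S" "ldesc x w" "reduced_word G S (x \<otimes> w) us" "reduced_word G S (x \<otimes> w) vs" for x us vs
      using less.hyps[OF that(2) _ that(3,4)] w that(1) by simp
    have key: "cl (free_word (s # ss')) = cl (free_word (s # us))" if "reduced_word G S (s \<otimes> w) us" for us
      using IH[OF S(1) rs that] S that by (simp add: cl_word_Cons reduced_word_def)
    have key': "cl (free_word (t # ts')) = cl (free_word (t # us))" if "reduced_word G S (t \<otimes> w) us" for us
      using IH[OF S(2) rt that] S that by (simp add: cl_word_Cons reduced_word_def)
    show ?thesis
    proof (cases "s = t")
      case True
      then show ?thesis using key[of ts'] rt Cons ts by simp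
    next
      case False
      show ?thesis
      proof (cases "s \<otimes> t = t \<otimes> s")
        case True
        have e: "s \<otimes> (t \<otimes> w) = t \<otimes> (s \<otimes> w)" using True w S(1,2) by (simp add: m_assoc[symmetric])
        have d: "ldesc s (t \<otimes> w)" "ldesc t (s \<otimes> w)"
          using ldesc_commute[OF w S(1,2) False True] rs(1)
            ldesc_commute[OF w S(2,1) False[symmetric] True[symmetric]] rt(1) by simp_all
        obtain us where us: "reduced_word G S (s \<otimes> (t \<otimes> w)) us"
          using reduced_word_ex[of "s \<otimes> (t \<otimes> w)"] w S(1,2) by auto
        have u: "set us \<subseteq> S" using us by (simp add: reduced_word_def)
        have "reduced_word G S (t \<otimes> w) (s # us)" using us d w S(1,2) by (simp add: reduced_word_Cons)
        moreover have "reduced_word G S (s \<otimes> w) (t # us)" using us d e w S(1,2) by (simp add: reduced_word_Cons)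
        ultimately show ?thesis
          using key key' cl_gen_commute[OF S(1,2) True u] Cons ts by simp
      next
        case nc: False
        have br: "s \<otimes> t \<otimes> s = t \<otimes> s \<otimes> t" by (rule noncommuting_braid[OF S(1,2) nc])
        then have e: "s \<otimes> (t \<otimes> (s \<otimes> w)) = t \<otimes> (s \<otimes> (t \<otimes> w))"
          using w S(1,2) by (metis S_closed m_assoc m_closed)
        have d: "ldesc t (s \<otimes> w)" "ldesc s (t \<otimes> (s \<otimes> w))" "ldesc s (t \<otimes> w)" "ldesc t (s \<otimes> (t \<otimes> w))"
          using ldesc_braid(2)[OF w S(1,2) nc rs(1) rt(1)] ldesc_braid(2)[OF w S(2,1) nc[symmetric] rt(1) rs(1)] by auto
        obtain us where us: "reduced_word G S (s \<otimes> (t \<otimes> (s \<otimes> w))) us"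
          using reduced_word_ex[of "s \<otimes> (t \<otimes> (s \<otimes> w))"] w S(1,2) by auto
        have u: "set us \<subseteq> S" using us by (simp add: reduced_word_def)
        have "reduced_word G S (s \<otimes> w) (t # s # us)" using us d w S(1,2) by (simp add: reduced_word_Cons)
        moreover have "reduced_word G S (t \<otimes> w) (s # t # us)" using us d e w S(1,2) by (simp add: reduced_word_Cons)
        ultimately show ?thesis
          using key key' cl_gen_braid[OF S(1,2) nc u] Cons ts by simp
      qed
    qed
  qed
qed

abbreviation TH where "TH \<equiv> hecke_T G S"

lemma TH_word: "w \<in> carrier G \<Longrightarrow> reduced_word G S w ss \<Longrightarrow> TH w = cl (free_word ss)"
  unfolding hecke_T_def using matsumoto[of w] someI[of "reduced_word G S w" ss] by blast

lemma TH_closed: "w \<in> carrier G \<Longrightarrow> TH w \<in> carrier HA"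
  using reduced_word_ex[of w] TH_word[of w] by (auto simp: reduced_word_def cl_closed free_carrier_closed)

lemma TH_one: "TH \<one> = \<one>\<^bsub>HA\<^esub>"
  using TH_word[of \<one> "[]"] by (simp add: reduced_word_def len_one free_word_Nil cl_one)

lemma TH_ascent: "w \<in> carrier G \<Longrightarrow> s \<in> S \<Longrightarrow> \<not> ldesc s w \<Longrightarrow> gen s \<otimes>\<^bsub>HA\<^esub> TH w = TH (s \<otimes> w)"
proof -
  assume w: "w \<in> carrier G" and s: "s \<in> S" and d: "\<not> ldesc s w"
  obtain ss where ss: "reduced_word G S w ss" using reduced_word_ex[OF w] by blast
  have "reduced_word G S (s \<otimes> w) (s # ss)"
    using ss d ldesc_flip[OF w s] w s by (simp add: reduced_word_Cons gen_cancel)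
  then show ?thesis
    using TH_word[OF w ss] TH_word[of "s \<otimes> w" "s # ss"] w s ss by (simp add: cl_word_Cons reduced_word_def)
qed

lemma gen_square_mult:
  assumes s: "s \<in> S" and h: "h \<in> carrier HA"
  shows "gen s \<otimes>\<^bsub>HA\<^esub> (gen s \<otimes>\<^bsub>HA\<^esub> h) = h \<oplus>\<^bsub>HA\<^esub> scalar \<xi> \<otimes>\<^bsub>HA\<^esub> (gen s \<otimes>\<^bsub>HA\<^esub> h)"
proof -
  obtain f where f: "f \<in> carrier FA" "h = cl f" using h hecke_carrier by blast
  let ?x = "free_word [s]" and ?c = "free_scalar \<xi> :: 'a free_alg"
  have x: "?x \<in> carrier FA" "?c \<in> carrier FA" using s by (simp_all add: free_carrier_closed)
  have xx: "free_word [s, s] = ?x * ?x" using free_word_Cons[of s "[s]"] by simp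
  have "?x * (?x * f) - (f + ?c * (?x * f)) = (?x * ?x - (1 + ?c * ?x)) * f"
    by (simp add: left_diff_distrib distrib_right mult.assoc)
  also have "\<dots> \<in> hecke_ideal G S"
    using relators_ideal[OF quadratic_relator[OF s]] f by (simp add: xx hecke_ideal_closed(7))
  finally have "cl (?x * (?x * f)) = cl (f + ?c * (?x * f))"
    using x f by (simp add: cl_eq_iff free_carrier_closed)
  then show ?thesis
    using x f by (simp add: hecke_gen_def hecke_scalar_def cl_mult cl_add free_carrier_closed)
qed

text \<open>The inverse of \<open>ev\<close>. It uses the same choice of reduced words as
  \<open>hecke_T\<close>, so that \<open>sig (bas w)\<close> is \<open>TH w\<close>.\<close>

definition sig :: "('a \<Rightarrow>\<^sub>0 laurent) \<Rightarrow> 'a free_alg set" where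
  "sig m = cl (\<Sum>w\<in>carrier G. free_scalar (lk m w) * free_word (SOME ss. reduced_word G S w ss))"

lemma some_reduced_word: "w \<in> carrier G \<Longrightarrow> reduced_word G S w (SOME ss. reduced_word G S w ss)"
  using reduced_word_ex by (rule someI_ex)

lemma sig_sum_closed:
  assumes "X \<subseteq> carrier G"
  shows "(\<Sum>w\<in>X. free_scalar (lk m w) * free_word (SOME ss. reduced_word G S w ss)) \<in> carrier FA"
proof -
  have "finite X" using assms finite_carrier finite_subset by blast
  then show ?thesis using assms
  proof (induction X)
    case (insert w X)
    then have "set (SOME ss. reduced_word G S w ss) \<subseteq> S" using some_reduced_word[of w] by (simp add: reduced_word_def)
    with insert show ?case by (simp add: free_carrier_closed)
  qed (simp add: free_carrier_closed)
qed

lemma sig_closed: "sig m \<in> carrier HA"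
  unfolding sig_def by (intro cl_closed sig_sum_closed) simp

lemma sig_add: "sig (m + m') = sig m \<oplus>\<^bsub>HA\<^esub> sig m'"
  unfolding sig_def
  by (subst cl_add[symmetric])
    (auto simp: sig_sum_closed lookup_add free_scalar_laws(1) distrib_right sum.distrib)

lemma sig_smul: "sig (smul a m) = scalar a \<otimes>\<^bsub>HA\<^esub> sig m"
  unfolding sig_def hecke_scalar_def
  by (subst cl_mult[symmetric])
    (auto simp: sig_sum_closed free_carrier_closed lookup_smul free_scalar_laws(4) sum_distrib_left mult.assoc)

lemma sig_bas: "w \<in> carrier G \<Longrightarrow> sig (bas w) = TH w"
proof -
  assume w: "w \<in> carrier G"
  have "(\<Sum>v\<in>carrier G. free_scalar (lk (bas w) v) * free_word (SOME ss. reduced_word G S v ss)) =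
      (\<Sum>v\<in>carrier G. if v = w then free_word (SOME ss. reduced_word G S w ss) else 0)"
    by (rule sum.cong) (auto simp: lookup_bas free_scalar_laws)
  then show ?thesis using w finite_carrier by (simp add: sig_def hecke_T_def)
qed

lemma sig_lam: "s \<in> S \<Longrightarrow> m \<in> FG \<Longrightarrow> sig (lam s m) = gen s \<otimes>\<^bsub>HA\<^esub> sig m"
proof -
  assume s: "s \<in> S" and m: "m \<in> FG"
  interpret HA: ring HA by (rule hecke_ring)
  have bas: "sig (lam s (bas w)) = gen s \<otimes>\<^bsub>HA\<^esub> sig (bas w)" if w: "w \<in> carrier G" for w
  proof (cases "ldesc s w")
    case False
    then show ?thesis using w s by (simp add: lam_bas sig_bas TH_ascent)
  next
    case True
    let ?v = "s \<otimes> w"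
    have v: "?v \<in> carrier G" "s \<otimes> ?v = w" "\<not> ldesc s ?v" using w s True ldesc_flip[OF w s] by (auto simp: gen_cancel)
    have "TH w = gen s \<otimes>\<^bsub>HA\<^esub> TH ?v" using TH_ascent[OF v(1) s v(3)] v(2) by simp
    then have "gen s \<otimes>\<^bsub>HA\<^esub> TH w = TH ?v \<oplus>\<^bsub>HA\<^esub> scalar \<xi> \<otimes>\<^bsub>HA\<^esub> TH w"
      using gen_square_mult[OF s TH_closed[OF v(1)]] by simp
    then show ?thesis using w s True by (simp add: lam_bas sig_add sig_smul sig_bas)
  qed
  have "sig (lam s (\<Sum>w\<in>X. smul (lk m w) (bas w))) = gen s \<otimes>\<^bsub>HA\<^esub> sig (\<Sum>w\<in>X. smul (lk m w) (bas w))"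
    if "finite X" "X \<subseteq> carrier G" for X
    using that
  proof (induction X)
    case empty
    have "sig 0 = \<zero>\<^bsub>HA\<^esub>" using sig_add[of 0 0] sig_closed[of 0] HA.add.r_cancel_one by simp
    then show ?case using gen_closed[OF s] by (simp add: laurent_linear_0[OF lam_linear])
  next
    case (insert w X)
    have sc: "gen s \<otimes>\<^bsub>HA\<^esub> (scalar a \<otimes>\<^bsub>HA\<^esub> h) = scalar a \<otimes>\<^bsub>HA\<^esub> (gen s \<otimes>\<^bsub>HA\<^esub> h)" if "h \<in> carrier HA" for a h
    proof -
      have "gen s \<otimes>\<^bsub>HA\<^esub> scalar a = scalar a \<otimes>\<^bsub>HA\<^esub> gen s"
        using s by (simp add: hecke_gen_def hecke_scalar_def cl_mult[symmetric] free_carrier_closed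
            free_scalar_central[of a "free_word [s]"])
      then show ?thesis using that gen_closed[OF s] scalar_closed[of a] by (simp add: HA.m_assoc[symmetric])
    qed
    show ?case
      using insert s bas[of w]
      by (simp add: laurent_linear_add[OF lam_linear] laurent_linear_smul[OF lam_linear] sig_add sig_smul
          sc sig_closed gen_closed scalar_closed HA.r_distr)
  qed
  from this[OF finite_carrier] show ?thesis using free_module_expand[OF finite_carrier m] by simp
qed

lemma sig_ev: "h \<in> carrier HA \<Longrightarrow> sig (ev h) = h"
proof -
  assume "h \<in> carrier HA"
  then obtain f where f: "f \<in> carrier FA" "h = cl f" using hecke_carrier by blast
  have word: "set ss \<subseteq> S \<Longrightarrow> sig (foldr lam ss (bas \<one>)) = cl (free_word ss) \<and> foldr lam ss (bas \<one>) \<in> FG" for ss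
  proof (induction ss)
    case Nil
    then show ?case by (simp add: sig_bas TH_one free_word_Nil cl_one bas_one_FG)
  next
    case (Cons s ss)
    then show ?case by (simp add: sig_lam lam_closed cl_word_Cons)
  qed
  from f(1) have "sig (act f (bas \<one>)) = cl f"
  proof (induction rule: free_induct)
    case (single u a)
    have "sig (act (Poly_Mapping.single u a) (bas \<one>)) = scalar a \<otimes>\<^bsub>HA\<^esub> cl (free_word (letters u))"
      using word[OF single] by (simp add: act_single sig_smul)
    also have "\<dots> = cl (Poly_Mapping.single u a)"
      using single unfolding single_word by (simp add: cl_mult free_carrier_closed hecke_scalar_def)
    finally show ?case .
  next
    case (add f g)
    then show ?case by (simp add: act_add sig_add cl_add)
  qed
  then show ?thesis using f by (simp add: ev_cl)
qed

lemma ev_TH: "w \<in> carrier G \<Longrightarrow> ev (TH w) = bas w"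
proof (induction "len w" arbitrary: w rule: less_induct)
  case less
  show ?case
  proof (cases "w = \<one>")
    case True
    then show ?thesis using ev_cl[of 1] by (simp add: TH_one cl_one[symmetric] free_carrier_closed act_one)
  next
    case False
    then obtain s where s: "s \<in> S" "ldesc s w" using ldesc_ex less.prems by blast
    let ?v = "s \<otimes> w"
    have v: "?v \<in> carrier G" "s \<otimes> ?v = w" "\<not> ldesc s ?v"
      using less.prems s ldesc_flip[OF less.prems s(1)] by (auto simp: gen_cancel)
    have "TH w = gen s \<otimes>\<^bsub>HA\<^esub> TH ?v" using TH_ascent[OF v(1) s(1) v(3)] v(2) by simp
    then have "ev (TH w) = lam s (ev (TH ?v))" using ev_gen_mult[OF s(1) TH_closed[OF v(1)]] by simp
    then show ?thesis using less.hyps[OF s(2) v(1)] v by (simp add: lam_bas)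
  qed
qed

lemma ev_sig_linear:
  "ev (sig (m + m')) = ev (sig m) + ev (sig m')" "ev (sig (smul a m)) = smul a (ev (sig m))"
  by (simp_all add: sig_add sig_smul ev_add ev_scalar_mult sig_closed)

lemma ev_sig: "m \<in> FG \<Longrightarrow> ev (sig m) = m"
proof -
  assume m: "m \<in> FG"
  have "ev (sig (\<Sum>w\<in>X. smul (lk m w) (bas w))) = (\<Sum>w\<in>X. smul (lk m w) (bas w))"
    if "finite X" "X \<subseteq> carrier G" for X
    using that
  proof (induction X)
    case empty
    show ?case using ev_sig_linear(2)[of 0 0] by (simp add: smul_laws)
  next
    case (insert w X)
    then show ?case
      by (simp add: ev_sig_linear sig_bas ev_TH)
  qed
  from this[OF finite_carrier] show ?thesis using free_module_expand[OF finite_carrier m] by simp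
qed

end

section \<open>Left cells and star operations\<close>

context bar_module
begin

lemma C_eqI:
  assumes "w \<in> I" "c \<in> FM" "\<beta> c = c" "lk c w = 1" "\<And>y. y \<noteq> w \<Longrightarrow> vanishing (lk c y)"
  shows "c = C w"
proof -
  have "vanishing (lk (c - C w) y)" for y
    using assms C_props[OF assms(1)] by (cases "y = w") (auto simp: lookup_minus vanishing_closed)
  then have "c - C w = 0"
    using assms C_props[OF assms(1)] by (intro bar_invariant_vanishing_0) (auto simp: free_module_closed bar_diff)
  then show ?thesis by simp
qed

end

context type_A_system
begin

section \<open>The Kazhdan--Lusztig basis as a canonical basis\<close>

lemma gen_scalar_commute: "s \<in> S \<Longrightarrow> gen s \<otimes>\<^bsub>HA\<^esub> scalar a = scalar a \<otimes>\<^bsub>HA\<^esub> gen s"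
  by (simp add: hecke_gen_def hecke_scalar_def cl_mult[symmetric] free_carrier_closed
      free_scalar_central[of a "free_word [s]"])

lemma gen_bar_letter: "s \<in> S \<Longrightarrow> gen s = cl (bar_letter s) \<oplus>\<^bsub>HA\<^esub> scalar \<xi>"
  by (simp add: hecke_gen_def hecke_scalar_def cl_add[symmetric] free_carrier_closed bar_letter_closed)
    (simp add: bar_letter_def)

definition barF :: "('a \<Rightarrow>\<^sub>0 laurent) \<Rightarrow> ('a \<Rightarrow>\<^sub>0 laurent)" where
  "barF m = ev (hecke_bar G S (sig m))"

lemma ev_bar_letter_mult:
  "s \<in> S \<Longrightarrow> h \<in> carrier HA \<Longrightarrow> ev (cl (bar_letter s) \<otimes>\<^bsub>HA\<^esub> h) = lam s (ev h) - smul \<xi> (ev h)"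
proof -
  assume s: "s \<in> S" and h: "h \<in> carrier HA"
  then obtain f where f: "f \<in> carrier FA" "h = cl f" using hecke_carrier by blast
  have "ev (cl (bar_letter s) \<otimes>\<^bsub>HA\<^esub> h) = act (bar_letter s) (act f (bas \<one>))"
    using s f by (simp add: cl_mult[symmetric] ev_cl free_carrier_closed bar_letter_closed act_mult)
  then show ?thesis using f by (simp add: bar_letter_def act_diff act_word act_scalar ev_cl)
qed

text \<open>For \<open>J = {}\<close> the set \<open>D_set G S J\<close> is the whole group, so weak
  descents and weak ascents do not occur.\<close>

lemma regular_bar_module: "bar_module G S n \<phi> (carrier G) {} lam barF"
proof (unfold_locales)
  show "left_weak_ideal G S (carrier G)" by (simp add: left_weak_ideal_def)
  show "carrier G \<noteq> {}" using one_closed by blast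
  show "carrier G \<subseteq> D_set G S {}" by (auto simp: D_set_def)
  note L = laurent_linear_add[OF lam_linear] laurent_linear_smul[OF lam_linear]
  show "lam s (m + m') = lam s m + lam s m'" "lam s (smul a m) = smul a (lam s m)" for s m m' a by (rule L)+
  show "barF m \<in> FG" if "m \<in> FG" for m
    unfolding barF_def by (intro ev_closed hecke_bar_props sig_closed)
  show "barF (m + m') = barF m + barF m'" for m m'
    by (simp add: barF_def sig_add hecke_bar_props sig_closed ev_add)
  show "barF (smul a m) = smul (laurent_bar a) (barF m)" for a m
    by (simp add: barF_def sig_smul hecke_bar_props sig_closed scalar_closed ev_scalar_mult)
  show "barF (bas \<one>) = bas \<one>"
    using ev_TH[of \<one>] by (simp add: barF_def sig_bas TH_one hecke_bar_props)
  show "barF (lam s m) = lam s (barF m) - smul \<xi> (barF m)" if "s \<in> S" "m \<in> FG" for s m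
    using that by (simp add: barF_def sig_lam hecke_bar_props sig_closed gen_closed ev_bar_letter_mult)
qed (auto simp: lam_closed lam_quadratic lam_commute lam_braid lam_bas D_set_def)

interpretation F: bar_module G S n \<phi> "carrier G" "{}" lam barF
  by (rule regular_bar_module)

lemma F_tau: "w \<in> carrier G \<Longrightarrow> s \<in> S \<Longrightarrow> F.tau s w \<longleftrightarrow> ldesc s w"
  by (simp add: F.tau_def D_set_def)

lemma finsum_sig:
  assumes "finite A"
  shows "(\<Oplus>\<^bsub>HA\<^esub>z\<in>A. scalar (a z) \<otimes>\<^bsub>HA\<^esub> sig (g z)) = sig (\<Sum>z\<in>A. smul (a z) (g z))"
proof -
  interpret HA: ring HA by (rule hecke_ring)
  show ?thesis using assms
  proof (induction A)
    case empty
    have "sig 0 = \<zero>\<^bsub>HA\<^esub>" using sig_add[of 0 0] sig_closed[of 0] HA.add.r_cancel_one by simp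
    then show ?case by simp
  next
    case (insert z A)
    then show ?case
      by (subst HA.finsum_insert) (auto simp: sig_closed scalar_closed sig_add sig_smul)
  qed
qed

text \<open>The maps \<open>ev\<close> and \<open>sig\<close> are mutually inverse and carry one bar
  involution to the other, so the description in \<open>KL_basis\<close> turns into the
  characterization of \<open>F.C w\<close> by \<open>F.C_eqI\<close>.\<close>

lemma KL_basis_eq:
  assumes w: "w \<in> carrier G"
  shows "KL_basis G S w = sig (F.C w)"
proof -
  interpret HA: ring HA by (rule hecke_ring)
  let ?B = "{y. bruhat y w}"
  have fin: "finite ?B" using finite_carrier bruhat_len by (rule_tac finite_subset[of _ "carrier G"]) auto
  have fs: "TH w \<oplus>\<^bsub>HA\<^esub> (\<Oplus>\<^bsub>HA\<^esub>y\<in>?B. scalar (p y) \<otimes>\<^bsub>HA\<^esub> TH y) =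
      sig (bas w + (\<Sum>y\<in>?B. smul (p y) (bas y)))" for p
  proof -
    have "(\<Oplus>\<^bsub>HA\<^esub>y\<in>?B. scalar (p y) \<otimes>\<^bsub>HA\<^esub> TH y) = (\<Oplus>\<^bsub>HA\<^esub>y\<in>?B. scalar (p y) \<otimes>\<^bsub>HA\<^esub> sig (bas y))"
      using bruhat_len by (intro HA.finsum_cong') (auto simp: sig_bas TH_closed scalar_closed)
    then show ?thesis using w by (simp add: finsum_sig[OF fin] sig_add sig_bas)
  qed
  have lkB: "lk (bas w + (\<Sum>y\<in>?B. smul (p y) (bas y))) z = (if z = w then 1 else if bruhat z w then p z else 0)" for p z
  proof -
    have "(\<Sum>y\<in>?B. p y * lk (bas y) z) = (\<Sum>y\<in>?B. if y = z then p z else 0)"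
      by (rule sum.cong) (auto simp: lookup_bas)
    then show ?thesis using fin bruhat_len[of w w] by (auto simp: lookup_add lookup_sum lookup_smul lookup_bas sum.delta)
  qed
  note C = F.C_props[OF w]
  have Ceq: "F.C w = bas w + (\<Sum>y\<in>?B. smul (lk (F.C w) y) (bas y))"
    by (rule poly_mapping_eqI) (use C in \<open>auto simp: lkB\<close>)
  show ?thesis
    unfolding KL_basis_def
  proof (rule the_equality, intro conjI)
    show "sig (F.C w) \<in> carrier HA" by (rule sig_closed)
    have "sig (ev (hecke_bar G S (sig (F.C w)))) = sig (F.C w)" using C(2) by (simp add: barF_def)
    then show "hecke_bar G S (sig (F.C w)) = sig (F.C w)" by (simp add: sig_ev hecke_bar_props sig_closed)
    show "\<exists>p. (\<forall>y. bruhat y w \<longrightarrow> p y \<in> q_laurent_plus) \<and>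
        sig (F.C w) = TH w \<oplus>\<^bsub>HA\<^esub> (\<Oplus>\<^bsub>HA\<^esub>y\<in>?B. scalar (p y) \<otimes>\<^bsub>HA\<^esub> TH y)"
    proof (intro exI conjI allI impI)
      fix y assume "bruhat y w"
      then have "y \<noteq> w" using bruhat_len[of w w] by auto
      then show "lk (F.C w) y \<in> q_laurent_plus" using C(4) by (simp add: q_laurent_plus_vanishing)
    next
      show "sig (F.C w) = TH w \<oplus>\<^bsub>HA\<^esub> (\<Oplus>\<^bsub>HA\<^esub>y\<in>?B. scalar (lk (F.C w) y) \<otimes>\<^bsub>HA\<^esub> TH y)"
        unfolding fs Ceq[symmetric] ..
    qed
  next
    fix c assume c: "c \<in> carrier HA \<and> hecke_bar G S c = c \<and> (\<exists>p. (\<forall>y. bruhat y w \<longrightarrow> p y \<in> q_laurent_plus) \<and>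
        c = TH w \<oplus>\<^bsub>HA\<^esub> (\<Oplus>\<^bsub>HA\<^esub>y\<in>?B. scalar (p y) \<otimes>\<^bsub>HA\<^esub> TH y))"
    then obtain p where p: "\<And>y. bruhat y w \<Longrightarrow> vanishing (p y)" "c = sig (bas w + (\<Sum>y\<in>?B. smul (p y) (bas y)))"
      unfolding fs q_laurent_plus_vanishing by auto
    let ?m = "bas w + (\<Sum>y\<in>?B. smul (p y) (bas y))"
    have "?m \<in> FG" using w bruhat_len by (intro free_module_closed free_module_sum) auto
    then have e: "ev c = ?m" by (simp add: p ev_sig)
    have "ev c = F.C w"
    proof (rule F.C_eqI[OF w])
      show "ev c \<in> FG" using c ev_closed by blast
      show "barF (ev c) = ev c" using c by (simp add: barF_def sig_ev)
      show "lk (ev c) w = 1" by (simp add: e lkB)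
      show "vanishing (lk (ev c) y)" if "y \<noteq> w" for y using that p(1) by (simp add: e lkB vanishing_closed)
    qed
    then show "c = sig (F.C w)" using c sig_ev by metis
  qed
qed

text \<open>The coefficient of \<open>F.C z\<close> in \<open>T\<^sub>s\<close> applied to
  \<open>F.C y\<close>, see \<open>lam_C\<close>.\<close>

definition lcoef :: "'a \<Rightarrow> 'a \<Rightarrow> 'a \<Rightarrow> laurent" where
  "lcoef s y z = (if ldesc s y then (if z = y then - qpow (-1) else 0)
    else (if z = y then qpow 1 else 0) + (if z = s \<otimes> y then 1 else 0) -
      of_int (if ldesc s z then F.\<mu> z y else 0))"

lemma lam_C:
  assumes s: "s \<in> S" and y: "y \<in> carrier G"
  shows "lam s (F.C y) = (\<Sum>z\<in>carrier G. smul (lcoef s y z) (F.C z))"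
proof (cases "ldesc s y")
  case True
  have "F.negative s (F.C y)" using F.negative_C[OF y s] True F_tau[OF y s] by simp
  then have "lam s (F.C y) = smul (- qpow (-1)) (F.C y)" by (simp add: F.negative_def)
  also have "\<dots> = (\<Sum>z\<in>carrier G. if z = y then smul (- qpow (-1)) (F.C y) else 0)"
    using y finite_carrier by (simp add: sum.delta)
  also have "\<dots> = (\<Sum>z\<in>carrier G. smul (lcoef s y z) (F.C z))"
    by (rule sum.cong) (use True in \<open>auto simp: lcoef_def smul_laws(5)\<close>)
  finally show ?thesis .
next
  case False
  have sy: "s \<otimes> y \<in> carrier G" using s y by simp
  have d1: "(\<Sum>z\<in>carrier G. smul (if z = x then a else 0) (F.C z)) = smul a (F.C x)" if "x \<in> carrier G" for x a
  proof -
    have "(\<Sum>z\<in>carrier G. smul (if z = x then a else 0) (F.C z)) = (\<Sum>z\<in>carrier G. if z = x then smul a (F.C x) else 0)"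
      by (rule sum.cong) (auto simp: smul_laws)
    then show ?thesis using that finite_carrier by (simp add: sum.delta)
  qed
  have "(\<Sum>z\<in>carrier G. smul (lcoef s y z) (F.C z)) =
      (\<Sum>z\<in>carrier G. smul (if z = y then qpow 1 else 0) (F.C z)) + (\<Sum>z\<in>carrier G. smul (if z = s \<otimes> y then 1 else 0) (F.C z))
      - (\<Sum>z\<in>carrier G. smul (of_int (if ldesc s z then F.\<mu> z y else 0)) (F.C z))"
    unfolding sum.distrib[symmetric] sum_subtractf[symmetric]
    by (rule sum.cong) (use False in \<open>simp_all add: lcoef_def smul_laws(7,8)\<close>)
  also have "\<dots> = smul (qpow 1) (F.C y) + F.C (s \<otimes> y)
      - (\<Sum>z\<in>carrier G. smul (of_int (if F.tau s z then F.\<mu> z y else 0)) (F.C z))"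
    using F_tau[OF _ s] by (simp add: d1[OF y] d1[OF sy] smul_laws(6))
  also have "\<dots> = lam s (F.C y)"
    using F.T_C_ascent[OF s y] False sy F_tau[OF y s] by simp
  finally show ?thesis by simp
qed

text \<open>Independence of the canonical basis identifies the coefficients of any expansion with
  those of \<open>lam_C\<close>.\<close>

lemma KL_occurs_lcoef:
  assumes x: "x \<in> carrier G" and y: "y \<in> carrier G" and occ: "KL_occurs G S x y"
  shows "\<exists>s\<in>S. lcoef s y x \<noteq> 0"
proof -
  from occ obtain s a where s: "s \<in> S" and a: "Poly_Mapping.keys a \<subseteq> carrier G" "lk a x \<noteq> 0"
    and e: "gen s \<otimes>\<^bsub>HA\<^esub> KL_basis G S y = (\<Oplus>\<^bsub>HA\<^esub>z\<in>Poly_Mapping.keys a. scalar (lk a z) \<otimes>\<^bsub>HA\<^esub> KL_basis G S z)"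
    unfolding KL_occurs_def by blast
  interpret HA: ring HA by (rule hecke_ring)
  have Cy: "F.C z \<in> FG" if "z \<in> carrier G" for z using F.C_props[OF that] by blast
  have "(\<Oplus>\<^bsub>HA\<^esub>z\<in>Poly_Mapping.keys a. scalar (lk a z) \<otimes>\<^bsub>HA\<^esub> KL_basis G S z) =
      (\<Oplus>\<^bsub>HA\<^esub>z\<in>Poly_Mapping.keys a. scalar (lk a z) \<otimes>\<^bsub>HA\<^esub> sig (F.C z))"
    using a(1) by (intro HA.finsum_cong') (auto simp: KL_basis_eq sig_closed scalar_closed)
  then have "sig (lam s (F.C y)) = sig (\<Sum>z\<in>Poly_Mapping.keys a. smul (lk a z) (F.C z))"
    using e by (simp add: KL_basis_eq[OF y] sig_lam[OF s Cy[OF y]] finsum_sig)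
  moreover have "(\<Sum>z\<in>Poly_Mapping.keys a. smul (lk a z) (F.C z)) \<in> FG"
    using a(1) Cy by (intro free_module_sum free_module_closed) auto
  ultimately have "lam s (F.C y) = (\<Sum>z\<in>Poly_Mapping.keys a. smul (lk a z) (F.C z))"
    using ev_sig lam_closed[OF s] by metis
  also have "\<dots> = (\<Sum>z\<in>carrier G. smul (lk a z) (F.C z))"
    using a(1) finite_carrier by (intro sum.mono_neutral_left) (auto simp: in_keys_iff smul_laws)
  finally have "lcoef s y x = lk a x"
    unfolding lam_C[OF s y] using x by (rule F.C_independent)
  with a(2) have "lcoef s y x \<noteq> 0" by simp
  with s show ?thesis by blast
qed

section \<open>Inversion of group elements and right multiplication\<close>

text \<open>The linear anti-automorphism of the Hecke algebra induced by inversion, in coordinates.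
  It exchanges \<open>lam\<close> and \<open>rho\<close> and maps \<open>F.C w\<close> to
  \<open>F.C (inv w)\<close>, which carries results on left multiplication over to the
  right.\<close>

definition iota :: "('a \<Rightarrow>\<^sub>0 laurent) \<Rightarrow> ('a \<Rightarrow>\<^sub>0 laurent)" where
  "iota = extend (\<lambda>w. bas (inv w))"

lemma iota_linear: "laurent_linear iota"
  unfolding iota_def by (rule extend_linear)

lemma iota_bas: "w \<in> carrier G \<Longrightarrow> iota (bas w) = bas (inv w)"
  unfolding iota_def by (simp add: extend_bas)

lemma iota_closed: "iota m \<in> FG"
  unfolding iota_def by (intro extend_closed free_module_closed) simp

lemma iota_lam: "s \<in> S \<Longrightarrow> m \<in> FG \<Longrightarrow> iota (lam s m) = rho s (iota m)"
proof -
  assume s: "s \<in> S" and m: "m \<in> FG"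
  note L = laurent_linear_add[OF iota_linear] laurent_linear_smul[OF iota_linear] laurent_linear_0[OF iota_linear]
  show ?thesis
  proof (rule linear_ext[OF laurent_linear_comp[OF iota_linear lam_linear] laurent_linear_comp[OF rho_linear iota_linear] _ m])
    fix w assume w: "w \<in> carrier G"
    show "iota (lam s (bas w)) = rho s (iota (bas w))"
      using w s ldesc_rdesc_inv[OF w s] by (simp add: lam_bas iota_bas rho_bas L inv_mult_gen)
  qed
qed

lemma iota_lookup: "z \<in> carrier G \<Longrightarrow> lk (iota m) z = lk m (inv z)"
proof -
  assume z: "z \<in> carrier G"
  have "lk (iota m) z = (\<Sum>w\<in>carrier G. if w = inv z then lk m (inv z) else 0)"
    unfolding iota_def extend_def lookup_sum lookup_smul
    by (rule sum.cong) (use z in \<open>auto simp: lookup_bas\<close>)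
  then show ?thesis using z finite_carrier by (simp add: sum.delta)
qed

lemma semilinear_ext:
  assumes "\<And>m m'. m \<in> FG \<Longrightarrow> m' \<in> FG \<Longrightarrow> A (m + m') = A m + A m'"
    "\<And>m a. m \<in> FG \<Longrightarrow> A (smul a m) = smul (laurent_bar a) (A m)"
    "\<And>m m'. m \<in> FG \<Longrightarrow> m' \<in> FG \<Longrightarrow> B (m + m') = B m + B m'"
    "\<And>m a. m \<in> FG \<Longrightarrow> B (smul a m) = smul (laurent_bar a) (B m)"
    "\<And>w. w \<in> carrier G \<Longrightarrow> A (bas w) = B (bas w)" and m: "m \<in> FG"
  shows "A m = B (m :: 'a \<Rightarrow>\<^sub>0 laurent)"
proof -
  have "A (\<Sum>w\<in>X. smul (lk m w) (bas w)) = B (\<Sum>w\<in>X. smul (lk m w) (bas w))"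
    if "finite X" "X \<subseteq> carrier G" for X
    using that
  proof (induction X)
    case empty
    then show ?case using assms(2)[of 0 0] assms(4)[of 0 0] by (simp add: free_module_closed smul_laws laurent_bar_0)
  next
    case (insert w X)
    then show ?case using assms by (simp add: free_module_closed free_module_sum subset_iff)
  qed
  from this[OF finite_carrier] show ?thesis using free_module_expand[OF finite_carrier m] by simp
qed

text \<open>The axioms of \<open>bar_module\<close> concern left multiplication only. Induction on
  length from \<open>bas w = lam t (bas v)\<close> moves \<open>rho s\<close> past
  \<open>lam t\<close>; at the identity left and right multiplication agree.\<close>

lemma barF_rho: "s \<in> S \<Longrightarrow> m \<in> FG \<Longrightarrow> barF (rho s m) = rho s (barF m) - smul \<xi> (barF m)"
proof -
  assume s: "s \<in> S" and m: "m \<in> FG"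
  note R = laurent_linear_add[OF rho_linear] laurent_linear_smul[OF rho_linear] laurent_linear_0[OF rho_linear]
  note Lm = laurent_linear_add[OF lam_linear] laurent_linear_smul[OF lam_linear]
  have Rd: "rho s (a - b) = rho s a - rho s b" for a b
    using R(1)[of s a "smul (- 1) b"] R(2)[of s "- 1" b] by (simp add: smul_laws)
  have Ld: "lam t (a - b) = lam t a - lam t b" for t a b
    using Lm(1)[of t a "smul (- 1) b"] Lm(2)[of t "- 1" b] by (simp add: smul_laws)
  show ?thesis
  proof (rule semilinear_ext[OF _ _ _ _ _ m])
    fix w assume "w \<in> carrier G"
    then show "barF (rho s (bas w)) = rho s (barF (bas w)) - smul \<xi> (barF (bas w))"
    proof (induction "len w" arbitrary: w rule: less_induct)
      case less
      show ?case
      proof (cases "w = \<one>")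
        case True
        have "rho s (bas \<one>) = lam s (bas \<one>)" using s by (simp add: rho_bas lam_bas len_one)
        moreover have "barF (lam s (bas \<one>)) = lam s (bas \<one>) - smul \<xi> (bas \<one>)"
          using F.bar_T[OF s bas_one_FG] by (simp add: F.bar_one)
        ultimately show ?thesis using True by (simp add: F.bar_one)
      next
        case False
        obtain t v where t: "t \<in> S" and v: "v \<in> carrier G" "w = t \<otimes> v" "\<not> ldesc t v" "len v < len w"
          using F.descent_factor[OF less.prems False] by metis
        have bv: "bas v \<in> FG" "barF (bas v) \<in> FG" using v by (simp_all add: free_module_closed F.bar_closed)
        have w: "bas w = lam t (bas v)" using v by (simp add: lam_bas)
        have "barF (rho s (bas w)) = barF (lam t (rho s (bas v)))"
          unfolding w using lam_rho_commute[OF t s bv(1)] by simp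
        also have "\<dots> = lam t (barF (rho s (bas v))) - smul \<xi> (barF (rho s (bas v)))"
          using s by (intro F.bar_T[OF t]) (simp add: rho_closed)
        also have "\<dots> = rho s (lam t (barF (bas v)) - smul \<xi> (barF (bas v))) -
            smul \<xi> (lam t (barF (bas v)) - smul \<xi> (barF (bas v)))"
          unfolding less.hyps[OF v(4,1)] Ld Rd using lam_rho_commute[OF t s bv(2)]
          by (simp add: R Lm smul_laws(1,2,10) algebra_simps)
        also have "lam t (barF (bas v)) - smul \<xi> (barF (bas v)) = barF (bas w)"
          unfolding w using F.bar_T[OF t bv(1)] by simp
        finally show ?thesis .
      qed
    qed
  qed (use s in \<open>auto simp: R F.bar_add F.bar_smul rho_closed smul_laws(1,2,10) mult.commute algebra_simps\<close>)
qed

lemma barF_iota: "m \<in> FG \<Longrightarrow> barF (iota m) = iota (barF m)"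
proof -
  assume m: "m \<in> FG"
  note L = laurent_linear_add[OF iota_linear] laurent_linear_smul[OF iota_linear] laurent_linear_0[OF iota_linear]
  have Ld: "iota (a - b) = iota a - iota b" for a b
    using L(1)[of a "smul (- 1) b"] L(2)[of "- 1" b] by (simp add: smul_laws)
  show ?thesis
  proof (rule semilinear_ext[OF _ _ _ _ _ m])
    fix w assume "w \<in> carrier G"
    then show "barF (iota (bas w)) = iota (barF (bas w))"
    proof (induction "len w" arbitrary: w rule: less_induct)
      case less
      show ?case
      proof (cases "w = \<one>")
        case True
        then show ?thesis by (simp add: iota_bas F.bar_one)
      next
        case False
        obtain t v where t: "t \<in> S" and v: "v \<in> carrier G" "w = t \<otimes> v" "\<not> ldesc t v" "len v < len w"
          using F.descent_factor[OF less.prems False] by metis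
        have bv: "bas v \<in> FG" "barF (bas v) \<in> FG" using v by (simp_all add: free_module_closed F.bar_closed)
        have w: "bas w = lam t (bas v)" using v by (simp add: lam_bas)
        show ?thesis
          unfolding w
          by (simp add: iota_lam[OF t bv(1)] barF_rho[OF t iota_closed] less.hyps[OF v(4,1)] F.bar_T[OF t bv(1)]
              Ld L iota_lam[OF t bv(2)])
      qed
    qed
  qed (auto simp: L F.bar_add F.bar_smul iota_closed)
qed

lemma iota_C: "w \<in> carrier G \<Longrightarrow> iota (F.C w) = F.C (inv w)"
proof -
  assume w: "w \<in> carrier G"
  note C = F.C_props[OF w]
  show ?thesis
  proof (rule F.C_eqI)
    show "barF (iota (F.C w)) = iota (F.C w)" using C by (simp add: barF_iota)
    show "lk (iota (F.C w)) (inv w) = 1" using C w by (simp add: iota_lookup)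
    fix y assume y: "y \<noteq> inv w"
    show "vanishing (lk (iota (F.C w)) y)"
    proof (cases "y \<in> carrier G")
      case True
      then have "inv y \<noteq> w" using y by auto
      then show ?thesis using C True by (simp add: iota_lookup)
    next
      case False
      then show ?thesis using iota_closed[of "F.C w"] by (simp add: free_module_iff vanishing_closed)
    qed
  qed (use w in \<open>simp_all add: iota_closed\<close>)
qed

definition rcoef :: "'a \<Rightarrow> 'a \<Rightarrow> 'a \<Rightarrow> laurent" where
  "rcoef s y z = lcoef s (inv y) (inv z)"

lemma rho_C:
  assumes s: "s \<in> S" and y: "y \<in> carrier G"
  shows "rho s (F.C y) = (\<Sum>z\<in>carrier G. smul (rcoef s y z) (F.C z))"
proof -
  have iy: "inv y \<in> carrier G" using y by simp
  have "rho s (F.C y) = rho s (iota (F.C (inv y)))" using iota_C[OF iy] y by simp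
  also have "\<dots> = iota (lam s (F.C (inv y)))" using iota_lam[OF s] F.C_props(1)[OF iy] by simp
  also have "\<dots> = (\<Sum>z\<in>carrier G. smul (lcoef s (inv y) z) (F.C (inv z)))"
    unfolding lam_C[OF s iy] laurent_linear_sum[OF iota_linear] laurent_linear_smul[OF iota_linear]
    by (rule sum.cong) (simp_all add: iota_C)
  also have "\<dots> = (\<Sum>z\<in>carrier G. smul (rcoef s y z) (F.C z))"
    by (rule sum.reindex_bij_witness[of _ "\<lambda>z. inv z" "\<lambda>z. inv z"]) (auto simp: rcoef_def)
  finally show ?thesis .
qed

text \<open>The coefficient of \<open>F.C x\<close> when left and right multiplication are applied
  to \<open>F.C y\<close> in either order. The restrictions on \<open>lcoef\<close> below are read
  off from this identity.\<close>

lemma lcoef_rcoef_commute: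
  assumes s: "s \<in> S" and r: "r \<in> S" and x: "x \<in> carrier G" and y: "y \<in> carrier G"
  shows "(\<Sum>z\<in>carrier G. rcoef r y z * lcoef s z x) = (\<Sum>z\<in>carrier G. lcoef s y z * rcoef r z x)"
proof -
  have "lam s (rho r (F.C y)) = (\<Sum>z\<in>carrier G. smul (rcoef r y z) (\<Sum>x\<in>carrier G. smul (lcoef s z x) (F.C x)))"
    unfolding rho_C[OF r y] laurent_linear_sum[OF lam_linear] laurent_linear_smul[OF lam_linear]
    by (rule sum.cong) (simp_all add: lam_C[OF s])
  also have "\<dots> = (\<Sum>x\<in>carrier G. smul (\<Sum>z\<in>carrier G. rcoef r y z * lcoef s z x) (F.C x))"
    unfolding smul_sum smul_sum_left smul_laws(10) by (rule sum.swap)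
  finally have 1: "lam s (rho r (F.C y)) = (\<Sum>x\<in>carrier G. smul (\<Sum>z\<in>carrier G. rcoef r y z * lcoef s z x) (F.C x))" .
  have "rho r (lam s (F.C y)) = (\<Sum>z\<in>carrier G. smul (lcoef s y z) (\<Sum>x\<in>carrier G. smul (rcoef r z x) (F.C x)))"
    unfolding lam_C[OF s y] laurent_linear_sum[OF rho_linear] laurent_linear_smul[OF rho_linear]
    by (rule sum.cong) (simp_all add: rho_C[OF r])
  also have "\<dots> = (\<Sum>x\<in>carrier G. smul (\<Sum>z\<in>carrier G. lcoef s y z * rcoef r z x) (F.C x))"
    unfolding smul_sum smul_sum_left smul_laws(10) by (rule sum.swap)
  finally have 2: "rho r (lam s (F.C y)) = (\<Sum>x\<in>carrier G. smul (\<Sum>z\<in>carrier G. lcoef s y z * rcoef r z x) (F.C x))" .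
  have "lam s (rho r (F.C y)) = rho r (lam s (F.C y))"
    by (rule lam_rho_commute[OF s r F.C_props(1)[OF y]])
  from F.C_independent[OF this[unfolded 1 2] x] show ?thesis .
qed

lemma rcoef_rdesc:
  assumes "r \<in> S" "y \<in> carrier G" "z \<in> carrier G" "rdesc r y"
  shows "rcoef r y z = (if z = y then - qpow (-1) else 0)"
proof -
  have "inv z = inv y \<longleftrightarrow> z = y" using assms by (metis inv_inv)
  then show ?thesis using assms by (simp add: rcoef_def lcoef_def rdesc_ldesc_inv)
qed

lemma rcoef_not_rdesc:
  assumes r: "r \<in> S" and y: "y \<in> carrier G" and z: "z \<in> carrier G" and d: "\<not> rdesc r y"
  shows "rcoef r y z = (if z = y then qpow 1 else 0) + (if z = y \<otimes> r then 1 else 0) -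
      of_int (if rdesc r z then F.\<mu> (inv z) (inv y) else 0)"
proof -
  have "inv z = inv y \<longleftrightarrow> z = y" using y z by (metis inv_inv)
  moreover have "inv z = r \<otimes> inv y \<longleftrightarrow> z = y \<otimes> r"
  proof -
    have e: "inv (y \<otimes> r) = r \<otimes> inv y" using y r by (simp add: inv_mult_group gen_inv)
    have c: "y \<otimes> r \<in> carrier G" using y r by simp
    show ?thesis unfolding e[symmetric] using z c by (metis inv_inv)
  qed
  ultimately show ?thesis
    using d r y z by (simp add: rcoef_def lcoef_def rdesc_ldesc_inv)
qed

lemma rcoef_mu:
  assumes r: "r \<in> S" and u: "u \<in> S" and y: "y \<in> carrier G" and z: "z \<in> carrier G"
    and d: "rdesc r y" "\<not> rdesc r z"
  shows "F.\<mu> (inv z) (inv y) = (if z = y \<otimes> r then -1 else 0)"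
proof -
  have iy: "inv y \<in> carrier G" and iz: "inv z \<in> carrier G" using y z by simp_all
  have dy: "ldesc r (inv y)" and dz: "\<not> ldesc r (inv z)" using d y z r by (simp_all add: rdesc_ldesc_inv)
  have "inv z = r \<otimes> inv y \<longleftrightarrow> z = y \<otimes> r"
  proof -
    have e: "inv (y \<otimes> r) = r \<otimes> inv y" using y r by (simp add: inv_mult_group gen_inv)
    have c: "y \<otimes> r \<in> carrier G" using y r by simp
    show ?thesis unfolding e[symmetric] using z c by (metis inv_inv)
  qed
  then show ?thesis
    using F.negative_mu[OF r iy F.negative_C[OF iy r] _ iz] dy dz F_tau[OF iy r] F_tau[OF iz r] by simp
qed

section \<open>Right descents and right star operations along the left preorder\<close>

text \<open>If \<open>r\<close> were a right descent of \<open>y\<close> but not of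
  \<open>x\<close>, the two sides of the commutation identity would be \<open>- q^-1\<close> and
  \<open>q\<close> times the same coefficient.\<close>

lemma lcoef_rdesc_mono:
  assumes s: "s \<in> S" and r: "r \<in> S" and x: "x \<in> carrier G" and y: "y \<in> carrier G"
    and nz: "lcoef s y x \<noteq> 0" and d: "rdesc r y"
  shows "rdesc r x"
proof (rule ccontr)
  assume nx: "\<not> rdesc r x"
  have "(\<Sum>z\<in>carrier G. rcoef r y z * lcoef s z x) = (\<Sum>z\<in>carrier G. if z = y then - qpow (-1) * lcoef s y x else 0)"
    by (rule sum.cong) (use r y d in \<open>auto simp: rcoef_rdesc\<close>)
  also have "\<dots> = - qpow (-1) * lcoef s y x" using y finite_carrier by (simp add: sum.delta)
  finally have 1: "(\<Sum>z\<in>carrier G. rcoef r y z * lcoef s z x) = - qpow (-1) * lcoef s y x" .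
  have "(\<Sum>z\<in>carrier G. lcoef s y z * rcoef r z x) = (\<Sum>z\<in>carrier G. if z = x then qpow 1 * lcoef s y x else 0)"
  proof (rule sum.cong)
    fix z assume z: "z \<in> carrier G"
    show "lcoef s y z * rcoef r z x = (if z = x then qpow 1 * lcoef s y x else 0)"
    proof (cases "rdesc r z")
      case True
      then have "x \<noteq> z" using nx by auto
      then show ?thesis using rcoef_rdesc[OF r z x True] by auto
    next
      case False
      then have "x \<noteq> z \<otimes> r" using nx rdesc_flip[OF z r] by auto
      then show ?thesis using rcoef_not_rdesc[OF r z x False] nx by (auto simp: mult.commute)
    qed
  qed simp
  also have "\<dots> = qpow 1 * lcoef s y x" using x finite_carrier by (simp add: sum.delta)
  finally have "qpow 1 * lcoef s y x = - qpow (-1) * lcoef s y x"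
    using lcoef_rcoef_commute[OF s r x y] 1 by metis
  then have "(qpow 1 + qpow (-1)) * lcoef s y x = 0"
    unfolding distrib_right by (metis add.commute minus_mult_left right_minus)
  then show False using q_plus_inverse_cancel nz by blast
qed

lemma star_star:
  assumes y: "y \<in> carrier G" and r: "r \<in> S" and u: "u \<in> S" and ru: "r \<otimes> u \<noteq> u \<otimes> r"
    and d: "rdesc r y" "\<not> rdesc u y"
  shows "star u r (star r u y) = y"
proof (cases "rdesc r (y \<otimes> u)")
  case True
  then show ?thesis using y r u d by (simp add: star_def gen_cancel_right)
next
  case False
  then have e: "star r u y = y \<otimes> u" by (simp add: star_def)
  note st = star_type[OF y r u ru d, unfolded e]
  have "rdesc u (y \<otimes> u \<otimes> r) \<longleftrightarrow> rdesc r (y \<otimes> u \<otimes> u)"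
    by (rule star_type(4)[OF st(3) u r ru[symmetric] st(1,2)])
  then show ?thesis using y r u d by (simp add: e star_def gen_cancel_right)
qed

text \<open>
  Right multiplication by \<open>C\<^sub>u\<close> induces a left module isomorphism that permutes the basis by the star
  operation, so it transports the matrix of \<open>T\<^sub>s\<close>.
\<close>

lemma rcoef_star:
  assumes y: "y \<in> carrier G" and z: "z \<in> carrier G" and r: "r \<in> S" and u: "u \<in> S" and ru: "r \<otimes> u \<noteq> u \<otimes> r"
    and d: "rdesc r y" "\<not> rdesc u y" and dz: "\<not> rdesc r z"
  shows "rcoef u y z = (if z = star r u y then 1 else 0)"
proof -
  have zy: "z \<noteq> y" using d dz by auto
  have st: "rdesc r (y \<otimes> u) \<longleftrightarrow> rdesc u (y \<otimes> r)" by (rule star_type(4)[OF y r u ru d])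
  have neq: "y \<otimes> u \<noteq> y \<otimes> r"
  proof
    assume "y \<otimes> u = y \<otimes> r"
    then have "u = r" using y r u by simp
    then show False using ru by simp
  qed
  have "rcoef u y z = (if z = y \<otimes> u then 1 else 0) - of_int (if rdesc u z then (if z = y \<otimes> r then -1 else 0) else 0)"
    using rcoef_not_rdesc[OF u y z d(2)] rcoef_mu[OF r u y z d(1) dz] zy by simp
  also have "\<dots> = (if z = star r u y then 1 else 0)"
  proof (cases "rdesc r (y \<otimes> u)")
    case True
    then have "z \<noteq> y \<otimes> u" "rdesc u (y \<otimes> r)" using dz st by auto
    then show ?thesis using True by (auto simp: star_def)
  next
    case False
    then have "\<not> rdesc u (y \<otimes> r)" using st by simp
    then show ?thesis using False neq by (auto simp: star_def)
  qed
  finally show ?thesis .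
qed

text \<open>In the commutation identity for \<open>s\<close> and \<open>u\<close>, monotonicity of
  right descents and \<open>rcoef_star\<close> leave one summand on each side: the one at
  \<open>star r u y\<close> and the one at \<open>x\<close>.\<close>

lemma lcoef_star:
  assumes s: "s \<in> S" and x: "x \<in> carrier G" and y: "y \<in> carrier G"
    and r: "r \<in> S" and u: "u \<in> S" and ru: "r \<otimes> u \<noteq> u \<otimes> r"
    and dx: "rdesc r x" "\<not> rdesc u x" and dy: "rdesc r y" "\<not> rdesc u y"
  shows "lcoef s (star r u y) (star r u x) = lcoef s y x"
proof -
  let ?x = "star r u x" and ?y = "star r u y"
  note sx = star_type[OF x r u ru dx] and sy = star_type[OF y r u ru dy]
  have "(\<Sum>z\<in>carrier G. rcoef u y z * lcoef s z ?x) = (\<Sum>z\<in>carrier G. if z = ?y then lcoef s ?y ?x else 0)"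
  proof (rule sum.cong)
    fix z assume z: "z \<in> carrier G"
    show "rcoef u y z * lcoef s z ?x = (if z = ?y then lcoef s ?y ?x else 0)"
    proof (cases "rdesc r z")
      case True
      then have "lcoef s z ?x = 0" using lcoef_rdesc_mono[OF s r sx(3) z] sx(2) by blast
      then show ?thesis by auto
    next
      case False
      then show ?thesis using rcoef_star[OF y z r u ru dy False] by simp
    qed
  qed simp
  also have "\<dots> = lcoef s ?y ?x" using sy(3) finite_carrier by (simp add: sum.delta)
  finally have 1: "(\<Sum>z\<in>carrier G. rcoef u y z * lcoef s z ?x) = lcoef s ?y ?x" .
  have "(\<Sum>z\<in>carrier G. lcoef s y z * rcoef u z ?x) = (\<Sum>z\<in>carrier G. if z = x then lcoef s y x else 0)"
  proof (rule sum.cong)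
    fix z assume z: "z \<in> carrier G"
    show "lcoef s y z * rcoef u z ?x = (if z = x then lcoef s y x else 0)"
    proof (cases "rdesc r z")
      case False
      then have "lcoef s y z = 0" using lcoef_rdesc_mono[OF s r z y _ dy(1)] by blast
      then show ?thesis using False dx by auto
    next
      case dz: True
      show ?thesis
      proof (cases "rdesc u z")
        case True
        have "?x \<noteq> z" using dz sx(2) by auto
        then have "rcoef u z ?x = 0" using rcoef_rdesc[OF u z sx(3) True] by simp
        moreover have "z \<noteq> x" using True dx by auto
        ultimately show ?thesis by simp
      next
        case False
        have "?x = star r u z \<longleftrightarrow> z = x"
          using star_star[OF x r u ru dx] star_star[OF z r u ru dz False] by metis
        then show ?thesis using rcoef_star[OF z sx(3) r u ru dz False sx(2)] by simp
      qed
    qed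
  qed simp
  also have "\<dots> = lcoef s y x" using x finite_carrier by (simp add: sum.delta)
  finally show ?thesis using lcoef_rcoef_commute[OF s u sx(3) y] 1 by simp
qed

section \<open>Cells and left star operations\<close>

definition occ :: "('a \<times> 'a) set" where
  "occ = {(x, y). x \<in> carrier G \<and> y \<in> carrier G \<and> (\<exists>s\<in>S. lcoef s y x \<noteq> 0)}"

lemma KL_left_preorder_occ: "KL_left_preorder G S \<subseteq> occ\<^sup>*"
  unfolding KL_left_preorder_def by (rule rtrancl_mono) (auto simp: occ_def KL_occurs_lcoef)

lemma occ_rdesc: "(x, y) \<in> occ\<^sup>* \<Longrightarrow> r \<in> S \<Longrightarrow> rdesc r y \<Longrightarrow> rdesc r x"
proof (induction rule: converse_rtrancl_induct)
  case (step x z)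
  then show ?case using lcoef_rdesc_mono by (auto simp: occ_def)
qed

text \<open>Right descents can only grow along the chain from \<open>y\<close> to \<open>x\<close>:
  \<open>r\<close> is inherited from \<open>y\<close>, and the absence of \<open>u\<close> at
  \<open>x\<close> passes back. So the star operation is defined on every member of the
  chain.\<close>

lemma occ_star:
  assumes r: "r \<in> S" and u: "u \<in> S" and ru: "r \<otimes> u \<noteq> u \<otimes> r"
  shows "(x, y) \<in> occ\<^sup>* \<Longrightarrow> rdesc r y \<Longrightarrow> \<not> rdesc u x \<Longrightarrow> (star r u x, star r u y) \<in> occ\<^sup>*"
proof (induction rule: converse_rtrancl_induct)
  case (step x z)
  obtain s where s: "s \<in> S" "x \<in> carrier G" "z \<in> carrier G" "lcoef s z x \<noteq> 0" using step(1) by (auto simp: occ_def)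
  have z: "rdesc r z" "\<not> rdesc u z"
    using occ_rdesc[OF step(2) r step.prems(1)] lcoef_rdesc_mono[OF s(1) u s(2,3,4)] step.prems(2) by auto
  have x: "rdesc r x" using lcoef_rdesc_mono[OF s(1) r s(2,3,4) z(1)] .
  have "lcoef s (star r u z) (star r u x) \<noteq> 0"
    using lcoef_star[OF s(1,2,3) r u ru x step.prems(2) z] s(4) by simp
  moreover have "star r u z \<in> carrier G" "star r u x \<in> carrier G"
    using star_type(3)[OF s(3) r u ru z] star_type(3)[OF s(2) r u ru x step.prems(2)] .
  ultimately have "(star r u x, star r u z) \<in> occ" using s(1) by (auto simp: occ_def)
  then show ?case using step.IH[OF step.prems(1) z(2)] by (rule converse_rtrancl_into_rtrancl)
qed simp

lemma cell_left_steps: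
  assumes x: "x \<in> carrier G" and y: "y \<in> carrier G" and xy: "(x, y) \<in> occ\<^sup>*" "(y, x) \<in> occ\<^sup>*"
  shows "(left_step n)\<^sup>*\<^sup>* (\<phi> x) (\<phi> y)"
proof -
  define E where "E z z' \<longleftrightarrow> (\<exists>x\<in>carrier G. \<exists>y\<in>carrier G. z = \<phi> x \<and> z' = \<phi> y \<and> (x, y) \<in> occ\<^sup>* \<and> (y, x) \<in> occ\<^sup>*)"
    for z z'
  have rd: "rdesc r x \<longleftrightarrow> rdesc r y" if "(x, y) \<in> occ\<^sup>*" "(y, x) \<in> occ\<^sup>*" "r \<in> S" for x y r
    using occ_rdesc[OF that(1,3)] occ_rdesc[OF that(2,3)] by blast
  show ?thesis
  proof (rule generalized_tau_invariant_connected[of E])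
    show "E y z" if "E z y" for z y using that by (auto simp: E_def)
    show "z permutes {1..n}" if "E z y" for z y using that phi_permutes by (auto simp: E_def)
    show "descents n z = descents n z'" if "E z z'" for z z'
    proof -
      from that obtain x y where *: "x \<in> carrier G" "y \<in> carrier G" "z = \<phi> x" "z' = \<phi> y"
        "(x, y) \<in> occ\<^sup>*" "(y, x) \<in> occ\<^sup>*" by (auto simp: E_def)
      have "j \<in> descents n z \<longleftrightarrow> j \<in> descents n z'" for j
      proof (cases "1 \<le> j \<and> j < n")
        case True
        then obtain s where s: "s \<in> S" "\<phi> s = transpose j (Suc j)" using index_gen by blast
        show ?thesis
          using rd[OF *(5,6) s(1)] rdesc_iff[OF *(1) s] rdesc_iff[OF *(2) s] True
          by (simp add: descents_def *(3,4))
      qed (auto simp: descents_def)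
      then show ?thesis by blast
    qed
    show "\<exists>y'. star_step n j y y' \<and> E z' y'" if Ezy: "E z y" and zz: "star_step n j z z'" for j z y z'
    proof -
      from Ezy obtain x v where *: "x \<in> carrier G" "v \<in> carrier G" "z = \<phi> x" "y = \<phi> v"
        "(x, v) \<in> occ\<^sup>*" "(v, x) \<in> occ\<^sup>*" by (auto simp: E_def)
      obtain r u where ru: "r \<in> S" "u \<in> S" "r \<otimes> u \<noteq> u \<otimes> r" "rdesc r x" "\<not> rdesc u x" "z' = \<phi> (star r u x)"
        and st: "\<And>x. x \<in> carrier G \<Longrightarrow> rdesc r x \<Longrightarrow> \<not> rdesc u x \<Longrightarrow> star_step n j (\<phi> x) (\<phi> (star r u x))"
        using star_step_star[OF *(1) zz[unfolded *(3)]] by metis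
      have v: "rdesc r v" "\<not> rdesc u v" using rd[OF *(5,6) ru(1)] rd[OF *(5,6) ru(2)] ru(4,5) by auto
      have "star r u x \<in> carrier G" "star r u v \<in> carrier G"
        using star_type(3)[OF *(1) ru(1-5)] star_type(3)[OF *(2) ru(1-3) v] .
      then have "E z' (\<phi> (star r u v))"
        unfolding E_def ru(6)
        using occ_star[OF ru(1-3) *(5) v(1) ru(5)] occ_star[OF ru(1-3) *(6) ru(4) v(2)] by blast
      with st[OF *(2) v] show ?thesis unfolding *(4) by blast
    qed
    show "E (\<phi> x) (\<phi> y)" using x y xy by (auto simp: E_def)
  qed
qed

end

section \<open>W-graph ideals\<close>

context type_A_system
begin

text \<open>Relations in the algebra become relations between operators. \<open>bar_T\<close> holds
  because the bar involution sends \<open>gen s\<close> to its inverse, which is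
  \<open>gen s\<close> minus the scalar \<open>\<xi>\<close>.\<close>

lemma hecke_module_bar_module:
  assumes J: "J \<subseteq> S" and I: "left_weak_ideal G S I" "I \<noteq> {}" "I \<subseteq> D_set G S J"
    and hm: "hecke_module G S I a"
    and SA: "\<And>w s. w \<in> I \<Longrightarrow> s \<in> SA G S I w \<Longrightarrow> a (gen s) (bas w) = bas (s \<otimes> w)"
    and SD: "\<And>w s. w \<in> I \<Longrightarrow> s \<in> SD G S w \<Longrightarrow> a (gen s) (bas w) = bas (s \<otimes> w) + smul \<xi> (bas w)"
    and WD: "\<And>w s. w \<in> I \<Longrightarrow> s \<in> WD G S J w \<Longrightarrow> a (gen s) (bas w) = smul (- qpow (-1)) (bas w)"
    and WA: "\<And>w s. w \<in> I \<Longrightarrow> s \<in> WA G S I J w \<Longrightarrow> \<exists>r.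
      (\<forall>y\<in>I. bruhat_less G S y (s \<otimes> w) \<longrightarrow> r y \<in> q_laurent_plus) \<and>
      a (gen s) (bas w) = smul (qpow 1) (bas w) - (\<Sum>y\<in>{y \<in> I. bruhat_less G S y (s \<otimes> w)}. smul (r y) (bas y))"
    and bc: "\<And>m. m \<in> free_module I \<Longrightarrow> b m \<in> free_module I"
    and ba: "\<And>m m'. m \<in> free_module I \<Longrightarrow> m' \<in> free_module I \<Longrightarrow> b (m + m') = b m + b m'"
    and bs: "\<And>c m. m \<in> free_module I \<Longrightarrow> b (smul c m) = smul (laurent_bar c) (b m)"
    and b1: "b (bas \<one>) = bas \<one>"
    and bh: "\<And>h m. h \<in> carrier HA \<Longrightarrow> m \<in> free_module I \<Longrightarrow> b (a h m) = a (hecke_bar G S h) (b m)"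
  shows "bar_module G S n \<phi> I J (\<lambda>s. a (gen s)) b"
proof -
  interpret HA: ring HA by (rule hecke_ring)
  have ac: "a h m \<in> free_module I" if "h \<in> carrier HA" "m \<in> free_module I" for h m
    using hm that by (simp add: hecke_module_def)
  have aa: "a h (m + m') = a h m + a h m'" if "h \<in> carrier HA" "m \<in> free_module I" "m' \<in> free_module I" for h m m'
    using hm that by (simp add: hecke_module_def)
  have ap: "a (h \<oplus>\<^bsub>HA\<^esub> h') m = a h m + a h' m" if "h \<in> carrier HA" "h' \<in> carrier HA" "m \<in> free_module I" for h h' m
    using hm that by (simp add: hecke_module_def)
  have am: "a (h \<otimes>\<^bsub>HA\<^esub> h') m = a h (a h' m)" if "h \<in> carrier HA" "h' \<in> carrier HA" "m \<in> free_module I" for h h' m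
    using hm that by (simp add: hecke_module_def)
  have a1: "a \<one>\<^bsub>HA\<^esub> m = m" if "m \<in> free_module I" for m using hm that by (simp add: hecke_module_def)
  have as: "a (scalar c) m = smul c m" if "m \<in> free_module I" for c m using hm that by (simp add: hecke_module_def)
  have w2: "cl (free_word [s, t]) = gen s \<otimes>\<^bsub>HA\<^esub> gen t" if "s \<in> S" "t \<in> S" for s t
    using that free_word_append[of "[s]" "[t]"]
    by (simp add: hecke_gen_def cl_mult[symmetric] free_carrier_closed)
  have w3: "cl (free_word [s, t, r]) = gen s \<otimes>\<^bsub>HA\<^esub> (gen t \<otimes>\<^bsub>HA\<^esub> gen r)" if "s \<in> S" "t \<in> S" "r \<in> S" for s t r
    using that free_word_append[of "[s]" "[t, r]"] free_word_append[of "[t]" "[r]"]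
    by (simp add: w2[symmetric] hecke_gen_def cl_mult[symmetric] free_carrier_closed)
  have Ic: "w \<in> carrier G" if "w \<in> I" for w using that I(1) by (auto simp: left_weak_ideal_def)
  note gc = gen_closed scalar_closed cl_closed free_carrier_closed bar_letter_closed
  show ?thesis
  proof (unfold_locales)
    show "J \<subseteq> S" "left_weak_ideal G S I" "I \<noteq> {}" "I \<subseteq> D_set G S J" by fact+
    show "a (gen s) m \<in> free_module I" if "s \<in> S" "m \<in> free_module I" for s m using that by (simp add: ac gc)
    show "a (gen s) (m + m') = a (gen s) m + a (gen s) m'"
      if "s \<in> S" "m \<in> free_module I" "m' \<in> free_module I" for s m m' using that by (simp add: aa gc)
    show "a (gen s) (smul c m) = smul c (a (gen s) m)" if "s \<in> S" "m \<in> free_module I" for s m c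
    proof -
      have "a (gen s) (smul c m) = a (gen s \<otimes>\<^bsub>HA\<^esub> scalar c) m" using that by (simp add: am as gc)
      also have "\<dots> = smul c (a (gen s) m)" using that by (simp add: gen_scalar_commute am as ac gc)
      finally show ?thesis .
    qed
    show "a (gen s) (a (gen s) m) = m + smul \<xi> (a (gen s) m)" if "s \<in> S" "m \<in> free_module I" for s m
    proof -
      have "a (gen s) (a (gen s) m) = a (gen s \<otimes>\<^bsub>HA\<^esub> (gen s \<otimes>\<^bsub>HA\<^esub> \<one>\<^bsub>HA\<^esub>)) m"
        using that by (simp add: am gc)
      also have "\<dots> = m + smul \<xi> (a (gen s) m)"
        using that unfolding gen_square_mult[OF that(1) HA.one_closed] by (simp add: ap a1 am as ac gc)
      finally show ?thesis .
    qed
    show "a (gen s) (a (gen t) m) = a (gen t) (a (gen s) m)"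
      if "s \<in> S" "t \<in> S" "s \<otimes> t = t \<otimes> s" "m \<in> free_module I" for s t m
      using cl_gen_commute[OF that(1-3), of "[]"] that by (simp add: w2 am[symmetric] gc)
    show "a (gen s) (a (gen t) (a (gen s) m)) = a (gen t) (a (gen s) (a (gen t) m))"
      if "s \<in> S" "t \<in> S" "s \<otimes> t \<noteq> t \<otimes> s" "m \<in> free_module I" for s t m
      using cl_gen_braid[OF that(1-3), of "[]"] that by (simp add: w3 am[symmetric] gc)
    show "a (gen s) (bas w) = bas (s \<otimes> w)" if "s \<in> S" "w \<in> I" "s \<otimes> w \<in> I" "\<not> ldesc s w" for s w
      using that by (intro SA) (auto simp: SA_def bruhat_gen_iff Ic)
    show "a (gen s) (bas w) = bas (s \<otimes> w) + smul \<xi> (bas w)" if "s \<in> S" "w \<in> I" "ldesc s w" for s w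
      using that by (intro SD) (auto simp: SD_def bruhat_gen_iff' Ic)
    show "a (gen s) (bas w) = smul (- qpow (-1)) (bas w)" if "s \<in> S" "w \<in> I" "s \<otimes> w \<notin> D_set G S J" for s w
      using that by (intro WD) (auto simp: WD_def)
    show "\<exists>r. (\<forall>y\<in>I. bruhat_less G S y (s \<otimes> w) \<longrightarrow> vanishing (r y)) \<and>
        a (gen s) (bas w) = smul (qpow 1) (bas w) - (\<Sum>y\<in>{y \<in> I. bruhat_less G S y (s \<otimes> w)}. smul (r y) (bas y))"
      if "s \<in> S" "w \<in> I" "s \<otimes> w \<in> D_set G S J" "s \<otimes> w \<notin> I" for s w
      using WA[of w s] that by (auto simp: WA_def q_laurent_plus_vanishing)
    show "b m \<in> free_module I" if "m \<in> free_module I" for m using that by (rule bc)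
    show "b (m + m') = b m + b m'" if "m \<in> free_module I" "m' \<in> free_module I" for m m' using that by (rule ba)
    show "b (smul c m) = smul (laurent_bar c) (b m)" if "m \<in> free_module I" for c m using that by (rule bs)
    show "b (bas \<one>) = bas \<one>" by (rule b1)
    show "b (a (gen s) m) = a (gen s) (b m) - smul \<xi> (b m)" if "s \<in> S" "m \<in> free_module I" for s m
    proof -
      have "a (gen s) (b m) = a (cl (bar_letter s)) (b m) + smul \<xi> (b m)"
        using that by (simp add: gen_bar_letter ap as bc gc)
      then show ?thesis using that by (simp add: bh hecke_bar_props gc)
    qed
  qed
qed

end

context bar_module
begin

lemma longest_coset_left_step:
  assumes d: "d \<in> I" and st: "left_step n (\<phi> (d \<otimes> longest_elt G S J)) z"
  shows "\<exists>d'\<in>I. z = \<phi> (d' \<otimes> longest_elt G S J)"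
proof -
  let ?w = "longest_elt G S J"
  have wc: "?w \<in> carrier G" by (rule longest_elt_closed[OF J_S])
  have dc: "d \<in> carrier G" by (rule I_closed[OF d])
  have dD: "d \<in> D_set G S J" using d I_D by blast
  obtain s t where s: "s \<in> S" and t: "t \<in> S" and nc: "s \<otimes> t \<noteq> t \<otimes> s" and z: "z = \<phi> (s \<otimes> (d \<otimes> ?w))"
    and tx: "ldesc t (d \<otimes> ?w) \<longleftrightarrow> \<not> ldesc s (d \<otimes> ?w)"
    and tsx: "ldesc t (s \<otimes> (d \<otimes> ?w)) \<longleftrightarrow> \<not> ldesc s (s \<otimes> (d \<otimes> ?w))"
    using left_step_gen[OF _ st] dc wc by auto
  have xc: "d \<otimes> ?w \<in> carrier G" using dc wc by simp
  note tau_iff = ldesc_longest_coset[OF J_S dD]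
  have "s \<otimes> d \<in> I"
  proof (cases "ldesc s (d \<otimes> ?w)")
    \<comment> \<open>Leaving \<open>I\<close> is possible only if \<open>s d = d r\<close> with
      \<open>r\<close> in \<open>J\<close>. The new element then stays in the coset of
      \<open>d\<close>, where \<open>t\<close> is still an ascent because
      \<open>t \<otimes> d\<close> is a longer minimal representative; but the star operation must
      make \<open>t\<close> a descent.\<close>
    case True
    show ?thesis
    proof (rule ccontr)
      assume nI: "s \<otimes> d \<notin> I"
      then have "\<not> ldesc s d" using I_descent[OF d s] by blast
      then have "s \<otimes> d \<notin> D_set G S J" using True tau_iff[OF s] by blast
      then obtain r where r: "r \<in> J" "s \<otimes> d = d \<otimes> r" using D_set_exchange[OF dD s _ J_S] by blast
      have rS: "r \<in> S" using r J_S by blast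
      have td: "\<not> ldesc t d" "t \<otimes> d \<in> D_set G S J" using tx True tau_iff[OF t] by blast+
      have g: "r \<otimes> ?w \<in> generate G J"
        using r longest_elt_props(1)[OF J_S] by (blast intro: generate.eng generate.incl)
      have e: "s \<otimes> (d \<otimes> ?w) = d \<otimes> (r \<otimes> ?w)" using r dc wc s rS by (metis S_closed m_assoc)
      have "t \<otimes> (d \<otimes> (r \<otimes> ?w)) = t \<otimes> d \<otimes> (r \<otimes> ?w)" using dc wc t rS by (simp add: m_assoc)
      then have "\<not> ldesc t (s \<otimes> (d \<otimes> ?w))"
        using len_coset[OF J_S dD g] len_coset[OF J_S td(2) g] td(1) e by simp
      then show False using tsx True s xc by (simp add: gen_cancel)
    qed
  next
    case False
    then have lt: "ldesc t (d \<otimes> ?w)" using tx by blast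
    have "\<not> ldesc t (s \<otimes> (d \<otimes> ?w))" using tsx False ldesc_flip[OF xc s] by blast
    \<comment> \<open>Transferred to the coset elements, this is the condition that keeps
      \<open>t \<otimes> d\<close> from contributing to \<open>T\<^sub>s C\<^sub>d\<close>, as
      \<open>star_ascent_in_I\<close> demands.\<close>
    then have nst: "\<not> ldesc s (t \<otimes> (d \<otimes> ?w))" using ldesc_braid(3)[OF xc s t nc lt False] by blast
    have "\<not> (ldesc t d \<and> tau s (t \<otimes> d))"
    proof
      assume a: "ldesc t d \<and> tau s (t \<otimes> d)"
      then have "t \<otimes> d \<in> D_set G S J" using D_set_ldesc[OF dD t _ J_S] by blast
      from ldesc_longest_coset[OF J_S this s] a have "ldesc s (t \<otimes> d \<otimes> ?w)" by (simp add: tau_def)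
      then show False using nst dc wc t by (simp add: m_assoc)
    qed
    then show ?thesis
      using False lt tau_iff[OF s] tau_iff[OF t] by (intro star_ascent_in_I[OF s t nc d]) (auto simp: tau_def)
  qed
  moreover have "s \<otimes> (d \<otimes> ?w) = s \<otimes> d \<otimes> ?w" using s dc wc by (simp add: m_assoc)
  ultimately show ?thesis using z by auto
qed

lemma longest_coset_union_of_cells:
  defines "X \<equiv> {x \<otimes> longest_elt G S J | x. x \<in> I}"
  shows "\<exists>\<C>. \<C> \<subseteq> left_cells G S \<and> X = \<Union>\<C>"
proof -
  let ?w = "longest_elt G S J"
  let ?R = "{(x, y). (x, y) \<in> KL_left_preorder G S \<and> (y, x) \<in> KL_left_preorder G S}"
  have wc: "?w \<in> carrier G" by (rule longest_elt_closed[OF J_S])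
  have Xc: "x \<in> carrier G" if "x \<in> X" for x using that I_closed wc by (auto simp: X_def)
  have closed: "\<exists>x\<in>X. z = \<phi> x" if "(left_step n)\<^sup>*\<^sup>* (\<phi> x) z" "x \<in> X" for x z
    using that
  proof (induction rule: rtranclp_induct)
    case (step y z)
    then show ?case using longest_coset_left_step unfolding X_def by blast
  qed blast
  have carr: "y \<in> carrier G" if "(x, y) \<in> KL_left_preorder G S" "x \<in> carrier G" for x y
    using that unfolding KL_left_preorder_def by (induction rule: rtrancl_induct) auto
  have cell: "y \<in> X" if x: "x \<in> X" and R: "(x, y) \<in> ?R" for x y
  proof -
    have xc: "x \<in> carrier G" and yc: "y \<in> carrier G" using Xc[OF x] carr R by auto
    have "(left_step n)\<^sup>*\<^sup>* (\<phi> x) (\<phi> y)"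
      using R KL_left_preorder_occ by (intro cell_left_steps xc yc) auto
    from closed[OF this x] obtain v where "v \<in> X" "\<phi> y = \<phi> v" by blast
    then show ?thesis using phi_eq_iff[OF yc Xc] by simp
  qed
  have "X = \<Union>((\<lambda>x. ?R `` {x}) ` X)"
  proof (rule subset_antisym; rule subsetI)
    fix x assume "x \<in> X"
    moreover have "(x, x) \<in> ?R" by (simp add: KL_left_preorder_def)
    ultimately show "x \<in> \<Union>((\<lambda>x. ?R `` {x}) ` X)" by blast
  next
    fix y assume "y \<in> \<Union>((\<lambda>x. ?R `` {x}) ` X)"
    then show "y \<in> X" using cell by blast
  qed
  moreover have "(\<lambda>x. ?R `` {x}) ` X \<subseteq> left_cells G S"
    unfolding left_cells_def using quotientI[OF Xc, of _ ?R] by blast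
  ultimately show ?thesis by blast
qed

end

theorem theorem2p7:
  fixes G (structure) and S I J :: "'a set"
  assumes "group G"
    and "type_A G S"
    and "w_graph_ideal G S I J"
  shows "\<exists>\<C>. \<C> \<subseteq> left_cells G S \<and> {x \<otimes> longest_elt G S J | x. x \<in> I} = \<Union>\<C>"
proof -
  obtain n \<phi> where \<phi>: "S \<subseteq> carrier G" "\<phi> \<in> iso G (sym_group n)"
    "\<phi> ` S = {transpose i (Suc i) | i. 1 \<le> i \<and> i < n}"
    using assms(2) unfolding type_A_def by blast
  interpret type_A_system G S n \<phi>
    using assms(1) \<phi> by (simp add: type_A_system_def type_A_system_axioms_def)
  obtain a b where ab: "I \<noteq> {}" "left_weak_ideal G S I" "J \<subseteq> S" "I \<subseteq> D_set G S J" "hecke_module G S I a"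
    "\<forall>w\<in>I.
           (\<forall>s\<in>SA G S I w. a (gen s) (bas w) = bas (s \<otimes> w)) \<and>
           (\<forall>s\<in>SD G S w. a (gen s) (bas w) = bas (s \<otimes> w) + smul \<xi> (bas w)) \<and>
           (\<forall>s\<in>WD G S J w. a (gen s) (bas w) = smul (- qpow (-1)) (bas w)) \<and>
           (\<forall>s\<in>WA G S I J w. \<exists>r.
              (\<forall>y\<in>I. bruhat_less G S y (s \<otimes> w) \<longrightarrow> r y \<in> q_laurent_plus) \<and>
              a (gen s) (bas w) = smul (qpow 1) (bas w) -
                (\<Sum>y\<in>{y \<in> I. bruhat_less G S y (s \<otimes> w)}. smul (r y) (bas y)))"
    "\<forall>m\<in>free_module I. b m \<in> free_module I \<and> b (b m) = m"
    "\<forall>m\<in>free_module I. \<forall>m'\<in>free_module I. b (m + m') = b m + b m'"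
    "\<forall>a. \<forall>m\<in>free_module I. b (smul a m) = smul (laurent_bar a) (b m)"
    "b (bas \<one>) = bas \<one>"
    "\<forall>h\<in>carrier HA. \<forall>m\<in>free_module I. b (a h m) = a (hecke_bar G S h) (b m)"
    using assms(3) unfolding w_graph_ideal_def by (elim conjE exE) (rule that)
  have "bar_module G S n \<phi> I J (\<lambda>s. a (gen s)) b"
    by (rule hecke_module_bar_module) (use ab in \<open>simp_all\<close>)
  then show ?thesis by (rule bar_module.longest_coset_union_of_cells)
qed

end
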